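(* Let $(\mathcal{T},\otimes,\mathbb{1})$ be a rigidly-compactly generated tensor triangulated category which satisfies the detection property and admits a model. Let $t\in\mathcal{T}$ be an object whose tensor triangular support $\mathrm{Supp}(t)\subseteq \mathrm{Spc}(\mathcal{T}^c)$ is a weakly scattered subset with respect to the inverse topology on $\mathrm{Spc}(\mathcal{T}^c)$. Then the local-to-global principle holds for $t$.
   Context: $\mathcal{T}^c$ is the subcategory of compact (= rigid) objects of $\mathcal{T}$ and $\mathrm{Spc}(\mathcal{T}^c)$ is its Balmer spectrum, a spectral space. A subset of $\mathrm{Spc}(\mathcal{T}^c)$ is Thomason if it is a union of closed subsets with quasi-compact complement. The inverse (Hochster dual) topology on $\mathrm{Spc}(\mathcal{T}^c)$ is the topology whose open subsets are exactly the Thomason subsets. Rickard idempotents: for a Thomason subset $Y$, let $\mathcal{T}^c_Y$ be the corresponding thick tensor ideal of compact objects (those whose Balmer support is contained in $Y$). There is an exact triangle $\Gamma_Y\mathbb{1}\to\mathbb{1}\to L_{Y^c}\mathbb{1}\to\Sigma\Gamma_Y\mathbb{1}$ with $\Gamma_Y\mathbb{1}\in \mathrm{Loc}\langle\mathcal{T}^c_Y\rangle$ and $L_{Y^c}\mathbb{1}\in \mathrm{Loc}\langle\mathcal{T}^c_Y\rangle^{\perp}$, where $\mathrm{Loc}\langle -\rangle$ is the generated localizing subcategory. A subset $Z\subseteq\mathrm{Spc}(\mathcal{T}^c)$ is weakly visible if $Z=Y_1\cap Y_2^c$ for Thomason subsets $Y_1,Y_2$; then $g(Z):=\Gamma_{Y_1}\mathbb{1}\otimes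 L_{Y_2^c}\mathbb{1}$ (independent of the choice up to isomorphism). Tensor triangular support: $\mathrm{Supp}(t)=\{\mathfrak{p}\in\mathrm{Spc}(\mathcal{T}^c) : t\otimes g(W)\neq 0 \text{ for every weakly visible } W \text{ containing } \mathfrak{p}\}$. Detection property: $\mathrm{Supp}(t)=\emptyset$ implies $t=0$, for every $t\in\mathcal{T}$. "Admits a model" means: $\mathcal{T}$ is the homotopy category of a stable monoidal model category or of a stable monoidal $\infty$-category, or it is the underlying category of a strong stable monoidal derivator. Local-to-global principle for $t$: for every cover $\{W_i\}_{i\in I}$ of $\mathrm{Spc}(\mathcal{T}^c)$ by weakly visible subsets, $t\in\mathrm{Locid}\langle t\otimes g(W_i): i\in I\rangle$, where $\mathrm{Locid}\langle -\rangle$ denotes the generated localizing tensor ideal. Weakly scattered: a point $w$ of a topological space $F$ is weakly isolated in $F$ if there is an open $U\subseteq F$ with $w\in U\subseteq\overline{\{w\}}$ (closure in $F$). A space $C$ is weakly scattered if every non-empty closed subset $F\subseteq C$ has a weakly isolated point. A subset of a space is weakly scattered if it is so with the subspace topology. *)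

theory Defs
  imports "HOL-Algebra.FiniteProduct" "HOL-Analysis.Abstract_Topology"
begin

unbundle cardinal_syntax

section \<open>Size\<close>

text \<open>
  The role of the universe of small sets is played by a regular uncountable cardinal \<open>\<kappa>\<close>:
  a set is small if it has fewer than \<open>\<kappa>\<close> elements.  An inaccessible \<open>\<kappa>\<close> gives the sets of a
  Grothendieck universe.  Since every small set is equipotent to a subset of the underlying type
  \<open>'u\<close> of \<open>\<kappa>\<close>, families and diagrams with a small shape are indexed by subsets of \<open>'u\<close>.
\<close>

definition universe :: "'u rel \<Rightarrow> bool" where
  "universe \<kappa> \<longleftrightarrow> Card_order \<kappa> \<and> regularCard \<kappa> \<and> natLeq <o \<kappa>"

definition small :: "'u rel \<Rightarrow> 'x set \<Rightarrow> bool" where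
  "small \<kappa> A \<longleftrightarrow> |A| <o \<kappa>"


section \<open>Categories\<close>

record ('o, 'm) category =
  Obj :: "'o set"
  Arr :: "'m set"
  Dom :: "'m \<Rightarrow> 'o"
  Cod :: "'m \<Rightarrow> 'o"
  Ide :: "'o \<Rightarrow> 'm"
  Comp :: "'m \<Rightarrow> 'm \<Rightarrow> 'm" (infixr "\<cdot>\<index>" 60)

definition Hom :: "('o, 'm, 'z) category_scheme \<Rightarrow> 'o \<Rightarrow> 'o \<Rightarrow> 'm set" where
  "Hom C x y = {f \<in> Arr C. Dom C f = x \<and> Cod C f = y}"

definition is_category :: "('o, 'm, 'z) category_scheme \<Rightarrow> bool" where
  "is_category C \<longleftrightarrow>
     (\<forall>f\<in>Arr C. Dom C f \<in> Obj C \<and> Cod C f \<in> Obj C) \<and>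
     (\<forall>x\<in>Obj C. Ide C x \<in> Hom C x x) \<and>
     (\<forall>x y z f g. f \<in> Hom C x y \<and> g \<in> Hom C y z \<longrightarrow> g \<cdot>\<^bsub>C\<^esub> f \<in> Hom C x z) \<and>
     (\<forall>x y f. f \<in> Hom C x y \<longrightarrow> f \<cdot>\<^bsub>C\<^esub> Ide C x = f \<and> Ide C y \<cdot>\<^bsub>C\<^esub> f = f) \<and>
     (\<forall>w x y z f g h. f \<in> Hom C w x \<and> g \<in> Hom C x y \<and> h \<in> Hom C y z \<longrightarrow>
        h \<cdot>\<^bsub>C\<^esub> (g \<cdot>\<^bsub>C\<^esub> f) = (h \<cdot>\<^bsub>C\<^esub> g) \<cdot>\<^bsub>C\<^esub> f)"

definition opc :: "('o, 'm, 'z) category_scheme \<Rightarrow> ('o, 'm, 'z) category_scheme" where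
  "opc C = C\<lparr>Dom := Cod C, Cod := Dom C, Comp := (\<lambda>g f. f \<cdot>\<^bsub>C\<^esub> g)\<rparr>"

definition is_inverse :: "('o, 'm, 'z) category_scheme \<Rightarrow> 'm \<Rightarrow> 'm \<Rightarrow> bool" where
  "is_inverse C f g \<longleftrightarrow> f \<in> Arr C \<and> g \<in> Hom C (Cod C f) (Dom C f) \<and>
     g \<cdot>\<^bsub>C\<^esub> f = Ide C (Dom C f) \<and> f \<cdot>\<^bsub>C\<^esub> g = Ide C (Cod C f)"

definition iso_arr :: "('o, 'm, 'z) category_scheme \<Rightarrow> 'm \<Rightarrow> bool" where
  "iso_arr C f \<longleftrightarrow> (\<exists>g. is_inverse C f g)"

definition inv_arr :: "('o, 'm, 'z) category_scheme \<Rightarrow> 'm \<Rightarrow> 'm" where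
  "inv_arr C f = (THE g. is_inverse C f g)"

definition Iso :: "('o, 'm, 'z) category_scheme \<Rightarrow> 'o \<Rightarrow> 'o \<Rightarrow> 'm set" where
  "Iso C x y = {f \<in> Hom C x y. iso_arr C f}"

definition isomorphic :: "('o, 'm, 'z) category_scheme \<Rightarrow> 'o \<Rightarrow> 'o \<Rightarrow> bool" where
  "isomorphic C x y \<longleftrightarrow> Iso C x y \<noteq> {}"

definition initial_ob :: "('o, 'm, 'z) category_scheme \<Rightarrow> 'o \<Rightarrow> bool" where
  "initial_ob C x \<longleftrightarrow> x \<in> Obj C \<and> (\<forall>y\<in>Obj C. \<exists>!f. f \<in> Hom C x y)"

definition zero_ob :: "('o, 'm, 'z) category_scheme \<Rightarrow> 'o \<Rightarrow> bool" where
  "zero_ob C x \<longleftrightarrow> initial_ob C x \<and> initial_ob (opc C) x"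

definition zero_arr :: "('o, 'm, 'z) category_scheme \<Rightarrow> 'm \<Rightarrow> bool" where
  "zero_arr C f \<longleftrightarrow> f \<in> Arr C \<and>
     (\<exists>z u v. zero_ob C z \<and> u \<in> Hom C (Dom C f) z \<and> v \<in> Hom C z (Cod C f) \<and> f = v \<cdot>\<^bsub>C\<^esub> u)"

definition is_coproduct ::
    "('o, 'm, 'z) category_scheme \<Rightarrow> 'i set \<Rightarrow> ('i \<Rightarrow> 'o) \<Rightarrow> 'o \<Rightarrow> ('i \<Rightarrow> 'm) \<Rightarrow> bool" where
  "is_coproduct C I x c \<iota> \<longleftrightarrow> c \<in> Obj C \<and> (\<forall>i\<in>I. \<iota> i \<in> Hom C (x i) c) \<and>
     (\<forall>y\<in>Obj C. \<forall>f. (\<forall>i\<in>I. f i \<in> Hom C (x i) y) \<longrightarrow>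
        (\<exists>!h. h \<in> Hom C c y \<and> (\<forall>i\<in>I. h \<cdot>\<^bsub>C\<^esub> \<iota> i = f i)))"

definition is_pushout :: "('o, 'm, 'z) category_scheme \<Rightarrow> 'm \<Rightarrow> 'm \<Rightarrow> 'm \<Rightarrow> 'm \<Rightarrow> bool" where
  "is_pushout C f g p q \<longleftrightarrow>
     {f, g, p, q} \<subseteq> Arr C \<and> Dom C f = Dom C g \<and> Dom C p = Cod C f \<and> Dom C q = Cod C g \<and>
     Cod C p = Cod C q \<and> p \<cdot>\<^bsub>C\<^esub> f = q \<cdot>\<^bsub>C\<^esub> g \<and>
     (\<forall>w u v. u \<in> Hom C (Cod C f) w \<and> v \<in> Hom C (Cod C g) w \<and> u \<cdot>\<^bsub>C\<^esub> f = v \<cdot>\<^bsub>C\<^esub> g \<longrightarrow>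
        (\<exists>!h. h \<in> Hom C (Cod C p) w \<and> h \<cdot>\<^bsub>C\<^esub> p = u \<and> h \<cdot>\<^bsub>C\<^esub> q = v))"

record ('a, 'b, 'c, 'd) functr =
  onO :: "'a \<Rightarrow> 'c"
  onA :: "'b \<Rightarrow> 'd"

definition is_functor ::
    "('a, 'b, 'y) category_scheme \<Rightarrow> ('c, 'd, 'z) category_scheme \<Rightarrow> ('a, 'b, 'c, 'd) functr \<Rightarrow> bool" where
  "is_functor C D F \<longleftrightarrow>
     (\<forall>x\<in>Obj C. onO F x \<in> Obj D \<and> onA F (Ide C x) = Ide D (onO F x)) \<and>
     (\<forall>x y f. f \<in> Hom C x y \<longrightarrow> onA F f \<in> Hom D (onO F x) (onO F y)) \<and>
     (\<forall>x y z f g. f \<in> Hom C x y \<and> g \<in> Hom C y z \<longrightarrow>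
        onA F (g \<cdot>\<^bsub>C\<^esub> f) = onA F g \<cdot>\<^bsub>D\<^esub> onA F f)"

definition fid :: "('a, 'b, 'a, 'b) functr" where
  "fid = \<lparr>onO = id, onA = id\<rparr>"

definition fcomp :: "('c, 'd, 'e, 'f) functr \<Rightarrow> ('a, 'b, 'c, 'd) functr \<Rightarrow> ('a, 'b, 'e, 'f) functr" where
  "fcomp G F = \<lparr>onO = onO G \<circ> onO F, onA = onA G \<circ> onA F\<rparr>"

text \<open>The constant functor at \<open>b\<close>, from any category.\<close>

definition pt :: "('c, 'd, 'z) category_scheme \<Rightarrow> 'c \<Rightarrow> ('a, 'b, 'c, 'd) functr" where
  "pt B b = \<lparr>onO = (\<lambda>_. b), onA = (\<lambda>_. Ide B b)\<rparr>"

definition feq ::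
    "('a, 'b, 'y) category_scheme \<Rightarrow> ('a, 'b, 'c, 'd) functr \<Rightarrow> ('a, 'b, 'c, 'd) functr \<Rightarrow> bool" where
  "feq C F G \<longleftrightarrow> (\<forall>x\<in>Obj C. onO F x = onO G x) \<and> (\<forall>f\<in>Arr C. onA F f = onA G f)"

definition nat_trans ::
    "('a, 'b, 'y) category_scheme \<Rightarrow> ('c, 'd, 'z) category_scheme \<Rightarrow>
     ('a, 'b, 'c, 'd) functr \<Rightarrow> ('a, 'b, 'c, 'd) functr \<Rightarrow> ('a \<Rightarrow> 'd) \<Rightarrow> bool" where
  "nat_trans C D F G \<alpha> \<longleftrightarrow>
     (\<forall>x\<in>Obj C. \<alpha> x \<in> Hom D (onO F x) (onO G x)) \<and>
     (\<forall>x y f. f \<in> Hom C x y \<longrightarrow> \<alpha> y \<cdot>\<^bsub>D\<^esub> onA F f = onA G f \<cdot>\<^bsub>D\<^esub> \<alpha> x)"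

definition equivalence ::
    "('a, 'b, 'y) category_scheme \<Rightarrow> ('c, 'd, 'z) category_scheme \<Rightarrow> ('a, 'b, 'c, 'd) functr \<Rightarrow> bool" where
  "equivalence C D F \<longleftrightarrow> is_functor C D F \<and>
     (\<forall>x\<in>Obj C. \<forall>y\<in>Obj C. bij_betw (onA F) (Hom C x y) (Hom D (onO F x) (onO F y))) \<and>
     (\<forall>y\<in>Obj D. \<exists>x\<in>Obj C. isomorphic D (onO F x) y)"

text \<open>\<open>F\<close> is left adjoint to \<open>G\<close> with unit \<open>\<eta>\<close> and counit \<open>\<epsilon>\<close>.\<close>

definition adjoint ::
    "('a, 'b, 'y) category_scheme \<Rightarrow> ('c, 'd, 'z) category_scheme \<Rightarrow> ('a, 'b, 'c, 'd) functr \<Rightarrow>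
     ('c, 'd, 'a, 'b) functr \<Rightarrow> ('a \<Rightarrow> 'b) \<Rightarrow> ('c \<Rightarrow> 'd) \<Rightarrow> bool" where
  "adjoint C D F G \<eta> \<epsilon> \<longleftrightarrow> is_functor C D F \<and> is_functor D C G \<and>
     nat_trans C C fid (fcomp G F) \<eta> \<and> nat_trans D D (fcomp F G) fid \<epsilon> \<and>
     (\<forall>x\<in>Obj C. \<epsilon> (onO F x) \<cdot>\<^bsub>D\<^esub> onA F (\<eta> x) = Ide D (onO F x)) \<and>
     (\<forall>y\<in>Obj D. onA G (\<epsilon> y) \<cdot>\<^bsub>C\<^esub> \<eta> (onO G y) = Ide C (onO G y))"


section \<open>Monoidal categories\<close>

text \<open>\<open>Assoc x y z : (x \<otimes> y) \<otimes> z \<rightarrow> x \<otimes> (y \<otimes> z)\<close>, \<open>LUnit x : 1 \<otimes> x \<rightarrow> x\<close>, \<open>RUnit x : x \<otimes> 1 \<rightarrow> x\<close>.\<close>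

record ('o, 'm) moncat = "('o, 'm) category" +
  TenO :: "'o \<Rightarrow> 'o \<Rightarrow> 'o" (infixr "\<otimes>\<^sub>o\<index>" 70)
  TenA :: "'m \<Rightarrow> 'm \<Rightarrow> 'm" (infixr "\<otimes>\<^sub>a\<index>" 70)
  UnitO :: "'o"
  Assoc :: "'o \<Rightarrow> 'o \<Rightarrow> 'o \<Rightarrow> 'm"
  LUnit :: "'o \<Rightarrow> 'm"
  RUnit :: "'o \<Rightarrow> 'm"

definition is_bifunctor :: "('o, 'm, 'z) moncat_scheme \<Rightarrow> bool" where
  "is_bifunctor C \<longleftrightarrow>
     (\<forall>x\<in>Obj C. \<forall>y\<in>Obj C. x \<otimes>\<^sub>o\<^bsub>C\<^esub> y \<in> Obj C \<and>
        Ide C x \<otimes>\<^sub>a\<^bsub>C\<^esub> Ide C y = Ide C (x \<otimes>\<^sub>o\<^bsub>C\<^esub> y)) \<and>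
     (\<forall>x x' y y' f g. f \<in> Hom C x x' \<and> g \<in> Hom C y y' \<longrightarrow>
        f \<otimes>\<^sub>a\<^bsub>C\<^esub> g \<in> Hom C (x \<otimes>\<^sub>o\<^bsub>C\<^esub> y) (x' \<otimes>\<^sub>o\<^bsub>C\<^esub> y')) \<and>
     (\<forall>x x' x'' y y' y'' f f' g g'.
        f \<in> Hom C x x' \<and> f' \<in> Hom C x' x'' \<and> g \<in> Hom C y y' \<and> g' \<in> Hom C y' y'' \<longrightarrow>
        (f' \<cdot>\<^bsub>C\<^esub> f) \<otimes>\<^sub>a\<^bsub>C\<^esub> (g' \<cdot>\<^bsub>C\<^esub> g) = (f' \<otimes>\<^sub>a\<^bsub>C\<^esub> g') \<cdot>\<^bsub>C\<^esub> (f \<otimes>\<^sub>a\<^bsub>C\<^esub> g))"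

definition is_monoidal :: "('o, 'm, 'z) moncat_scheme \<Rightarrow> bool" where
  "is_monoidal C \<longleftrightarrow> is_category C \<and> is_bifunctor C \<and> UnitO C \<in> Obj C \<and>
     (\<forall>x\<in>Obj C. \<forall>y\<in>Obj C. \<forall>z\<in>Obj C.
        Assoc C x y z \<in> Iso C ((x \<otimes>\<^sub>o\<^bsub>C\<^esub> y) \<otimes>\<^sub>o\<^bsub>C\<^esub> z) (x \<otimes>\<^sub>o\<^bsub>C\<^esub> y \<otimes>\<^sub>o\<^bsub>C\<^esub> z)) \<and>
     (\<forall>x\<in>Obj C. LUnit C x \<in> Iso C (UnitO C \<otimes>\<^sub>o\<^bsub>C\<^esub> x) x \<and> RUnit C x \<in> Iso C (x \<otimes>\<^sub>o\<^bsub>C\<^esub> UnitO C) x) \<and>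
     (\<forall>x x' y y' z z' f g h. f \<in> Hom C x x' \<and> g \<in> Hom C y y' \<and> h \<in> Hom C z z' \<longrightarrow>
        Assoc C x' y' z' \<cdot>\<^bsub>C\<^esub> ((f \<otimes>\<^sub>a\<^bsub>C\<^esub> g) \<otimes>\<^sub>a\<^bsub>C\<^esub> h) = (f \<otimes>\<^sub>a\<^bsub>C\<^esub> g \<otimes>\<^sub>a\<^bsub>C\<^esub> h) \<cdot>\<^bsub>C\<^esub> Assoc C x y z) \<and>
     (\<forall>x x' f. f \<in> Hom C x x' \<longrightarrow>
        LUnit C x' \<cdot>\<^bsub>C\<^esub> (Ide C (UnitO C) \<otimes>\<^sub>a\<^bsub>C\<^esub> f) = f \<cdot>\<^bsub>C\<^esub> LUnit C x \<and>
        RUnit C x' \<cdot>\<^bsub>C\<^esub> (f \<otimes>\<^sub>a\<^bsub>C\<^esub> Ide C (UnitO C)) = f \<cdot>\<^bsub>C\<^esub> RUnit C x) \<and>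
     (\<forall>w\<in>Obj C. \<forall>x\<in>Obj C. \<forall>y\<in>Obj C. \<forall>z\<in>Obj C.
        Assoc C w x (y \<otimes>\<^sub>o\<^bsub>C\<^esub> z) \<cdot>\<^bsub>C\<^esub> Assoc C (w \<otimes>\<^sub>o\<^bsub>C\<^esub> x) y z =
        (Ide C w \<otimes>\<^sub>a\<^bsub>C\<^esub> Assoc C x y z) \<cdot>\<^bsub>C\<^esub> Assoc C w (x \<otimes>\<^sub>o\<^bsub>C\<^esub> y) z \<cdot>\<^bsub>C\<^esub> (Assoc C w x y \<otimes>\<^sub>a\<^bsub>C\<^esub> Ide C z)) \<and>
     (\<forall>x\<in>Obj C. \<forall>y\<in>Obj C.
        (Ide C x \<otimes>\<^sub>a\<^bsub>C\<^esub> LUnit C y) \<cdot>\<^bsub>C\<^esub> Assoc C x (UnitO C) y = RUnit C x \<otimes>\<^sub>a\<^bsub>C\<^esub> Ide C y)"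

definition strong_monoidal ::
    "('a, 'b, 'y) moncat_scheme \<Rightarrow> ('c, 'd, 'z) moncat_scheme \<Rightarrow> ('a, 'b, 'c, 'd) functr \<Rightarrow>
     ('a \<Rightarrow> 'a \<Rightarrow> 'd) \<Rightarrow> 'd \<Rightarrow> bool" where
  "strong_monoidal C D F \<mu> \<iota> \<longleftrightarrow> is_functor C D F \<and>
     (\<forall>x\<in>Obj C. \<forall>y\<in>Obj C. \<mu> x y \<in> Iso D (onO F x \<otimes>\<^sub>o\<^bsub>D\<^esub> onO F y) (onO F (x \<otimes>\<^sub>o\<^bsub>C\<^esub> y))) \<and>
     \<iota> \<in> Iso D (UnitO D) (onO F (UnitO C)) \<and>
     (\<forall>x x' y y' f g. f \<in> Hom C x x' \<and> g \<in> Hom C y y' \<longrightarrow>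
        \<mu> x' y' \<cdot>\<^bsub>D\<^esub> (onA F f \<otimes>\<^sub>a\<^bsub>D\<^esub> onA F g) = onA F (f \<otimes>\<^sub>a\<^bsub>C\<^esub> g) \<cdot>\<^bsub>D\<^esub> \<mu> x y) \<and>
     (\<forall>x\<in>Obj C. \<forall>y\<in>Obj C. \<forall>z\<in>Obj C.
        onA F (Assoc C x y z) \<cdot>\<^bsub>D\<^esub> \<mu> (x \<otimes>\<^sub>o\<^bsub>C\<^esub> y) z \<cdot>\<^bsub>D\<^esub> (\<mu> x y \<otimes>\<^sub>a\<^bsub>D\<^esub> Ide D (onO F z)) =
        \<mu> x (y \<otimes>\<^sub>o\<^bsub>C\<^esub> z) \<cdot>\<^bsub>D\<^esub> (Ide D (onO F x) \<otimes>\<^sub>a\<^bsub>D\<^esub> \<mu> y z) \<cdot>\<^bsub>D\<^esub> Assoc D (onO F x) (onO F y) (onO F z)) \<and>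
     (\<forall>x\<in>Obj C.
        onA F (LUnit C x) \<cdot>\<^bsub>D\<^esub> \<mu> (UnitO C) x \<cdot>\<^bsub>D\<^esub> (\<iota> \<otimes>\<^sub>a\<^bsub>D\<^esub> Ide D (onO F x)) = LUnit D (onO F x) \<and>
        onA F (RUnit C x) \<cdot>\<^bsub>D\<^esub> \<mu> x (UnitO C) \<cdot>\<^bsub>D\<^esub> (Ide D (onO F x) \<otimes>\<^sub>a\<^bsub>D\<^esub> \<iota>) = RUnit D (onO F x))"


section \<open>Tensor triangulated categories\<close>

text \<open>
  \<open>Braid x y : x \<otimes> y \<rightarrow> y \<otimes> x\<close>; \<open>Plus\<close> and \<open>Zr x y\<close> give the addition and the zero of each hom-set;
  \<open>Shift\<close> is the suspension functor \<open>\<Sigma>\<close>; \<open>(f, g, h) \<in> Tri\<close> are the exact triangles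
  \<open>x \<rightarrow> y \<rightarrow> z \<rightarrow> \<Sigma>x\<close>; \<open>ShL x y : \<Sigma>x \<otimes> y \<rightarrow> \<Sigma>(x \<otimes> y)\<close>.
\<close>

record ('o, 'm) ttcat = "('o, 'm) moncat" +
  Braid :: "'o \<Rightarrow> 'o \<Rightarrow> 'm"
  Plus :: "'m \<Rightarrow> 'm \<Rightarrow> 'm"
  Zr :: "'o \<Rightarrow> 'o \<Rightarrow> 'm"
  Shift :: "('o, 'm, 'o, 'm) functr"
  Tri :: "('m \<times> 'm \<times> 'm) set"
  ShL :: "'o \<Rightarrow> 'o \<Rightarrow> 'm"

definition hgrp :: "('o, 'm) ttcat \<Rightarrow> 'o \<Rightarrow> 'o \<Rightarrow> 'm monoid" where
  "hgrp T x y = \<lparr>carrier = Hom T x y, mult = Plus T, one = Zr T x y\<rparr>"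

definition Neg :: "('o, 'm) ttcat \<Rightarrow> 'm \<Rightarrow> 'm" where
  "Neg T f = m_inv (hgrp T (Dom T f) (Cod T f)) f"

definition is_additive :: "('o, 'm) ttcat \<Rightarrow> bool" where
  "is_additive T \<longleftrightarrow> is_category T \<and>
     (\<forall>x\<in>Obj T. \<forall>y\<in>Obj T. comm_group (hgrp T x y)) \<and>
     (\<forall>x y z f f' g g'. f \<in> Hom T x y \<and> f' \<in> Hom T x y \<and> g \<in> Hom T y z \<and> g' \<in> Hom T y z \<longrightarrow>
        g \<cdot>\<^bsub>T\<^esub> Plus T f f' = Plus T (g \<cdot>\<^bsub>T\<^esub> f) (g \<cdot>\<^bsub>T\<^esub> f') \<and>
        Plus T g g' \<cdot>\<^bsub>T\<^esub> f = Plus T (g \<cdot>\<^bsub>T\<^esub> f) (g' \<cdot>\<^bsub>T\<^esub> f)) \<and>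
     (\<exists>z. zero_ob T z) \<and>
     (\<forall>x\<in>Obj T. \<forall>y\<in>Obj T. \<exists>c \<iota>. is_coproduct T UNIV (\<lambda>b. if b then x else y) c \<iota>)"

abbreviation ShO :: "('o, 'm) ttcat \<Rightarrow> 'o \<Rightarrow> 'o" where "ShO T \<equiv> onO (Shift T)"
abbreviation ShA :: "('o, 'm) ttcat \<Rightarrow> 'm \<Rightarrow> 'm" where "ShA T \<equiv> onA (Shift T)"

definition tri_shape :: "('o, 'm) ttcat \<Rightarrow> 'm \<Rightarrow> 'm \<Rightarrow> 'm \<Rightarrow> bool" where
  "tri_shape T f g h \<longleftrightarrow> f \<in> Arr T \<and> g \<in> Arr T \<and> Dom T g = Cod T f \<and>
     h \<in> Hom T (Cod T g) (ShO T (Dom T f))"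

definition tri_mor ::
    "('o, 'm) ttcat \<Rightarrow> 'm \<times> 'm \<times> 'm \<Rightarrow> 'm \<times> 'm \<times> 'm \<Rightarrow> 'm \<Rightarrow> 'm \<Rightarrow> 'm \<Rightarrow> bool" where
  "tri_mor T t t' a b c \<longleftrightarrow> (case (t, t') of ((f, g, h), (f', g', h')) \<Rightarrow>
     a \<in> Hom T (Dom T f) (Dom T f') \<and> b \<in> Hom T (Cod T f) (Cod T f') \<and> c \<in> Hom T (Cod T g) (Cod T g') \<and>
     b \<cdot>\<^bsub>T\<^esub> f = f' \<cdot>\<^bsub>T\<^esub> a \<and> c \<cdot>\<^bsub>T\<^esub> g = g' \<cdot>\<^bsub>T\<^esub> b \<and> ShA T a \<cdot>\<^bsub>T\<^esub> h = h' \<cdot>\<^bsub>T\<^esub> c)"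

definition tri_iso :: "('o, 'm) ttcat \<Rightarrow> 'm \<times> 'm \<times> 'm \<Rightarrow> 'm \<times> 'm \<times> 'm \<Rightarrow> bool" where
  "tri_iso T t t' \<longleftrightarrow> (\<exists>a b c. tri_mor T t t' a b c \<and> iso_arr T a \<and> iso_arr T b \<and> iso_arr T c)"

definition is_triangulated :: "('o, 'm) ttcat \<Rightarrow> bool" where
  "is_triangulated T \<longleftrightarrow> is_additive T \<and> equivalence T T (Shift T) \<and>
     (\<forall>x y f g. f \<in> Hom T x y \<and> g \<in> Hom T x y \<longrightarrow> ShA T (Plus T f g) = Plus T (ShA T f) (ShA T g)) \<and>
     (\<forall>f g h. (f, g, h) \<in> Tri T \<longrightarrow> tri_shape T f g h) \<and>
     (\<forall>f g h f' g' h'. (f, g, h) \<in> Tri T \<and> tri_shape T f' g' h' \<and> tri_iso T (f, g, h) (f', g', h') \<longrightarrow>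
        (f', g', h') \<in> Tri T) \<and>
     (\<forall>x\<in>Obj T. \<forall>z. zero_ob T z \<longrightarrow> (Ide T x, Zr T x z, Zr T z (ShO T x)) \<in> Tri T) \<and>
     (\<forall>f\<in>Arr T. \<exists>g h. (f, g, h) \<in> Tri T) \<and>
     (\<forall>f g h. tri_shape T f g h \<longrightarrow>
        ((f, g, h) \<in> Tri T \<longleftrightarrow> (g, h, Neg T (ShA T f)) \<in> Tri T)) \<and>
     (\<forall>f g h f' g' h' a b. (f, g, h) \<in> Tri T \<and> (f', g', h') \<in> Tri T \<and>
        a \<in> Hom T (Dom T f) (Dom T f') \<and> b \<in> Hom T (Cod T f) (Cod T f') \<and> b \<cdot>\<^bsub>T\<^esub> f = f' \<cdot>\<^bsub>T\<^esub> a \<longrightarrow>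
        (\<exists>c. tri_mor T (f, g, h) (f', g', h') a b c)) \<and>
     (\<forall>f f' f'' g g' g'' h' h''.
        (f, f', f'') \<in> Tri T \<and> (g, g', g'') \<in> Tri T \<and> Dom T g = Cod T f \<and> (g \<cdot>\<^bsub>T\<^esub> f, h', h'') \<in> Tri T \<longrightarrow>
        (\<exists>u v. (u, v, ShA T f' \<cdot>\<^bsub>T\<^esub> g'') \<in> Tri T \<and>
           u \<in> Hom T (Cod T f') (Cod T h') \<and> v \<in> Hom T (Cod T h') (Cod T g') \<and>
           u \<cdot>\<^bsub>T\<^esub> f' = h' \<cdot>\<^bsub>T\<^esub> g \<and> h'' \<cdot>\<^bsub>T\<^esub> u = f'' \<and> v \<cdot>\<^bsub>T\<^esub> h' = g' \<and> g'' \<cdot>\<^bsub>T\<^esub> v = ShA T f \<cdot>\<^bsub>T\<^esub> h''))"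

definition ShR :: "('o, 'm) ttcat \<Rightarrow> 'o \<Rightarrow> 'o \<Rightarrow> 'm" where
  "ShR T x y = ShA T (Braid T y x) \<cdot>\<^bsub>T\<^esub> ShL T y x \<cdot>\<^bsub>T\<^esub> Braid T x (ShO T y)"

text \<open>
  Tensor and triangulation are compatible in the sense of Hovey, Palmieri and Strickland:
  the tensor is exact in each variable (in the second one by symmetry, via \<open>ShR\<close>), \<open>ShL\<close> is
  coherent, and the two ways of pulling suspensions out of \<open>\<Sigma>x \<otimes> \<Sigma>y\<close> differ by a sign.
\<close>

definition tt_category :: "('o, 'm) ttcat \<Rightarrow> bool" where
  "tt_category T \<longleftrightarrow> is_triangulated T \<and> is_monoidal T \<and>
     (\<forall>x\<in>Obj T. \<forall>y\<in>Obj T. Braid T x y \<in> Hom T (x \<otimes>\<^sub>o\<^bsub>T\<^esub> y) (y \<otimes>\<^sub>o\<^bsub>T\<^esub> x) \<and>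
        Braid T y x \<cdot>\<^bsub>T\<^esub> Braid T x y = Ide T (x \<otimes>\<^sub>o\<^bsub>T\<^esub> y)) \<and>
     (\<forall>x x' y y' f g. f \<in> Hom T x x' \<and> g \<in> Hom T y y' \<longrightarrow>
        Braid T x' y' \<cdot>\<^bsub>T\<^esub> (f \<otimes>\<^sub>a\<^bsub>T\<^esub> g) = (g \<otimes>\<^sub>a\<^bsub>T\<^esub> f) \<cdot>\<^bsub>T\<^esub> Braid T x y) \<and>
     (\<forall>x\<in>Obj T. \<forall>y\<in>Obj T. \<forall>z\<in>Obj T.
        Assoc T y z x \<cdot>\<^bsub>T\<^esub> Braid T x (y \<otimes>\<^sub>o\<^bsub>T\<^esub> z) \<cdot>\<^bsub>T\<^esub> Assoc T x y z =
        (Ide T y \<otimes>\<^sub>a\<^bsub>T\<^esub> Braid T x z) \<cdot>\<^bsub>T\<^esub> Assoc T y x z \<cdot>\<^bsub>T\<^esub> (Braid T x y \<otimes>\<^sub>a\<^bsub>T\<^esub> Ide T z)) \<and>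
     (\<forall>x x' y y' f f' g. f \<in> Hom T x x' \<and> f' \<in> Hom T x x' \<and> g \<in> Hom T y y' \<longrightarrow>
        Plus T f f' \<otimes>\<^sub>a\<^bsub>T\<^esub> g = Plus T (f \<otimes>\<^sub>a\<^bsub>T\<^esub> g) (f' \<otimes>\<^sub>a\<^bsub>T\<^esub> g) \<and>
        g \<otimes>\<^sub>a\<^bsub>T\<^esub> Plus T f f' = Plus T (g \<otimes>\<^sub>a\<^bsub>T\<^esub> f) (g \<otimes>\<^sub>a\<^bsub>T\<^esub> f')) \<and>
     (\<forall>x\<in>Obj T. \<forall>y\<in>Obj T. ShL T x y \<in> Iso T (ShO T x \<otimes>\<^sub>o\<^bsub>T\<^esub> y) (ShO T (x \<otimes>\<^sub>o\<^bsub>T\<^esub> y))) \<and>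
     (\<forall>x x' y y' f g. f \<in> Hom T x x' \<and> g \<in> Hom T y y' \<longrightarrow>
        ShL T x' y' \<cdot>\<^bsub>T\<^esub> (ShA T f \<otimes>\<^sub>a\<^bsub>T\<^esub> g) = ShA T (f \<otimes>\<^sub>a\<^bsub>T\<^esub> g) \<cdot>\<^bsub>T\<^esub> ShL T x y) \<and>
     (\<forall>f g h. \<forall>y\<in>Obj T. (f, g, h) \<in> Tri T \<longrightarrow>
        (f \<otimes>\<^sub>a\<^bsub>T\<^esub> Ide T y, g \<otimes>\<^sub>a\<^bsub>T\<^esub> Ide T y, ShL T (Dom T f) y \<cdot>\<^bsub>T\<^esub> (h \<otimes>\<^sub>a\<^bsub>T\<^esub> Ide T y)) \<in> Tri T) \<and>
     (\<forall>x\<in>Obj T. ShA T (RUnit T x) \<cdot>\<^bsub>T\<^esub> ShL T x (UnitO T) = RUnit T (ShO T x)) \<and>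
     (\<forall>x\<in>Obj T. \<forall>y\<in>Obj T. \<forall>z\<in>Obj T.
        ShA T (Assoc T x y z) \<cdot>\<^bsub>T\<^esub> ShL T (x \<otimes>\<^sub>o\<^bsub>T\<^esub> y) z \<cdot>\<^bsub>T\<^esub> (ShL T x y \<otimes>\<^sub>a\<^bsub>T\<^esub> Ide T z) =
        ShL T x (y \<otimes>\<^sub>o\<^bsub>T\<^esub> z) \<cdot>\<^bsub>T\<^esub> Assoc T (ShO T x) y z) \<and>
     (\<forall>x\<in>Obj T. \<forall>y\<in>Obj T.
        ShA T (ShR T x y) \<cdot>\<^bsub>T\<^esub> ShL T x (ShO T y) = Neg T (ShA T (ShL T x y) \<cdot>\<^bsub>T\<^esub> ShR T (ShO T x) y))"

definition compact_ob :: "'u rel \<Rightarrow> ('o, 'm) ttcat \<Rightarrow> 'o \<Rightarrow> bool" where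
  "compact_ob \<kappa> T x \<longleftrightarrow> x \<in> Obj T \<and>
     (\<forall>I :: 'u set. \<forall>y c \<iota>. small \<kappa> I \<and> (\<forall>i\<in>I. y i \<in> Obj T) \<and> is_coproduct T I y c \<iota> \<longrightarrow>
        bij_betw (\<lambda>\<phi>. finprod (hgrp T x c) (\<lambda>i. \<iota> i \<cdot>\<^bsub>T\<^esub> \<phi> i) {i\<in>I. \<phi> i \<noteq> Zr T x (y i)})
          {\<phi> \<in> (\<Pi>\<^sub>E i\<in>I. Hom T x (y i)). finite {i\<in>I. \<phi> i \<noteq> Zr T x (y i)}}
          (Hom T x c))"

abbreviation cpt :: "'u rel \<Rightarrow> ('o, 'm) ttcat \<Rightarrow> 'o set" where
  "cpt \<kappa> T \<equiv> {x. compact_ob \<kappa> T x}"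

definition rigid_ob :: "('o, 'm) ttcat \<Rightarrow> 'o \<Rightarrow> bool" where
  "rigid_ob T x \<longleftrightarrow> x \<in> Obj T \<and>
     (\<exists>y\<in>Obj T. \<exists>ev \<in> Hom T (y \<otimes>\<^sub>o\<^bsub>T\<^esub> x) (UnitO T). \<exists>coev \<in> Hom T (UnitO T) (x \<otimes>\<^sub>o\<^bsub>T\<^esub> y).
        RUnit T x \<cdot>\<^bsub>T\<^esub> (Ide T x \<otimes>\<^sub>a\<^bsub>T\<^esub> ev) \<cdot>\<^bsub>T\<^esub> Assoc T x y x \<cdot>\<^bsub>T\<^esub> (coev \<otimes>\<^sub>a\<^bsub>T\<^esub> Ide T x) = LUnit T x \<and>
        LUnit T y \<cdot>\<^bsub>T\<^esub> (ev \<otimes>\<^sub>a\<^bsub>T\<^esub> Ide T y) \<cdot>\<^bsub>T\<^esub> inv_arr T (Assoc T y x y) \<cdot>\<^bsub>T\<^esub> (Ide T y \<otimes>\<^sub>a\<^bsub>T\<^esub> coev) = RUnit T y)"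

definition rigidly_compactly_generated :: "'u rel \<Rightarrow> ('o, 'm) ttcat \<Rightarrow> bool" where
  "rigidly_compactly_generated \<kappa> T \<longleftrightarrow> tt_category T \<and>
     (\<forall>I :: 'u set. \<forall>x. small \<kappa> I \<and> (\<forall>i\<in>I. x i \<in> Obj T) \<longrightarrow> (\<exists>c \<iota>. is_coproduct T I x c \<iota>)) \<and>
     (\<forall>I :: 'u set. \<forall>x c \<iota>. \<forall>y\<in>Obj T. small \<kappa> I \<and> (\<forall>i\<in>I. x i \<in> Obj T) \<and> is_coproduct T I x c \<iota> \<longrightarrow>
        is_coproduct T I (\<lambda>i. x i \<otimes>\<^sub>o\<^bsub>T\<^esub> y) (c \<otimes>\<^sub>o\<^bsub>T\<^esub> y) (\<lambda>i. \<iota> i \<otimes>\<^sub>a\<^bsub>T\<^esub> Ide T y)) \<and>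
     (\<exists>G \<subseteq> cpt \<kappa> T. small \<kappa> G \<and> (\<forall>x\<in>cpt \<kappa> T. \<exists>g\<in>G. isomorphic T g x) \<and>
        (\<forall>g\<in>G. \<forall>g'\<in>G. small \<kappa> (Hom T g g'))) \<and>
     (\<forall>t\<in>Obj T. (\<forall>x\<in>cpt \<kappa> T. Hom T x t = {Zr T x t}) \<longrightarrow> zero_ob T t) \<and>
     (\<forall>x. compact_ob \<kappa> T x \<longleftrightarrow> rigid_ob T x)"


section \<open>The Balmer spectrum and its topologies\<close>

definition two_of_three :: "('o, 'm) ttcat \<Rightarrow> 'o set \<Rightarrow> 'o set \<Rightarrow> bool" where
  "two_of_three T A L \<longleftrightarrow> (\<forall>f g h. (f, g, h) \<in> Tri T \<and> {Dom T f, Cod T f, Cod T g} \<subseteq> A \<longrightarrow>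
     (Dom T f \<in> L \<and> Cod T f \<in> L \<longrightarrow> Cod T g \<in> L) \<and>
     (Dom T f \<in> L \<and> Cod T g \<in> L \<longrightarrow> Cod T f \<in> L) \<and>
     (Cod T f \<in> L \<and> Cod T g \<in> L \<longrightarrow> Dom T f \<in> L))"

definition iso_closed :: "('o, 'm) ttcat \<Rightarrow> 'o set \<Rightarrow> bool" where
  "iso_closed T L \<longleftrightarrow> (\<forall>x\<in>L. \<forall>y. isomorphic T x y \<longrightarrow> y \<in> L)"

definition thick_ideal :: "'u rel \<Rightarrow> ('o, 'm) ttcat \<Rightarrow> 'o set \<Rightarrow> bool" where
  "thick_ideal \<kappa> T J \<longleftrightarrow> J \<subseteq> cpt \<kappa> T \<and> (\<forall>z. zero_ob T z \<longrightarrow> z \<in> J) \<and> iso_closed T J \<and>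
     two_of_three T (cpt \<kappa> T) J \<and>
     (\<forall>x\<in>cpt \<kappa> T. \<forall>y\<in>J. \<forall>s r. s \<in> Hom T x y \<and> r \<in> Hom T y x \<and> r \<cdot>\<^bsub>T\<^esub> s = Ide T x \<longrightarrow> x \<in> J) \<and>
     (\<forall>x\<in>cpt \<kappa> T. \<forall>y\<in>J. x \<otimes>\<^sub>o\<^bsub>T\<^esub> y \<in> J)"

definition Spc :: "'u rel \<Rightarrow> ('o, 'm) ttcat \<Rightarrow> 'o set set" where
  "Spc \<kappa> T = {P. thick_ideal \<kappa> T P \<and> P \<noteq> cpt \<kappa> T \<and>
     (\<forall>x\<in>cpt \<kappa> T. \<forall>y\<in>cpt \<kappa> T. x \<otimes>\<^sub>o\<^bsub>T\<^esub> y \<in> P \<longrightarrow> x \<in> P \<or> y \<in> P)}"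

definition supp :: "'u rel \<Rightarrow> ('o, 'm) ttcat \<Rightarrow> 'o \<Rightarrow> 'o set set" where
  "supp \<kappa> T x = {P \<in> Spc \<kappa> T. x \<notin> P}"

definition Spc_top :: "'u rel \<Rightarrow> ('o, 'm) ttcat \<Rightarrow> 'o set topology" where
  "Spc_top \<kappa> T = topology_generated_by {Spc \<kappa> T - supp \<kappa> T x |x. compact_ob \<kappa> T x}"

definition thomason_in :: "'a topology \<Rightarrow> 'a set \<Rightarrow> bool" where
  "thomason_in X Y \<longleftrightarrow>
     (\<exists>\<A>. Y = \<Union>\<A> \<and> (\<forall>A\<in>\<A>. closedin X A \<and> compactin X (topspace X - A)))"

lemma istopology_thomason_in: "istopology (thomason_in X)"
  unfolding istopology_def
proof (intro conjI allI impI)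
  fix S T assume "thomason_in X S" "thomason_in X T"
  then obtain \<A> \<B> where
    A: "S = \<Union>\<A>" "\<And>A. A \<in> \<A> \<Longrightarrow> closedin X A \<and> compactin X (topspace X - A)" and
    B: "T = \<Union>\<B>" "\<And>B. B \<in> \<B> \<Longrightarrow> closedin X B \<and> compactin X (topspace X - B)"
    unfolding thomason_in_def by metis
  have "closedin X (A \<inter> B) \<and> compactin X (topspace X - A \<inter> B)" if "A \<in> \<A>" "B \<in> \<B>" for A B
    using A(2)[OF that(1)] B(2)[OF that(2)] by (simp add: Diff_Int compactin_Un closedin_Int)
  moreover have "S \<inter> T = \<Union>{A \<inter> B |A B. A \<in> \<A> \<and> B \<in> \<B>}"
    using A(1) B(1) by blast
  ultimately show "thomason_in X (S \<inter> T)"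
    unfolding thomason_in_def by (intro exI[of _ "{A \<inter> B |A B. A \<in> \<A> \<and> B \<in> \<B>}"]) blast
next
  fix \<K> assume K: "\<forall>K\<in>\<K>. thomason_in X K"
  define \<C> where "\<C> = {A. closedin X A \<and> compactin X (topspace X - A) \<and> A \<subseteq> \<Union>\<K>}"
  have "\<Union>\<K> \<subseteq> \<Union>\<C>"
  proof
    fix x assume "x \<in> \<Union>\<K>"
    then obtain K where x: "K \<in> \<K>" "x \<in> K" by blast
    with K obtain \<A> where A: "K = \<Union>\<A>" "\<forall>A\<in>\<A>. closedin X A \<and> compactin X (topspace X - A)"
      unfolding thomason_in_def by blast
    from A(1) x(2) obtain A where "A \<in> \<A>" "x \<in> A" by blast
    with A x(1) have "A \<in> \<C>" unfolding \<C>_def by blast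
    with \<open>x \<in> A\<close> show "x \<in> \<Union>\<C>" by blast
  qed
  moreover have "\<Union>\<C> \<subseteq> \<Union>\<K>" unfolding \<C>_def by blast
  ultimately have "\<Union>\<K> = \<Union>\<C>" by (rule subset_antisym)
  moreover have "\<forall>A\<in>\<C>. closedin X A \<and> compactin X (topspace X - A)" unfolding \<C>_def by simp
  ultimately show "thomason_in X (\<Union>\<K>)" unfolding thomason_in_def by blast
qed

definition inverse_topology :: "'a topology \<Rightarrow> 'a topology" where
  "inverse_topology X = topology (thomason_in X)"

lemma openin_inverse_topology: "openin (inverse_topology X) = thomason_in X"
  unfolding inverse_topology_def by (rule topology_inverse'[OF istopology_thomason_in])

definition weakly_isolated :: "'a topology \<Rightarrow> 'a \<Rightarrow> bool" where
  "weakly_isolated F w \<longleftrightarrow> (\<exists>U. openin F U \<and> w \<in> U \<and> U \<subseteq> F closure_of {w})"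

definition weakly_scattered :: "'a topology \<Rightarrow> bool" where
  "weakly_scattered C \<longleftrightarrow>
     (\<forall>F. closedin C F \<and> F \<noteq> {} \<longrightarrow> (\<exists>w\<in>F. weakly_isolated (subtopology C F) w))"


section \<open>Localizing subcategories, Rickard idempotents and support\<close>

definition localizing :: "'u rel \<Rightarrow> ('o, 'm) ttcat \<Rightarrow> 'o set \<Rightarrow> bool" where
  "localizing \<kappa> T L \<longleftrightarrow> L \<subseteq> Obj T \<and> (\<forall>z. zero_ob T z \<longrightarrow> z \<in> L) \<and> iso_closed T L \<and>
     two_of_three T (Obj T) L \<and>
     (\<forall>I :: 'u set. \<forall>x c \<iota>. small \<kappa> I \<and> (\<forall>i\<in>I. x i \<in> L) \<and> is_coproduct T I x c \<iota> \<longrightarrow> c \<in> L)"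

definition Loc :: "'u rel \<Rightarrow> ('o, 'm) ttcat \<Rightarrow> 'o set \<Rightarrow> 'o set" where
  "Loc \<kappa> T S = \<Inter>{L. localizing \<kappa> T L \<and> S \<subseteq> L}"

definition Locid :: "'u rel \<Rightarrow> ('o, 'm) ttcat \<Rightarrow> 'o set \<Rightarrow> 'o set" where
  "Locid \<kappa> T S = \<Inter>{L. localizing \<kappa> T L \<and> (\<forall>x\<in>Obj T. \<forall>y\<in>L. x \<otimes>\<^sub>o\<^bsub>T\<^esub> y \<in> L) \<and> S \<subseteq> L}"

definition perp :: "('o, 'm) ttcat \<Rightarrow> 'o set \<Rightarrow> 'o set" where
  "perp T L = {y \<in> Obj T. \<forall>x\<in>L. Hom T x y = {Zr T x y}}"

abbreviation thomason :: "'u rel \<Rightarrow> ('o, 'm) ttcat \<Rightarrow> 'o set set \<Rightarrow> bool" where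
  "thomason \<kappa> T Y \<equiv> thomason_in (Spc_top \<kappa> T) Y"

definition cpt_supp :: "'u rel \<Rightarrow> ('o, 'm) ttcat \<Rightarrow> 'o set set \<Rightarrow> 'o set" where
  "cpt_supp \<kappa> T Y = {x \<in> cpt \<kappa> T. supp \<kappa> T x \<subseteq> Y}"

definition rickard :: "'u rel \<Rightarrow> ('o, 'm) ttcat \<Rightarrow> 'o set set \<Rightarrow> 'o \<Rightarrow> 'o \<Rightarrow> bool" where
  "rickard \<kappa> T Y e l \<longleftrightarrow> (\<exists>a b c. (a, b, c) \<in> Tri T \<and> a \<in> Hom T e (UnitO T) \<and> b \<in> Hom T (UnitO T) l \<and>
     e \<in> Loc \<kappa> T (cpt_supp \<kappa> T Y) \<and> l \<in> perp T (Loc \<kappa> T (cpt_supp \<kappa> T Y)))"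

text \<open>\<open>Gam \<kappa> T Y\<close> is \<open>\<Gamma>\<^sub>Y 1\<close> and \<open>Lam \<kappa> T Y\<close> is \<open>L 1\<close> for the complement of \<open>Y\<close>.\<close>

definition Gam :: "'u rel \<Rightarrow> ('o, 'm) ttcat \<Rightarrow> 'o set set \<Rightarrow> 'o" where
  "Gam \<kappa> T Y = (SOME e. \<exists>l. rickard \<kappa> T Y e l)"

definition Lam :: "'u rel \<Rightarrow> ('o, 'm) ttcat \<Rightarrow> 'o set set \<Rightarrow> 'o" where
  "Lam \<kappa> T Y = (SOME l. \<exists>e. rickard \<kappa> T Y e l)"

definition weakly_visible :: "'u rel \<Rightarrow> ('o, 'm) ttcat \<Rightarrow> 'o set set \<Rightarrow> bool" where
  "weakly_visible \<kappa> T W \<longleftrightarrow>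
     (\<exists>Y1 Y2. thomason \<kappa> T Y1 \<and> thomason \<kappa> T Y2 \<and> W = Y1 \<inter> (Spc \<kappa> T - Y2))"

definition g_ob :: "'u rel \<Rightarrow> ('o, 'm) ttcat \<Rightarrow> 'o set set \<Rightarrow> 'o" where
  "g_ob \<kappa> T W = (SOME x. \<exists>Y1 Y2. thomason \<kappa> T Y1 \<and> thomason \<kappa> T Y2 \<and> W = Y1 \<inter> (Spc \<kappa> T - Y2) \<and>
     x = Gam \<kappa> T Y1 \<otimes>\<^sub>o\<^bsub>T\<^esub> Lam \<kappa> T Y2)"

definition Supp :: "'u rel \<Rightarrow> ('o, 'm) ttcat \<Rightarrow> 'o \<Rightarrow> 'o set set" where
  "Supp \<kappa> T t = {P \<in> Spc \<kappa> T. \<forall>W. weakly_visible \<kappa> T W \<and> P \<in> W \<longrightarrow> \<not> zero_ob T (t \<otimes>\<^sub>o\<^bsub>T\<^esub> g_ob \<kappa> T W)}"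

definition detection_property :: "'u rel \<Rightarrow> ('o, 'm) ttcat \<Rightarrow> bool" where
  "detection_property \<kappa> T \<longleftrightarrow> (\<forall>t\<in>Obj T. Supp \<kappa> T t = {} \<longrightarrow> zero_ob T t)"

text \<open>A cover is given by the set of its members.\<close>

definition local_to_global :: "'u rel \<Rightarrow> ('o, 'm) ttcat \<Rightarrow> 'o \<Rightarrow> bool" where
  "local_to_global \<kappa> T t \<longleftrightarrow>
     (\<forall>\<W>. (\<forall>W\<in>\<W>. weakly_visible \<kappa> T W) \<and> \<Union>\<W> = Spc \<kappa> T \<longrightarrow>
        t \<in> Locid \<kappa> T {t \<otimes>\<^sub>o\<^bsub>T\<^esub> g_ob \<kappa> T W |W. W \<in> \<W>})"


section \<open>Triangulations presented by a model\<close>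

text \<open>
  In each kind of model the suspension is described by a collection \<open>S\<close> of coherent suspension
  squares, each one exhibiting an object \<open>W s\<close> as the suspension of \<open>X s\<close>; \<open>SM\<close> consists of
  \<open>(s, s', a, d)\<close> for the maps of squares inducing \<open>a : X s \<rightarrow> X s'\<close> and \<open>d : W s \<rightarrow> W s'\<close>.
  The exact triangles come from coherent diagrams \<open>x \<rightarrow> y \<rightarrow> z \<rightarrow> W s\<close> with \<open>x = X s\<close>.
  The collections below are already transported to the category carrying the suspension functor.
\<close>

definition susp_comparison ::
    "('o, 'm, 'z) category_scheme \<Rightarrow> ('o, 'm, 'o, 'm) functr \<Rightarrow> 's set \<Rightarrow> ('s \<Rightarrow> 'o) \<Rightarrow> ('s \<Rightarrow> 'o) \<Rightarrow>
     ('s \<times> 's \<times> 'm \<times> 'm) set \<Rightarrow> ('s \<Rightarrow> 'm) \<Rightarrow> bool" where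
  "susp_comparison H Sg S X W SM \<sigma> \<longleftrightarrow>
     (\<forall>s\<in>S. \<sigma> s \<in> Iso H (W s) (onO Sg (X s))) \<and>
     (\<forall>(s, s', a, d) \<in> SM. onA Sg a \<cdot>\<^bsub>H\<^esub> \<sigma> s = \<sigma> s' \<cdot>\<^bsub>H\<^esub> d)"

definition triangles_presented ::
    "('o, 'm) ttcat \<Rightarrow> 's set \<Rightarrow> ('s \<Rightarrow> 'o) \<Rightarrow> ('s \<Rightarrow> 'o) \<Rightarrow> ('s \<times> 's \<times> 'm \<times> 'm) set \<Rightarrow>
     ('s \<times> 'm \<times> 'm \<times> 'm) set \<Rightarrow> bool" where
  "triangles_presented T S X W SM Cf \<longleftrightarrow>
     (\<exists>\<sigma>. susp_comparison T (Shift T) S X W SM \<sigma> \<and>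
        Tri T = {(f, g, h). tri_shape T f g h \<and>
          (\<exists>(s, f', g', h') \<in> Cf. tri_iso T (f', g', \<sigma> s \<cdot>\<^bsub>T\<^esub> h') (f, g, h))})"


section \<open>Stable monoidal model categories\<close>

record ('o, 'm) model_cat = "('o, 'm) moncat" +
  Weq :: "'m set"
  Cof :: "'m set"
  Fib :: "'m set"

definition is_colimit ::
    "('i, 'j, 'y) category_scheme \<Rightarrow> ('o, 'm, 'z) category_scheme \<Rightarrow> ('i, 'j, 'o, 'm) functr \<Rightarrow> 'o \<Rightarrow>
     ('i \<Rightarrow> 'm) \<Rightarrow> bool" where
  "is_colimit J C F c \<iota> \<longleftrightarrow> c \<in> Obj C \<and> nat_trans J C F (pt C c) \<iota> \<and>
     (\<forall>y\<in>Obj C. \<forall>f. nat_trans J C F (pt C y) f \<longrightarrow>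
        (\<exists>!h. h \<in> Hom C c y \<and> (\<forall>i\<in>Obj J. h \<cdot>\<^bsub>C\<^esub> \<iota> i = f i)))"

definition small_category :: "'u rel \<Rightarrow> ('u, 'u) category \<Rightarrow> bool" where
  "small_category \<kappa> J \<longleftrightarrow> is_category J \<and> small \<kappa> (Obj J) \<and> small \<kappa> (Arr J)"

definition bicomplete :: "'u rel \<Rightarrow> ('o, 'm, 'z) category_scheme \<Rightarrow> bool" where
  "bicomplete \<kappa> C \<longleftrightarrow> (\<forall>J :: ('u, 'u) category. \<forall>F. small_category \<kappa> J \<and> is_functor J C F \<longrightarrow>
     (\<exists>c \<iota>. is_colimit J C F c \<iota>) \<and> (\<exists>c \<pi>. is_colimit (opc J) (opc C) F c \<pi>))"

definition retract_of :: "('o, 'm, 'z) category_scheme \<Rightarrow> 'm \<Rightarrow> 'm \<Rightarrow> bool" where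
  "retract_of C f g \<longleftrightarrow> f \<in> Arr C \<and> g \<in> Arr C \<and>
     (\<exists>a b a' b'. a \<in> Hom C (Dom C f) (Dom C g) \<and> b \<in> Hom C (Dom C g) (Dom C f) \<and>
        a' \<in> Hom C (Cod C f) (Cod C g) \<and> b' \<in> Hom C (Cod C g) (Cod C f) \<and>
        b \<cdot>\<^bsub>C\<^esub> a = Ide C (Dom C f) \<and> b' \<cdot>\<^bsub>C\<^esub> a' = Ide C (Cod C f) \<and>
        g \<cdot>\<^bsub>C\<^esub> a = a' \<cdot>\<^bsub>C\<^esub> f \<and> f \<cdot>\<^bsub>C\<^esub> b = b' \<cdot>\<^bsub>C\<^esub> g)"

definition has_lifting :: "('o, 'm, 'z) category_scheme \<Rightarrow> 'm \<Rightarrow> 'm \<Rightarrow> bool" where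
  "has_lifting C i p \<longleftrightarrow>
     (\<forall>a b. a \<in> Hom C (Dom C i) (Dom C p) \<and> b \<in> Hom C (Cod C i) (Cod C p) \<and> p \<cdot>\<^bsub>C\<^esub> a = b \<cdot>\<^bsub>C\<^esub> i \<longrightarrow>
        (\<exists>h \<in> Hom C (Cod C i) (Dom C p). h \<cdot>\<^bsub>C\<^esub> i = a \<and> p \<cdot>\<^bsub>C\<^esub> h = b))"

definition model_structure :: "'u rel \<Rightarrow> ('a, 'b) model_cat \<Rightarrow> bool" where
  "model_structure \<kappa> M \<longleftrightarrow> is_category M \<and> bicomplete \<kappa> M \<and>
     Weq M \<subseteq> Arr M \<and> Cof M \<subseteq> Arr M \<and> Fib M \<subseteq> Arr M \<and>
     (\<forall>x y z f g. f \<in> Hom M x y \<and> g \<in> Hom M y z \<longrightarrow>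
        (f \<in> Weq M \<and> g \<in> Weq M \<longrightarrow> g \<cdot>\<^bsub>M\<^esub> f \<in> Weq M) \<and>
        (f \<in> Weq M \<and> g \<cdot>\<^bsub>M\<^esub> f \<in> Weq M \<longrightarrow> g \<in> Weq M) \<and>
        (g \<in> Weq M \<and> g \<cdot>\<^bsub>M\<^esub> f \<in> Weq M \<longrightarrow> f \<in> Weq M)) \<and>
     (\<forall>f g. retract_of M f g \<longrightarrow>
        (g \<in> Weq M \<longrightarrow> f \<in> Weq M) \<and> (g \<in> Cof M \<longrightarrow> f \<in> Cof M) \<and> (g \<in> Fib M \<longrightarrow> f \<in> Fib M)) \<and>
     (\<forall>i\<in>Cof M. \<forall>p\<in>Fib M. i \<in> Weq M \<or> p \<in> Weq M \<longrightarrow> has_lifting M i p) \<and>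
     (\<forall>f\<in>Arr M.
        (\<exists>i\<in>Cof M \<inter> Weq M. \<exists>p\<in>Fib M. Dom M p = Cod M i \<and> f = p \<cdot>\<^bsub>M\<^esub> i) \<and>
        (\<exists>i\<in>Cof M. \<exists>p\<in>Fib M \<inter> Weq M. Dom M p = Cod M i \<and> f = p \<cdot>\<^bsub>M\<^esub> i))"

definition cofibrant :: "('a, 'b) model_cat \<Rightarrow> 'a \<Rightarrow> bool" where
  "cofibrant M x \<longleftrightarrow> x \<in> Obj M \<and> (\<forall>z. initial_ob M z \<longrightarrow> Hom M z x \<subseteq> Cof M)"

text \<open>Closed on both sides, the pushout-product axiom, and the unit axiom (Hovey).\<close>

definition monoidal_model_category :: "'u rel \<Rightarrow> ('a, 'b) model_cat \<Rightarrow> bool" where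
  "monoidal_model_category \<kappa> M \<longleftrightarrow> model_structure \<kappa> M \<and> is_monoidal M \<and>
     (\<forall>x\<in>Obj M.
        (\<exists>R \<eta> \<epsilon>. adjoint M M \<lparr>onO = (\<lambda>y. y \<otimes>\<^sub>o\<^bsub>M\<^esub> x), onA = (\<lambda>f. f \<otimes>\<^sub>a\<^bsub>M\<^esub> Ide M x)\<rparr> R \<eta> \<epsilon>) \<and>
        (\<exists>R \<eta> \<epsilon>. adjoint M M \<lparr>onO = (\<lambda>y. x \<otimes>\<^sub>o\<^bsub>M\<^esub> y), onA = (\<lambda>f. Ide M x \<otimes>\<^sub>a\<^bsub>M\<^esub> f)\<rparr> R \<eta> \<epsilon>)) \<and>
     (\<forall>f\<in>Cof M. \<forall>g\<in>Cof M. \<forall>p q k.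
        is_pushout M (f \<otimes>\<^sub>a\<^bsub>M\<^esub> Ide M (Dom M g)) (Ide M (Dom M f) \<otimes>\<^sub>a\<^bsub>M\<^esub> g) p q \<and>
        k \<in> Hom M (Cod M p) (Cod M f \<otimes>\<^sub>o\<^bsub>M\<^esub> Cod M g) \<and>
        k \<cdot>\<^bsub>M\<^esub> p = Ide M (Cod M f) \<otimes>\<^sub>a\<^bsub>M\<^esub> g \<and> k \<cdot>\<^bsub>M\<^esub> q = f \<otimes>\<^sub>a\<^bsub>M\<^esub> Ide M (Cod M g) \<longrightarrow>
        k \<in> Cof M \<and> (f \<in> Weq M \<or> g \<in> Weq M \<longrightarrow> k \<in> Weq M)) \<and>
     (\<forall>q\<in>Weq M \<inter> Fib M. \<forall>x. cofibrant M (Dom M q) \<and> Cod M q = UnitO M \<and> cofibrant M x \<longrightarrow>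
        q \<otimes>\<^sub>a\<^bsub>M\<^esub> Ide M x \<in> Weq M \<and> Ide M x \<otimes>\<^sub>a\<^bsub>M\<^esub> q \<in> Weq M)"

text \<open>
  The homotopy category is the Gabriel-Zisman localization: its arrows are zigzags up to the
  congruence generated by the relations \<open>zz_rel\<close>.  A zigzag is the list of its steps in the order in
  which they are traversed; a step \<open>(True, f)\<close> is \<open>f\<close> and a step \<open>(False, w)\<close> is the formal inverse
  of \<open>w\<close>.
\<close>

fun zigzag ::
    "('o, 'm, 'z) category_scheme \<Rightarrow> 'm set \<Rightarrow> 'o \<Rightarrow> (bool \<times> 'm) list \<Rightarrow> 'o \<Rightarrow> bool" where
  "zigzag C V x [] y \<longleftrightarrow> x \<in> Obj C \<and> x = y"
| "zigzag C V x ((b, f) # ws) y \<longleftrightarrow> (if b then f \<in> Arr C \<and> Dom C f = x \<and> zigzag C V (Cod C f) ws y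
     else f \<in> V \<and> Cod C f = x \<and> zigzag C V (Dom C f) ws y)"

inductive zz_rel ::
    "('o, 'm, 'z) category_scheme \<Rightarrow> 'm set \<Rightarrow> (bool \<times> 'm) list \<Rightarrow> (bool \<times> 'm) list \<Rightarrow> bool"
  for C V where
  "f \<in> Hom C x y \<Longrightarrow> g \<in> Hom C y z \<Longrightarrow> zz_rel C V [(True, f), (True, g)] [(True, g \<cdot>\<^bsub>C\<^esub> f)]"
| "x \<in> Obj C \<Longrightarrow> zz_rel C V [(True, Ide C x)] []"
| "w \<in> V \<Longrightarrow> zz_rel C V [(True, w), (False, w)] []"
| "w \<in> V \<Longrightarrow> zz_rel C V [(False, w), (True, w)] []"

definition zz_step ::
    "('o, 'm, 'z) category_scheme \<Rightarrow> 'm set \<Rightarrow> 'o \<Rightarrow> 'o \<Rightarrow> (bool \<times> 'm) list \<Rightarrow> (bool \<times> 'm) list \<Rightarrow> bool" where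
  "zz_step C V x y p q \<longleftrightarrow> zigzag C V x p y \<and> zigzag C V x q y \<and>
     (\<exists>us l r vs. zz_rel C V l r \<and> p = us @ l @ vs \<and> q = us @ r @ vs)"

definition zz_class ::
    "('o, 'm, 'z) category_scheme \<Rightarrow> 'm set \<Rightarrow> 'o \<Rightarrow> 'o \<Rightarrow> (bool \<times> 'm) list \<Rightarrow> (bool \<times> 'm) list set" where
  "zz_class C V x y p = {q. equivclp (zz_step C V x y) p q}"

definition localization ::
    "('o, 'm, 'z) category_scheme \<Rightarrow> 'm set \<Rightarrow> ('o, 'o \<times> (bool \<times> 'm) list set \<times> 'o) category" where
  "localization C V =
     \<lparr>Obj = Obj C,
      Arr = {(x, zz_class C V x y p, y) |x y p. zigzag C V x p y},
      Dom = (\<lambda>(x, _, _). x),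
      Cod = (\<lambda>(_, _, y). y),
      Ide = (\<lambda>x. (x, zz_class C V x x [], x)),
      Comp = (\<lambda>(_, Q, z) (x, P, _). (x, \<Union>p\<in>P. \<Union>q\<in>Q. zz_class C V x z (p @ q), z))\<rparr>"

definition Ho :: "('a, 'b) model_cat \<Rightarrow> ('a, 'a \<times> (bool \<times> 'b) list set \<times> 'a) category" where
  "Ho M = localization M (Weq M)"

definition gamma :: "('a, 'b) model_cat \<Rightarrow> ('a, 'b, 'a, 'a \<times> (bool \<times> 'b) list set \<times> 'a) functr" where
  "gamma M = \<lparr>onO = id,
     onA = (\<lambda>f. (Dom M f, zz_class M (Weq M) (Dom M f) (Cod M f) [(True, f)], Cod M f))\<rparr>"

definition is_cokernel :: "('o, 'm, 'z) category_scheme \<Rightarrow> 'm \<Rightarrow> 'm \<Rightarrow> bool" where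
  "is_cokernel C f g \<longleftrightarrow> (\<exists>z u v. zero_ob C z \<and> Cod C u = z \<and> is_pushout C f u g v)"

text \<open>
  A suspension square on a cofibrant object \<open>x\<close> is a cofibration \<open>i : x \<rightarrow> c\<close> into a weakly
  contractible object together with its cokernel \<open>q : c \<rightarrow> c/x\<close>.
\<close>

definition model_susp :: "('a, 'b) model_cat \<Rightarrow> ('b \<times> 'b) set" where
  "model_susp M = {(i, q). i \<in> Cof M \<and> cofibrant M (Dom M i) \<and>
     (\<forall>z. zero_ob M z \<longrightarrow> Hom M (Cod M i) z \<subseteq> Weq M) \<and> is_cokernel M i q}"

definition model_susp_mor ::
    "('a, 'b) model_cat \<Rightarrow> ('a, 'b, 'c, 'd) functr \<Rightarrow> (('b \<times> 'b) \<times> ('b \<times> 'b) \<times> 'd \<times> 'd) set" where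
  "model_susp_mor M F = {((i, q), (i', q'), onA F a, onA F d) |i q i' q' a d.
     (i, q) \<in> model_susp M \<and> (i', q') \<in> model_susp M \<and>
     a \<in> Hom M (Dom M i) (Dom M i') \<and> d \<in> Hom M (Cod M q) (Cod M q') \<and>
     (\<exists>b \<in> Hom M (Cod M i) (Cod M i'). b \<cdot>\<^bsub>M\<^esub> i = i' \<cdot>\<^bsub>M\<^esub> a \<and> d \<cdot>\<^bsub>M\<^esub> q = q' \<cdot>\<^bsub>M\<^esub> b)}"

text \<open>
  For a cofibration \<open>f : x \<rightarrow> y\<close> of cofibrant objects with cokernel \<open>g : y \<rightarrow> z\<close>, the connecting map
  in the homotopy category is \<open>z \<leftarrow> y \<union>\<^sub>x c \<rightarrow> c/x\<close>, where the left map collapses \<open>c\<close> (and is a weak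
  equivalence) and the right map collapses \<open>y\<close>.
\<close>

definition model_cofib ::
    "('a, 'b) model_cat \<Rightarrow> ('c, 'd, 'z) category_scheme \<Rightarrow> ('a, 'b, 'c, 'd) functr \<Rightarrow>
     (('b \<times> 'b) \<times> 'd \<times> 'd \<times> 'd) set" where
  "model_cofib M H F = {((i, q), onA F f, onA F g, onA F v \<cdot>\<^bsub>H\<^esub> inv_arr H (onA F u)) |i q f g u v.
     (i, q) \<in> model_susp M \<and> f \<in> Cof M \<and> Dom M f = Dom M i \<and> is_cokernel M f g \<and>
     (\<exists>j k. is_pushout M f i j k \<and>
        u \<in> Hom M (Cod M j) (Cod M g) \<and> u \<cdot>\<^bsub>M\<^esub> j = g \<and> zero_arr M (u \<cdot>\<^bsub>M\<^esub> k) \<and>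
        v \<in> Hom M (Cod M j) (Cod M q) \<and> zero_arr M (v \<cdot>\<^bsub>M\<^esub> j) \<and> v \<cdot>\<^bsub>M\<^esub> k = q)}"

definition stable_model :: "('a, 'b) model_cat \<Rightarrow> bool" where
  "stable_model M \<longleftrightarrow> (\<exists>z. zero_ob M z) \<and>
     (\<exists>Sg \<sigma>. equivalence (Ho M) (Ho M) Sg \<and>
        susp_comparison (Ho M) Sg (model_susp M) (\<lambda>s. Dom M (fst s)) (\<lambda>s. Cod M (snd s))
          (model_susp_mor M (gamma M)) \<sigma>)"

text \<open>
  The comparison of the derived tensor product of \<open>M\<close> with the tensor product of \<open>T\<close>: on cofibrant
  objects the derived tensor product is computed by the tensor product of \<open>M\<close>, and the derived unit
  is a cofibrant replacement \<open>q\<close> of the unit.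
\<close>

definition model_tensor_comparison ::
    "('a, 'b) model_cat \<Rightarrow> ('o, 'm) ttcat \<Rightarrow> ('a, 'b, 'o, 'm) functr \<Rightarrow> bool" where
  "model_tensor_comparison M T F \<longleftrightarrow> (\<exists>\<mu> q \<iota>.
     (\<forall>x y. cofibrant M x \<and> cofibrant M y \<longrightarrow>
        \<mu> x y \<in> Iso T (onO F x \<otimes>\<^sub>o\<^bsub>T\<^esub> onO F y) (onO F (x \<otimes>\<^sub>o\<^bsub>M\<^esub> y))) \<and>
     (\<forall>x x' y y' f g. cofibrant M x \<and> cofibrant M x' \<and> cofibrant M y \<and> cofibrant M y' \<and>
        f \<in> Hom M x x' \<and> g \<in> Hom M y y' \<longrightarrow>
        \<mu> x' y' \<cdot>\<^bsub>T\<^esub> (onA F f \<otimes>\<^sub>a\<^bsub>T\<^esub> onA F g) = onA F (f \<otimes>\<^sub>a\<^bsub>M\<^esub> g) \<cdot>\<^bsub>T\<^esub> \<mu> x y) \<and>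
     (\<forall>x y z. cofibrant M x \<and> cofibrant M y \<and> cofibrant M z \<longrightarrow>
        onA F (Assoc M x y z) \<cdot>\<^bsub>T\<^esub> \<mu> (x \<otimes>\<^sub>o\<^bsub>M\<^esub> y) z \<cdot>\<^bsub>T\<^esub> (\<mu> x y \<otimes>\<^sub>a\<^bsub>T\<^esub> Ide T (onO F z)) =
        \<mu> x (y \<otimes>\<^sub>o\<^bsub>M\<^esub> z) \<cdot>\<^bsub>T\<^esub> (Ide T (onO F x) \<otimes>\<^sub>a\<^bsub>T\<^esub> \<mu> y z) \<cdot>\<^bsub>T\<^esub> Assoc T (onO F x) (onO F y) (onO F z)) \<and>
     q \<in> Weq M \<and> cofibrant M (Dom M q) \<and> Cod M q = UnitO M \<and>
     \<iota> \<in> Iso T (UnitO T) (onO F (Dom M q)) \<and>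
     (\<forall>x. cofibrant M x \<longrightarrow>
        onA F (LUnit M x \<cdot>\<^bsub>M\<^esub> (q \<otimes>\<^sub>a\<^bsub>M\<^esub> Ide M x)) \<cdot>\<^bsub>T\<^esub> \<mu> (Dom M q) x \<cdot>\<^bsub>T\<^esub> (\<iota> \<otimes>\<^sub>a\<^bsub>T\<^esub> Ide T (onO F x)) =
          LUnit T (onO F x) \<and>
        onA F (RUnit M x \<cdot>\<^bsub>M\<^esub> (Ide M x \<otimes>\<^sub>a\<^bsub>M\<^esub> q)) \<cdot>\<^bsub>T\<^esub> \<mu> x (Dom M q) \<cdot>\<^bsub>T\<^esub> (Ide T (onO F x) \<otimes>\<^sub>a\<^bsub>T\<^esub> \<iota>) =
          RUnit T (onO F x)))"

definition homotopy_category_of_model_category ::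
    "'u rel \<Rightarrow> ('a, 'b) model_cat \<Rightarrow> ('o, 'm) ttcat \<Rightarrow> bool" where
  "homotopy_category_of_model_category \<kappa> M T \<longleftrightarrow> monoidal_model_category \<kappa> M \<and> stable_model M \<and>
     (\<exists>E. equivalence (Ho M) T E \<and>
        (let F = fcomp E (gamma M) in
           model_tensor_comparison M T F \<and>
           triangles_presented T (model_susp M) (\<lambda>s. onO F (Dom M (fst s))) (\<lambda>s. onO F (Cod M (snd s)))
             (model_susp_mor M F) (model_cofib M T F)))"


section \<open>Strong stable monoidal derivators\<close>

text \<open>
  For a small category \<open>A\<close>, \<open>DC A\<close> is the value of the derivator with its tensor product; for
  \<open>u : A \<rightarrow> B\<close>, \<open>DF A B u : DC B \<rightarrow> DC A\<close> is \<open>u\<^sup>*\<close> with monoidal constraints \<open>DM A B u\<close> and \<open>DU A B u\<close>;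
  for \<open>\<alpha> : u \<Rightarrow> v\<close>, \<open>DN A B u v \<alpha>\<close> is \<open>\<alpha>\<^sup>* : u\<^sup>* \<Rightarrow> v\<^sup>*\<close>.  Shapes such as products, comma categories and
  finite posets are only determined up to isomorphism, so the axioms quantify over all small
  categories of the given shape.
\<close>

record ('u, 'p, 'q) derivator =
  DC :: "('u, 'u) category \<Rightarrow> ('p, 'q) moncat"
  DF :: "('u, 'u) category \<Rightarrow> ('u, 'u) category \<Rightarrow> ('u, 'u, 'u, 'u) functr \<Rightarrow> ('p, 'q, 'p, 'q) functr"
  DN :: "('u, 'u) category \<Rightarrow> ('u, 'u) category \<Rightarrow> ('u, 'u, 'u, 'u) functr \<Rightarrow> ('u, 'u, 'u, 'u) functr \<Rightarrow>
         ('u \<Rightarrow> 'u) \<Rightarrow> 'p \<Rightarrow> 'q"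
  DM :: "('u, 'u) category \<Rightarrow> ('u, 'u) category \<Rightarrow> ('u, 'u, 'u, 'u) functr \<Rightarrow> 'p \<Rightarrow> 'p \<Rightarrow> 'q"
  DU :: "('u, 'u) category \<Rightarrow> ('u, 'u) category \<Rightarrow> ('u, 'u, 'u, 'u) functr \<Rightarrow> 'q"

definition small_functor ::
    "'u rel \<Rightarrow> ('u, 'u) category \<Rightarrow> ('u, 'u) category \<Rightarrow> ('u, 'u, 'u, 'u) functr \<Rightarrow> bool" where
  "small_functor \<kappa> A B u \<longleftrightarrow> small_category \<kappa> A \<and> small_category \<kappa> B \<and> is_functor A B u"

definition prederivator :: "'u rel \<Rightarrow> ('u, 'p, 'q) derivator \<Rightarrow> bool" where
  "prederivator \<kappa> D \<longleftrightarrow>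
     (\<forall>A. small_category \<kappa> A \<longrightarrow> is_category (DC D A) \<and> feq (DC D A) (DF D A A fid) fid) \<and>
     (\<forall>A B u. small_functor \<kappa> A B u \<longrightarrow> is_functor (DC D B) (DC D A) (DF D A B u) \<and>
        (\<forall>X\<in>Obj (DC D B). DN D A B u u (\<lambda>a. Ide B (onO u a)) X = Ide (DC D A) (onO (DF D A B u) X))) \<and>
     (\<forall>A B u u'. small_functor \<kappa> A B u \<and> small_functor \<kappa> A B u' \<and> feq A u u' \<longrightarrow>
        feq (DC D B) (DF D A B u) (DF D A B u')) \<and>
     (\<forall>A B C u v. small_functor \<kappa> A B u \<and> small_functor \<kappa> B C v \<longrightarrow>
        feq (DC D C) (DF D A C (fcomp v u)) (fcomp (DF D A B u) (DF D B C v))) \<and>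
     (\<forall>A B u v \<alpha>. small_functor \<kappa> A B u \<and> small_functor \<kappa> A B v \<and> nat_trans A B u v \<alpha> \<longrightarrow>
        nat_trans (DC D B) (DC D A) (DF D A B u) (DF D A B v) (DN D A B u v \<alpha>)) \<and>
     (\<forall>A B u v u' v' \<alpha> \<alpha>'. small_functor \<kappa> A B u \<and> small_functor \<kappa> A B v \<and> nat_trans A B u v \<alpha> \<and>
        feq A u u' \<and> feq A v v' \<and> (\<forall>a\<in>Obj A. \<alpha>' a = \<alpha> a) \<longrightarrow>
        (\<forall>X\<in>Obj (DC D B). DN D A B u' v' \<alpha>' X = DN D A B u v \<alpha> X)) \<and>
     (\<forall>A B u v w \<alpha> \<beta>. small_functor \<kappa> A B u \<and> small_functor \<kappa> A B v \<and> small_functor \<kappa> A B w \<and>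
        nat_trans A B u v \<alpha> \<and> nat_trans A B v w \<beta> \<longrightarrow>
        (\<forall>X\<in>Obj (DC D B). DN D A B u w (\<lambda>a. \<beta> a \<cdot>\<^bsub>B\<^esub> \<alpha> a) X =
           DN D A B v w \<beta> X \<cdot>\<^bsub>DC D A\<^esub> DN D A B u v \<alpha> X)) \<and>
     (\<forall>A B C u v w \<alpha>. small_functor \<kappa> A B w \<and> small_functor \<kappa> B C u \<and> small_functor \<kappa> B C v \<and>
        nat_trans B C u v \<alpha> \<longrightarrow>
        (\<forall>X\<in>Obj (DC D C). DN D A C (fcomp u w) (fcomp v w) (\<lambda>a. \<alpha> (onO w a)) X =
           onA (DF D A B w) (DN D B C u v \<alpha> X))) \<and>
     (\<forall>A B C u v w \<alpha>. small_functor \<kappa> A B u \<and> small_functor \<kappa> A B v \<and> small_functor \<kappa> B C w \<and>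
        nat_trans A B u v \<alpha> \<longrightarrow>
        (\<forall>X\<in>Obj (DC D C). DN D A C (fcomp w u) (fcomp w v) (\<lambda>a. onA w (\<alpha> a)) X =
           DN D A B u v \<alpha> (onO (DF D B C w) X)))"

definition product_category ::
    "'i set \<Rightarrow> ('i \<Rightarrow> ('o, 'm, 'z) category_scheme) \<Rightarrow> ('i \<Rightarrow> 'o, 'i \<Rightarrow> 'm) category" where
  "product_category I C =
     \<lparr>Obj = (\<Pi>\<^sub>E i\<in>I. Obj (C i)),
      Arr = (\<Pi>\<^sub>E i\<in>I. Arr (C i)),
      Dom = (\<lambda>f. \<lambda>i\<in>I. Dom (C i) (f i)),
      Cod = (\<lambda>f. \<lambda>i\<in>I. Cod (C i) (f i)),
      Ide = (\<lambda>x. \<lambda>i\<in>I. Ide (C i) (x i)),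
      Comp = (\<lambda>g f. \<lambda>i\<in>I. g i \<cdot>\<^bsub>C i\<^esub> f i)\<rparr>"

definition is_coproduct_cat ::
    "'i set \<Rightarrow> ('i \<Rightarrow> ('u, 'u) category) \<Rightarrow> ('u, 'u) category \<Rightarrow> ('i \<Rightarrow> ('u, 'u, 'u, 'u) functr) \<Rightarrow> bool" where
  "is_coproduct_cat I A C j \<longleftrightarrow> (\<forall>i\<in>I. is_functor (A i) C (j i)) \<and>
     bij_betw (\<lambda>(i, a). onO (j i) a) (SIGMA i:I. Obj (A i)) (Obj C) \<and>
     bij_betw (\<lambda>(i, f). onA (j i) f) (SIGMA i:I. Arr (A i)) (Arr C)"

definition is_product_cat ::
    "('u, 'u) category \<Rightarrow> ('u, 'u) category \<Rightarrow> ('u, 'u) category \<Rightarrow> ('u, 'u, 'u, 'u) functr \<Rightarrow>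
     ('u, 'u, 'u, 'u) functr \<Rightarrow> bool" where
  "is_product_cat A B P p q \<longleftrightarrow> is_functor P A p \<and> is_functor P B q \<and>
     bij_betw (\<lambda>x. (onO p x, onO q x)) (Obj P) (Obj A \<times> Obj B) \<and>
     bij_betw (\<lambda>f. (onA p f, onA q f)) (Arr P) (Arr A \<times> Arr B)"

definition terminal_cat :: "('u, 'u) category \<Rightarrow> 'u \<Rightarrow> bool" where
  "terminal_cat E e \<longleftrightarrow> is_category E \<and> Obj E = {e} \<and> Arr E = {Ide E e}"

text \<open>
  \<open>P\<close> is the comma category of pairs \<open>(a, \<phi> : u a \<rightarrow> b)\<close>, respectively \<open>(a, \<phi> : b \<rightarrow> u a)\<close>,
  with projection \<open>p\<close> to \<open>A\<close>.
\<close>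

definition comma_over ::
    "('u, 'u) category \<Rightarrow> ('u, 'u) category \<Rightarrow> ('u, 'u, 'u, 'u) functr \<Rightarrow> 'u \<Rightarrow> ('u, 'u) category \<Rightarrow>
     ('u, 'u, 'u, 'u) functr \<Rightarrow> ('u \<Rightarrow> 'u) \<Rightarrow> bool" where
  "comma_over A B u b P p \<phi> \<longleftrightarrow> is_functor P A p \<and>
     bij_betw (\<lambda>x. (onO p x, \<phi> x)) (Obj P) {(a, f). a \<in> Obj A \<and> f \<in> Hom B (onO u a) b} \<and>
     bij_betw (\<lambda>r. (Dom P r, onA p r, Cod P r)) (Arr P)
       {(x, k, y). x \<in> Obj P \<and> y \<in> Obj P \<and> k \<in> Hom A (onO p x) (onO p y) \<and> \<phi> y \<cdot>\<^bsub>B\<^esub> onA u k = \<phi> x}"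

definition comma_under ::
    "('u, 'u) category \<Rightarrow> ('u, 'u) category \<Rightarrow> ('u, 'u, 'u, 'u) functr \<Rightarrow> 'u \<Rightarrow> ('u, 'u) category \<Rightarrow>
     ('u, 'u, 'u, 'u) functr \<Rightarrow> ('u \<Rightarrow> 'u) \<Rightarrow> bool" where
  "comma_under A B u b P p \<phi> \<longleftrightarrow> is_functor P A p \<and>
     bij_betw (\<lambda>x. (onO p x, \<phi> x)) (Obj P) {(a, f). a \<in> Obj A \<and> f \<in> Hom B b (onO u a)} \<and>
     bij_betw (\<lambda>r. (Dom P r, onA p r, Cod P r)) (Arr P)
       {(x, k, y). x \<in> Obj P \<and> y \<in> Obj P \<and> k \<in> Hom A (onO p x) (onO p y) \<and> onA u k \<cdot>\<^bsub>B\<^esub> \<phi> x = \<phi> y}"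

definition Der1 :: "'u rel \<Rightarrow> ('u, 'p, 'q) derivator \<Rightarrow> bool" where
  "Der1 \<kappa> D \<longleftrightarrow> (\<forall>I :: 'u set. \<forall>A C j. small \<kappa> I \<and> (\<forall>i\<in>I. small_category \<kappa> (A i)) \<and>
     small_category \<kappa> C \<and> is_coproduct_cat I A C j \<longrightarrow>
     equivalence (DC D C) (product_category I (\<lambda>i. DC D (A i)))
       \<lparr>onO = (\<lambda>X. \<lambda>i\<in>I. onO (DF D (A i) C (j i)) X), onA = (\<lambda>f. \<lambda>i\<in>I. onA (DF D (A i) C (j i)) f)\<rparr>)"

definition Der2 :: "'u rel \<Rightarrow> ('u, 'p, 'q) derivator \<Rightarrow> bool" where
  "Der2 \<kappa> D \<longleftrightarrow> (\<forall>A E e. small_category \<kappa> A \<and> small_category \<kappa> E \<and> terminal_cat E e \<longrightarrow>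
     (\<forall>f\<in>Arr (DC D A). (\<forall>a\<in>Obj A. iso_arr (DC D E) (onA (DF D E A (pt A a)) f)) \<longrightarrow> iso_arr (DC D A) f))"

definition Der3 :: "'u rel \<Rightarrow> ('u, 'p, 'q) derivator \<Rightarrow> bool" where
  "Der3 \<kappa> D \<longleftrightarrow> (\<forall>A B u. small_functor \<kappa> A B u \<longrightarrow>
     (\<exists>L \<eta> \<epsilon>. adjoint (DC D A) (DC D B) L (DF D A B u) \<eta> \<epsilon>) \<and>
     (\<exists>R \<eta> \<epsilon>. adjoint (DC D B) (DC D A) (DF D A B u) R \<eta> \<epsilon>))"

text \<open>
  The canonical mates \<open>\<pi>\<^sub>! p\<^sup>* \<rightarrow> b\<^sup>* u\<^sub>!\<close> and \<open>b\<^sup>* u\<^sub>* \<rightarrow> \<pi>\<^sub>* p\<^sup>*\<close> of the comma squares are isomorphisms,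
  where \<open>\<pi>\<close> is the functor from the comma category to the terminal category.
\<close>

definition Der4 :: "'u rel \<Rightarrow> ('u, 'p, 'q) derivator \<Rightarrow> bool" where
  "Der4 \<kappa> D \<longleftrightarrow> (\<forall>A B u b P p \<phi> E e. small_functor \<kappa> A B u \<and> b \<in> Obj B \<and> small_category \<kappa> P \<and>
     small_category \<kappa> E \<and> terminal_cat E e \<longrightarrow>
     (comma_over A B u b P p \<phi> \<longrightarrow>
        (\<forall>U \<eta> \<epsilon> V \<eta>' \<epsilon>'. adjoint (DC D A) (DC D B) U (DF D A B u) \<eta> \<epsilon> \<and>
           adjoint (DC D P) (DC D E) V (DF D P E (pt E e)) \<eta>' \<epsilon>' \<longrightarrow>
           (\<forall>X\<in>Obj (DC D A). iso_arr (DC D E)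
              (\<epsilon>' (onO (DF D E B (pt B b)) (onO U X)) \<cdot>\<^bsub>DC D E\<^esub>
               onA V (DN D P B (fcomp u p) (pt B b) \<phi> (onO U X) \<cdot>\<^bsub>DC D P\<^esub> onA (DF D P A p) (\<eta> X)))))) \<and>
     (comma_under A B u b P p \<phi> \<longrightarrow>
        (\<forall>U \<eta> \<epsilon> V \<eta>' \<epsilon>'. adjoint (DC D B) (DC D A) (DF D A B u) U \<eta> \<epsilon> \<and>
           adjoint (DC D E) (DC D P) (DF D P E (pt E e)) V \<eta>' \<epsilon>' \<longrightarrow>
           (\<forall>X\<in>Obj (DC D A). iso_arr (DC D E)
              (onA V (onA (DF D P A p) (\<epsilon> X) \<cdot>\<^bsub>DC D P\<^esub> DN D P B (pt B b) (fcomp u p) \<phi> (onO U X)) \<cdot>\<^bsub>DC D E\<^esub>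
               \<eta>' (onO (DF D E B (pt B b)) (onO U X)))))))"

text \<open>\<open>S\<close> is the poset \<open>(V, lq)\<close>, regarded as a category, with objects labelled by \<open>e\<close>.\<close>

definition poset_cat ::
    "('u, 'u) category \<Rightarrow> 'v set \<Rightarrow> ('v \<Rightarrow> 'v \<Rightarrow> bool) \<Rightarrow> ('v \<Rightarrow> 'u) \<Rightarrow> bool" where
  "poset_cat S V lq e \<longleftrightarrow> is_category S \<and> bij_betw e V (Obj S) \<and>
     (\<forall>i\<in>V. \<forall>j\<in>V. if lq i j then \<exists>f. Hom S (e i) (e j) = {f} else Hom S (e i) (e j) = {})"

abbreviation le2 :: "nat \<times> nat \<Rightarrow> nat \<times> nat \<Rightarrow> bool" where
  "le2 v w \<equiv> fst v \<le> fst w \<and> snd v \<le> snd w"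

abbreviation sqV :: "(nat \<times> nat) set" where "sqV \<equiv> {0, 1} \<times> {0, 1}"
abbreviation rectV :: "(nat \<times> nat) set" where "rectV \<equiv> {0, 1} \<times> {0, 1, 2}"
abbreviation spanV :: "(nat \<times> nat) set" where "spanV \<equiv> {(0, 0), (0, 1), (1, 0)}"
abbreviation cospanV :: "(nat \<times> nat) set" where "cospanV \<equiv> {(0, 1), (1, 0), (1, 1)}"

text \<open>
  Strength: the underlying diagram functor from \<open>D(A \<times> [1])\<close> to the arrow category of \<open>D(A)\<close> is full
  and essentially surjective.  Here \<open>i0, i1 : A \<rightarrow> A \<times> [1]\<close> are the two inclusions and
  \<open>\<alpha> : i0 \<Rightarrow> i1\<close> is the canonical transformation.
\<close>

definition Der5 :: "'u rel \<Rightarrow> ('u, 'p, 'q) derivator \<Rightarrow> bool" where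
  "Der5 \<kappa> D \<longleftrightarrow> (\<forall>A I e P p q i0 i1 \<alpha>. small_category \<kappa> A \<and> small_category \<kappa> I \<and>
     poset_cat I {0, 1 :: nat} (\<le>) e \<and> small_category \<kappa> P \<and> is_product_cat A I P p q \<and>
     is_functor A P i0 \<and> feq A (fcomp p i0) fid \<and> feq A (fcomp q i0) (pt I (e 0)) \<and>
     is_functor A P i1 \<and> feq A (fcomp p i1) fid \<and> feq A (fcomp q i1) (pt I (e 1)) \<and>
     nat_trans A P i0 i1 \<alpha> \<and> (\<forall>a\<in>Obj A. onA p (\<alpha> a) = Ide A a) \<longrightarrow>
     (let C = DC D A; F0 = DF D A P i0; F1 = DF D A P i1; \<delta> = DN D A P i0 i1 \<alpha> in
       (\<forall>X\<in>Obj (DC D P). \<forall>Y\<in>Obj (DC D P). \<forall>a b.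
          a \<in> Hom C (onO F0 X) (onO F0 Y) \<and> b \<in> Hom C (onO F1 X) (onO F1 Y) \<and> b \<cdot>\<^bsub>C\<^esub> \<delta> X = \<delta> Y \<cdot>\<^bsub>C\<^esub> a \<longrightarrow>
          (\<exists>f \<in> Hom (DC D P) X Y. onA F0 f = a \<and> onA F1 f = b)) \<and>
       (\<forall>g\<in>Arr C. \<exists>X\<in>Obj (DC D P). \<exists>a \<in> Iso C (onO F0 X) (Dom C g). \<exists>b \<in> Iso C (onO F1 X) (Cod C g).
          b \<cdot>\<^bsub>C\<^esub> \<delta> X = g \<cdot>\<^bsub>C\<^esub> a)))"

definition cocartesian_square ::
    "'u rel \<Rightarrow> ('u, 'p, 'q) derivator \<Rightarrow> ('u, 'u) category \<Rightarrow> (nat \<times> nat \<Rightarrow> 'u) \<Rightarrow> 'p \<Rightarrow> bool" where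
  "cocartesian_square \<kappa> D Q e X \<longleftrightarrow> X \<in> Obj (DC D Q) \<and>
     (\<exists>K k i L \<eta> \<epsilon>. poset_cat K spanV le2 k \<and> small_functor \<kappa> K Q i \<and> (\<forall>v\<in>spanV. onO i (k v) = e v) \<and>
        adjoint (DC D K) (DC D Q) L (DF D K Q i) \<eta> \<epsilon> \<and> iso_arr (DC D Q) (\<epsilon> X))"

definition cartesian_square ::
    "'u rel \<Rightarrow> ('u, 'p, 'q) derivator \<Rightarrow> ('u, 'u) category \<Rightarrow> (nat \<times> nat \<Rightarrow> 'u) \<Rightarrow> 'p \<Rightarrow> bool" where
  "cartesian_square \<kappa> D Q e X \<longleftrightarrow> X \<in> Obj (DC D Q) \<and>
     (\<exists>K k i R \<eta> \<epsilon>. poset_cat K cospanV le2 k \<and> small_functor \<kappa> K Q i \<and> (\<forall>v\<in>cospanV. onO i (k v) = e v) \<and>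
        adjoint (DC D Q) (DC D K) (DF D K Q i) R \<eta> \<epsilon> \<and> iso_arr (DC D Q) (\<eta> X))"

definition strong_stable_derivator :: "'u rel \<Rightarrow> ('u, 'p, 'q) derivator \<Rightarrow> bool" where
  "strong_stable_derivator \<kappa> D \<longleftrightarrow>
     prederivator \<kappa> D \<and> Der1 \<kappa> D \<and> Der2 \<kappa> D \<and> Der3 \<kappa> D \<and> Der4 \<kappa> D \<and> Der5 \<kappa> D \<and>
     (\<forall>E e. small_category \<kappa> E \<and> terminal_cat E e \<longrightarrow> (\<exists>z. zero_ob (DC D E) z)) \<and>
     (\<forall>Q e. small_category \<kappa> Q \<and> poset_cat Q sqV le2 e \<longrightarrow>
        (\<forall>X. cocartesian_square \<kappa> D Q e X \<longleftrightarrow> cartesian_square \<kappa> D Q e X))"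

text \<open>
  A monoidal structure on \<open>D\<close>: a pseudomonoid structure, that is, monoidal structures on the values
  for which all \<open>u\<^sup>*\<close> are strong monoidal, pseudofunctorially, and all \<open>\<alpha>\<^sup>*\<close> are monoidal.
\<close>

definition monoidal_prederivator :: "'u rel \<Rightarrow> ('u, 'p, 'q) derivator \<Rightarrow> bool" where
  "monoidal_prederivator \<kappa> D \<longleftrightarrow>
     (\<forall>A. small_category \<kappa> A \<longrightarrow> is_monoidal (DC D A) \<and>
        (\<forall>X\<in>Obj (DC D A). \<forall>Y\<in>Obj (DC D A). DM D A A fid X Y = Ide (DC D A) (X \<otimes>\<^sub>o\<^bsub>DC D A\<^esub> Y)) \<and>
        DU D A A fid = Ide (DC D A) (UnitO (DC D A))) \<and>
     (\<forall>A B u. small_functor \<kappa> A B u \<longrightarrow>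
        strong_monoidal (DC D B) (DC D A) (DF D A B u) (DM D A B u) (DU D A B u)) \<and>
     (\<forall>A B u u'. small_functor \<kappa> A B u \<and> small_functor \<kappa> A B u' \<and> feq A u u' \<longrightarrow>
        DU D A B u = DU D A B u' \<and>
        (\<forall>X\<in>Obj (DC D B). \<forall>Y\<in>Obj (DC D B). DM D A B u X Y = DM D A B u' X Y)) \<and>
     (\<forall>A B C u v. small_functor \<kappa> A B u \<and> small_functor \<kappa> B C v \<longrightarrow>
        (\<forall>X\<in>Obj (DC D C). \<forall>Y\<in>Obj (DC D C). DM D A C (fcomp v u) X Y =
           onA (DF D A B u) (DM D B C v X Y) \<cdot>\<^bsub>DC D A\<^esub> DM D A B u (onO (DF D B C v) X) (onO (DF D B C v) Y)) \<and>
        DU D A C (fcomp v u) = onA (DF D A B u) (DU D B C v) \<cdot>\<^bsub>DC D A\<^esub> DU D A B u) \<and>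
     (\<forall>A B u v \<alpha>. small_functor \<kappa> A B u \<and> small_functor \<kappa> A B v \<and> nat_trans A B u v \<alpha> \<longrightarrow>
        (\<forall>X\<in>Obj (DC D B). \<forall>Y\<in>Obj (DC D B).
           DN D A B u v \<alpha> (X \<otimes>\<^sub>o\<^bsub>DC D B\<^esub> Y) \<cdot>\<^bsub>DC D A\<^esub> DM D A B u X Y =
           DM D A B v X Y \<cdot>\<^bsub>DC D A\<^esub> (DN D A B u v \<alpha> X \<otimes>\<^sub>a\<^bsub>DC D A\<^esub> DN D A B u v \<alpha> Y)) \<and>
        DN D A B u v \<alpha> (UnitO (DC D B)) \<cdot>\<^bsub>DC D A\<^esub> DU D A B u = DU D A B v)"

text \<open>
  The tensor product preserves homotopy colimits in each variable: for \<open>u : A \<rightarrow> B\<close> and a small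
  category \<open>C\<close> with products \<open>P = A \<times> C\<close>, \<open>Q = B \<times> C\<close> and \<open>v = u \<times> C\<close>, the canonical maps
  \<open>v\<^sub>!(X \<boxtimes> Y) \<rightarrow> u\<^sub>!X \<boxtimes> Y\<close> and \<open>v\<^sub>!(Y \<boxtimes> X) \<rightarrow> Y \<boxtimes> u\<^sub>!X\<close> of external products are isomorphisms.
\<close>

definition cocontinuous_tensor :: "'u rel \<Rightarrow> ('u, 'p, 'q) derivator \<Rightarrow> bool" where
  "cocontinuous_tensor \<kappa> D \<longleftrightarrow> (\<forall>A B C u P pA pC Q qB qC v U \<eta> \<epsilon> V \<eta>' \<epsilon>'.
     small_functor \<kappa> A B u \<and> small_category \<kappa> C \<and> is_product_cat A C P pA pC \<and> is_product_cat B C Q qB qC \<and>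
     small_functor \<kappa> P Q v \<and> feq P (fcomp qB v) (fcomp u pA) \<and> feq P (fcomp qC v) pC \<and>
     adjoint (DC D A) (DC D B) U (DF D A B u) \<eta> \<epsilon> \<and> adjoint (DC D P) (DC D Q) V (DF D P Q v) \<eta>' \<epsilon>' \<longrightarrow>
     (\<forall>X\<in>Obj (DC D A). \<forall>Y\<in>Obj (DC D C).
        (let X' = onO (DF D Q B qB) (onO U X); Y' = onO (DF D Q C qC) Y;
             a = onA (DF D P A pA) (\<eta> X); b = Ide (DC D P) (onO (DF D P C pC) Y) in
         iso_arr (DC D Q) (\<epsilon>' (X' \<otimes>\<^sub>o\<^bsub>DC D Q\<^esub> Y') \<cdot>\<^bsub>DC D Q\<^esub>
           onA V (DM D P Q v X' Y' \<cdot>\<^bsub>DC D P\<^esub> (a \<otimes>\<^sub>a\<^bsub>DC D P\<^esub> b))) \<and>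
         iso_arr (DC D Q) (\<epsilon>' (Y' \<otimes>\<^sub>o\<^bsub>DC D Q\<^esub> X') \<cdot>\<^bsub>DC D Q\<^esub>
           onA V (DM D P Q v Y' X' \<cdot>\<^bsub>DC D P\<^esub> (b \<otimes>\<^sub>a\<^bsub>DC D P\<^esub> a))))))"

definition strong_stable_monoidal_derivator :: "'u rel \<Rightarrow> ('u, 'p, 'q) derivator \<Rightarrow> bool" where
  "strong_stable_monoidal_derivator \<kappa> D \<longleftrightarrow>
     strong_stable_derivator \<kappa> D \<and> monoidal_prederivator \<kappa> D \<and> cocontinuous_tensor \<kappa> D"

text \<open>Values of a coherent diagram \<open>X \<in> D(S)\<close> at an object and at an arrow of \<open>S\<close>.\<close>

definition dob :: "('u, 'p, 'q) derivator \<Rightarrow> ('u, 'u) category \<Rightarrow> ('u, 'u) category \<Rightarrow> 'p \<Rightarrow> 'u \<Rightarrow> 'p" where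
  "dob D E S X a = onO (DF D E S (pt S a)) X"

definition dar ::
    "('u, 'p, 'q) derivator \<Rightarrow> ('u, 'u) category \<Rightarrow> ('u, 'u) category \<Rightarrow> 'p \<Rightarrow> 'u \<Rightarrow> 'u \<Rightarrow> 'q" where
  "dar D E S X a b = DN D E S (pt S a) (pt S b) (\<lambda>_. THE f. f \<in> Hom S a b) X"

definition der_susp ::
    "'u rel \<Rightarrow> ('u, 'p, 'q) derivator \<Rightarrow> ('u, 'u) category \<Rightarrow> ('u, 'u) category \<Rightarrow> (nat \<times> nat \<Rightarrow> 'u) \<Rightarrow> 'p set" where
  "der_susp \<kappa> D E Q e = {X. cocartesian_square \<kappa> D Q e X \<and>
     zero_ob (DC D E) (dob D E Q X (e (0, 1))) \<and> zero_ob (DC D E) (dob D E Q X (e (1, 0)))}"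

definition der_susp_mor ::
    "'u rel \<Rightarrow> ('u, 'p, 'q) derivator \<Rightarrow> ('u, 'u) category \<Rightarrow> ('u, 'u) category \<Rightarrow> (nat \<times> nat \<Rightarrow> 'u) \<Rightarrow>
     ('p, 'q, 'o, 'm) functr \<Rightarrow> ('p \<times> 'p \<times> 'm \<times> 'm) set" where
  "der_susp_mor \<kappa> D E Q e F =
     {(X, Y, onA F (onA (DF D E Q (pt Q (e (0, 0)))) f), onA F (onA (DF D E Q (pt Q (e (1, 1)))) f)) |X Y f.
        X \<in> der_susp \<kappa> D E Q e \<and> Y \<in> der_susp \<kappa> D E Q e \<and> f \<in> Hom (DC D Q) X Y}"

text \<open>
  Coherent diagrams of shape \<open>[1] \<times> [2]\<close>, with rows \<open>x \<rightarrow> y \<rightarrow> 0\<close> and \<open>0 \<rightarrow> z \<rightarrow> w\<close>, in which both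
  squares are cocartesian; \<open>l\<close>, \<open>r\<close> and \<open>s\<close> restrict to the left, right and outer square.
\<close>

definition der_cofib ::
    "'u rel \<Rightarrow> ('u, 'p, 'q) derivator \<Rightarrow> ('u, 'u) category \<Rightarrow> ('u, 'u) category \<Rightarrow> (nat \<times> nat \<Rightarrow> 'u) \<Rightarrow>
     ('p, 'q, 'o, 'm) functr \<Rightarrow> ('p \<times> 'm \<times> 'm \<times> 'm) set" where
  "der_cofib \<kappa> D E Q e F =
     {(onO (DF D Q R s) Z, onA F (dar D E R Z (d (0, 0)) (d (0, 1))), onA F (dar D E R Z (d (0, 1)) (d (1, 1))),
       onA F (dar D E R Z (d (1, 1)) (d (1, 2)))) |R d l r s Z.
        poset_cat R rectV le2 d \<and> small_functor \<kappa> Q R l \<and> small_functor \<kappa> Q R r \<and> small_functor \<kappa> Q R s \<and>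
        (\<forall>(i, j)\<in>sqV. onO l (e (i, j)) = d (i, j) \<and> onO r (e (i, j)) = d (i, j + 1) \<and>
           onO s (e (i, j)) = d (i, 2 * j)) \<and>
        Z \<in> Obj (DC D R) \<and>
        cocartesian_square \<kappa> D Q e (onO (DF D Q R l) Z) \<and> cocartesian_square \<kappa> D Q e (onO (DF D Q R r) Z) \<and>
        zero_ob (DC D E) (dob D E R Z (d (1, 0))) \<and> zero_ob (DC D E) (dob D E R Z (d (0, 2)))}"

definition underlying_category_of_derivator ::
    "'u rel \<Rightarrow> ('u, 'p, 'q) derivator \<Rightarrow> ('o, 'm) ttcat \<Rightarrow> bool" where
  "underlying_category_of_derivator \<kappa> D T \<longleftrightarrow> strong_stable_monoidal_derivator \<kappa> D \<and>
     (\<exists>E z Q e F \<mu> \<iota>. small_category \<kappa> E \<and> terminal_cat E z \<and> small_category \<kappa> Q \<and> poset_cat Q sqV le2 e \<and>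
        equivalence (DC D E) T F \<and> strong_monoidal (DC D E) T F \<mu> \<iota> \<and>
        triangles_presented T (der_susp \<kappa> D E Q e) (\<lambda>X. onO F (dob D E Q X (e (0, 0))))
          (\<lambda>X. onO F (dob D E Q X (e (1, 1)))) (der_susp_mor \<kappa> D E Q e F) (der_cofib \<kappa> D E Q e F))"


section \<open>Stable monoidal quasi-categories\<close>

subsection \<open>Simplicial sets\<close>

text \<open>\<open>Opr X m n \<theta> : X\<^sub>n \<rightarrow> X\<^sub>m\<close> is the operator of a monotone map \<open>\<theta> : [m] \<rightarrow> [n]\<close>.\<close>

record 'x sset =
  Spx :: "nat \<Rightarrow> 'x set"
  Opr :: "nat \<Rightarrow> nat \<Rightarrow> (nat \<Rightarrow> nat) \<Rightarrow> 'x \<Rightarrow> 'x"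

definition mono_maps :: "nat \<Rightarrow> nat \<Rightarrow> (nat \<Rightarrow> nat) set" where
  "mono_maps m n = {\<theta>. (\<forall>i\<le>m. \<theta> i \<le> n) \<and> (\<forall>i j. i \<le> j \<and> j \<le> m \<longrightarrow> \<theta> i \<le> \<theta> j)}"

definition is_sset :: "('x, 'z) sset_scheme \<Rightarrow> bool" where
  "is_sset X \<longleftrightarrow>
     (\<forall>m n. \<forall>\<theta>\<in>mono_maps m n. \<forall>x\<in>Spx X n. Opr X m n \<theta> x \<in> Spx X m) \<and>
     (\<forall>n. \<forall>x\<in>Spx X n. Opr X n n id x = x) \<and>
     (\<forall>k m n. \<forall>\<theta>\<in>mono_maps k m. \<forall>\<psi>\<in>mono_maps m n. \<forall>x\<in>Spx X n.
        Opr X k n (\<psi> \<circ> \<theta>) x = Opr X k m \<theta> (Opr X m n \<psi> x)) \<and>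
     (\<forall>m n. \<forall>\<theta>\<in>mono_maps m n. \<forall>\<theta>'\<in>mono_maps m n. (\<forall>i\<le>m. \<theta> i = \<theta>' i) \<longrightarrow>
        (\<forall>x\<in>Spx X n. Opr X m n \<theta> x = Opr X m n \<theta>' x))"

definition sset_map :: "('x, 'y) sset_scheme \<Rightarrow> ('v, 'z) sset_scheme \<Rightarrow> (nat \<Rightarrow> 'x \<Rightarrow> 'v) \<Rightarrow> bool" where
  "sset_map X Y f \<longleftrightarrow> (\<forall>n. \<forall>x\<in>Spx X n. f n x \<in> Spx Y n) \<and>
     (\<forall>m n. \<forall>\<theta>\<in>mono_maps m n. \<forall>x\<in>Spx X n. f m (Opr X m n \<theta> x) = Opr Y m n \<theta> (f n x))"

definition vert :: "('x, 'z) sset_scheme \<Rightarrow> nat \<Rightarrow> 'x \<Rightarrow> nat \<Rightarrow> 'x" where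
  "vert X n s i = Opr X 0 n (\<lambda>_. i) s"

definition edge :: "('x, 'z) sset_scheme \<Rightarrow> nat \<Rightarrow> 'x \<Rightarrow> nat \<Rightarrow> nat \<Rightarrow> 'x" where
  "edge X n s i j = Opr X 1 n (\<lambda>k. if k = 0 then i else j) s"

definition degen :: "('x, 'z) sset_scheme \<Rightarrow> 'x \<Rightarrow> 'x" where
  "degen X x = Opr X 1 0 (\<lambda>_. 0) x"

definition edges :: "('x, 'z) sset_scheme \<Rightarrow> 'x \<Rightarrow> 'x \<Rightarrow> 'x set" where
  "edges X x y = {e \<in> Spx X 1. vert X 1 e 0 = x \<and> vert X 1 e 1 = y}"

definition simplex :: "nat \<Rightarrow> (nat \<Rightarrow> nat) sset" where
  "simplex n = \<lparr>Spx = (\<lambda>k. {s \<in> extensional {..k}. s \<in> mono_maps k n}),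
     Opr = (\<lambda>m k \<theta> s. restrict (s \<circ> \<theta>) {..m})\<rparr>"

definition prod_sset :: "('x, 'y) sset_scheme \<Rightarrow> ('v, 'z) sset_scheme \<Rightarrow> ('x \<times> 'v) sset" where
  "prod_sset X Y = \<lparr>Spx = (\<lambda>n. Spx X n \<times> Spx Y n),
     Opr = (\<lambda>m n \<theta> (x, y). (Opr X m n \<theta> x, Opr Y m n \<theta> y))\<rparr>"

definition pow_sset :: "'i set \<Rightarrow> ('x, 'z) sset_scheme \<Rightarrow> ('i \<Rightarrow> 'x) sset" where
  "pow_sset I X = \<lparr>Spx = (\<lambda>n. I \<rightarrow>\<^sub>E Spx X n), Opr = (\<lambda>m n \<theta> x. \<lambda>i\<in>I. Opr X m n \<theta> (x i))\<rparr>"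

text \<open>
  Maps out of nerves of posets and of their simplicial subsets.  A simplicial subset of the nerve
  of a poset with order \<open>lq\<close> is given by the family \<open>F\<close> of the vertex sets of its simplices.
  \<open>sdiag X lq F \<Phi>\<close> says that \<open>\<Phi>\<close> is a simplicial map from it to \<open>X\<close>.
\<close>

definition chain :: "('v \<Rightarrow> 'v \<Rightarrow> bool) \<Rightarrow> 'v set set \<Rightarrow> nat \<Rightarrow> (nat \<Rightarrow> 'v) \<Rightarrow> bool" where
  "chain lq F n s \<longleftrightarrow> s ` {..n} \<in> F \<and> (\<forall>i j. i \<le> j \<and> j \<le> n \<longrightarrow> lq (s i) (s j))"

definition sdiag ::
    "('x, 'z) sset_scheme \<Rightarrow> ('v \<Rightarrow> 'v \<Rightarrow> bool) \<Rightarrow> 'v set set \<Rightarrow> (nat \<Rightarrow> (nat \<Rightarrow> 'v) \<Rightarrow> 'x) \<Rightarrow> bool" where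
  "sdiag X lq F \<Phi> \<longleftrightarrow> (\<forall>n s. chain lq F n s \<longrightarrow> \<Phi> n s \<in> Spx X n) \<and>
     (\<forall>m n s s'. \<forall>\<theta>\<in>mono_maps m n. chain lq F n s \<and> (\<forall>i\<le>m. s' i = s (\<theta> i)) \<longrightarrow>
        \<Phi> m s' = Opr X m n \<theta> (\<Phi> n s))"

definition extends ::
    "('v \<Rightarrow> 'v \<Rightarrow> bool) \<Rightarrow> 'v set set \<Rightarrow> (nat \<Rightarrow> (nat \<Rightarrow> 'v) \<Rightarrow> 'x) \<Rightarrow> (nat \<Rightarrow> (nat \<Rightarrow> 'v) \<Rightarrow> 'x) \<Rightarrow> bool" where
  "extends lq F \<Psi> \<Phi> \<longleftrightarrow> (\<forall>n s. chain lq F n s \<longrightarrow> \<Psi> n s = \<Phi> n s)"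

abbreviation full :: "'v set \<Rightarrow> 'v set set" where "full V \<equiv> {A. A \<noteq> {} \<and> A \<subseteq> V}"
abbreviation horn :: "nat \<Rightarrow> nat \<Rightarrow> nat set set" where
  "horn n k \<equiv> {A \<in> full {..n}. \<not> {..n} - {k} \<subseteq> A}"
abbreviation boundary :: "nat \<Rightarrow> nat set set" where "boundary n \<equiv> {A \<in> full {..n}. A \<noteq> {..n}}"

abbreviation at1 :: "(nat \<Rightarrow> (nat \<Rightarrow> 'v) \<Rightarrow> 'x) \<Rightarrow> 'v \<Rightarrow> 'x" where
  "at1 \<Phi> v \<equiv> \<Phi> 0 (\<lambda>_. v)"
abbreviation at2 :: "(nat \<Rightarrow> (nat \<Rightarrow> 'v) \<Rightarrow> 'x) \<Rightarrow> 'v \<Rightarrow> 'v \<Rightarrow> 'x" where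
  "at2 \<Phi> v w \<equiv> \<Phi> 1 (\<lambda>k. if k = 0 then v else w)"

definition quasi_category :: "('x, 'z) sset_scheme \<Rightarrow> bool" where
  "quasi_category X \<longleftrightarrow> is_sset X \<and>
     (\<forall>n k \<Phi>. 0 < k \<and> k < n \<and> sdiag X (\<le>) (horn n k) \<Phi> \<longrightarrow>
        (\<exists>\<Psi>. sdiag X (\<le>) (full {..n}) \<Psi> \<and> extends (\<le>) (horn n k) \<Psi> \<Phi>))"

definition ecls :: "('x, 'z) sset_scheme \<Rightarrow> 'x \<Rightarrow> 'x set" where
  "ecls X e = {e'. \<exists>s\<in>Spx X 2. edge X 2 s 0 1 = e \<and> edge X 2 s 1 2 = degen X (vert X 1 e 1) \<and>
     edge X 2 s 0 2 = e'}"

definition hcat :: "('x, 'z) sset_scheme \<Rightarrow> ('x, 'x set) category" where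
  "hcat X =
     \<lparr>Obj = Spx X 0,
      Arr = ecls X ` Spx X 1,
      Dom = (\<lambda>c. vert X 1 (SOME e. e \<in> c) 0),
      Cod = (\<lambda>c. vert X 1 (SOME e. e \<in> c) 1),
      Ide = (\<lambda>x. ecls X (degen X x)),
      Comp = (\<lambda>d c. {e. \<exists>s\<in>Spx X 2. edge X 2 s 0 1 \<in> c \<and> edge X 2 s 1 2 \<in> d \<and> edge X 2 s 0 2 = e})\<rparr>"

definition equiv_edge :: "('x, 'z) sset_scheme \<Rightarrow> 'x \<Rightarrow> bool" where
  "equiv_edge X e \<longleftrightarrow> e \<in> Spx X 1 \<and> iso_arr (hcat X) (ecls X e)"

definition nat_equiv ::
    "('x, 'y) sset_scheme \<Rightarrow> ('v, 'z) sset_scheme \<Rightarrow> (nat \<Rightarrow> 'x \<Rightarrow> 'v) \<Rightarrow> (nat \<Rightarrow> 'x \<Rightarrow> 'v) \<Rightarrow> bool" where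
  "nat_equiv X Y f g \<longleftrightarrow> (\<exists>H. sset_map (prod_sset X (simplex 1)) Y H \<and>
     (\<forall>n. \<forall>x\<in>Spx X n. H n (x, \<lambda>i\<in>{..n}. 0) = f n x \<and> H n (x, \<lambda>i\<in>{..n}. 1) = g n x) \<and>
     (\<forall>x\<in>Spx X 0. equiv_edge Y (H 1 (degen X x, \<lambda>i\<in>{..1}. i))))"

definition qcat_equivalence ::
    "('x, 'y) sset_scheme \<Rightarrow> ('v, 'z) sset_scheme \<Rightarrow> (nat \<Rightarrow> 'x \<Rightarrow> 'v) \<Rightarrow> bool" where
  "qcat_equivalence X Y f \<longleftrightarrow> sset_map X Y f \<and> (\<exists>g. sset_map Y X g \<and>
     nat_equiv X X (\<lambda>_ x. x) (\<lambda>n x. g n (f n x)) \<and> nat_equiv Y Y (\<lambda>n y. f n (g n y)) (\<lambda>_ y. y))"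

subsection \<open>Stable quasi-categories\<close>

definition initial_vertex :: "('x, 'z) sset_scheme \<Rightarrow> 'x \<Rightarrow> bool" where
  "initial_vertex X x \<longleftrightarrow> x \<in> Spx X 0 \<and>
     (\<forall>n \<Phi>. 1 \<le> n \<and> sdiag X (\<le>) (boundary n) \<Phi> \<and> at1 \<Phi> 0 = x \<longrightarrow>
        (\<exists>\<Psi>. sdiag X (\<le>) (full {..n}) \<Psi> \<and> extends (\<le>) (boundary n) \<Psi> \<Phi>))"

definition terminal_vertex :: "('x, 'z) sset_scheme \<Rightarrow> 'x \<Rightarrow> bool" where
  "terminal_vertex X x \<longleftrightarrow> x \<in> Spx X 0 \<and>
     (\<forall>n \<Phi>. 1 \<le> n \<and> sdiag X (\<le>) (boundary n) \<Phi> \<and> at1 \<Phi> n = x \<longrightarrow>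
        (\<exists>\<Psi>. sdiag X (\<le>) (full {..n}) \<Psi> \<and> extends (\<le>) (boundary n) \<Psi> \<Phi>))"

definition zero_vertex :: "('x, 'z) sset_scheme \<Rightarrow> 'x \<Rightarrow> bool" where
  "zero_vertex X x \<longleftrightarrow> initial_vertex X x \<and> terminal_vertex X x"

abbreviation is_square :: "('x, 'z) sset_scheme \<Rightarrow> (nat \<Rightarrow> (nat \<Rightarrow> nat \<times> nat) \<Rightarrow> 'x) \<Rightarrow> bool" where
  "is_square X Q \<equiv> sdiag X le2 (full sqV) Q"

text \<open>
  A square is a pushout if it is an initial object of the slice under its restriction to the span,
  that is, maps from the join of the span with the boundary of an \<open>n\<close>-simplex whose restriction to
  the join with the vertex \<open>0\<close> is the square extend to the join with the \<open>n\<close>-simplex.  Pullbacks are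
  dual.
\<close>

fun le_join :: "nat \<times> nat + nat \<Rightarrow> nat \<times> nat + nat \<Rightarrow> bool" where
  "le_join (Inl v) (Inl w) = le2 v w"
| "le_join (Inl v) (Inr j) = True"
| "le_join (Inr i) (Inl w) = False"
| "le_join (Inr i) (Inr j) = (i \<le> j)"

fun le_cojoin :: "nat \<times> nat + nat \<Rightarrow> nat \<times> nat + nat \<Rightarrow> bool" where
  "le_cojoin (Inl v) (Inl w) = le2 v w"
| "le_cojoin (Inl v) (Inr j) = False"
| "le_cojoin (Inr i) (Inl w) = True"
| "le_cojoin (Inr i) (Inr j) = (i \<le> j)"

abbreviation joinV :: "(nat \<times> nat) set \<Rightarrow> nat \<Rightarrow> (nat \<times> nat + nat) set" where
  "joinV K n \<equiv> Inl ` K \<union> Inr ` {..n}"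
abbreviation join_boundary :: "(nat \<times> nat) set \<Rightarrow> nat \<Rightarrow> (nat \<times> nat + nat) set set" where
  "join_boundary K n \<equiv> {A \<in> full (joinV K n). \<not> Inr ` {..n} \<subseteq> A}"

definition pushout_square :: "('x, 'z) sset_scheme \<Rightarrow> (nat \<Rightarrow> (nat \<Rightarrow> nat \<times> nat) \<Rightarrow> 'x) \<Rightarrow> bool" where
  "pushout_square X Q \<longleftrightarrow> is_square X Q \<and>
     (\<forall>n \<Phi>. 1 \<le> n \<and> sdiag X le_join (join_boundary spanV n) \<Phi> \<and>
        (\<forall>m s. chain le2 (full sqV) m s \<longrightarrow>
           \<Phi> m (\<lambda>i. if s i = (1, 1) then Inr 0 else Inl (s i)) = Q m s) \<longrightarrow>
        (\<exists>\<Psi>. sdiag X le_join (full (joinV spanV n)) \<Psi> \<and> extends le_join (join_boundary spanV n) \<Psi> \<Phi>))"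

definition pullback_square :: "('x, 'z) sset_scheme \<Rightarrow> (nat \<Rightarrow> (nat \<Rightarrow> nat \<times> nat) \<Rightarrow> 'x) \<Rightarrow> bool" where
  "pullback_square X Q \<longleftrightarrow> is_square X Q \<and>
     (\<forall>n \<Phi>. 1 \<le> n \<and> sdiag X le_cojoin (join_boundary cospanV n) \<Phi> \<and>
        (\<forall>m s. chain le2 (full sqV) m s \<longrightarrow>
           \<Phi> m (\<lambda>i. if s i = (0, 0) then Inr n else Inl (s i)) = Q m s) \<longrightarrow>
        (\<exists>\<Psi>. sdiag X le_cojoin (full (joinV cospanV n)) \<Psi> \<and>
           extends le_cojoin (join_boundary cospanV n) \<Psi> \<Phi>))"

definition stable_qcat :: "('x, 'z) sset_scheme \<Rightarrow> bool" where
  "stable_qcat X \<longleftrightarrow> quasi_category X \<and> (\<exists>z. zero_vertex X z) \<and>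
     (\<forall>e\<in>Spx X 1.
        (\<exists>Q. pushout_square X Q \<and> zero_vertex X (at1 Q (1, 0)) \<and> at2 Q (0, 0) (0, 1) = e) \<and>
        (\<exists>Q. pullback_square X Q \<and> zero_vertex X (at1 Q (1, 0)) \<and> at2 Q (0, 1) (1, 1) = e)) \<and>
     (\<forall>Q. is_square X Q \<and> zero_vertex X (at1 Q (1, 0)) \<longrightarrow> (pushout_square X Q \<longleftrightarrow> pullback_square X Q))"

subsection \<open>Monoidal quasi-categories\<close>

type_synonym delta_arr = "nat \<times> nat \<times> (nat \<Rightarrow> nat)"

text \<open>The opposite of the simplex category; \<open>dmap m n \<theta>\<close> is \<open>\<theta> : [m] \<rightarrow> [n]\<close> as an arrow \<open>[n] \<rightarrow> [m]\<close>.\<close>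

definition dmap :: "nat \<Rightarrow> nat \<Rightarrow> (nat \<Rightarrow> nat) \<Rightarrow> delta_arr" where
  "dmap m n \<theta> = (m, n, restrict \<theta> {..m})"

definition delta_op :: "(nat, delta_arr) category" where
  "delta_op =
     \<lparr>Obj = UNIV,
      Arr = {dmap m n \<theta> |m n \<theta>. \<theta> \<in> mono_maps m n},
      Dom = (\<lambda>(m, n, \<theta>). n),
      Cod = (\<lambda>(m, n, \<theta>). m),
      Ide = (\<lambda>n. dmap n n id),
      Comp = (\<lambda>(k, _, \<psi>) (_, n, \<theta>). dmap k n (\<theta> \<circ> \<psi>))\<rparr>"

type_synonym delta_simplex = "(nat \<Rightarrow> nat) \<times> (nat \<times> nat \<Rightarrow> delta_arr)"

text \<open>An \<open>n\<close>-simplex of the nerve is a functor from \<open>[n]\<close>, given on objects and on arrows \<open>i \<le> j\<close>.\<close>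

definition nerve :: "('o, 'm, 'z) category_scheme \<Rightarrow> ((nat \<Rightarrow> 'o) \<times> (nat \<times> nat \<Rightarrow> 'm)) sset" where
  "nerve C =
     \<lparr>Spx = (\<lambda>n. {(x, a). x \<in> {..n} \<rightarrow>\<^sub>E Obj C \<and> a \<in> extensional {(i, j). i \<le> j \<and> j \<le> n} \<and>
        (\<forall>i j. i \<le> j \<and> j \<le> n \<longrightarrow> a (i, j) \<in> Hom C (x i) (x j)) \<and>
        (\<forall>i\<le>n. a (i, i) = Ide C (x i)) \<and>
        (\<forall>i j k. i \<le> j \<and> j \<le> k \<and> k \<le> n \<longrightarrow> a (i, k) = a (j, k) \<cdot>\<^bsub>C\<^esub> a (i, j))}),
      Opr = (\<lambda>m n \<theta> (x, a). (restrict (x \<circ> \<theta>) {..m},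
        restrict (\<lambda>(i, j). a (\<theta> i, \<theta> j)) {(i, j). i \<le> j \<and> j \<le> m}))\<rparr>"

definition nerve_edge :: "('o, 'm, 'z) category_scheme \<Rightarrow> 'm \<Rightarrow> (nat \<Rightarrow> 'o) \<times> (nat \<times> nat \<Rightarrow> 'm)" where
  "nerve_edge C f = (\<lambda>i\<in>{..1}. if i = 0 then Dom C f else Cod C f,
     restrict (\<lambda>(i, j). if j = 0 then Ide C (Dom C f) else if i = 0 then f else Ide C (Cod C f))
       {(i, j). i \<le> j \<and> j \<le> 1})"

definition inner_fibration ::
    "('x, 'y) sset_scheme \<Rightarrow> ('s, 'z) sset_scheme \<Rightarrow> (nat \<Rightarrow> 'x \<Rightarrow> 's) \<Rightarrow> bool" where
  "inner_fibration X S p \<longleftrightarrow> sset_map X S p \<and>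
     (\<forall>n k \<Phi> \<Theta>. 0 < k \<and> k < n \<and> sdiag X (\<le>) (horn n k) \<Phi> \<and> sdiag S (\<le>) (full {..n}) \<Theta> \<and>
        extends (\<le>) (horn n k) \<Theta> (\<lambda>m s. p m (\<Phi> m s)) \<longrightarrow>
        (\<exists>\<Psi>. sdiag X (\<le>) (full {..n}) \<Psi> \<and> extends (\<le>) (horn n k) \<Psi> \<Phi> \<and>
           extends (\<le>) (full {..n}) (\<lambda>m s. p m (\<Psi> m s)) \<Theta>))"

definition cocartesian_edge ::
    "('x, 'y) sset_scheme \<Rightarrow> ('s, 'z) sset_scheme \<Rightarrow> (nat \<Rightarrow> 'x \<Rightarrow> 's) \<Rightarrow> 'x \<Rightarrow> bool" where
  "cocartesian_edge X S p e \<longleftrightarrow> e \<in> Spx X 1 \<and>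
     (\<forall>n \<Phi> \<Theta>. 2 \<le> n \<and> sdiag X (\<le>) (horn n 0) \<Phi> \<and> at2 \<Phi> 0 1 = e \<and> sdiag S (\<le>) (full {..n}) \<Theta> \<and>
        extends (\<le>) (horn n 0) \<Theta> (\<lambda>m s. p m (\<Phi> m s)) \<longrightarrow>
        (\<exists>\<Psi>. sdiag X (\<le>) (full {..n}) \<Psi> \<and> extends (\<le>) (horn n 0) \<Psi> \<Phi> \<and>
           extends (\<le>) (full {..n}) (\<lambda>m s. p m (\<Psi> m s)) \<Theta>))"

definition cocartesian_fibration ::
    "('x, 'y) sset_scheme \<Rightarrow> ('s, 'z) sset_scheme \<Rightarrow> (nat \<Rightarrow> 'x \<Rightarrow> 's) \<Rightarrow> bool" where
  "cocartesian_fibration X S p \<longleftrightarrow> inner_fibration X S p \<and>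
     (\<forall>x\<in>Spx X 0. \<forall>t\<in>Spx S 1. vert S 1 t 0 = p 0 x \<longrightarrow>
        (\<exists>e. cocartesian_edge X S p e \<and> vert X 1 e 0 = x \<and> p 1 e = t))"

text \<open>
  A monoidal quasi-category is a cocartesian fibration over the nerve of the opposite simplex
  category satisfying the Segal condition; \<open>fib X 1\<close> is its underlying quasi-category.
\<close>

record 'x moninf = "'x sset" +
  Prj :: "nat \<Rightarrow> 'x \<Rightarrow> delta_simplex"

definition cocart :: "'x moninf \<Rightarrow> delta_arr \<Rightarrow> 'x \<Rightarrow> 'x \<Rightarrow> 'x set" where
  "cocart X t x y = {e \<in> edges X x y. Prj X 1 e = nerve_edge delta_op t \<and>
     cocartesian_edge X (nerve delta_op) (Prj X) e}"

definition fib :: "'x moninf \<Rightarrow> nat \<Rightarrow> 'x sset" where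
  "fib X n = \<lparr>Spx = (\<lambda>k. {x \<in> Spx X k. Prj X k x =
       (\<lambda>i\<in>{..k}. n, restrict (\<lambda>_. Ide delta_op n) {(i, j). i \<le> j \<and> j \<le> k})}),
     Opr = Opr X\<rparr>"

text \<open>\<open>F : fib X n \<rightarrow> fib X m\<close> is the functor induced by \<open>t : [n] \<rightarrow> [m]\<close> in the opposite simplex category.\<close>

definition pushforward :: "'x moninf \<Rightarrow> nat \<Rightarrow> nat \<Rightarrow> delta_arr \<Rightarrow> (nat \<Rightarrow> 'x \<Rightarrow> 'x) \<Rightarrow> bool" where
  "pushforward X n m t F \<longleftrightarrow> sset_map (fib X n) (fib X m) F \<and>
     (\<exists>H. sset_map (prod_sset (fib X n) (simplex 1)) X H \<and>
        (\<forall>k. \<forall>x\<in>Spx (fib X n) k. H k (x, \<lambda>i\<in>{..k}. 0) = x \<and> H k (x, \<lambda>i\<in>{..k}. 1) = F k x \<and>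
           (\<forall>\<chi>\<in>Spx (simplex 1) k. Prj X k (H k (x, \<chi>)) = Opr (nerve delta_op) k 1 \<chi> (nerve_edge delta_op t))) \<and>
        (\<forall>x\<in>Spx (fib X n) 0.
           cocartesian_edge X (nerve delta_op) (Prj X) (H 1 (degen X x, \<lambda>i\<in>{..1}. i))))"

text \<open>The inclusion of \<open>{i - 1, i}\<close> into \<open>[n]\<close>, and the outer face \<open>{0, 2}\<close> of \<open>[2]\<close>.\<close>

abbreviation rho :: "nat \<Rightarrow> nat \<Rightarrow> delta_arr" where
  "rho n i \<equiv> dmap 1 n (\<lambda>k. if k = 0 then i - 1 else i)"
abbreviation mlt :: delta_arr where
  "mlt \<equiv> dmap 1 2 (\<lambda>k. if k = 0 then 0 else 2)"

definition monoidal_qcat :: "'x moninf \<Rightarrow> bool" where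
  "monoidal_qcat X \<longleftrightarrow> is_sset X \<and> cocartesian_fibration X (nerve delta_op) (Prj X) \<and>
     (\<forall>n. \<exists>F. (\<forall>i\<in>{1..n}. pushforward X n 1 (rho n i) (F i)) \<and>
        qcat_equivalence (fib X n) (pow_sset {1..n} (fib X 1)) (\<lambda>k x. \<lambda>i\<in>{1..n}. F i k x))"

text \<open>The diagram \<open>R\<close> in \<open>fib X m\<close> is the image of the diagram \<open>Q\<close> in \<open>fib X n\<close> under \<open>t : [n] \<rightarrow> [m]\<close>.\<close>

definition pushes_to ::
    "'x moninf \<Rightarrow> delta_arr \<Rightarrow> (nat \<Rightarrow> (nat \<Rightarrow> nat \<times> nat) \<Rightarrow> 'x) \<Rightarrow> (nat \<Rightarrow> (nat \<Rightarrow> nat \<times> nat) \<Rightarrow> 'x) \<Rightarrow> bool" where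
  "pushes_to X t Q R \<longleftrightarrow>
     (\<exists>G. sdiag X (\<lambda>(v, i) (w, j). le2 v w \<and> i \<le> j) (full (sqV \<times> {0, 1 :: nat})) G \<and>
        (\<forall>k s. chain le2 (full sqV) k s \<longrightarrow> G k (\<lambda>i. (s i, 0)) = Q k s \<and> G k (\<lambda>i. (s i, 1)) = R k s \<and>
           (\<forall>\<chi>\<in>mono_maps k 1. Prj X k (G k (\<lambda>i. (s i, \<chi> i))) =
              Opr (nerve delta_op) k 1 \<chi> (nerve_edge delta_op t))) \<and>
        (\<forall>v\<in>sqV. cocartesian_edge X (nerve delta_op) (Prj X) (at2 G (v, 0) (v, 1))))"

definition constant_square :: "('x, 'z) sset_scheme \<Rightarrow> (nat \<Rightarrow> (nat \<Rightarrow> nat \<times> nat) \<Rightarrow> 'x) \<Rightarrow> bool" where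
  "constant_square X Q \<longleftrightarrow> (\<forall>v\<in>sqV. \<forall>w\<in>sqV. le2 v w \<longrightarrow> equiv_edge X (at2 Q v w))"

text \<open>
  The tensor product is exact in each variable: it preserves initial objects and pushout squares
  when the other variable is held constant.
\<close>

definition exact_tensor :: "'x moninf \<Rightarrow> bool" where
  "exact_tensor X \<longleftrightarrow>
     (\<forall>p\<in>Spx (fib X 2) 0. \<forall>x y z. cocart X (rho 2 1) p x \<noteq> {} \<and> cocart X (rho 2 2) p y \<noteq> {} \<and>
        cocart X mlt p z \<noteq> {} \<and> (initial_vertex (fib X 1) x \<or> initial_vertex (fib X 1) y) \<longrightarrow>
        initial_vertex (fib X 1) z) \<and>
     (\<forall>Q A B R. is_square (fib X 2) Q \<and> is_square (fib X 1) A \<and> is_square (fib X 1) B \<and>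
        is_square (fib X 1) R \<and> pushes_to X (rho 2 1) Q A \<and> pushes_to X (rho 2 2) Q B \<and> pushes_to X mlt Q R \<and>
        (constant_square (fib X 1) A \<and> pushout_square (fib X 1) B \<or>
         pushout_square (fib X 1) A \<and> constant_square (fib X 1) B) \<longrightarrow>
        pushout_square (fib X 1) R)"

definition stable_monoidal_qcat :: "'x moninf \<Rightarrow> bool" where
  "stable_monoidal_qcat X \<longleftrightarrow> monoidal_qcat X \<and> stable_qcat (fib X 1) \<and> exact_tensor X"

subsection \<open>The homotopy category of a stable monoidal quasi-category\<close>

text \<open>
  A witness \<open>(p, x, y, z, a, b, m)\<close> exhibits \<open>z\<close> as the tensor product of \<open>x\<close> and \<open>y\<close>.  The
  comparison \<open>\<mu>\<close> assigns to it an isomorphism \<open>F x \<otimes> F y \<rightarrow> F z\<close>, naturally, associatively and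
  unitally; composites of edges are formed in the homotopy category of the total space.
\<close>

type_synonym 'x witness = "'x \<times> 'x \<times> 'x \<times> 'x \<times> 'x \<times> 'x \<times> 'x"

definition witnesses :: "'x moninf \<Rightarrow> 'x witness set" where
  "witnesses X = {(p, x, y, z, a, b, m). p \<in> Spx (fib X 2) 0 \<and>
     a \<in> cocart X (rho 2 1) p x \<and> b \<in> cocart X (rho 2 2) p y \<and> m \<in> cocart X mlt p z}"

definition hcomp :: "'x moninf \<Rightarrow> 'x \<Rightarrow> 'x \<Rightarrow> 'x set" where
  "hcomp X f e = Comp (hcat X) (ecls X f) (ecls X e)"

definition qcat_tensor_comparison ::
    "'x moninf \<Rightarrow> ('o, 'm) ttcat \<Rightarrow> ('x, 'x set, 'o, 'm) functr \<Rightarrow> bool" where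
  "qcat_tensor_comparison X T F \<longleftrightarrow> (\<exists>\<mu> \<iota> o0 u0 n0.
     (\<forall>(p, x, y, z, a, b, m) \<in> witnesses X.
        \<mu> (p, x, y, z, a, b, m) \<in> Iso T (onO F x \<otimes>\<^sub>o\<^bsub>T\<^esub> onO F y) (onO F z)) \<and>
     (\<forall>p x y z a b m p' x' y' z' a' b' m' r f g h.
        (p, x, y, z, a, b, m) \<in> witnesses X \<and> (p', x', y', z', a', b', m') \<in> witnesses X \<and>
        r \<in> edges (fib X 2) p p' \<and> f \<in> edges (fib X 1) x x' \<and> g \<in> edges (fib X 1) y y' \<and>
        h \<in> edges (fib X 1) z z' \<and>
        hcomp X f a = hcomp X a' r \<and> hcomp X g b = hcomp X b' r \<and> hcomp X h m = hcomp X m' r \<longrightarrow>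
        onA F (ecls (fib X 1) h) \<cdot>\<^bsub>T\<^esub> \<mu> (p, x, y, z, a, b, m) =
        \<mu> (p', x', y', z', a', b', m') \<cdot>\<^bsub>T\<^esub>
          (onA F (ecls (fib X 1) f) \<otimes>\<^sub>a\<^bsub>T\<^esub> onA F (ecls (fib X 1) g))) \<and>
     (\<forall>q c12 c23 cL cR p12 p23 pL pR x y z u v t a b m b' d m' aL bL mL aR bR mR.
        q \<in> Spx (fib X 3) 0 \<and>
        c12 \<in> cocart X (dmap 2 3 (\<lambda>k. k)) q p12 \<and>
        c23 \<in> cocart X (dmap 2 3 (\<lambda>k. k + 1)) q p23 \<and>
        cL \<in> cocart X (dmap 2 3 (\<lambda>k. if k = 0 then 0 else k + 1)) q pL \<and>
        cR \<in> cocart X (dmap 2 3 (\<lambda>k. if k = 2 then 3 else k)) q pR \<and>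
        (p12, x, y, u, a, b, m) \<in> witnesses X \<and> (p23, y, z, v, b', d, m') \<in> witnesses X \<and>
        (pL, u, z, t, aL, bL, mL) \<in> witnesses X \<and> (pR, x, v, t, aR, bR, mR) \<in> witnesses X \<and>
        hcomp X a c12 = hcomp X aR cR \<and> hcomp X b c12 = hcomp X b' c23 \<and> hcomp X d c23 = hcomp X bL cL \<and>
        hcomp X m c12 = hcomp X aL cL \<and> hcomp X m' c23 = hcomp X bR cR \<and> hcomp X mL cL = hcomp X mR cR \<longrightarrow>
        \<mu> (pL, u, z, t, aL, bL, mL) \<cdot>\<^bsub>T\<^esub> (\<mu> (p12, x, y, u, a, b, m) \<otimes>\<^sub>a\<^bsub>T\<^esub> Ide T (onO F z)) =
        \<mu> (pR, x, v, t, aR, bR, mR) \<cdot>\<^bsub>T\<^esub> (Ide T (onO F x) \<otimes>\<^sub>a\<^bsub>T\<^esub> \<mu> (p23, y, z, v, b', d, m')) \<cdot>\<^bsub>T\<^esub>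
          Assoc T (onO F x) (onO F y) (onO F z)) \<and>
     o0 \<in> Spx (fib X 0) 0 \<and> n0 \<in> cocart X (dmap 1 0 (\<lambda>_. 0)) o0 u0 \<and>
     \<iota> \<in> Iso T (UnitO T) (onO F u0) \<and>
     (\<forall>p x a b m s d. (p, u0, x, x, a, b, m) \<in> witnesses X \<and>
        s \<in> cocart X (dmap 2 1 (\<lambda>k. k - 1)) x p \<and> d \<in> cocart X (dmap 0 1 (\<lambda>_. 0)) x o0 \<and>
        hcomp X a s = hcomp X n0 d \<and> hcomp X b s = ecls X (degen X x) \<and> hcomp X m s = ecls X (degen X x) \<longrightarrow>
        \<mu> (p, u0, x, x, a, b, m) \<cdot>\<^bsub>T\<^esub> (\<iota> \<otimes>\<^sub>a\<^bsub>T\<^esub> Ide T (onO F x)) = LUnit T (onO F x)) \<and>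
     (\<forall>p x a b m s d. (p, x, u0, x, a, b, m) \<in> witnesses X \<and>
        s \<in> cocart X (dmap 2 1 (\<lambda>k. min k 1)) x p \<and> d \<in> cocart X (dmap 0 1 (\<lambda>_. 1)) x o0 \<and>
        hcomp X b s = hcomp X n0 d \<and> hcomp X a s = ecls X (degen X x) \<and> hcomp X m s = ecls X (degen X x) \<longrightarrow>
        \<mu> (p, x, u0, x, a, b, m) \<cdot>\<^bsub>T\<^esub> (Ide T (onO F x) \<otimes>\<^sub>a\<^bsub>T\<^esub> \<iota>) = RUnit T (onO F x)))"

definition qcat_susp :: "('x, 'z) sset_scheme \<Rightarrow> (nat \<Rightarrow> (nat \<Rightarrow> nat \<times> nat) \<Rightarrow> 'x) set" where
  "qcat_susp C = {Q. pushout_square C Q \<and> zero_vertex C (at1 Q (0, 1)) \<and> zero_vertex C (at1 Q (1, 0))}"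

definition qcat_susp_mor ::
    "('x, 'z) sset_scheme \<Rightarrow> ('x, 'x set, 'o, 'm) functr \<Rightarrow>
     ((nat \<Rightarrow> (nat \<Rightarrow> nat \<times> nat) \<Rightarrow> 'x) \<times> (nat \<Rightarrow> (nat \<Rightarrow> nat \<times> nat) \<Rightarrow> 'x) \<times> 'm \<times> 'm) set" where
  "qcat_susp_mor C F =
     {(Q, Q', onA F (ecls C (at2 G ((0, 0), 0) ((0, 0), 1))), onA F (ecls C (at2 G ((1, 1), 0) ((1, 1), 1)))) |Q Q' G.
        Q \<in> qcat_susp C \<and> Q' \<in> qcat_susp C \<and>
        sdiag C (\<lambda>(v, i) (w, j). le2 v w \<and> i \<le> j) (full (sqV \<times> {0, 1 :: nat})) G \<and>
        (\<forall>k s. chain le2 (full sqV) k s \<longrightarrow> G k (\<lambda>i. (s i, 0)) = Q k s \<and> G k (\<lambda>i. (s i, 1)) = Q' k s)}"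

definition qcat_cofib ::
    "('x, 'z) sset_scheme \<Rightarrow> ('x, 'x set, 'o, 'm) functr \<Rightarrow>
     ((nat \<Rightarrow> (nat \<Rightarrow> nat \<times> nat) \<Rightarrow> 'x) \<times> 'm \<times> 'm \<times> 'm) set" where
  "qcat_cofib C F =
     {(\<lambda>k s. R k (\<lambda>i. (fst (s i), 2 * snd (s i))), onA F (ecls C (at2 R (0, 0) (0, 1))),
       onA F (ecls C (at2 R (0, 1) (1, 1))), onA F (ecls C (at2 R (1, 1) (1, 2)))) |R.
        sdiag C le2 (full rectV) R \<and> pushout_square C R \<and>
        pushout_square C (\<lambda>k s. R k (\<lambda>i. (fst (s i), snd (s i) + 1))) \<and>
        zero_vertex C (at1 R (1, 0)) \<and> zero_vertex C (at1 R (0, 2))}"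

definition homotopy_category_of_infinity_category :: "'x moninf \<Rightarrow> ('o, 'm) ttcat \<Rightarrow> bool" where
  "homotopy_category_of_infinity_category X T \<longleftrightarrow> stable_monoidal_qcat X \<and>
     (\<exists>F. equivalence (hcat (fib X 1)) T F \<and> qcat_tensor_comparison X T F \<and>
        triangles_presented T (qcat_susp (fib X 1)) (\<lambda>Q. onO F (at1 Q (0, 0))) (\<lambda>Q. onO F (at1 Q (1, 1)))
          (qcat_susp_mor (fib X 1) F) (qcat_cofib (fib X 1) F))"

end

theory Submission
  imports Defs "HOL-Library.Multiset"
begin

text \<open>
  Let \<open>L\<close> be a localizing ideal containing all \<open>t \<otimes> g(W\<^sub>i)\<close>.  The compact objects \<open>x\<close> with
  \<open>x \<otimes> t \<in> L\<close> form a radical thick ideal, hence are exactly the compact objects supported on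
  some Thomason subset \<open>Y\<close>, and \<open>\<Gamma>\<^sub>Y \<otimes> t \<in> L\<close>.  If \<open>Supp t \<subseteq> Y\<close>, then \<open>L\<^sub>Y \<otimes> t\<close> has empty
  support, so it vanishes by detection, and \<open>t \<in> L\<close>.

  Otherwise choose a point \<open>w\<close> of \<open>F = Supp t - Y\<close>, weakly isolated by an open \<open>U\<close>, and a member
  \<open>W = A - B\<close> of the cover containing \<open>w\<close>.  As \<open>B\<close> is open in the inverse topology and misses \<open>w\<close>,
  it misses \<open>U\<close>, which lies in the closure of \<open>w\<close>.  Take a compact \<open>x\<close> with \<open>w \<in> supp x\<close>, whose
  support lies in \<open>A\<close> and in a Thomason subset cutting out \<open>U\<close> on \<open>F\<close>.  Then
  \<open>\<Gamma>\<^sub>B \<otimes> x \<otimes> L\<^sub>Y \<otimes> t\<close> has empty support and vanishes, while \<open>L\<^sub>B \<otimes> x \<otimes> L\<^sub>Y \<otimes> t\<close> lies in \<open>L\<close>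
  because \<open>x\<close> is absorbed by \<open>\<Gamma>\<^sub>A\<close>.  Hence \<open>x \<otimes> L\<^sub>Y \<otimes> t \<in> L\<close>, so \<open>x \<otimes> t \<in> L\<close> and \<open>w \<in> Y\<close>, a
  contradiction.
\<close>

section \<open>Categories\<close>

text \<open>Collecting in \<open>Y\<close> all that \<open>L\<close> absorbs already replaces a
  transfinite filtration of the support: weak scatteredness is applied just once, to the closed
  remainder, and the maximality built into \<open>Y\<close> does the rest. The Rickard idempotents
  are values of the choice operator: \<open>Gam\<close> and \<open>Lam\<close> are chosen
  separately, and \<open>g_ob\<close> through some presentation of its argument. Every argument
  therefore unpacks the presentation that was actually chosen, and gives each chosen object a
  partner completing it to a triangle. Much of the work lies in the existence of these triangles.
  They come from a tower over the unit in the style of Brown representability, whose stages must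
  stay manageable although the hypotheses bound Hom sets only between compact objects; this is the
  origin of \<open>hom_small\<close>. Mapping telescopes serve twice: as the colimit of the tower,
  and to show that localizing subcategories contain retracts, without which the objects absorbed by
  \<open>L\<close> would not form a thick ideal. Duality enters as a bijection between explicit
  arrows, which is why the coherence laws are worked out in detail.\<close>

lemma in_Hom [simp]: "f \<in> Hom C x y \<longleftrightarrow> f \<in> Arr C \<and> Dom C f = x \<and> Cod C f = y"
  by (auto simp: Hom_def)

locale cat =
  fixes C :: "('o, 'm, 'z) category_scheme" (structure)
  assumes is_category: "is_category C"
begin

lemma dom_obj [simp]: "f \<in> Arr C \<Longrightarrow> Dom C f \<in> Obj C"
  and cod_obj [simp]: "f \<in> Arr C \<Longrightarrow> Cod C f \<in> Obj C"
  using is_category unfolding is_category_def by blast+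

lemma ide_arr [simp]:
  assumes "x \<in> Obj C"
  shows "Ide C x \<in> Arr C" "Dom C (Ide C x) = x" "Cod C (Ide C x) = x"
  using is_category assms unfolding is_category_def by auto

lemma comp_arr [simp]:
  assumes "f \<in> Arr C" "g \<in> Arr C" "Dom C g = Cod C f"
  shows "g \<cdot> f \<in> Arr C" "Dom C (g \<cdot> f) = Dom C f" "Cod C (g \<cdot> f) = Cod C g"
proof -
  have "\<forall>x y z f g. f \<in> Hom C x y \<and> g \<in> Hom C y z \<longrightarrow> g \<cdot> f \<in> Hom C x z"
    using is_category unfolding is_category_def by blast
  from this[rule_format, of f "Dom C f" "Cod C f" g "Cod C g"] assms
  show "g \<cdot> f \<in> Arr C" "Dom C (g \<cdot> f) = Dom C f" "Cod C (g \<cdot> f) = Cod C g" by auto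
qed

lemma comp_ide [simp]:
  assumes "f \<in> Arr C"
  shows "Dom C f = x \<Longrightarrow> f \<cdot> Ide C x = f" "Cod C f = x \<Longrightarrow> Ide C x \<cdot> f = f"
proof -
  have "\<forall>x y f. f \<in> Hom C x y \<longrightarrow> f \<cdot> Ide C x = f \<and> Ide C y \<cdot> f = f"
    using is_category unfolding is_category_def by blast
  from this[rule_format, of f "Dom C f" "Cod C f"] assms
  show "Dom C f = x \<Longrightarrow> f \<cdot> Ide C x = f" "Cod C f = x \<Longrightarrow> Ide C x \<cdot> f = f" by auto
qed

lemma comp_assoc [simp]:
  assumes "f \<in> Arr C" "g \<in> Arr C" "h \<in> Arr C" "Dom C g = Cod C f" "Dom C h = Cod C g"
  shows "(h \<cdot> g) \<cdot> f = h \<cdot> (g \<cdot> f)"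
proof -
  have "\<forall>w x y z f g h. f \<in> Hom C w x \<and> g \<in> Hom C x y \<and> h \<in> Hom C y z \<longrightarrow>
        h \<cdot> (g \<cdot> f) = (h \<cdot> g) \<cdot> f"
    using is_category unfolding is_category_def by blast
  from this[rule_format, of f "Dom C f" "Cod C f" g "Cod C g" h "Cod C h"] assms
  show ?thesis by auto
qed

text \<open>Simplification nests composites to the right by \<open>comp_assoc\<close>, so an
  equation for \<open>g \<cdot> f\<close> no longer matches once another factor \<open>e\<close>
  follows. This form rewrites the hidden prefix.\<close>

lemma comp_eq_left:
  assumes "g \<cdot> f = k" "f \<in> Arr C" "g \<in> Arr C" "Dom C g = Cod C f"
    "e \<in> Arr C" "Cod C e = Dom C f"
  shows "g \<cdot> (f \<cdot> e) = k \<cdot> e"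
  using assms comp_assoc by metis

lemma is_inverse_iff:
  "is_inverse C f g \<longleftrightarrow> f \<in> Arr C \<and> g \<in> Arr C \<and> Dom C g = Cod C f \<and> Cod C g = Dom C f \<and>
     g \<cdot> f = Ide C (Dom C f) \<and> f \<cdot> g = Ide C (Cod C f)"
  unfolding is_inverse_def by auto

lemma inv_arr_eq: "is_inverse C f g \<Longrightarrow> inv_arr C f = g"
proof -
  assume g: "is_inverse C f g"
  have "h = g" if h: "is_inverse C f h" for h
  proof -
    have "h = h \<cdot> (f \<cdot> g)" using g h unfolding is_inverse_iff by simp
    also have "\<dots> = (h \<cdot> f) \<cdot> g" using g h unfolding is_inverse_iff by (intro comp_assoc[symmetric]) auto
    also have "\<dots> = g" using g h unfolding is_inverse_iff by simp
    finally show ?thesis .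
  qed
  then show ?thesis unfolding inv_arr_def using g by (intro the_equality)
qed

lemma inv_arr_is_inverse: "iso_arr C f \<Longrightarrow> is_inverse C f (inv_arr C f)"
  unfolding iso_arr_def using inv_arr_eq by auto

lemma iso_arr_in_arr: "iso_arr C f \<Longrightarrow> f \<in> Arr C"
  unfolding iso_arr_def is_inverse_def by auto

lemma inv_arr_arr [simp]:
  assumes "iso_arr C f"
  shows "inv_arr C f \<in> Arr C" "Dom C (inv_arr C f) = Cod C f" "Cod C (inv_arr C f) = Dom C f"
  using inv_arr_is_inverse[OF assms] unfolding is_inverse_iff by auto

lemma inv_arr_comp [simp]:
  assumes "iso_arr C f"
  shows "inv_arr C f \<cdot> f = Ide C (Dom C f)" "f \<cdot> inv_arr C f = Ide C (Cod C f)"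
  using inv_arr_is_inverse[OF assms] unfolding is_inverse_iff by auto

lemma inv_arr_comp_assoc [simp]:
  assumes "iso_arr C f" "e \<in> Arr C"
  shows "Cod C e = Dom C f \<Longrightarrow> inv_arr C f \<cdot> (f \<cdot> e) = e"
    "Cod C e = Cod C f \<Longrightarrow> f \<cdot> (inv_arr C f \<cdot> e) = e"
  using assms iso_arr_in_arr by (simp_all flip: comp_assoc)

lemma iso_arrI:
  assumes "f \<in> Arr C" "g \<in> Arr C" "Dom C g = Cod C f" "Cod C g = Dom C f"
    "g \<cdot> f = Ide C (Dom C f)" "f \<cdot> g = Ide C (Cod C f)"
  shows "iso_arr C f"
  using assms unfolding iso_arr_def is_inverse_iff by blast

lemma iso_arr_inv [simp]: "iso_arr C f \<Longrightarrow> iso_arr C (inv_arr C f)"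
  by (rule iso_arrI[where g=f]) (simp_all add: iso_arr_in_arr)

lemma iso_arr_ide [simp]: "x \<in> Obj C \<Longrightarrow> iso_arr C (Ide C x)"
  by (rule iso_arrI[where g="Ide C x"]) simp_all

lemma iso_arr_comp:
  assumes "iso_arr C f" "iso_arr C g" "Dom C g = Cod C f"
  shows "iso_arr C (g \<cdot> f)"
  by (rule iso_arrI[where g="inv_arr C f \<cdot> inv_arr C g"])
    (use assms in \<open>simp_all add: iso_arr_in_arr\<close>)

lemma iso_arr_cancel_left:
  assumes "iso_arr C f" "f \<cdot> g = f \<cdot> h" "g \<in> Arr C" "h \<in> Arr C" "Cod C g = Dom C f" "Cod C h = Dom C f"
  shows "g = h"
  using assms inv_arr_comp_assoc(1) by metis

lemma iso_arr_cancel_right: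
  assumes "iso_arr C f" "g \<cdot> f = h \<cdot> f" "g \<in> Arr C" "h \<in> Arr C" "Dom C g = Cod C f" "Dom C h = Cod C f"
  shows "g = h"
proof -
  have "(g \<cdot> f) \<cdot> inv_arr C f = (h \<cdot> f) \<cdot> inv_arr C f" using assms(2) by simp
  then show ?thesis using assms(1,3-) by (simp add: iso_arr_in_arr)
qed

lemma in_Iso [simp]: "f \<in> Iso C x y \<longleftrightarrow> iso_arr C f \<and> Dom C f = x \<and> Cod C f = y"
  unfolding Iso_def by (auto simp: iso_arr_in_arr)

lemma isomorphic_iff: "isomorphic C x y \<longleftrightarrow> (\<exists>f. iso_arr C f \<and> Dom C f = x \<and> Cod C f = y)"
  unfolding isomorphic_def by (metis ex_in_conv in_Iso)

lemma isomorphic_refl: "x \<in> Obj C \<Longrightarrow> isomorphic C x x"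
  unfolding isomorphic_iff by (rule exI[of _ "Ide C x"]) simp

lemma isomorphicI: "iso_arr C f \<Longrightarrow> Dom C f = x \<Longrightarrow> Cod C f = y \<Longrightarrow> isomorphic C x y"
  unfolding isomorphic_iff by blast

lemma isomorphic_sym: "isomorphic C x y \<Longrightarrow> isomorphic C y x"
  unfolding isomorphic_iff using iso_arr_inv inv_arr_arr(2,3) by fast

lemma isomorphic_trans [trans]:
  assumes "isomorphic C x y" "isomorphic C y z"
  shows "isomorphic C x z"
proof -
  obtain f g where "iso_arr C f" "Dom C f = x" "Cod C f = y" "iso_arr C g" "Dom C g = y" "Cod C g = z"
    using assms unfolding isomorphic_iff by blast
  then show ?thesis by (intro isomorphicI[of "g \<cdot> f"] iso_arr_comp) (simp_all add: iso_arr_in_arr)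
qed

lemma isomorphic_obj: "isomorphic C x y \<Longrightarrow> x \<in> Obj C \<and> y \<in> Obj C"
  unfolding isomorphic_iff using iso_arr_in_arr by auto

section \<open>Coproducts in an arbitrary category\<close>

lemma coproduct_arr:
  assumes "is_coproduct C I y c \<iota>"
  shows "c \<in> Obj C" "i \<in> I \<Longrightarrow> \<iota> i \<in> Arr C" "i \<in> I \<Longrightarrow> Dom C (\<iota> i) = y i" "i \<in> I \<Longrightarrow> Cod C (\<iota> i) = c"
  using assms unfolding is_coproduct_def by auto

lemma coproduct_arr_ex:
  assumes "is_coproduct C I y c \<iota>" "w \<in> Obj C"
    and "\<forall>i\<in>I. f i \<in> Arr C \<and> Dom C (f i) = y i \<and> Cod C (f i) = w"
  shows "\<exists>h. h \<in> Arr C \<and> Dom C h = c \<and> Cod C h = w \<and> (\<forall>i\<in>I. h \<cdot> \<iota> i = f i)"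
proof -
  have "\<forall>y'\<in>Obj C. \<forall>f. (\<forall>i\<in>I. f i \<in> Hom C (y i) y') \<longrightarrow>
        (\<exists>!h. h \<in> Hom C c y' \<and> (\<forall>i\<in>I. h \<cdot> \<iota> i = f i))"
    using assms(1) unfolding is_coproduct_def by blast
  from this[rule_format, of w f] show ?thesis using assms(2,3) by auto
qed

lemma coproduct_arr_unique:
  assumes "is_coproduct C I y c \<iota>" "g \<in> Arr C" "h \<in> Arr C" "Dom C g = c" "Dom C h = c"
    "Cod C g = Cod C h" "\<And>i. i \<in> I \<Longrightarrow> g \<cdot> \<iota> i = h \<cdot> \<iota> i"
  shows "g = h"
proof -
  note a = coproduct_arr[OF assms(1)]
  have "\<forall>y'\<in>Obj C. \<forall>f. (\<forall>i\<in>I. f i \<in> Hom C (y i) y') \<longrightarrow>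
        (\<exists>!h. h \<in> Hom C c y' \<and> (\<forall>i\<in>I. h \<cdot> \<iota> i = f i))"
    using assms(1) unfolding is_coproduct_def by blast
  from this[rule_format, of "Cod C g" "\<lambda>i. g \<cdot> \<iota> i"]
  have "\<exists>!k. k \<in> Hom C c (Cod C g) \<and> (\<forall>i\<in>I. k \<cdot> \<iota> i = g \<cdot> \<iota> i)"
    using a assms(2-4) by simp
  moreover have "g \<in> Hom C c (Cod C g)" "h \<in> Hom C c (Cod C g)" using assms(2-6) by simp_all
  ultimately show ?thesis using assms(7) by metis
qed

lemma is_coproductI:
  assumes "c \<in> Obj C" "\<forall>i\<in>I. \<iota> i \<in> Arr C \<and> Dom C (\<iota> i) = y i \<and> Cod C (\<iota> i) = c"
    and ex: "\<And>w f. w \<in> Obj C \<Longrightarrow> \<forall>i\<in>I. f i \<in> Arr C \<and> Dom C (f i) = y i \<and> Cod C (f i) = w \<Longrightarrow>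
       \<exists>h. h \<in> Arr C \<and> Dom C h = c \<and> Cod C h = w \<and> (\<forall>i\<in>I. h \<cdot> \<iota> i = f i)"
    and unique: "\<And>g h. g \<in> Arr C \<Longrightarrow> h \<in> Arr C \<Longrightarrow> Dom C g = c \<Longrightarrow> Dom C h = c \<Longrightarrow>
       Cod C g = Cod C h \<Longrightarrow> \<forall>i\<in>I. g \<cdot> \<iota> i = h \<cdot> \<iota> i \<Longrightarrow> g = h"
  shows "is_coproduct C I y c \<iota>"
  unfolding is_coproduct_def
proof (intro conjI ballI allI impI)
  show "c \<in> Obj C" by fact
  show "\<iota> i \<in> Hom C (y i) c" if "i \<in> I" for i using assms(2) that by simp
  fix w f assume w: "w \<in> Obj C" and f: "\<forall>i\<in>I. f i \<in> Hom C (y i) w"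
  then obtain h where h: "h \<in> Arr C \<and> Dom C h = c \<and> Cod C h = w \<and> (\<forall>i\<in>I. h \<cdot> \<iota> i = f i)"
    using ex[of w f] by auto
  show "\<exists>!h. h \<in> Hom C c w \<and> (\<forall>i\<in>I. h \<cdot> \<iota> i = f i)"
  proof (rule ex1I[of _ h])
    show "h \<in> Hom C c w \<and> (\<forall>i\<in>I. h \<cdot> \<iota> i = f i)" using h by simp
    show "k = h" if "k \<in> Hom C c w \<and> (\<forall>i\<in>I. k \<cdot> \<iota> i = f i)" for k
      using that h by (intro unique) auto
  qed
qed

lemma coproduct_cong:
  "(\<And>i. i \<in> I \<Longrightarrow> y i = y' i \<and> \<iota> i = \<iota>' i) \<Longrightarrow> is_coproduct C I y c \<iota> \<Longrightarrow> is_coproduct C I y' c \<iota>'"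
  unfolding is_coproduct_def by simp

lemma coproduct_reindex:
  assumes m: "bij_betw m J I" and cop: "is_coproduct C I y c \<iota>"
  shows "is_coproduct C J (\<lambda>j. y (m j)) c (\<lambda>j. \<iota> (m j))"
proof (rule is_coproductI)
  note a = coproduct_arr[OF cop]
  have J: "m j \<in> I" if "j \<in> J" for j using bij_betwE[OF m] that by blast
  define n where "n = the_inv_into J m"
  have n: "n i \<in> J" "m (n i) = i" if "i \<in> I" for i
    using that m the_inv_into_into[of m J i J] f_the_inv_into_f[of m J i]
    unfolding bij_betw_def n_def by auto
  have n': "n (m j) = j" if "j \<in> J" for j
    using that m the_inv_into_f_f[of m J j] unfolding bij_betw_def n_def by auto
  show "c \<in> Obj C" by (rule a)
  show "\<forall>j\<in>J. \<iota> (m j) \<in> Arr C \<and> Dom C (\<iota> (m j)) = y (m j) \<and> Cod C (\<iota> (m j)) = c"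
    using a J by simp
  show "\<exists>h. h \<in> Arr C \<and> Dom C h = c \<and> Cod C h = w \<and> (\<forall>j\<in>J. h \<cdot> \<iota> (m j) = f j)"
    if w: "w \<in> Obj C" and f: "\<forall>j\<in>J. f j \<in> Arr C \<and> Dom C (f j) = y (m j) \<and> Cod C (f j) = w" for w f
  proof -
    have "\<forall>i\<in>I. f (n i) \<in> Arr C \<and> Dom C (f (n i)) = y i \<and> Cod C (f (n i)) = w"
      using f n by simp
    then obtain h where "h \<in> Arr C" "Dom C h = c" "Cod C h = w" "\<forall>i\<in>I. h \<cdot> \<iota> i = f (n i)"
      using coproduct_arr_ex[OF cop w, of "\<lambda>i. f (n i)"] by blast
    then show ?thesis using J n' by (intro exI[of _ h]) simp
  qed
  show "g = h" if gh: "g \<in> Arr C" "h \<in> Arr C" "Dom C g = c" "Dom C h = c" "Cod C g = Cod C h"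
    "\<forall>j\<in>J. g \<cdot> \<iota> (m j) = h \<cdot> \<iota> (m j)" for g h
  proof (rule coproduct_arr_unique[OF cop gh(1-5)])
    show "g \<cdot> \<iota> i = h \<cdot> \<iota> i" if "i \<in> I" for i
      using gh(6)[rule_format, OF n(1)[OF that]] n(2)[OF that] by simp
  qed
qed

end

section \<open>Monoidal categories\<close>

locale mon = cat C for C :: "('o, 'm, 'z) moncat_scheme" (structure) +
  assumes is_monoidal: "is_monoidal C"
begin

abbreviation unit_ob ("\<I>") where "\<I> \<equiv> UnitO C"
abbreviation as ("\<a>") where "\<a> \<equiv> Assoc C"
abbreviation lu ("\<l>") where "\<l> \<equiv> LUnit C"
abbreviation ru ("\<r>") where "\<r> \<equiv> RUnit C"

lemma unit_obj [simp]: "\<I> \<in> Obj C"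
  using is_monoidal unfolding is_monoidal_def by blast

lemma is_bifunctor: "is_bifunctor C"
  using is_monoidal unfolding is_monoidal_def by blast

lemma tensor_obj [simp]: "x \<in> Obj C \<Longrightarrow> y \<in> Obj C \<Longrightarrow> x \<otimes>\<^sub>o y \<in> Obj C"
  and tensor_ide [simp]: "x \<in> Obj C \<Longrightarrow> y \<in> Obj C \<Longrightarrow> Ide C x \<otimes>\<^sub>a Ide C y = Ide C (x \<otimes>\<^sub>o y)"
  using is_bifunctor unfolding is_bifunctor_def by simp_all

lemma tensor_arr [simp]:
  assumes "f \<in> Arr C" "g \<in> Arr C"
  shows "f \<otimes>\<^sub>a g \<in> Arr C" "Dom C (f \<otimes>\<^sub>a g) = Dom C f \<otimes>\<^sub>o Dom C g" "Cod C (f \<otimes>\<^sub>a g) = Cod C f \<otimes>\<^sub>o Cod C g"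
proof -
  have "\<forall>x x' y y' f g. f \<in> Hom C x x' \<and> g \<in> Hom C y y' \<longrightarrow> f \<otimes>\<^sub>a g \<in> Hom C (x \<otimes>\<^sub>o y) (x' \<otimes>\<^sub>o y')"
    using is_bifunctor unfolding is_bifunctor_def by (elim conjE)
  from this[rule_format, of f "Dom C f" "Cod C f" g "Dom C g" "Cod C g"] assms
  show "f \<otimes>\<^sub>a g \<in> Arr C" "Dom C (f \<otimes>\<^sub>a g) = Dom C f \<otimes>\<^sub>o Dom C g" "Cod C (f \<otimes>\<^sub>a g) = Cod C f \<otimes>\<^sub>o Cod C g"
    by auto
qed

lemma tensor_comp [simp]:
  assumes "f \<in> Arr C" "f' \<in> Arr C" "g \<in> Arr C" "g' \<in> Arr C" "Dom C f' = Cod C f" "Dom C g' = Cod C g"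
  shows "(f' \<otimes>\<^sub>a g') \<cdot> (f \<otimes>\<^sub>a g) = (f' \<cdot> f) \<otimes>\<^sub>a (g' \<cdot> g)"
proof -
  have "\<forall>x x' x'' y y' y'' f f' g g'.
        f \<in> Hom C x x' \<and> f' \<in> Hom C x' x'' \<and> g \<in> Hom C y y' \<and> g' \<in> Hom C y' y'' \<longrightarrow>
        (f' \<cdot> f) \<otimes>\<^sub>a (g' \<cdot> g) = (f' \<otimes>\<^sub>a g') \<cdot> (f \<otimes>\<^sub>a g)"
    using is_bifunctor unfolding is_bifunctor_def by (elim conjE)
  from this[rule_format, of f "Dom C f" "Cod C f" f' "Cod C f'" g "Dom C g" "Cod C g" g' "Cod C g'"] assms
  show ?thesis by simp
qed

lemma tensor_comp_assoc [simp]: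
  assumes "f \<in> Arr C" "f' \<in> Arr C" "g \<in> Arr C" "g' \<in> Arr C" "Dom C f' = Cod C f" "Dom C g' = Cod C g"
    "k \<in> Arr C" "Cod C k = Dom C f \<otimes>\<^sub>o Dom C g"
  shows "(f' \<otimes>\<^sub>a g') \<cdot> ((f \<otimes>\<^sub>a g) \<cdot> k) = ((f' \<cdot> f) \<otimes>\<^sub>a (g' \<cdot> g)) \<cdot> k"
  using assms by (intro comp_eq_left) simp_all

lemma assoc_iso [simp]:
  assumes "x \<in> Obj C" "y \<in> Obj C" "z \<in> Obj C"
  shows "iso_arr C (\<a> x y z)" "\<a> x y z \<in> Arr C" "Dom C (\<a> x y z) = (x \<otimes>\<^sub>o y) \<otimes>\<^sub>o z" "Cod C (\<a> x y z) = x \<otimes>\<^sub>o y \<otimes>\<^sub>o z"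
proof -
  have "\<a> x y z \<in> Iso C ((x \<otimes>\<^sub>o y) \<otimes>\<^sub>o z) (x \<otimes>\<^sub>o y \<otimes>\<^sub>o z)"
    using is_monoidal assms unfolding is_monoidal_def by simp
  then show "iso_arr C (\<a> x y z)" "\<a> x y z \<in> Arr C" "Dom C (\<a> x y z) = (x \<otimes>\<^sub>o y) \<otimes>\<^sub>o z" "Cod C (\<a> x y z) = x \<otimes>\<^sub>o y \<otimes>\<^sub>o z"
    using iso_arr_in_arr by auto
qed

lemma unitor_iso [simp]:
  assumes "x \<in> Obj C"
  shows "iso_arr C (\<l> x)" "\<l> x \<in> Arr C" "Dom C (\<l> x) = \<I> \<otimes>\<^sub>o x" "Cod C (\<l> x) = x"
    "iso_arr C (\<r> x)" "\<r> x \<in> Arr C" "Dom C (\<r> x) = x \<otimes>\<^sub>o \<I>" "Cod C (\<r> x) = x"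
proof -
  have "\<l> x \<in> Iso C (\<I> \<otimes>\<^sub>o x) x \<and> \<r> x \<in> Iso C (x \<otimes>\<^sub>o \<I>) x"
    using is_monoidal assms unfolding is_monoidal_def by blast
  then show "iso_arr C (\<l> x)" "\<l> x \<in> Arr C" "Dom C (\<l> x) = \<I> \<otimes>\<^sub>o x" "Cod C (\<l> x) = x"
    "iso_arr C (\<r> x)" "\<r> x \<in> Arr C" "Dom C (\<r> x) = x \<otimes>\<^sub>o \<I>" "Cod C (\<r> x) = x"
    using iso_arr_in_arr by auto
qed

lemma assoc_nat:
  assumes "f \<in> Arr C" "g \<in> Arr C" "h \<in> Arr C"
  shows "\<a> (Cod C f) (Cod C g) (Cod C h) \<cdot> ((f \<otimes>\<^sub>a g) \<otimes>\<^sub>a h) = (f \<otimes>\<^sub>a g \<otimes>\<^sub>a h) \<cdot> \<a> (Dom C f) (Dom C g) (Dom C h)"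
proof -
  have "\<forall>x x' y y' z z' f g h. f \<in> Hom C x x' \<and> g \<in> Hom C y y' \<and> h \<in> Hom C z z' \<longrightarrow>
        \<a> x' y' z' \<cdot> ((f \<otimes>\<^sub>a g) \<otimes>\<^sub>a h) = (f \<otimes>\<^sub>a g \<otimes>\<^sub>a h) \<cdot> \<a> x y z"
    using is_monoidal unfolding is_monoidal_def by blast
  then show ?thesis using assms by auto
qed

lemma unitor_nat:
  assumes "f \<in> Arr C"
  shows "\<l> (Cod C f) \<cdot> (Ide C \<I> \<otimes>\<^sub>a f) = f \<cdot> \<l> (Dom C f)" "\<r> (Cod C f) \<cdot> (f \<otimes>\<^sub>a Ide C \<I>) = f \<cdot> \<r> (Dom C f)"
proof -
  have "\<forall>x x' f. f \<in> Hom C x x' \<longrightarrow>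
        \<l> x' \<cdot> (Ide C \<I> \<otimes>\<^sub>a f) = f \<cdot> \<l> x \<and> \<r> x' \<cdot> (f \<otimes>\<^sub>a Ide C \<I>) = f \<cdot> \<r> x"
    using is_monoidal unfolding is_monoidal_def by blast
  then show "\<l> (Cod C f) \<cdot> (Ide C \<I> \<otimes>\<^sub>a f) = f \<cdot> \<l> (Dom C f)" "\<r> (Cod C f) \<cdot> (f \<otimes>\<^sub>a Ide C \<I>) = f \<cdot> \<r> (Dom C f)"
    using assms by auto
qed

lemma pentagon:
  assumes "w \<in> Obj C" "x \<in> Obj C" "y \<in> Obj C" "z \<in> Obj C"
  shows "\<a> w x (y \<otimes>\<^sub>o z) \<cdot> \<a> (w \<otimes>\<^sub>o x) y z =
     (Ide C w \<otimes>\<^sub>a \<a> x y z) \<cdot> \<a> w (x \<otimes>\<^sub>o y) z \<cdot> (\<a> w x y \<otimes>\<^sub>a Ide C z)"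
  using is_monoidal assms unfolding is_monoidal_def by blast

lemma triangle:
  assumes "x \<in> Obj C" "y \<in> Obj C"
  shows "(Ide C x \<otimes>\<^sub>a \<l> y) \<cdot> \<a> x \<I> y = \<r> x \<otimes>\<^sub>a Ide C y"
  using is_monoidal assms unfolding is_monoidal_def by blast

lemma tensor_iso_arr:
  assumes "iso_arr C f" "iso_arr C g"
  shows "iso_arr C (f \<otimes>\<^sub>a g)"
  by (rule iso_arrI[where g="inv_arr C f \<otimes>\<^sub>a inv_arr C g"])
    (use assms in \<open>simp_all add: iso_arr_in_arr\<close>)

lemma tensor_isomorphic:
  assumes "isomorphic C x x'" "isomorphic C y y'"
  shows "isomorphic C (x \<otimes>\<^sub>o y) (x' \<otimes>\<^sub>o y')"
proof -
  obtain f g where "iso_arr C f" "Dom C f = x" "Cod C f = x'" "iso_arr C g" "Dom C g = y" "Cod C g = y'"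
    using assms unfolding isomorphic_iff by blast
  then show ?thesis by (intro isomorphicI[of "f \<otimes>\<^sub>a g"] tensor_iso_arr) (simp_all add: iso_arr_in_arr)
qed

lemma assoc_isomorphic:
  "x \<in> Obj C \<Longrightarrow> y \<in> Obj C \<Longrightarrow> z \<in> Obj C \<Longrightarrow> isomorphic C ((x \<otimes>\<^sub>o y) \<otimes>\<^sub>o z) (x \<otimes>\<^sub>o y \<otimes>\<^sub>o z)"
  by (rule isomorphicI[of "\<a> x y z"]) simp_all

lemma lunit_isomorphic: "x \<in> Obj C \<Longrightarrow> isomorphic C (\<I> \<otimes>\<^sub>o x) x"
  by (rule isomorphicI[of "\<l> x"]) simp_all

text \<open>The right unitor is a natural isomorphism from tensoring with the unit to the identity
  functor, so the former is faithful. Coherence equations may hence be checked after tensoring with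
  the unit.\<close>

lemma tensor_unit_faithful:
  assumes "f \<otimes>\<^sub>a Ide C \<I> = g \<otimes>\<^sub>a Ide C \<I>" "f \<in> Arr C" "g \<in> Arr C" "Dom C f = Dom C g" "Cod C f = Cod C g"
  shows "f = g"
proof -
  have "f \<cdot> \<r> (Dom C f) = g \<cdot> \<r> (Dom C f)"
    using assms unitor_nat(2)[of f] unitor_nat(2)[of g] by simp
  then show ?thesis by (rule iso_arr_cancel_right[rotated]) (use assms in simp_all)
qed

lemma unit_tensor_faithful:
  assumes "Ide C \<I> \<otimes>\<^sub>a f = Ide C \<I> \<otimes>\<^sub>a g" "f \<in> Arr C" "g \<in> Arr C" "Dom C f = Dom C g" "Cod C f = Cod C g"
  shows "f = g"
proof -
  have "f \<cdot> \<l> (Dom C f) = g \<cdot> \<l> (Dom C f)"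
    using assms unitor_nat(1)[of f] unitor_nat(1)[of g] by simp
  then show ?thesis by (rule iso_arr_cancel_right[rotated]) (use assms in simp_all)
qed

text \<open>One of Kelly's coherence laws that follow from the pentagon and the triangle. After
  tensoring with the unit, the pentagon for \<open>x\<close>, \<open>y\<close> and two units links
  the triangle at \<open>x \<otimes> y\<close> with the triangle at \<open>y\<close>; an associator
  and the extra unit are then cancelled.\<close>

lemma runit_tensor:
  assumes [simp]: "x \<in> Obj C" "y \<in> Obj C"
  shows "(Ide C x \<otimes>\<^sub>a \<r> y) \<cdot> \<a> x y \<I> = \<r> (x \<otimes>\<^sub>o y)"
proof (rule tensor_unit_faithful)
  show "((Ide C x \<otimes>\<^sub>a \<r> y) \<cdot> \<a> x y \<I>) \<otimes>\<^sub>a Ide C \<I> = \<r> (x \<otimes>\<^sub>o y) \<otimes>\<^sub>a Ide C \<I>"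
  proof (rule iso_arr_cancel_left)
    have l: "\<a> x y \<I> \<cdot> (Ide C (x \<otimes>\<^sub>o y) \<otimes>\<^sub>a \<l> \<I>) = (Ide C x \<otimes>\<^sub>a (Ide C y \<otimes>\<^sub>a \<l> \<I>)) \<cdot> \<a> x y (\<I> \<otimes>\<^sub>o \<I>)"
      using assoc_nat[of "Ide C x" "Ide C y" "\<l> \<I>"] by simp
    have r: "\<a> x y \<I> \<cdot> ((Ide C x \<otimes>\<^sub>a \<r> y) \<otimes>\<^sub>a Ide C \<I>) = (Ide C x \<otimes>\<^sub>a (\<r> y \<otimes>\<^sub>a Ide C \<I>)) \<cdot> \<a> x (y \<otimes>\<^sub>o \<I>) \<I>"
      using assoc_nat[of "Ide C x" "\<r> y" "Ide C \<I>"] by simp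
    have "\<a> x y \<I> \<cdot> (\<r> (x \<otimes>\<^sub>o y) \<otimes>\<^sub>a Ide C \<I>)
        = \<a> x y \<I> \<cdot> (Ide C (x \<otimes>\<^sub>o y) \<otimes>\<^sub>a \<l> \<I>) \<cdot> \<a> (x \<otimes>\<^sub>o y) \<I> \<I>"
      using triangle[of "x \<otimes>\<^sub>o y" \<I>] by simp
    also have "\<dots> = (Ide C x \<otimes>\<^sub>a (Ide C y \<otimes>\<^sub>a \<l> \<I>)) \<cdot> \<a> x y (\<I> \<otimes>\<^sub>o \<I>) \<cdot> \<a> (x \<otimes>\<^sub>o y) \<I> \<I>"
      by (rule comp_eq_left[OF l, THEN trans]) simp_all
    also have "\<dots> = (Ide C x \<otimes>\<^sub>a ((Ide C y \<otimes>\<^sub>a \<l> \<I>) \<cdot> \<a> y \<I> \<I>)) \<cdot> \<a> x (y \<otimes>\<^sub>o \<I>) \<I> \<cdot> (\<a> x y \<I> \<otimes>\<^sub>a Ide C \<I>)"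
      unfolding pentagon[of x y \<I> \<I>, simplified] by simp
    also have "\<dots> = (Ide C x \<otimes>\<^sub>a (\<r> y \<otimes>\<^sub>a Ide C \<I>)) \<cdot> \<a> x (y \<otimes>\<^sub>o \<I>) \<I> \<cdot> (\<a> x y \<I> \<otimes>\<^sub>a Ide C \<I>)"
      using triangle[of y \<I>] by simp
    also have "\<dots> = \<a> x y \<I> \<cdot> ((Ide C x \<otimes>\<^sub>a \<r> y) \<otimes>\<^sub>a Ide C \<I>) \<cdot> (\<a> x y \<I> \<otimes>\<^sub>a Ide C \<I>)"
      by (rule comp_eq_left[OF r, THEN trans, symmetric]) simp_all
    finally show "\<a> x y \<I> \<cdot> (((Ide C x \<otimes>\<^sub>a \<r> y) \<cdot> \<a> x y \<I>) \<otimes>\<^sub>a Ide C \<I>) = \<a> x y \<I> \<cdot> (\<r> (x \<otimes>\<^sub>o y) \<otimes>\<^sub>a Ide C \<I>)"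
      by simp
  qed simp_all
qed simp_all

text \<open>Naturality of the right unitor along itself identifies the right unitor of the tensor
  square of the unit with \<open>\<r> \<I> \<otimes> id\<close>. The triangle and
  \<open>runit_tensor\<close> then make both sides agree after tensoring with the unit.\<close>

lemma lunit_unit: "\<l> \<I> = \<r> \<I>"
proof -
  have "\<r> \<I> \<cdot> \<r> (\<I> \<otimes>\<^sub>o \<I>) = \<r> \<I> \<cdot> (\<r> \<I> \<otimes>\<^sub>a Ide C \<I>)" using unitor_nat(2)[of "\<r> \<I>"] by simp
  then have "\<r> (\<I> \<otimes>\<^sub>o \<I>) = \<r> \<I> \<otimes>\<^sub>a Ide C \<I>" by (rule iso_arr_cancel_left[rotated]) simp_all
  then have "(Ide C \<I> \<otimes>\<^sub>a \<l> \<I>) \<cdot> \<a> \<I> \<I> \<I> = (Ide C \<I> \<otimes>\<^sub>a \<r> \<I>) \<cdot> \<a> \<I> \<I> \<I>"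
    using triangle[of \<I> \<I>] runit_tensor[of \<I> \<I>] by simp
  then have "Ide C \<I> \<otimes>\<^sub>a \<l> \<I> = Ide C \<I> \<otimes>\<^sub>a \<r> \<I>" by (rule iso_arr_cancel_right[rotated]) simp_all
  then show ?thesis by (rule unit_tensor_faithful) simp_all
qed

section \<open>Dual pairs and the adjunction that they induce\<close>

definition dual_pair :: "'o \<Rightarrow> 'o \<Rightarrow> 'm \<Rightarrow> 'm \<Rightarrow> bool" where
  "dual_pair y y' ev coev \<longleftrightarrow> y \<in> Obj C \<and> y' \<in> Obj C \<and> ev \<in> Hom C (y' \<otimes>\<^sub>o y) \<I> \<and> coev \<in> Hom C \<I> (y \<otimes>\<^sub>o y') \<and>
     \<r> y \<cdot> (Ide C y \<otimes>\<^sub>a ev) \<cdot> \<a> y y' y \<cdot> (coev \<otimes>\<^sub>a Ide C y) = \<l> y \<and>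
     \<l> y' \<cdot> (ev \<otimes>\<^sub>a Ide C y') \<cdot> inv_arr C (\<a> y' y y') \<cdot> (Ide C y' \<otimes>\<^sub>a coev) = \<r> y'"

text \<open>The adjunction between tensoring with \<open>y\<close> and with its dual
  \<open>y'\<close>: a map \<open>x \<otimes> y \<rightarrow> c\<close> goes to its mate
  \<open>x \<rightarrow> c \<otimes> y'\<close>, and \<open>untransp\<close> leads back. The counit
  \<open>ev\<close> and the unit \<open>coev\<close> occur in one direction each.\<close>

definition transp :: "'o \<Rightarrow> 'o \<Rightarrow> 'o \<Rightarrow> 'm \<Rightarrow> 'm \<Rightarrow> 'm" where
  "transp x y y' coev f = (f \<otimes>\<^sub>a Ide C y') \<cdot> inv_arr C (\<a> x y y') \<cdot> (Ide C x \<otimes>\<^sub>a coev) \<cdot> inv_arr C (\<r> x)"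

definition untransp :: "'o \<Rightarrow> 'o \<Rightarrow> 'o \<Rightarrow> 'm \<Rightarrow> 'm \<Rightarrow> 'm" where
  "untransp c y y' ev g = \<r> c \<cdot> (Ide C c \<otimes>\<^sub>a ev) \<cdot> \<a> c y' y \<cdot> (g \<otimes>\<^sub>a Ide C y)"

lemma assoc_inv_nat:
  assumes "f \<in> Arr C" "g \<in> Arr C" "h \<in> Arr C"
  shows "((f \<otimes>\<^sub>a g) \<otimes>\<^sub>a h) \<cdot> inv_arr C (\<a> (Dom C f) (Dom C g) (Dom C h)) =
    inv_arr C (\<a> (Cod C f) (Cod C g) (Cod C h)) \<cdot> (f \<otimes>\<^sub>a g \<otimes>\<^sub>a h)"
proof (rule iso_arr_cancel_left[of "\<a> (Cod C f) (Cod C g) (Cod C h)"])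
  show "\<a> (Cod C f) (Cod C g) (Cod C h) \<cdot> (((f \<otimes>\<^sub>a g) \<otimes>\<^sub>a h) \<cdot> inv_arr C (\<a> (Dom C f) (Dom C g) (Dom C h))) =
    \<a> (Cod C f) (Cod C g) (Cod C h) \<cdot> (inv_arr C (\<a> (Cod C f) (Cod C g) (Cod C h)) \<cdot> (f \<otimes>\<^sub>a g \<otimes>\<^sub>a h))"
    using assms by (subst comp_eq_left[OF assoc_nat]) simp_all
qed (use assms in simp_all)

lemma dual_pairD:
  assumes "dual_pair y y' ev coev"
  shows "y \<in> Obj C" "y' \<in> Obj C" "ev \<in> Arr C" "Dom C ev = y' \<otimes>\<^sub>o y" "Cod C ev = \<I>"
    "coev \<in> Arr C" "Dom C coev = \<I>" "Cod C coev = y \<otimes>\<^sub>o y'"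
    "\<r> y \<cdot> (Ide C y \<otimes>\<^sub>a ev) \<cdot> \<a> y y' y \<cdot> (coev \<otimes>\<^sub>a Ide C y) = \<l> y"
    "\<l> y' \<cdot> (ev \<otimes>\<^sub>a Ide C y') \<cdot> inv_arr C (\<a> y' y y') \<cdot> (Ide C y' \<otimes>\<^sub>a coev) = \<r> y'"
  using assms unfolding dual_pair_def by simp_all

text \<open>The first duality equation with an inert factor \<open>x\<close> on the left. The
  pentagon moves the associators together, so that everything happens inside the second tensor
  factor.\<close>

lemma dual_zigzag:
  assumes d: "dual_pair y y' ev coev" and [simp]: "x \<in> Obj C"
  shows "\<r> (x \<otimes>\<^sub>o y) \<cdot> (Ide C (x \<otimes>\<^sub>o y) \<otimes>\<^sub>a ev) \<cdot> \<a> (x \<otimes>\<^sub>o y) y' y \<cdot> (inv_arr C (\<a> x y y') \<otimes>\<^sub>a Ide C y) \<cdot>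
      ((Ide C x \<otimes>\<^sub>a coev) \<otimes>\<^sub>a Ide C y) = \<r> x \<otimes>\<^sub>a Ide C y"
proof -
  note [simp] = dual_pairD(1-8)[OF d]
  have 1: "\<r> (x \<otimes>\<^sub>o y) = (Ide C x \<otimes>\<^sub>a \<r> y) \<cdot> \<a> x y \<I>" by (simp add: runit_tensor)
  have 2: "\<a> x y \<I> \<cdot> (Ide C (x \<otimes>\<^sub>o y) \<otimes>\<^sub>a ev) = (Ide C x \<otimes>\<^sub>a (Ide C y \<otimes>\<^sub>a ev)) \<cdot> \<a> x y (y' \<otimes>\<^sub>o y)"
    using assoc_nat[of "Ide C x" "Ide C y" ev] by simp
  have 3: "\<a> x (y \<otimes>\<^sub>o y') y \<cdot> ((Ide C x \<otimes>\<^sub>a coev) \<otimes>\<^sub>a Ide C y) = (Ide C x \<otimes>\<^sub>a (coev \<otimes>\<^sub>a Ide C y)) \<cdot> \<a> x \<I> y"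
    using assoc_nat[of "Ide C x" coev "Ide C y"] by simp
  have "\<a> x y (y' \<otimes>\<^sub>o y) \<cdot> \<a> (x \<otimes>\<^sub>o y) y' y \<cdot> (inv_arr C (\<a> x y y') \<otimes>\<^sub>a Ide C y)
      = (Ide C x \<otimes>\<^sub>a \<a> y y' y) \<cdot> \<a> x (y \<otimes>\<^sub>o y') y"
    by (rule comp_eq_left[OF pentagon[of x y y' y], THEN trans]) simp_all
  note 4 = comp_eq_left[OF this, of "(Ide C x \<otimes>\<^sub>a coev) \<otimes>\<^sub>a Ide C y", simplified]
  have "\<r> (x \<otimes>\<^sub>o y) \<cdot> (Ide C (x \<otimes>\<^sub>o y) \<otimes>\<^sub>a ev) \<cdot> \<a> (x \<otimes>\<^sub>o y) y' y \<cdot> (inv_arr C (\<a> x y y') \<otimes>\<^sub>a Ide C y) \<cdot>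
      ((Ide C x \<otimes>\<^sub>a coev) \<otimes>\<^sub>a Ide C y)
    = (Ide C x \<otimes>\<^sub>a \<r> y) \<cdot> (\<a> x y \<I> \<cdot> (Ide C (x \<otimes>\<^sub>o y) \<otimes>\<^sub>a ev) \<cdot> (\<a> (x \<otimes>\<^sub>o y) y' y \<cdot>
      ((inv_arr C (\<a> x y y') \<otimes>\<^sub>a Ide C y) \<cdot> ((Ide C x \<otimes>\<^sub>a coev) \<otimes>\<^sub>a Ide C y))))"
    unfolding 1 by (rule comp_assoc) simp_all
  also have "\<dots> = (Ide C x \<otimes>\<^sub>a \<r> y) \<cdot> ((Ide C x \<otimes>\<^sub>a (Ide C y \<otimes>\<^sub>a ev)) \<cdot> \<a> x y (y' \<otimes>\<^sub>o y)) \<cdot> (\<a> (x \<otimes>\<^sub>o y) y' y \<cdot>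
      ((inv_arr C (\<a> x y y') \<otimes>\<^sub>a Ide C y) \<cdot> ((Ide C x \<otimes>\<^sub>a coev) \<otimes>\<^sub>a Ide C y)))"
    by (subst comp_eq_left[OF 2]) simp_all
  also have "\<dots> = (Ide C x \<otimes>\<^sub>a \<r> y) \<cdot> (Ide C x \<otimes>\<^sub>a (Ide C y \<otimes>\<^sub>a ev)) \<cdot> (\<a> x y (y' \<otimes>\<^sub>o y) \<cdot> \<a> (x \<otimes>\<^sub>o y) y' y \<cdot>
      ((inv_arr C (\<a> x y y') \<otimes>\<^sub>a Ide C y) \<cdot> ((Ide C x \<otimes>\<^sub>a coev) \<otimes>\<^sub>a Ide C y)))"
    by (subst comp_assoc) (simp_all del: comp_assoc tensor_comp_assoc tensor_comp)
  also have "\<dots> = (Ide C x \<otimes>\<^sub>a \<r> y) \<cdot> (Ide C x \<otimes>\<^sub>a (Ide C y \<otimes>\<^sub>a ev)) \<cdot>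
      (Ide C x \<otimes>\<^sub>a \<a> y y' y) \<cdot> (\<a> x (y \<otimes>\<^sub>o y') y \<cdot> ((Ide C x \<otimes>\<^sub>a coev) \<otimes>\<^sub>a Ide C y))"
    using 4 by simp
  also have "\<dots> = (Ide C x \<otimes>\<^sub>a (\<r> y \<cdot> (Ide C y \<otimes>\<^sub>a ev) \<cdot> \<a> y y' y \<cdot> (coev \<otimes>\<^sub>a Ide C y))) \<cdot> \<a> x \<I> y"
    unfolding 3 by simp
  also have "\<dots> = \<r> x \<otimes>\<^sub>a Ide C y"
    unfolding dual_pairD(9)[OF d] by (simp add: triangle)
  finally show ?thesis .
qed

text \<open>The second duality equation with the inert factor \<open>c\<close>. Again the pentagon,
  now for \<open>c\<close>, \<open>y'\<close>, \<open>y\<close>, \<open>y'\<close>, collects the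
  equation in one tensor factor, where the triangle absorbs the right unitor of
  \<open>c\<close>.\<close>

lemma dual_zigzag':
  assumes d: "dual_pair y y' ev coev" and [simp]: "c \<in> Obj C"
  shows "(\<r> c \<otimes>\<^sub>a Ide C y') \<cdot> ((Ide C c \<otimes>\<^sub>a ev) \<otimes>\<^sub>a Ide C y') \<cdot> (\<a> c y' y \<otimes>\<^sub>a Ide C y') \<cdot>
      inv_arr C (\<a> (c \<otimes>\<^sub>o y') y y') \<cdot> (Ide C (c \<otimes>\<^sub>o y') \<otimes>\<^sub>a coev) = \<r> (c \<otimes>\<^sub>o y')"
proof -
  note [simp] = dual_pairD(1-8)[OF d]
  let ?A = "inv_arr C (\<a> c (y' \<otimes>\<^sub>o y) y')" and ?B = "Ide C c \<otimes>\<^sub>a inv_arr C (\<a> y' y y')"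
  have 1: "(\<a> c y' y \<otimes>\<^sub>a Ide C y') \<cdot> inv_arr C (\<a> (c \<otimes>\<^sub>o y') y y') = ?A \<cdot> ?B \<cdot> \<a> c y' (y \<otimes>\<^sub>o y')"
  proof (rule iso_arr_cancel_right[of "\<a> (c \<otimes>\<^sub>o y') y y'"])
    show "((\<a> c y' y \<otimes>\<^sub>a Ide C y') \<cdot> inv_arr C (\<a> (c \<otimes>\<^sub>o y') y y')) \<cdot> \<a> (c \<otimes>\<^sub>o y') y y' =
        (?A \<cdot> ?B \<cdot> \<a> c y' (y \<otimes>\<^sub>o y')) \<cdot> \<a> (c \<otimes>\<^sub>o y') y y'"
      using pentagon[of c y' y y'] by simp
  qed simp_all
  have 2: "((Ide C c \<otimes>\<^sub>a ev) \<otimes>\<^sub>a Ide C y') \<cdot> ?A = inv_arr C (\<a> c \<I> y') \<cdot> (Ide C c \<otimes>\<^sub>a (ev \<otimes>\<^sub>a Ide C y'))"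
    using assoc_inv_nat[of "Ide C c" ev "Ide C y'"] by simp
  have 3: "\<a> c y' (y \<otimes>\<^sub>o y') \<cdot> (Ide C (c \<otimes>\<^sub>o y') \<otimes>\<^sub>a coev) = (Ide C c \<otimes>\<^sub>a (Ide C y' \<otimes>\<^sub>a coev)) \<cdot> \<a> c y' \<I>"
    using assoc_nat[of "Ide C c" "Ide C y'" coev] by simp
  have 4: "(\<r> c \<otimes>\<^sub>a Ide C y') \<cdot> inv_arr C (\<a> c \<I> y') = Ide C c \<otimes>\<^sub>a \<l> y'"
    by (simp flip: triangle)
  have "(\<r> c \<otimes>\<^sub>a Ide C y') \<cdot> ((Ide C c \<otimes>\<^sub>a ev) \<otimes>\<^sub>a Ide C y') \<cdot> (\<a> c y' y \<otimes>\<^sub>a Ide C y') \<cdot>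
      inv_arr C (\<a> (c \<otimes>\<^sub>o y') y y') \<cdot> (Ide C (c \<otimes>\<^sub>o y') \<otimes>\<^sub>a coev)
    = (\<r> c \<otimes>\<^sub>a Ide C y') \<cdot> (((Ide C c \<otimes>\<^sub>a ev) \<otimes>\<^sub>a Ide C y') \<cdot> (?A \<cdot> (?B \<cdot> (\<a> c y' (y \<otimes>\<^sub>o y') \<cdot> (Ide C (c \<otimes>\<^sub>o y') \<otimes>\<^sub>a coev)))))"
    by (subst comp_eq_left[OF 1]) (simp_all del: tensor_comp tensor_comp_assoc)
  also have "\<dots> = (\<r> c \<otimes>\<^sub>a Ide C y') \<cdot> (inv_arr C (\<a> c \<I> y') \<cdot> ((Ide C c \<otimes>\<^sub>a (ev \<otimes>\<^sub>a Ide C y')) \<cdot> (?B \<cdot> ((Ide C c \<otimes>\<^sub>a (Ide C y' \<otimes>\<^sub>a coev)) \<cdot> \<a> c y' \<I>))))"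
    unfolding 3 by (subst comp_eq_left[OF 2]) (simp_all del: tensor_comp tensor_comp_assoc)
  also have "\<dots> = (Ide C c \<otimes>\<^sub>a \<l> y') \<cdot> ((Ide C c \<otimes>\<^sub>a (ev \<otimes>\<^sub>a Ide C y')) \<cdot> (?B \<cdot> ((Ide C c \<otimes>\<^sub>a (Ide C y' \<otimes>\<^sub>a coev)) \<cdot> \<a> c y' \<I>)))"
    by (subst comp_eq_left[OF 4]) (simp_all del: tensor_comp tensor_comp_assoc)
  also have "\<dots> = (Ide C c \<otimes>\<^sub>a (\<l> y' \<cdot> (ev \<otimes>\<^sub>a Ide C y') \<cdot> inv_arr C (\<a> y' y y') \<cdot> (Ide C y' \<otimes>\<^sub>a coev))) \<cdot> \<a> c y' \<I>"
    by simp
  also have "\<dots> = \<r> (c \<otimes>\<^sub>o y')"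
    unfolding dual_pairD(10)[OF d] by (simp add: runit_tensor)
  finally show ?thesis .
qed

lemma transp_arr:
  assumes "dual_pair y y' ev coev" "x \<in> Obj C" "f \<in> Arr C" "Dom C f = x \<otimes>\<^sub>o y"
  shows "transp x y y' coev f \<in> Arr C" "Dom C (transp x y y' coev f) = x"
    "Cod C (transp x y y' coev f) = Cod C f \<otimes>\<^sub>o y'"
  using assms dual_pairD[OF assms(1)] unfolding transp_def by simp_all

lemma untransp_arr:
  assumes "dual_pair y y' ev coev" "c \<in> Obj C" "g \<in> Arr C" "Cod C g = c \<otimes>\<^sub>o y'"
  shows "untransp c y y' ev g \<in> Arr C" "Dom C (untransp c y y' ev g) = Dom C g \<otimes>\<^sub>o y"
    "Cod C (untransp c y y' ev g) = c"
  using assms dual_pairD[OF assms(1)] unfolding untransp_def by simp_all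

lemma transp_comp:
  assumes "dual_pair y y' ev coev" "x \<in> Obj C" "f \<in> Arr C" "Dom C f = x \<otimes>\<^sub>o y" "g \<in> Arr C" "Dom C g = Cod C f"
  shows "transp x y y' coev (g \<cdot> f) = (g \<otimes>\<^sub>a Ide C y') \<cdot> transp x y y' coev f"
  using assms dual_pairD[OF assms(1)] unfolding transp_def by simp

text \<open>By naturality \<open>f\<close> slides to the front past the associator,
  \<open>ev\<close> and the unitor; what remains behind it is \<open>dual_zigzag\<close>. This law
  makes transposition injective, as the compactness of tensor products requires.\<close>

lemma untransp_transp:
  assumes d: "dual_pair y y' ev coev" and [simp]: "x \<in> Obj C" "f \<in> Arr C" "Dom C f = x \<otimes>\<^sub>o y"
  shows "untransp (Cod C f) y y' ev (transp x y y' coev f) = f"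
proof -
  note [simp] = dual_pairD(1-8)[OF d]
  let ?s = "inv_arr C (\<a> x y y') \<cdot> (Ide C x \<otimes>\<^sub>a coev) \<cdot> inv_arr C (\<r> x)"
  have s: "?s \<otimes>\<^sub>a Ide C y = (inv_arr C (\<a> x y y') \<otimes>\<^sub>a Ide C y) \<cdot>
      ((Ide C x \<otimes>\<^sub>a coev) \<otimes>\<^sub>a Ide C y) \<cdot> (inv_arr C (\<r> x) \<otimes>\<^sub>a Ide C y)"
    by simp
  have 1: "\<a> (Cod C f) y' y \<cdot> ((f \<otimes>\<^sub>a Ide C y') \<otimes>\<^sub>a Ide C y) = (f \<otimes>\<^sub>a Ide C (y' \<otimes>\<^sub>o y)) \<cdot> \<a> (x \<otimes>\<^sub>o y) y' y"
    using assoc_nat[of f "Ide C y'" "Ide C y"] by simp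
  have 2: "\<r> (Cod C f) \<cdot> (f \<otimes>\<^sub>a Ide C \<I>) = f \<cdot> \<r> (x \<otimes>\<^sub>o y)"
    using unitor_nat(2)[of f] by simp
  have "untransp (Cod C f) y y' ev (transp x y y' coev f) =
     \<r> (Cod C f) \<cdot> ((Ide C (Cod C f) \<otimes>\<^sub>a ev) \<cdot> (\<a> (Cod C f) y' y \<cdot> (((f \<otimes>\<^sub>a Ide C y') \<otimes>\<^sub>a Ide C y) \<cdot> (?s \<otimes>\<^sub>a Ide C y))))"
    unfolding untransp_def transp_def by simp
  also have "\<dots> = \<r> (Cod C f) \<cdot> ((Ide C (Cod C f) \<otimes>\<^sub>a ev) \<cdot> ((f \<otimes>\<^sub>a Ide C (y' \<otimes>\<^sub>o y)) \<cdot> (\<a> (x \<otimes>\<^sub>o y) y' y \<cdot> (?s \<otimes>\<^sub>a Ide C y))))"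
    by (subst comp_eq_left[OF 1]) simp_all
  also have "\<dots> = \<r> (Cod C f) \<cdot> ((f \<otimes>\<^sub>a Ide C \<I>) \<cdot> ((Ide C (x \<otimes>\<^sub>o y) \<otimes>\<^sub>a ev) \<cdot> (\<a> (x \<otimes>\<^sub>o y) y' y \<cdot> (?s \<otimes>\<^sub>a Ide C y))))"
    by simp
  also have "\<dots> = f \<cdot> (\<r> (x \<otimes>\<^sub>o y) \<cdot> ((Ide C (x \<otimes>\<^sub>o y) \<otimes>\<^sub>a ev) \<cdot> (\<a> (x \<otimes>\<^sub>o y) y' y \<cdot> (?s \<otimes>\<^sub>a Ide C y))))"
    by (subst comp_eq_left[OF 2]) simp_all
  also have "\<r> (x \<otimes>\<^sub>o y) \<cdot> ((Ide C (x \<otimes>\<^sub>o y) \<otimes>\<^sub>a ev) \<cdot> (\<a> (x \<otimes>\<^sub>o y) y' y \<cdot> (?s \<otimes>\<^sub>a Ide C y)))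
     = (\<r> (x \<otimes>\<^sub>o y) \<cdot> (Ide C (x \<otimes>\<^sub>o y) \<otimes>\<^sub>a ev) \<cdot> \<a> (x \<otimes>\<^sub>o y) y' y \<cdot> (inv_arr C (\<a> x y y') \<otimes>\<^sub>a Ide C y) \<cdot>
      ((Ide C x \<otimes>\<^sub>a coev) \<otimes>\<^sub>a Ide C y)) \<cdot> (inv_arr C (\<r> x) \<otimes>\<^sub>a Ide C y)"
    unfolding s by (simp del: tensor_comp tensor_comp_assoc)
  also have "\<dots> = Ide C (x \<otimes>\<^sub>o y)"
    unfolding dual_zigzag[OF d \<open>x \<in> Obj C\<close>] by simp
  finally show ?thesis by simp
qed

text \<open>Here \<open>g\<close> slides to the back and \<open>dual_zigzag'\<close> remains in
  front. This law serves to annihilate maps into \<open>l \<otimes> y\<close>, for an orthogonal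
  object \<open>l\<close>, through their mates.\<close>

lemma transp_untransp:
  assumes d: "dual_pair y y' ev coev" and [simp]: "c \<in> Obj C" "g \<in> Arr C" "Cod C g = c \<otimes>\<^sub>o y'"
  shows "transp (Dom C g) y y' coev (untransp c y y' ev g) = g"
proof -
  note [simp] = dual_pairD(1-8)[OF d]
  let ?x = "Dom C g"
  have 1: "((g \<otimes>\<^sub>a Ide C y) \<otimes>\<^sub>a Ide C y') \<cdot> inv_arr C (\<a> ?x y y') = inv_arr C (\<a> (c \<otimes>\<^sub>o y') y y') \<cdot> (g \<otimes>\<^sub>a Ide C (y \<otimes>\<^sub>o y'))"
    using assoc_inv_nat[of g "Ide C y" "Ide C y'"] by simp
  have 2: "(g \<otimes>\<^sub>a Ide C \<I>) \<cdot> inv_arr C (\<r> ?x) = inv_arr C (\<r> (c \<otimes>\<^sub>o y')) \<cdot> g"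
  proof (rule iso_arr_cancel_left[of "\<r> (c \<otimes>\<^sub>o y')"])
    show "\<r> (c \<otimes>\<^sub>o y') \<cdot> ((g \<otimes>\<^sub>a Ide C \<I>) \<cdot> inv_arr C (\<r> ?x)) = \<r> (c \<otimes>\<^sub>o y') \<cdot> (inv_arr C (\<r> (c \<otimes>\<^sub>o y')) \<cdot> g)"
      using unitor_nat(2)[of g] by (subst comp_eq_left[where k="g \<cdot> \<r> ?x"]) simp_all
  qed simp_all
  let ?u = "(\<r> c \<otimes>\<^sub>a Ide C y') \<cdot> ((Ide C c \<otimes>\<^sub>a ev) \<otimes>\<^sub>a Ide C y') \<cdot> (\<a> c y' y \<otimes>\<^sub>a Ide C y')"
  have u: "?u \<in> Arr C" "Dom C ?u = ((c \<otimes>\<^sub>o y') \<otimes>\<^sub>o y) \<otimes>\<^sub>o y'" "Cod C ?u = c \<otimes>\<^sub>o y'" by simp_all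
  have "transp ?x y y' coev (untransp c y y' ev g) =
     ?u \<cdot> (((g \<otimes>\<^sub>a Ide C y) \<otimes>\<^sub>a Ide C y') \<cdot> (inv_arr C (\<a> ?x y y') \<cdot> ((Ide C ?x \<otimes>\<^sub>a coev) \<cdot> inv_arr C (\<r> ?x))))"
    unfolding untransp_def transp_def by simp
  also have "\<dots> = ?u \<cdot> (inv_arr C (\<a> (c \<otimes>\<^sub>o y') y y') \<cdot> ((g \<otimes>\<^sub>a Ide C (y \<otimes>\<^sub>o y')) \<cdot> ((Ide C ?x \<otimes>\<^sub>a coev) \<cdot> inv_arr C (\<r> ?x))))"
    by (subst comp_eq_left[OF 1]) simp_all
  also have "\<dots> = ?u \<cdot> (inv_arr C (\<a> (c \<otimes>\<^sub>o y') y y') \<cdot> ((Ide C (c \<otimes>\<^sub>o y') \<otimes>\<^sub>a coev) \<cdot> ((g \<otimes>\<^sub>a Ide C \<I>) \<cdot> inv_arr C (\<r> ?x))))"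
    by simp
  also have "\<dots> = ((\<r> c \<otimes>\<^sub>a Ide C y') \<cdot> ((Ide C c \<otimes>\<^sub>a ev) \<otimes>\<^sub>a Ide C y') \<cdot> (\<a> c y' y \<otimes>\<^sub>a Ide C y') \<cdot>
      inv_arr C (\<a> (c \<otimes>\<^sub>o y') y y') \<cdot> (Ide C (c \<otimes>\<^sub>o y') \<otimes>\<^sub>a coev)) \<cdot> (inv_arr C (\<r> (c \<otimes>\<^sub>o y')) \<cdot> g)"
    unfolding 2 by (simp del: tensor_comp tensor_comp_assoc)
  also have "\<dots> = g" unfolding dual_zigzag'[OF d \<open>c \<in> Obj C\<close>] by simp
  finally show ?thesis .
qed

lemma transp_inj:
  assumes "dual_pair y y' ev coev" "x \<in> Obj C" "f \<in> Arr C" "Dom C f = x \<otimes>\<^sub>o y"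
    "g \<in> Arr C" "Dom C g = x \<otimes>\<^sub>o y" "Cod C f = Cod C g" "transp x y y' coev f = transp x y y' coev g"
  shows "f = g"
  using untransp_transp[OF assms(1,2,3,4)]
  unfolding assms(7,8) untransp_transp[OF assms(1,2,5,6)] by (rule sym)

text \<open>As the left and right unitors of the unit coincide, the triangle turns both duality
  equations into cancellations of inverse maps.\<close>

lemma dual_pair_unit: "dual_pair \<I> \<I> (\<l> \<I>) (inv_arr C (\<l> \<I>))"
proof -
  have t: "(Ide C \<I> \<otimes>\<^sub>a \<l> \<I>) \<cdot> \<a> \<I> \<I> \<I> = \<l> \<I> \<otimes>\<^sub>a Ide C \<I>"
    using triangle[of \<I> \<I>] by (simp add: lunit_unit)
  have "(Ide C \<I> \<otimes>\<^sub>a \<l> \<I>) \<cdot> \<a> \<I> \<I> \<I> \<cdot> (inv_arr C (\<l> \<I>) \<otimes>\<^sub>a Ide C \<I>) =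
      (\<l> \<I> \<otimes>\<^sub>a Ide C \<I>) \<cdot> (inv_arr C (\<l> \<I>) \<otimes>\<^sub>a Ide C \<I>)"
    by (rule comp_eq_left[OF t]) simp_all
  then have 1: "(Ide C \<I> \<otimes>\<^sub>a \<l> \<I>) \<cdot> \<a> \<I> \<I> \<I> \<cdot> (inv_arr C (\<l> \<I>) \<otimes>\<^sub>a Ide C \<I>) = Ide C (\<I> \<otimes>\<^sub>o \<I>)" by simp
  have t': "(\<l> \<I> \<otimes>\<^sub>a Ide C \<I>) \<cdot> inv_arr C (\<a> \<I> \<I> \<I>) = Ide C \<I> \<otimes>\<^sub>a \<l> \<I>"
    unfolding t[symmetric] by simp
  have "(\<l> \<I> \<otimes>\<^sub>a Ide C \<I>) \<cdot> inv_arr C (\<a> \<I> \<I> \<I>) \<cdot> (Ide C \<I> \<otimes>\<^sub>a inv_arr C (\<l> \<I>)) =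
      (Ide C \<I> \<otimes>\<^sub>a \<l> \<I>) \<cdot> (Ide C \<I> \<otimes>\<^sub>a inv_arr C (\<l> \<I>))"
    by (rule comp_eq_left[OF t']) simp_all
  then have 2: "(\<l> \<I> \<otimes>\<^sub>a Ide C \<I>) \<cdot> inv_arr C (\<a> \<I> \<I> \<I>) \<cdot> (Ide C \<I> \<otimes>\<^sub>a inv_arr C (\<l> \<I>)) = Ide C (\<I> \<otimes>\<^sub>o \<I>)" by simp
  show ?thesis
    unfolding dual_pair_def lunit_unit[symmetric] 1 2
    by (intro conjI; simp)
qed

end

section \<open>Small sets\<close>

locale univ =
  fixes \<kappa> :: "'u rel"
  assumes universe: "universe \<kappa>"
begin

text \<open>Regularity in the form used by the cardinal library: unions and sums over small index
  sets of small sets remain small.\<close>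

lemma stable: "stable \<kappa>"
proof (rule regularCard_stable)
  show "Card_order \<kappa>" "regularCard \<kappa>" using universe unfolding universe_def by blast+
  have "natLeq \<le>o \<kappa>" using universe unfolding universe_def by (simp add: ordLess_imp_ordLeq)
  then show "\<not> finite (Field \<kappa>)"
    using \<open>Card_order \<kappa>\<close> cinfinite_def cinfinite_mono natLeq_cinfinite by blast
qed

lemma small_subset: "small \<kappa> A \<Longrightarrow> B \<subseteq> A \<Longrightarrow> small \<kappa> B"
  unfolding small_def using card_of_mono1 ordLeq_ordLess_trans by blast

lemma small_image: "small \<kappa> A \<Longrightarrow> small \<kappa> (f ` A)"
  unfolding small_def using card_of_image ordLeq_ordLess_trans by blast

lemma small_UN: "small \<kappa> I \<Longrightarrow> (\<And>i. i \<in> I \<Longrightarrow> small \<kappa> (A i)) \<Longrightarrow> small \<kappa> (\<Union>i\<in>I. A i)"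
  unfolding small_def using stable stable_UNION by blast

lemma small_Sigma: "small \<kappa> I \<Longrightarrow> (\<And>i. i \<in> I \<Longrightarrow> small \<kappa> (A i)) \<Longrightarrow> small \<kappa> (SIGMA i:I. A i)"
  unfolding small_def using stable stable_elim by blast

lemma small_nat: "small \<kappa> (UNIV :: nat set)"
  using universe card_of_nat ordIso_ordLess_trans unfolding universe_def small_def by blast

lemma small_lists: "small \<kappa> A \<Longrightarrow> small \<kappa> (lists A)"
proof -
  assume A: "small \<kappa> A"
  have "small \<kappa> {xs \<in> lists A. length xs = n}" for n
  proof (induction n)
    case 0
    have "{xs \<in> lists A. length xs = 0} = (\<lambda>_. []) ` {0::nat}" by auto
    then show ?case by (simp only: small_image[OF small_subset[OF small_nat subset_UNIV]])
  next
    case (Suc n)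
    have "{xs \<in> lists A. length xs = Suc n} = (\<lambda>(x, xs). x # xs) ` (A \<times> {xs \<in> lists A. length xs = n})"
      by (auto simp: length_Suc_conv image_iff)
    then show ?case using A Suc by (simp add: small_image small_Sigma)
  qed
  then have "small \<kappa> (\<Union>n. {xs \<in> lists A. length xs = n})" by (intro small_UN small_nat)
  moreover have "lists A = (\<Union>n. {xs \<in> lists A. length xs = n})" by blast
  ultimately show ?thesis by simp
qed

text \<open>Maps from a compact object into a small coproduct will be encoded by finite sets of
  components, which are counted here.\<close>

lemma small_finite_subsets: "small \<kappa> A \<Longrightarrow> small \<kappa> {F. finite F \<and> F \<subseteq> A}"
proof -
  assume A: "small \<kappa> A"
  have "{F. finite F \<and> F \<subseteq> A} \<subseteq> set ` lists A"
  proof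
    fix F assume "F \<in> {F. finite F \<and> F \<subseteq> A}"
    then obtain xs where "set xs = F" "F \<subseteq> A" using finite_list by blast
    then show "F \<in> set ` lists A" by (intro image_eqI[of _ _ xs]) auto
  qed
  then show ?thesis using small_image[OF small_lists[OF A]] small_subset by blast
qed

lemma small_inj:
  fixes A :: "'i set"
  assumes "small \<kappa> A"
  obtains m :: "'i \<Rightarrow> 'u" where "inj_on m A"
proof -
  have "Card_order \<kappa>" using universe unfolding universe_def by blast
  then have "|A| \<le>o |Field \<kappa>|"
    using assms card_of_Field_ordIso ordIso_symmetric ordLess_imp_ordLeq ordLeq_ordIso_trans
    unfolding small_def by blast
  then show ?thesis using that card_of_ordLeq[of A "Field \<kappa>"] by blast
qed

end

section \<open>Tensor triangulated categories\<close>

locale tt = mon T for T :: "('o, 'm) ttcat" (structure) +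
  assumes tt_category: "tt_category T"
begin

abbreviation pl (infixl "\<oplus>" 55) where "f \<oplus> g \<equiv> Plus T f g"
abbreviation zr ("\<z>") where "\<z> \<equiv> Zr T"
abbreviation ng ("\<ominus> _" [81] 80) where "\<ominus> f \<equiv> Neg T f"
abbreviation so ("\<Sigma>\<^sub>o") where "\<Sigma>\<^sub>o \<equiv> ShO T"
abbreviation sa ("\<Sigma>\<^sub>a") where "\<Sigma>\<^sub>a \<equiv> ShA T"

lemma is_triangulated: "is_triangulated T"
  using tt_category unfolding tt_category_def by (elim conjE)

lemma is_additive: "is_additive T"
  using is_triangulated unfolding is_triangulated_def by (elim conjE)

section \<open>The additive structure of the Hom sets\<close>

lemma comm_group_Hom: "x \<in> Obj T \<Longrightarrow> y \<in> Obj T \<Longrightarrow> comm_group (hgrp T x y)"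
  using is_additive unfolding is_additive_def by blast

lemma hgrp_simps [simp]: "carrier (hgrp T x y) = Hom T x y" "monoid.mult (hgrp T x y) = Plus T" "one (hgrp T x y) = \<z> x y"
  unfolding hgrp_def by simp_all

lemma plus_arr [simp]:
  assumes "f \<in> Arr T" "g \<in> Arr T" "Dom T f = Dom T g" "Cod T f = Cod T g"
  shows "f \<oplus> g \<in> Arr T" "Dom T (f \<oplus> g) = Dom T g" "Cod T (f \<oplus> g) = Cod T g"
proof -
  interpret comm_group "hgrp T (Dom T g) (Cod T g)" by (rule comm_group_Hom) (use assms in simp_all)
  show "f \<oplus> g \<in> Arr T" "Dom T (f \<oplus> g) = Dom T g" "Cod T (f \<oplus> g) = Cod T g"
    using m_closed[of f g] assms by simp_all
qed

lemma zr_arr [simp]: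
  assumes "x \<in> Obj T" "y \<in> Obj T"
  shows "\<z> x y \<in> Arr T" "Dom T (\<z> x y) = x" "Cod T (\<z> x y) = y"
proof -
  interpret comm_group "hgrp T x y" by (rule comm_group_Hom) (use assms in simp_all)
  show "\<z> x y \<in> Arr T" "Dom T (\<z> x y) = x" "Cod T (\<z> x y) = y" using one_closed by simp_all
qed

lemma neg_arr [simp]:
  assumes "f \<in> Arr T"
  shows "\<ominus> f \<in> Arr T" "Dom T (\<ominus> f) = Dom T f" "Cod T (\<ominus> f) = Cod T f"
proof -
  interpret comm_group "hgrp T (Dom T f) (Cod T f)" by (rule comm_group_Hom) (use assms in simp_all)
  show "\<ominus> f \<in> Arr T" "Dom T (\<ominus> f) = Dom T f" "Cod T (\<ominus> f) = Cod T f"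
    using inv_closed[of f] assms unfolding Neg_def by simp_all
qed

lemma plus_comm:
  assumes "f \<in> Arr T" "g \<in> Arr T" "Dom T f = Dom T g" "Cod T f = Cod T g"
  shows "f \<oplus> g = g \<oplus> f"
proof -
  interpret comm_group "hgrp T (Dom T g) (Cod T g)" by (rule comm_group_Hom) (use assms in simp_all)
  show ?thesis using m_comm[of f g] assms by simp
qed

lemma plus_assoc:
  assumes "f \<in> Arr T" "g \<in> Arr T" "h \<in> Arr T" "Dom T f = Dom T g" "Cod T f = Cod T g"
    "Dom T h = Dom T g" "Cod T h = Cod T g"
  shows "(f \<oplus> g) \<oplus> h = f \<oplus> (g \<oplus> h)"
proof -
  interpret comm_group "hgrp T (Dom T g) (Cod T g)" by (rule comm_group_Hom) (use assms in simp_all)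
  show ?thesis using m_assoc[of f g h] assms by simp
qed

lemma plus_zr [simp]:
  assumes "f \<in> Arr T" "Dom T f = x" "Cod T f = y"
  shows "f \<oplus> \<z> x y = f" "\<z> x y \<oplus> f = f"
proof -
  interpret comm_group "hgrp T x y" by (rule comm_group_Hom) (use assms in auto)
  show "f \<oplus> \<z> x y = f" "\<z> x y \<oplus> f = f" using r_one[of f] l_one[of f] assms by simp_all
qed

lemma plus_neg [simp]:
  assumes "f \<in> Arr T"
  shows "f \<oplus> \<ominus> f = \<z> (Dom T f) (Cod T f)" "\<ominus> f \<oplus> f = \<z> (Dom T f) (Cod T f)"
proof -
  interpret comm_group "hgrp T (Dom T f) (Cod T f)" by (rule comm_group_Hom) (use assms in simp_all)
  show "f \<oplus> \<ominus> f = \<z> (Dom T f) (Cod T f)" "\<ominus> f \<oplus> f = \<z> (Dom T f) (Cod T f)"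
    using r_inv[of f] l_inv[of f] assms unfolding Neg_def by simp_all
qed

lemma plus_cancel:
  assumes "f \<oplus> g = f \<oplus> h" "f \<in> Arr T" "g \<in> Arr T" "h \<in> Arr T" "Dom T f = Dom T g" "Cod T f = Cod T g"
    "Dom T h = Dom T g" "Cod T h = Cod T g"
  shows "g = h"
proof -
  interpret comm_group "hgrp T (Dom T g) (Cod T g)" by (rule comm_group_Hom) (use assms in simp_all)
  have "f \<in> Units (hgrp T (Dom T g) (Cod T g))" unfolding Units_eq using assms(2,5,6) by simp
  moreover have "g \<in> carrier (hgrp T (Dom T g) (Cod T g))" "h \<in> carrier (hgrp T (Dom T g) (Cod T g))"
    using assms(3,4,7,8) by simp_all
  ultimately show ?thesis using Units_l_cancel[of f g h] assms(1) unfolding hgrp_simps by blast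
qed

lemma comp_plus:
  assumes "f \<in> Arr T" "f' \<in> Arr T" "g \<in> Arr T" "Dom T f = Dom T f'" "Cod T f = Cod T f'" "Dom T g = Cod T f'"
  shows "g \<cdot> (f \<oplus> f') = (g \<cdot> f) \<oplus> (g \<cdot> f')"
proof -
  have "\<forall>x y z f f' g g'. f \<in> Hom T x y \<and> f' \<in> Hom T x y \<and> g \<in> Hom T y z \<and> g' \<in> Hom T y z \<longrightarrow>
        g \<cdot> Plus T f f' = Plus T (g \<cdot> f) (g \<cdot> f') \<and>
        Plus T g g' \<cdot> f = Plus T (g \<cdot> f) (g' \<cdot> f)"
    using is_additive unfolding is_additive_def by (elim conjE)
  from this[rule_format, of f "Dom T f'" "Cod T f'" f' g "Cod T g" g] assms show ?thesis by simp
qed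

lemma plus_comp:
  assumes "f \<in> Arr T" "g \<in> Arr T" "g' \<in> Arr T" "Dom T g = Cod T f" "Dom T g' = Cod T f" "Cod T g = Cod T g'"
  shows "(g \<oplus> g') \<cdot> f = (g \<cdot> f) \<oplus> (g' \<cdot> f)"
proof -
  have "\<forall>x y z f f' g g'. f \<in> Hom T x y \<and> f' \<in> Hom T x y \<and> g \<in> Hom T y z \<and> g' \<in> Hom T y z \<longrightarrow>
        g \<cdot> Plus T f f' = Plus T (g \<cdot> f) (g \<cdot> f') \<and>
        Plus T g g' \<cdot> f = Plus T (g \<cdot> f) (g' \<cdot> f)"
    using is_additive unfolding is_additive_def by (elim conjE)
  from this[rule_format, of f "Dom T f" "Cod T f" f g "Cod T g'" g'] assms show ?thesis by simp
qed

lemma idem_zr: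
  assumes "f \<oplus> f = f" "f \<in> Arr T"
  shows "f = \<z> (Dom T f) (Cod T f)"
proof (rule plus_cancel)
  show "f \<oplus> f = f \<oplus> \<z> (Dom T f) (Cod T f)" using assms by simp
qed (use assms(2) in simp_all)

lemma comp_zr [simp]:
  assumes "g \<in> Arr T" "x \<in> Obj T" "Dom T g = y"
  shows "g \<cdot> \<z> x y = \<z> x (Cod T g)"
proof -
  have "y \<in> Obj T" using assms by auto
  then have "(g \<cdot> \<z> x y) \<oplus> (g \<cdot> \<z> x y) = g \<cdot> (\<z> x y \<oplus> \<z> x y)"
    using assms by (intro comp_plus[symmetric]) simp_all
  also have "\<dots> = g \<cdot> \<z> x y" using assms \<open>y \<in> Obj T\<close> by simp
  finally have "g \<cdot> \<z> x y = \<z> (Dom T (g \<cdot> \<z> x y)) (Cod T (g \<cdot> \<z> x y))"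
    by (rule idem_zr) (use assms \<open>y \<in> Obj T\<close> in simp)
  then show ?thesis using assms \<open>y \<in> Obj T\<close> by simp
qed

lemma zr_comp [simp]:
  assumes "f \<in> Arr T" "y \<in> Obj T" "Cod T f = x"
  shows "\<z> x y \<cdot> f = \<z> (Dom T f) y"
proof -
  have "x \<in> Obj T" using assms by auto
  then have "(\<z> x y \<cdot> f) \<oplus> (\<z> x y \<cdot> f) = (\<z> x y \<oplus> \<z> x y) \<cdot> f"
    using assms by (intro plus_comp[symmetric]) simp_all
  also have "\<dots> = \<z> x y \<cdot> f" using assms \<open>x \<in> Obj T\<close> by simp
  finally have "\<z> x y \<cdot> f = \<z> (Dom T (\<z> x y \<cdot> f)) (Cod T (\<z> x y \<cdot> f))"
    by (rule idem_zr) (use assms \<open>x \<in> Obj T\<close> in simp)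
  then show ?thesis using assms \<open>x \<in> Obj T\<close> by simp
qed

lemma neg_unique:
  assumes "f \<oplus> g = \<z> (Dom T f) (Cod T f)" "f \<in> Arr T" "g \<in> Arr T" "Dom T f = Dom T g" "Cod T f = Cod T g"
  shows "g = \<ominus> f"
proof (rule plus_cancel)
  show "f \<oplus> g = f \<oplus> \<ominus> f" using assms by simp
qed (use assms(2-) in simp_all)

lemma comp_neg:
  assumes "f \<in> Arr T" "g \<in> Arr T" "Dom T g = Cod T f"
  shows "g \<cdot> \<ominus> f = \<ominus> (g \<cdot> f)" "\<ominus> g \<cdot> f = \<ominus> (g \<cdot> f)"
proof -
  show "g \<cdot> \<ominus> f = \<ominus> (g \<cdot> f)"
  proof (rule neg_unique)
    have "(g \<cdot> f) \<oplus> (g \<cdot> \<ominus> f) = g \<cdot> (f \<oplus> \<ominus> f)"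
      by (rule comp_plus[symmetric]) (use assms in simp_all)
    then show "(g \<cdot> f) \<oplus> (g \<cdot> \<ominus> f) = \<z> (Dom T (g \<cdot> f)) (Cod T (g \<cdot> f))"
      using assms by simp
  qed (use assms in simp_all)
  show "\<ominus> g \<cdot> f = \<ominus> (g \<cdot> f)"
  proof (rule neg_unique)
    have "(g \<cdot> f) \<oplus> (\<ominus> g \<cdot> f) = (g \<oplus> \<ominus> g) \<cdot> f"
      by (rule plus_comp[symmetric]) (use assms in simp_all)
    then show "(g \<cdot> f) \<oplus> (\<ominus> g \<cdot> f) = \<z> (Dom T (g \<cdot> f)) (Cod T (g \<cdot> f))"
      using assms by simp
  qed (use assms in simp_all)
qed

lemma neg_neg [simp]: "f \<in> Arr T \<Longrightarrow> \<ominus> (\<ominus> f) = f"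
  by (rule neg_unique[symmetric]) simp_all

lemma neg_zr [simp]: "x \<in> Obj T \<Longrightarrow> y \<in> Obj T \<Longrightarrow> \<ominus> (\<z> x y) = \<z> x y"
  by (rule neg_unique[symmetric]) simp_all

lemma neg_eq_zr:
  assumes "\<ominus> f = \<z> x y" "f \<in> Arr T" "Dom T f = x" "Cod T f = y"
  shows "f = \<z> x y"
proof -
  have "f = \<ominus> (\<ominus> f)" using assms(2) by simp
  also have "\<dots> = \<z> x y" unfolding assms(1) using assms(2-) by auto
  finally show ?thesis .
qed

definition diff where "diff f g = f \<oplus> \<ominus> g"

lemma diff_arr [simp]:
  assumes "f \<in> Arr T" "g \<in> Arr T" "Dom T f = Dom T g" "Cod T f = Cod T g"
  shows "diff f g \<in> Arr T" "Dom T (diff f g) = Dom T g" "Cod T (diff f g) = Cod T g"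
  using assms unfolding diff_def by simp_all

lemma comp_diff:
  assumes "f \<in> Arr T" "f' \<in> Arr T" "g \<in> Arr T" "Dom T f = Dom T f'" "Cod T f = Cod T f'" "Dom T g = Cod T f'"
  shows "g \<cdot> diff f f' = diff (g \<cdot> f) (g \<cdot> f')"
  unfolding diff_def using assms by (simp add: comp_plus comp_neg)

lemma diff_comp:
  assumes "f \<in> Arr T" "g \<in> Arr T" "g' \<in> Arr T" "Dom T g = Cod T f" "Dom T g' = Cod T f" "Cod T g = Cod T g'"
  shows "diff g g' \<cdot> f = diff (g \<cdot> f) (g' \<cdot> f)"
  unfolding diff_def using assms by (simp add: plus_comp comp_neg)

lemma diff_self [simp]: "f \<in> Arr T \<Longrightarrow> diff f f = \<z> (Dom T f) (Cod T f)"
  unfolding diff_def by simp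

lemma diff_zr [simp]: "f \<in> Arr T \<Longrightarrow> Dom T f = x \<Longrightarrow> Cod T f = y \<Longrightarrow> diff f (\<z> x y) = f"
  unfolding diff_def by auto

lemma diff_eq_zr:
  assumes "diff f g = \<z> x y" "f \<in> Arr T" "g \<in> Arr T" "Dom T f = x" "Cod T f = y" "Dom T g = x" "Cod T g = y"
  shows "f = g"
proof -
  have xy: "x \<in> Obj T" "y \<in> Obj T" using assms by auto
  have "f = f \<oplus> (\<ominus> g \<oplus> g)" using assms by simp
  also have "\<dots> = diff f g \<oplus> g" unfolding diff_def using assms by (intro plus_assoc[symmetric]) simp_all
  also have "\<dots> = g" using assms by simp
  finally show ?thesis .
qed

section \<open>Zero objects\<close>

lemma zero_ob_obj: "zero_ob T z \<Longrightarrow> z \<in> Obj T"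
  unfolding zero_ob_def initial_ob_def by blast

text \<open>Turns the universal property into an equation between arrows, which the suspension and
  the tensor product visibly preserve.\<close>

lemma zero_ob_iff: "z \<in> Obj T \<Longrightarrow> zero_ob T z \<longleftrightarrow> Ide T z = \<z> z z"
proof
  assume z: "z \<in> Obj T"
  show "Ide T z = \<z> z z" if "zero_ob T z"
  proof -
    have "\<exists>!f. f \<in> Hom T z z" using that z unfolding zero_ob_def initial_ob_def by blast
    then show ?thesis using z ide_arr[OF z] zr_arr[OF z z] by (metis in_Hom)
  qed
  assume e: "Ide T z = \<z> z z"
  have 1: "f = \<z> z y" if "f \<in> Arr T" "Dom T f = z" "Cod T f = y" for f y
  proof -
    have "f = f \<cdot> Ide T z" using that by simp
    also have "\<dots> = \<z> z y" unfolding e using that z by simp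
    finally show ?thesis .
  qed
  have 2: "f = \<z> y z" if "f \<in> Arr T" "Cod T f = z" "Dom T f = y" for f y
  proof -
    have "f = Ide T z \<cdot> f" using that by simp
    also have "\<dots> = \<z> y z" unfolding e using that z by simp
    finally show ?thesis .
  qed
  have "\<exists>!f. f \<in> Hom T z y" if "y \<in> Obj T" for y
    by (rule ex1I[of _ "\<z> z y"]) (use 1 that z in auto)
  moreover have "\<exists>!f. f \<in> Hom (opc T) z y" if "y \<in> Obj T" for y
    by (rule ex1I[of _ "\<z> y z"]) (use 2 that z in \<open>auto simp: opc_def\<close>)
  ultimately show "zero_ob T z" using z unfolding zero_ob_def initial_ob_def by (simp add: opc_def)
qed

lemma zero_ob_from: "zero_ob T z \<Longrightarrow> f \<in> Arr T \<Longrightarrow> Dom T f = z \<Longrightarrow> f = \<z> z (Cod T f)"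
  and zero_ob_to: "zero_ob T z \<Longrightarrow> f \<in> Arr T \<Longrightarrow> Cod T f = z \<Longrightarrow> f = \<z> (Dom T f) z"
proof -
  assume z: "zero_ob T z" and f: "f \<in> Arr T"
  note zo = zero_ob_obj[OF z]
  note e = z[unfolded zero_ob_iff[OF zo]]
  show "f = \<z> z (Cod T f)" if "Dom T f = z"
  proof -
    have "f = f \<cdot> Ide T z" using that f by simp
    also have "\<dots> = \<z> z (Cod T f)" unfolding e using that f zo by simp
    finally show ?thesis .
  qed
  show "f = \<z> (Dom T f) z" if "Cod T f = z"
  proof -
    have "f = Ide T z \<cdot> f" using that f by simp
    also have "\<dots> = \<z> (Dom T f) z" unfolding e using that f zo by simp
    finally show ?thesis .
  qed
qed

lemma zero_ob_exists: "\<exists>z. zero_ob T z"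
  using is_additive unfolding is_additive_def by (elim conjE)

lemma zero_ob_retract:
  assumes "zero_ob T y" "s \<in> Arr T" "r \<in> Arr T" "Dom T s = x" "Cod T s = y" "Dom T r = y" "Cod T r = x"
    "r \<cdot> s = Ide T x"
  shows "zero_ob T x"
proof -
  have x: "x \<in> Obj T" "y \<in> Obj T" using assms by auto
  have "Ide T x = r \<cdot> \<z> x y" using assms zero_ob_to[OF assms(1,2,5)] by simp
  then show ?thesis using assms x by (simp add: zero_ob_iff)
qed

lemma zero_ob_iso:
  assumes "isomorphic T x y" "zero_ob T y"
  shows "zero_ob T x"
proof -
  obtain f where f: "iso_arr T f" "Dom T f = x" "Cod T f = y" using assms unfolding isomorphic_iff by blast
  show ?thesis
    by (rule zero_ob_retract[OF assms(2), of f "inv_arr T f"]) (use f iso_arr_in_arr in simp_all)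
qed

section \<open>The suspension functor\<close>

lemma shift_functor: "is_functor T T (Shift T)"
  using is_triangulated unfolding is_triangulated_def equivalence_def by (elim conjE)

lemma shift_obj [simp]: "x \<in> Obj T \<Longrightarrow> \<Sigma>\<^sub>o x \<in> Obj T"
  and shift_ide [simp]: "x \<in> Obj T \<Longrightarrow> \<Sigma>\<^sub>a (Ide T x) = Ide T (\<Sigma>\<^sub>o x)"
  using shift_functor unfolding is_functor_def by simp_all

lemma shift_arr [simp]:
  assumes "f \<in> Arr T"
  shows "\<Sigma>\<^sub>a f \<in> Arr T" "Dom T (\<Sigma>\<^sub>a f) = \<Sigma>\<^sub>o (Dom T f)" "Cod T (\<Sigma>\<^sub>a f) = \<Sigma>\<^sub>o (Cod T f)"
proof -
  have "\<forall>x y f. f \<in> Hom T x y \<longrightarrow> \<Sigma>\<^sub>a f \<in> Hom T (\<Sigma>\<^sub>o x) (\<Sigma>\<^sub>o y)"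
    using shift_functor unfolding is_functor_def by (elim conjE)
  from this[rule_format, of f "Dom T f" "Cod T f"] assms
  show "\<Sigma>\<^sub>a f \<in> Arr T" "Dom T (\<Sigma>\<^sub>a f) = \<Sigma>\<^sub>o (Dom T f)" "Cod T (\<Sigma>\<^sub>a f) = \<Sigma>\<^sub>o (Cod T f)"
    by simp_all
qed

lemma shift_comp:
  assumes "f \<in> Arr T" "g \<in> Arr T" "Dom T g = Cod T f"
  shows "\<Sigma>\<^sub>a (g \<cdot> f) = \<Sigma>\<^sub>a g \<cdot> \<Sigma>\<^sub>a f"
proof -
  have "\<forall>x y z f g. f \<in> Hom T x y \<and> g \<in> Hom T y z \<longrightarrow> \<Sigma>\<^sub>a (g \<cdot> f) = \<Sigma>\<^sub>a g \<cdot> \<Sigma>\<^sub>a f"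
    using shift_functor unfolding is_functor_def by (elim conjE)
  from this[rule_format, of f "Dom T f" "Cod T f" g "Cod T g"] assms show ?thesis by simp
qed

lemma shift_bij:
  assumes "x \<in> Obj T" "y \<in> Obj T"
  shows "bij_betw \<Sigma>\<^sub>a (Hom T x y) (Hom T (\<Sigma>\<^sub>o x) (\<Sigma>\<^sub>o y))"
proof -
  have "\<forall>x\<in>Obj T. \<forall>y\<in>Obj T. bij_betw \<Sigma>\<^sub>a (Hom T x y) (Hom T (\<Sigma>\<^sub>o x) (\<Sigma>\<^sub>o y))"
    using is_triangulated unfolding is_triangulated_def equivalence_def by (elim conjE)
  then show ?thesis using assms by simp
qed

lemma shift_faithful:
  assumes "\<Sigma>\<^sub>a f = \<Sigma>\<^sub>a g" "f \<in> Arr T" "g \<in> Arr T" "Dom T f = Dom T g" "Cod T f = Cod T g"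
  shows "f = g"
proof -
  have "inj_on \<Sigma>\<^sub>a (Hom T (Dom T g) (Cod T g))"
    using shift_bij[of "Dom T g" "Cod T g"] assms(3) unfolding bij_betw_def by simp
  then show ?thesis using assms by (auto dest: inj_onD)
qed

lemma shift_full:
  assumes "g \<in> Arr T" "Dom T g = \<Sigma>\<^sub>o x" "Cod T g = \<Sigma>\<^sub>o y" "x \<in> Obj T" "y \<in> Obj T"
  shows "\<exists>f. f \<in> Arr T \<and> Dom T f = x \<and> Cod T f = y \<and> \<Sigma>\<^sub>a f = g"
proof -
  have "g \<in> \<Sigma>\<^sub>a ` Hom T x y"
    using shift_bij[OF assms(4,5)] assms(1-3) unfolding bij_betw_def by simp
  then show ?thesis by auto
qed

text \<open>The suspension is an equivalence and need not be bijective on objects, so desuspending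
  costs an isomorphism \<open>u\<close> that the later arguments carry along.\<close>

lemma desuspension:
  assumes "y \<in> Obj T"
  shows "\<exists>x u. x \<in> Obj T \<and> iso_arr T u \<and> Dom T u = \<Sigma>\<^sub>o x \<and> Cod T u = y"
proof -
  have "\<forall>y\<in>Obj T. \<exists>x\<in>Obj T. isomorphic T (\<Sigma>\<^sub>o x) y"
    using is_triangulated unfolding is_triangulated_def equivalence_def by (elim conjE)
  then obtain x where "x \<in> Obj T" "isomorphic T (\<Sigma>\<^sub>o x) y" using assms by blast
  then show ?thesis unfolding isomorphic_iff by blast
qed

lemma shift_plus:
  assumes "f \<in> Arr T" "g \<in> Arr T" "Dom T f = Dom T g" "Cod T f = Cod T g"
  shows "\<Sigma>\<^sub>a (f \<oplus> g) = \<Sigma>\<^sub>a f \<oplus> \<Sigma>\<^sub>a g"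
proof -
  have "\<forall>x y f g. f \<in> Hom T x y \<and> g \<in> Hom T x y \<longrightarrow> \<Sigma>\<^sub>a (Plus T f g) = Plus T (\<Sigma>\<^sub>a f) (\<Sigma>\<^sub>a g)"
    using is_triangulated unfolding is_triangulated_def by (elim conjE)
  from this[rule_format, of f "Dom T g" "Cod T g" g] assms show ?thesis by simp
qed

lemma shift_zr [simp]:
  assumes "x \<in> Obj T" "y \<in> Obj T"
  shows "\<Sigma>\<^sub>a (\<z> x y) = \<z> (\<Sigma>\<^sub>o x) (\<Sigma>\<^sub>o y)"
proof -
  have "\<Sigma>\<^sub>a (\<z> x y) \<oplus> \<Sigma>\<^sub>a (\<z> x y) = \<Sigma>\<^sub>a (\<z> x y \<oplus> \<z> x y)"
    using assms by (intro shift_plus[symmetric]) simp_all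
  also have "\<dots> = \<Sigma>\<^sub>a (\<z> x y)" using assms by simp
  finally have "\<Sigma>\<^sub>a (\<z> x y) = \<z> (Dom T (\<Sigma>\<^sub>a (\<z> x y))) (Cod T (\<Sigma>\<^sub>a (\<z> x y)))"
    by (rule idem_zr) (use assms in simp)
  then show ?thesis using assms by simp
qed

lemma shift_eq_zr:
  assumes "\<Sigma>\<^sub>a f = \<z> (\<Sigma>\<^sub>o x) (\<Sigma>\<^sub>o y)" "f \<in> Arr T" "Dom T f = x" "Cod T f = y"
  shows "f = \<z> x y"
proof -
  have xy: "x \<in> Obj T" "y \<in> Obj T" using assms by auto
  show ?thesis by (rule shift_faithful) (use assms xy in simp_all)
qed

lemma shift_iso_arr: "iso_arr T f \<Longrightarrow> iso_arr T (\<Sigma>\<^sub>a f)"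
  by (rule iso_arrI[where g="\<Sigma>\<^sub>a (inv_arr T f)"]) (simp_all add: iso_arr_in_arr flip: shift_comp)

lemma shift_zero_ob: "zero_ob T z \<Longrightarrow> zero_ob T (\<Sigma>\<^sub>o z)"
proof -
  assume z: "zero_ob T z"
  note o = zero_ob_obj[OF z]
  have "Ide T (\<Sigma>\<^sub>o z) = \<Sigma>\<^sub>a (Ide T z)" using o by simp
  also have "\<dots> = \<z> (\<Sigma>\<^sub>o z) (\<Sigma>\<^sub>o z)" unfolding z[unfolded zero_ob_iff[OF o]] using o by simp
  finally show ?thesis using o zero_ob_iff by simp
qed

lemma shift_zero_ob_iff: "x \<in> Obj T \<Longrightarrow> zero_ob T (\<Sigma>\<^sub>o x) \<longleftrightarrow> zero_ob T x"
  using shift_zero_ob shift_eq_zr[of "Ide T x" x x] zero_ob_iff[of x] zero_ob_iff[of "\<Sigma>\<^sub>o x"] by auto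

section \<open>Exact triangles and the long exact sequences\<close>

lemma triD:
  assumes "(f, g, h) \<in> Tri T"
  shows "f \<in> Arr T" "g \<in> Arr T" "h \<in> Arr T" "Dom T g = Cod T f" "Dom T h = Cod T g" "Cod T h = \<Sigma>\<^sub>o (Dom T f)"
    "tri_shape T f g h"
proof -
  have "\<forall>f g h. (f, g, h) \<in> Tri T \<longrightarrow> tri_shape T f g h"
    using is_triangulated unfolding is_triangulated_def by (elim conjE)
  then show s: "tri_shape T f g h" using assms by blast
  show "f \<in> Arr T" "g \<in> Arr T" "h \<in> Arr T" "Dom T g = Cod T f" "Dom T h = Cod T g" "Cod T h = \<Sigma>\<^sub>o (Dom T f)"
    using s unfolding tri_shape_def by simp_all
qed

lemma tri_rot_iff: "tri_shape T f g h \<Longrightarrow> (f, g, h) \<in> Tri T \<longleftrightarrow> (g, h, \<ominus> (\<Sigma>\<^sub>a f)) \<in> Tri T"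
proof -
  have "\<forall>f g h. tri_shape T f g h \<longrightarrow> ((f, g, h) \<in> Tri T \<longleftrightarrow> (g, h, Neg T (\<Sigma>\<^sub>a f)) \<in> Tri T)"
    using is_triangulated unfolding is_triangulated_def by (elim conjE)
  then show "tri_shape T f g h \<Longrightarrow> ?thesis" by blast
qed

lemma tri_rot: "(f, g, h) \<in> Tri T \<Longrightarrow> (g, h, \<ominus> (\<Sigma>\<^sub>a f)) \<in> Tri T"
  using tri_rot_iff triD(7) by blast

lemma tri_ide: "x \<in> Obj T \<Longrightarrow> zero_ob T z \<Longrightarrow> (Ide T x, \<z> x z, \<z> z (\<Sigma>\<^sub>o x)) \<in> Tri T"
proof -
  have "\<forall>x\<in>Obj T. \<forall>z. zero_ob T z \<longrightarrow> (Ide T x, \<z> x z, \<z> z (\<Sigma>\<^sub>o x)) \<in> Tri T"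
    using is_triangulated unfolding is_triangulated_def by (elim conjE)
  then show "x \<in> Obj T \<Longrightarrow> zero_ob T z \<Longrightarrow> ?thesis" by blast
qed

lemma tri_exists: "f \<in> Arr T \<Longrightarrow> \<exists>g h. (f, g, h) \<in> Tri T"
proof -
  have "\<forall>f\<in>Arr T. \<exists>g h. (f, g, h) \<in> Tri T"
    using is_triangulated unfolding is_triangulated_def by (elim conjE)
  then show "f \<in> Arr T \<Longrightarrow> ?thesis" by blast
qed

lemma tri_mor_exists:
  assumes "(f, g, h) \<in> Tri T" "(f', g', h') \<in> Tri T" "a \<in> Arr T" "Dom T a = Dom T f" "Cod T a = Dom T f'"
    "b \<in> Arr T" "Dom T b = Cod T f" "Cod T b = Cod T f'" "b \<cdot> f = f' \<cdot> a"
  shows "\<exists>c. c \<in> Arr T \<and> Dom T c = Cod T g \<and> Cod T c = Cod T g' \<and> c \<cdot> g = g' \<cdot> b \<and> \<Sigma>\<^sub>a a \<cdot> h = h' \<cdot> c"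
proof -
  have "\<forall>f g h f' g' h' a b. (f, g, h) \<in> Tri T \<and> (f', g', h') \<in> Tri T \<and>
        a \<in> Hom T (Dom T f) (Dom T f') \<and> b \<in> Hom T (Cod T f) (Cod T f') \<and> b \<cdot> f = f' \<cdot> a \<longrightarrow>
        (\<exists>c. tri_mor T (f, g, h) (f', g', h') a b c)"
    using is_triangulated unfolding is_triangulated_def by (elim conjE)
  then obtain c where "tri_mor T (f, g, h) (f', g', h') a b c" using assms by (metis in_Hom)
  then show ?thesis unfolding tri_mor_def by auto
qed

text \<open>Exactness of the contravariant Hom functor: \<open>k\<close> is the middle component of
  a morphism into the triangle \<open>0 \<rightarrow> c = c \<rightarrow> \<Sigma>0\<close>, a
  backward rotation of a trivial one, and the third component is the factorization.\<close>

lemma tri_exact_con: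
  assumes tri: "(f, g, h) \<in> Tri T" and k: "k \<in> Arr T" "Dom T k = Cod T f" "k \<cdot> f = \<z> (Dom T f) (Cod T k)"
  shows "\<exists>m. m \<in> Arr T \<and> Dom T m = Cod T g \<and> Cod T m = Cod T k \<and> m \<cdot> g = k"
proof -
  note t = triD[OF tri]
  obtain z where z: "zero_ob T z" using zero_ob_exists by blast
  let ?c = "Cod T k"
  have o: "z \<in> Obj T" "?c \<in> Obj T" "Dom T f \<in> Obj T" using zero_ob_obj[OF z] k t by simp_all
  have "(Ide T ?c, \<z> ?c (\<Sigma>\<^sub>o z), \<ominus> (\<Sigma>\<^sub>a (\<z> z ?c))) \<in> Tri T"
    using tri_ide[OF o(2) shift_zero_ob[OF z]] o by simp
  then have tri': "(\<z> z ?c, Ide T ?c, \<z> ?c (\<Sigma>\<^sub>o z)) \<in> Tri T"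
    by (subst tri_rot_iff) (use o in \<open>simp_all add: tri_shape_def\<close>)
  have "\<exists>m. m \<in> Arr T \<and> Dom T m = Cod T g \<and> Cod T m = Cod T (Ide T ?c) \<and> m \<cdot> g = Ide T ?c \<cdot> k \<and>
      \<Sigma>\<^sub>a (\<z> (Dom T f) z) \<cdot> h = \<z> ?c (\<Sigma>\<^sub>o z) \<cdot> m"
    by (rule tri_mor_exists[OF tri tri']) (use o k t in simp_all)
  then show ?thesis using o k(1) by auto
qed

text \<open>The completion axiom yields third components, whereas a first one is wanted. Both
  triangles are therefore rotated until the missing map stands in third position, where it appears
  suspended; fullness and faithfulness of the suspension bring it back, and the two signs
  cancel.\<close>

lemma tri_exact_cov:
  assumes tri: "(f, g, h) \<in> Tri T" and k: "k \<in> Arr T" "Cod T k = Cod T f" "g \<cdot> k = \<z> (Dom T k) (Cod T g)"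
  shows "\<exists>m. m \<in> Arr T \<and> Dom T m = Dom T k \<and> Cod T m = Dom T f \<and> f \<cdot> m = k"
proof -
  note t = triD[OF tri]
  obtain z where z: "zero_ob T z" using zero_ob_exists by blast
  let ?c = "Dom T k"
  have o: "z \<in> Obj T" "?c \<in> Obj T" "Dom T f \<in> Obj T" "Cod T g \<in> Obj T" using zero_ob_obj[OF z] k t by simp_all
  have tri': "(\<z> ?c z, \<z> z (\<Sigma>\<^sub>o ?c), \<ominus> (Ide T (\<Sigma>\<^sub>o ?c))) \<in> Tri T"
    using tri_rot[OF tri_ide[OF o(2) z]] o by simp
  have "\<exists>m. m \<in> Arr T \<and> Dom T m = Cod T (\<z> z (\<Sigma>\<^sub>o ?c)) \<and> Cod T m = Cod T h \<and>
      m \<cdot> \<z> z (\<Sigma>\<^sub>o ?c) = h \<cdot> \<z> z (Cod T g) \<and> \<Sigma>\<^sub>a k \<cdot> \<ominus> (Ide T (\<Sigma>\<^sub>o ?c)) = \<ominus> (\<Sigma>\<^sub>a f) \<cdot> m"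
    by (rule tri_mor_exists[OF tri' tri_rot[OF tri]]) (use o k t in simp_all)
  then obtain m where m: "m \<in> Arr T" "Dom T m = \<Sigma>\<^sub>o ?c" "Cod T m = \<Sigma>\<^sub>o (Dom T f)"
    "\<Sigma>\<^sub>a k \<cdot> \<ominus> (Ide T (\<Sigma>\<^sub>o ?c)) = \<ominus> (\<Sigma>\<^sub>a f) \<cdot> m"
    using o t by auto
  have "\<ominus> (\<Sigma>\<^sub>a k) = \<ominus> (\<Sigma>\<^sub>a f \<cdot> m)" using m k o t by (simp add: comp_neg)
  then have "\<ominus> (\<ominus> (\<Sigma>\<^sub>a k)) = \<ominus> (\<ominus> (\<Sigma>\<^sub>a f \<cdot> m))" by (rule arg_cong)
  then have sk: "\<Sigma>\<^sub>a k = \<Sigma>\<^sub>a f \<cdot> m" using m(1-3) k t by simp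
  obtain m' where m': "m' \<in> Arr T" "Dom T m' = ?c" "Cod T m' = Dom T f" "\<Sigma>\<^sub>a m' = m"
    using shift_full[OF m(1-3)] o by blast
  have "f \<cdot> m' = k"
    by (rule shift_faithful) (use m' t k sk in \<open>simp_all add: shift_comp\<close>)
  with m' show ?thesis by blast
qed

text \<open>The triangle on the identity of the first vertex maps into the given one, and its third
  vertex is zero; so \<open>g \<cdot> f\<close> factors through a zero object.\<close>

lemma tri_comp_zr:
  assumes tri: "(f, g, h) \<in> Tri T"
  shows "g \<cdot> f = \<z> (Dom T f) (Cod T g)"
proof -
  note t = triD[OF tri]
  obtain z where z: "zero_ob T z" using zero_ob_exists by blast
  let ?x = "Dom T f"
  have o: "z \<in> Obj T" "?x \<in> Obj T" "Cod T f \<in> Obj T" using zero_ob_obj[OF z] t by simp_all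
  have "\<exists>c. c \<in> Arr T \<and> Dom T c = Cod T (\<z> ?x z) \<and> Cod T c = Cod T g \<and> c \<cdot> \<z> ?x z = g \<cdot> f \<and>
      \<Sigma>\<^sub>a (Ide T ?x) \<cdot> \<z> z (\<Sigma>\<^sub>o ?x) = h \<cdot> c"
    by (rule tri_mor_exists[OF tri_ide[OF o(2) z] tri]) (use o t in simp_all)
  then obtain c where c: "c \<in> Arr T" "Dom T c = z" "Cod T c = Cod T g" "c \<cdot> \<z> ?x z = g \<cdot> f"
    using o by auto
  then show ?thesis using o by simp
qed

lemma tri_exact_con_third:
  assumes tri: "(f, g, h) \<in> Tri T" and k: "k \<in> Arr T" "Dom T k = Cod T g" "k \<cdot> g = \<z> (Cod T f) (Cod T k)"
  shows "\<exists>m. m \<in> Arr T \<and> Dom T m = \<Sigma>\<^sub>o (Dom T f) \<and> Cod T m = Cod T k \<and> m \<cdot> h = k"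
  using tri_exact_con[OF tri_rot[OF tri] k(1)] k triD[OF tri] by simp

lemma tri_exact_cov_third:
  assumes tri: "(f, g, h) \<in> Tri T" and k: "k \<in> Arr T" "Cod T k = Cod T g" "h \<cdot> k = \<z> (Dom T k) (\<Sigma>\<^sub>o (Dom T f))"
  shows "\<exists>m. m \<in> Arr T \<and> Dom T m = Dom T k \<and> Cod T m = Cod T f \<and> g \<cdot> m = k"
  using tri_exact_cov[OF tri_rot[OF tri] k(1)] k triD[OF tri] by simp

lemma tri_shift_comp_zr:
  assumes tri: "(f, g, h) \<in> Tri T"
  shows "\<Sigma>\<^sub>a f \<cdot> h = \<z> (Cod T g) (\<Sigma>\<^sub>o (Cod T f))"
proof -
  note t = triD[OF tri]
  have "\<ominus> (\<Sigma>\<^sub>a f) \<cdot> h = \<z> (Cod T g) (\<Sigma>\<^sub>o (Cod T f))"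
    using tri_comp_zr[OF tri_rot[OF tri_rot[OF tri]]] t(1-6) by simp
  then have "\<ominus> (\<Sigma>\<^sub>a f \<cdot> h) = \<z> (Cod T g) (\<Sigma>\<^sub>o (Cod T f))"
    using t(1-6) by (simp only: comp_neg(2)[of h "\<Sigma>\<^sub>a f"] shift_arr)
  then show ?thesis by (rule neg_eq_zr) (use t(1-6) in simp_all)
qed

text \<open>The cone of a split monomorphism is its complement. The retraction \<open>q\<close>
  forces the connecting map \<open>h\<close> to vanish; the candidate complement is the target of
  \<open>b\<close> with section \<open>p\<close>, and \<open>g \<cdot> p \<cdot> b = g\<close> says
  that \<open>g\<close> sees only this part of the middle object.\<close>

lemma split_mono_cone:
  assumes tri: "(f, g, h) \<in> Tri T"
    and q: "q \<in> Arr T" "Dom T q = Cod T f" "Cod T q = Dom T f" "q \<cdot> f = Ide T (Dom T f)"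
    and b: "b \<in> Arr T" "Dom T b = Cod T f" "b \<cdot> f = \<z> (Dom T f) (Cod T b)"
    and p: "p \<in> Arr T" "Dom T p = Cod T b" "Cod T p = Cod T f" "b \<cdot> p = Ide T (Cod T b)" "g \<cdot> p \<cdot> b = g"
  shows "isomorphic T (Cod T g) (Cod T b)"
proof -
  note t = triD[OF tri]
  have "h = \<Sigma>\<^sub>a (q \<cdot> f) \<cdot> h" using q t by simp
  also have "\<dots> = \<Sigma>\<^sub>a q \<cdot> (\<Sigma>\<^sub>a f \<cdot> h)"
    using q(1-3) t by (subst shift_comp) simp_all
  also have "\<dots> = \<z> (Cod T g) (\<Sigma>\<^sub>o (Dom T f))"
    unfolding tri_shift_comp_zr[OF tri] using q(1-3) t by simp
  finally have h: "h = \<z> (Cod T g) (\<Sigma>\<^sub>o (Dom T f))" .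
  obtain k where k: "k \<in> Arr T" "Dom T k = Cod T g" "Cod T k = Cod T b" "k \<cdot> g = b"
    using tri_exact_con[OF tri b] by blast
  let ?v = "g \<cdot> p"
  have v: "?v \<in> Arr T" "Dom T ?v = Cod T b" "Cod T ?v = Cod T g" using t p(1-3) by simp_all
  have kv: "k \<cdot> ?v = Ide T (Cod T b)"
    using comp_eq_left[OF k(4), of p] k(1,2) p(1-4) t by simp
  \<comment> \<open>The defect of the second inverse law is annihilated by \<open>g\<close>, so it
    factors through \<open>h\<close>, which is zero.\<close>
  let ?d = "diff (?v \<cdot> k) (Ide T (Cod T g))"
  have "?d \<cdot> g = diff ((?v \<cdot> k) \<cdot> g) g" using v k(1-3) t by (subst diff_comp) simp_all
  also have "(?v \<cdot> k) \<cdot> g = g" using p(1-3) k(1-3) t k(4) p(5) by simp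
  finally have "?d \<cdot> g = \<z> (Cod T f) (Cod T g)" using t by simp
  then obtain m where m: "m \<in> Arr T" "Dom T m = \<Sigma>\<^sub>o (Dom T f)" "Cod T m = Cod T g" "m \<cdot> h = ?d"
    using tri_exact_con_third[OF tri, of ?d] v k(1-3) t by auto
  then have "?d = \<z> (Cod T g) (Cod T g)" unfolding h using t by simp
  then have vk: "?v \<cdot> k = Ide T (Cod T g)" by (rule diff_eq_zr) (use v k(1-3) t in simp_all)
  show ?thesis
    by (rule isomorphicI[of k]) (use iso_arrI[of k ?v] kv vk v k(1-3) in simp_all)
qed

text \<open>Rotating once or twice moves each vertex into the middle, up to suspension; invariance
  under suspension in both directions then reduces the three cases to one.\<close>

lemma two_of_threeI:
  assumes sub: "L \<subseteq> Obj T"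
    and shift: "\<And>x. x \<in> Obj T \<Longrightarrow> \<Sigma>\<^sub>o x \<in> L \<longleftrightarrow> x \<in> L"
    and mid: "\<And>f g h. (f, g, h) \<in> Tri T \<Longrightarrow> Dom T f \<in> L \<Longrightarrow> Cod T g \<in> L \<Longrightarrow> Cod T f \<in> L"
  shows "two_of_three T (Obj T) L"
  unfolding two_of_three_def
proof (intro allI impI conjI; (elim conjE)?)
  fix f g h assume tri: "(f, g, h) \<in> Tri T"
  note t = triD[OF tri]
  show "Cod T f \<in> L" if "Dom T f \<in> L" "Cod T g \<in> L" using mid[OF tri] that by blast
  show "Cod T g \<in> L" if "Dom T f \<in> L" "Cod T f \<in> L"
    using mid[OF tri_rot[OF tri]] that t shift[of "Dom T f"] by simp
  show "Dom T f \<in> L" if "Cod T f \<in> L" "Cod T g \<in> L"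
    using mid[OF tri_rot[OF tri_rot[OF tri]]] that t shift[of "Dom T f"] shift[of "Cod T f"] by simp
qed

lemma two_of_threeD:
  assumes "two_of_three T A L" "(f, g, h) \<in> Tri T" "Dom T f \<in> A" "Cod T f \<in> A" "Cod T g \<in> A"
  shows "Dom T f \<in> L \<Longrightarrow> Cod T f \<in> L \<Longrightarrow> Cod T g \<in> L" "Dom T f \<in> L \<Longrightarrow> Cod T g \<in> L \<Longrightarrow> Cod T f \<in> L"
    "Cod T f \<in> L \<Longrightarrow> Cod T g \<in> L \<Longrightarrow> Dom T f \<in> L"
  using assms unfolding two_of_three_def by blast+

section \<open>Symmetry and exactness of the tensor product\<close>

lemma braid_isomorphic: "x \<in> Obj T \<Longrightarrow> y \<in> Obj T \<Longrightarrow> isomorphic T (x \<otimes>\<^sub>o y) (y \<otimes>\<^sub>o x)"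
proof -
  assume xy: "x \<in> Obj T" "y \<in> Obj T"
  have "\<forall>x\<in>Obj T. \<forall>y\<in>Obj T. Braid T x y \<in> Hom T (x \<otimes>\<^sub>o y) (y \<otimes>\<^sub>o x) \<and>
        Braid T y x \<cdot> Braid T x y = Ide T (x \<otimes>\<^sub>o y)"
    using tt_category unfolding tt_category_def by (elim conjE)
  then show ?thesis
    using xy by (intro isomorphicI[of "Braid T x y"] iso_arrI[of _ "Braid T y x"]) simp_all
qed

lemma tensor_zr [simp]:
  assumes "x \<in> Obj T" "y \<in> Obj T" "g \<in> Arr T"
  shows "\<z> x y \<otimes>\<^sub>a g = \<z> (x \<otimes>\<^sub>o Dom T g) (y \<otimes>\<^sub>o Cod T g)"
proof -
  have "\<forall>x x' y y' f f' g. f \<in> Hom T x x' \<and> f' \<in> Hom T x x' \<and> g \<in> Hom T y y' \<longrightarrow>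
        Plus T f f' \<otimes>\<^sub>a g = Plus T (f \<otimes>\<^sub>a g) (f' \<otimes>\<^sub>a g) \<and> g \<otimes>\<^sub>a Plus T f f' = Plus T (g \<otimes>\<^sub>a f) (g \<otimes>\<^sub>a f')"
    using tt_category unfolding tt_category_def by (elim conjE)
  from this[rule_format, of "\<z> x y" x y "\<z> x y" g "Dom T g" "Cod T g"]
  have "(\<z> x y \<otimes>\<^sub>a g) \<oplus> (\<z> x y \<otimes>\<^sub>a g) = \<z> x y \<otimes>\<^sub>a g" using assms by simp
  then have "\<z> x y \<otimes>\<^sub>a g = \<z> (Dom T (\<z> x y \<otimes>\<^sub>a g)) (Cod T (\<z> x y \<otimes>\<^sub>a g))"
    by (rule idem_zr) (use assms in simp)
  then show ?thesis using assms by simp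
qed

lemma tri_tensor:
  assumes "(f, g, h) \<in> Tri T" "y \<in> Obj T"
  shows "(f \<otimes>\<^sub>a Ide T y, g \<otimes>\<^sub>a Ide T y, ShL T (Dom T f) y \<cdot> (h \<otimes>\<^sub>a Ide T y)) \<in> Tri T"
proof -
  have "\<forall>f g h. \<forall>y\<in>Obj T. (f, g, h) \<in> Tri T \<longrightarrow>
        (f \<otimes>\<^sub>a Ide T y, g \<otimes>\<^sub>a Ide T y, ShL T (Dom T f) y \<cdot> (h \<otimes>\<^sub>a Ide T y)) \<in> Tri T"
    using tt_category unfolding tt_category_def by (elim conjE)
  then show ?thesis using assms by blast
qed

lemma zero_ob_tensor:
  assumes "zero_ob T z" "y \<in> Obj T"
  shows "zero_ob T (z \<otimes>\<^sub>o y)" "zero_ob T (y \<otimes>\<^sub>o z)"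
proof -
  note o = zero_ob_obj[OF assms(1)]
  have "Ide T (z \<otimes>\<^sub>o y) = Ide T z \<otimes>\<^sub>a Ide T y" using o assms(2) by simp
  also have "\<dots> = \<z> (z \<otimes>\<^sub>o y) (z \<otimes>\<^sub>o y)" unfolding assms(1)[unfolded zero_ob_iff[OF o]] using o assms(2) by simp
  finally show z: "zero_ob T (z \<otimes>\<^sub>o y)" using zero_ob_iff[of "z \<otimes>\<^sub>o y"] o assms(2) by simp
  show "zero_ob T (y \<otimes>\<^sub>o z)" using zero_ob_iso[OF braid_isomorphic z] o assms by simp
qed

end

section \<open>Coproducts and compact objects\<close>

lemma (in cat) coproduct_summand_obj:
  assumes "is_coproduct C I y c \<iota>" "i \<in> I"
  shows "y i \<in> Obj C"
  using coproduct_arr(2,3)[OF assms] dom_obj by metis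

context tt
begin

lemma coproduct_proj:
  assumes cop: "is_coproduct T I y c \<iota>"
  obtains p where "\<And>i. i \<in> I \<Longrightarrow> p i \<in> Arr T" "\<And>i. i \<in> I \<Longrightarrow> Dom T (p i) = c" "\<And>i. i \<in> I \<Longrightarrow> Cod T (p i) = y i"
    "\<And>i. i \<in> I \<Longrightarrow> p i \<cdot> \<iota> i = Ide T (y i)"
    "\<And>i j. i \<in> I \<Longrightarrow> j \<in> I \<Longrightarrow> j \<noteq> i \<Longrightarrow> p i \<cdot> \<iota> j = \<z> (y j) (y i)"
proof -
  note a = coproduct_arr[OF cop]
  note o = coproduct_summand_obj[OF cop]
  have "\<exists>h. h \<in> Arr T \<and> Dom T h = c \<and> Cod T h = y i \<and>
      (\<forall>j\<in>I. h \<cdot> \<iota> j = (if j = i then Ide T (y i) else \<z> (y j) (y i)))" if "i \<in> I" for i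
    by (rule coproduct_arr_ex[OF cop]) (use o that in simp_all)
  then obtain p where p: "\<forall>i\<in>I. p i \<in> Arr T \<and> Dom T (p i) = c \<and> Cod T (p i) = y i \<and>
      (\<forall>j\<in>I. p i \<cdot> \<iota> j = (if j = i then Ide T (y i) else \<z> (y j) (y i)))"
    by metis
  show ?thesis by (rule that[of p]) (use p in simp_all)
qed

lemma comp_finprod:
  assumes "finite A" "\<forall>i\<in>A. \<psi> i \<in> Arr T \<and> Dom T (\<psi> i) = x \<and> Cod T (\<psi> i) = c"
    "g \<in> Arr T" "Dom T g = c" "Cod T g = w" "x \<in> Obj T"
  shows "g \<cdot> finprod (hgrp T x c) \<psi> A = finprod (hgrp T x w) (\<lambda>i. g \<cdot> \<psi> i) A"
proof -
  have cw: "c \<in> Obj T" "w \<in> Obj T" using assms(3-5) by auto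
  interpret X: comm_group "hgrp T x c" by (rule comm_group_Hom) fact+
  interpret Y: comm_group "hgrp T x w" by (rule comm_group_Hom) fact+
  show ?thesis using assms(1,2)
  proof (induction A)
    case empty
    then show ?case using assms(3-6) cw by simp
  next
    case (insert i A)
    have 1: "\<psi> \<in> A \<rightarrow> carrier (hgrp T x c)" "\<psi> i \<in> carrier (hgrp T x c)" using insert.prems by auto
    have 2: "(\<lambda>i. g \<cdot> \<psi> i) \<in> A \<rightarrow> carrier (hgrp T x w)" "g \<cdot> \<psi> i \<in> carrier (hgrp T x w)"
      using insert.prems assms(3-5) by auto
    have 3: "finprod (hgrp T x c) \<psi> A \<in> carrier (hgrp T x c)" by (rule X.finprod_closed[OF 1(1)])
    have "g \<cdot> (\<psi> i \<oplus> finprod (hgrp T x c) \<psi> A) = (g \<cdot> \<psi> i) \<oplus> (g \<cdot> finprod (hgrp T x c) \<psi> A)"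
      by (rule comp_plus) (use 1 3 assms(3-5) in simp_all)
    then show ?case
      using X.finprod_insert[OF insert.hyps 1] Y.finprod_insert[OF insert.hyps 2] insert.IH insert.prems by simp
  qed
qed

lemma finprod_comp:
  assumes "finite A" "\<forall>i\<in>A. \<psi> i \<in> Arr T \<and> Dom T (\<psi> i) = c \<and> Cod T (\<psi> i) = w"
    "f \<in> Arr T" "Dom T f = x" "Cod T f = c" "w \<in> Obj T"
  shows "finprod (hgrp T c w) \<psi> A \<cdot> f = finprod (hgrp T x w) (\<lambda>i. \<psi> i \<cdot> f) A"
proof -
  have xc: "x \<in> Obj T" "c \<in> Obj T" using assms(3-5) by auto
  interpret X: comm_group "hgrp T c w" by (rule comm_group_Hom) fact+
  interpret Y: comm_group "hgrp T x w" by (rule comm_group_Hom) fact+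
  show ?thesis using assms(1,2)
  proof (induction A)
    case empty
    then show ?case using assms(3-6) xc by simp
  next
    case (insert i A)
    have 1: "\<psi> \<in> A \<rightarrow> carrier (hgrp T c w)" "\<psi> i \<in> carrier (hgrp T c w)" using insert.prems by auto
    have 2: "(\<lambda>i. \<psi> i \<cdot> f) \<in> A \<rightarrow> carrier (hgrp T x w)" "\<psi> i \<cdot> f \<in> carrier (hgrp T x w)"
      using insert.prems assms(3-5) by auto
    have 3: "finprod (hgrp T c w) \<psi> A \<in> carrier (hgrp T c w)" by (rule X.finprod_closed[OF 1(1)])
    have "(\<psi> i \<oplus> finprod (hgrp T c w) \<psi> A) \<cdot> f = (\<psi> i \<cdot> f) \<oplus> (finprod (hgrp T c w) \<psi> A \<cdot> f)"
      by (rule plus_comp) (use 1 3 assms(3-5) in simp_all)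
    then show ?case
      using X.finprod_insert[OF insert.hyps 1] Y.finprod_insert[OF insert.hyps 2] insert.IH insert.prems by simp
  qed
qed

text \<open>An arrow into a coproduct is supported on \<open>F\<close> if it factors through the coproduct of the
  summands in \<open>F\<close>; this is expressed without choosing the latter.\<close>

definition supported :: "('i \<Rightarrow> 'm) \<Rightarrow> 'i set \<Rightarrow> 'm \<Rightarrow> bool" where
  "supported \<iota> F f \<longleftrightarrow> (\<forall>g g'. g \<in> Arr T \<and> g' \<in> Arr T \<and> Dom T g = Cod T f \<and> Dom T g' = Cod T f \<and>
     Cod T g = Cod T g' \<and> (\<forall>i\<in>F. g \<cdot> \<iota> i = g' \<cdot> \<iota> i) \<longrightarrow> g \<cdot> f = g' \<cdot> f)"

lemma supportedD:
  assumes "supported \<iota> F f" "g \<in> Arr T" "g' \<in> Arr T" "Dom T g = Cod T f" "Dom T g' = Cod T f"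
    "Cod T g = Cod T g'" "\<forall>i\<in>F. g \<cdot> \<iota> i = g' \<cdot> \<iota> i"
  shows "g \<cdot> f = g' \<cdot> f"
  using assms unfolding supported_def by blast

text \<open>The finite sum \<open>e\<close> of the idempotents \<open>\<iota> i \<cdot> p i\<close>
  over \<open>F\<close> agrees with the identity on every summand in \<open>F\<close>, and
  \<open>f\<close> cannot distinguish two maps that agree there. Hence
  \<open>f = e \<cdot> f\<close>.\<close>

lemma supported_expand:
  assumes cop: "is_coproduct T I y c \<iota>" and F: "F \<subseteq> I" "finite F" "supported \<iota> F f"
    and f: "f \<in> Arr T" "Dom T f = x" "Cod T f = c"
    and p: "\<And>i. i \<in> I \<Longrightarrow> p i \<in> Arr T" "\<And>i. i \<in> I \<Longrightarrow> Dom T (p i) = c" "\<And>i. i \<in> I \<Longrightarrow> Cod T (p i) = y i"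
    "\<And>i. i \<in> I \<Longrightarrow> p i \<cdot> \<iota> i = Ide T (y i)"
    "\<And>i j. i \<in> I \<Longrightarrow> j \<in> I \<Longrightarrow> j \<noteq> i \<Longrightarrow> p i \<cdot> \<iota> j = \<z> (y j) (y i)"
  shows "f = finprod (hgrp T x c) (\<lambda>i. \<iota> i \<cdot> (p i \<cdot> f)) F"
proof -
  note a = coproduct_arr[OF cop]
  have x: "x \<in> Obj T" using f by auto
  interpret X: comm_group "hgrp T c c" by (rule comm_group_Hom; rule a)
  define e where "e = finprod (hgrp T c c) (\<lambda>i. \<iota> i \<cdot> p i) F"
  have ip: "\<forall>i\<in>F. \<iota> i \<cdot> p i \<in> Arr T \<and> Dom T (\<iota> i \<cdot> p i) = c \<and> Cod T (\<iota> i \<cdot> p i) = c"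
    using F(1) a p(1-3) by auto
  then have "(\<lambda>i. \<iota> i \<cdot> p i) \<in> F \<rightarrow> carrier (hgrp T c c)" by simp
  then have "e \<in> carrier (hgrp T c c)" unfolding e_def by (rule X.finprod_closed)
  then have e: "e \<in> Arr T" "Dom T e = c" "Cod T e = c" by simp_all
  have "e \<cdot> \<iota> j = \<iota> j" if j: "j \<in> F" for j
  proof -
    have jI: "j \<in> I" using j F(1) by blast
    note yj = coproduct_summand_obj[OF cop jI]
    interpret Y: comm_group "hgrp T (y j) c" by (rule comm_group_Hom) (use yj a in simp_all)
    have "e \<cdot> \<iota> j = finprod (hgrp T (y j) c) (\<lambda>i. (\<iota> i \<cdot> p i) \<cdot> \<iota> j) F"
      unfolding e_def by (rule finprod_comp) (use F(2) ip a jI in simp_all)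
    also have "\<dots> = finprod (hgrp T (y j) c) (\<lambda>i. if j = i then \<iota> j else one (hgrp T (y j) c)) F"
    proof (rule Y.finprod_cong')
      show "(\<lambda>i. if j = i then \<iota> j else \<one>\<^bsub>hgrp T (y j) c\<^esub>) \<in> F \<rightarrow> carrier (hgrp T (y j) c)"
        using F(1) a yj by auto
      show "(\<iota> i \<cdot> p i) \<cdot> \<iota> j = (if j = i then \<iota> j else \<one>\<^bsub>hgrp T (y j) c\<^esub>)" if "i \<in> F" for i
      proof -
        have i: "i \<in> I" using that F(1) by blast
        then have "(\<iota> i \<cdot> p i) \<cdot> \<iota> j = \<iota> i \<cdot> (p i \<cdot> \<iota> j)" using a jI p(1-3) by simp
        then show ?thesis using p(4)[OF i] p(5)[OF i jI] a(2-4)[OF i] yj by auto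
      qed
    qed simp
    also have "\<dots> = \<iota> j"
      by (rule Y.finprod_singleton[OF j F(2)]) (use yj a F(1) jI in \<open>auto\<close>)
    finally show ?thesis .
  qed
  then have "e \<cdot> f = Ide T c \<cdot> f"
    by (intro supportedD[OF F(3)]) (use e f a F(1) in \<open>simp_all add: subset_iff\<close>)
  then have "f = e \<cdot> f" using f by simp
  also have "\<dots> = finprod (hgrp T x c) (\<lambda>i. (\<iota> i \<cdot> p i) \<cdot> f) F"
    unfolding e_def by (rule finprod_comp) (use F(2) ip f a in simp_all)
  also have "\<dots> = finprod (hgrp T x c) (\<lambda>i. \<iota> i \<cdot> (p i \<cdot> f)) F"
  proof -
    interpret Z: comm_group "hgrp T x c" by (rule comm_group_Hom) (use x a in simp_all)
    have *: "(\<iota> i \<cdot> p i) \<cdot> f = \<iota> i \<cdot> (p i \<cdot> f) \<and> \<iota> i \<cdot> (p i \<cdot> f) \<in> carrier (hgrp T x c)" if "i \<in> F" for i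
      using that F(1) a p(1-3) f by (simp add: subset_iff)
    show ?thesis by (rule Z.finprod_cong') (use * in auto)
  qed
  finally show ?thesis .
qed

text \<open>The projections of an infinite coproduct need not be jointly monic, but they do detect
  maps with finite support.\<close>

lemma supported_eq_zr:
  assumes cop: "is_coproduct T I y c \<iota>" and F: "F \<subseteq> I" "finite F" "supported \<iota> F f"
    and f: "f \<in> Arr T" "Dom T f = x" "Cod T f = c"
    and p: "\<And>i. i \<in> I \<Longrightarrow> p i \<in> Arr T" "\<And>i. i \<in> I \<Longrightarrow> Dom T (p i) = c" "\<And>i. i \<in> I \<Longrightarrow> Cod T (p i) = y i"
    "\<And>i. i \<in> I \<Longrightarrow> p i \<cdot> \<iota> i = Ide T (y i)"
    "\<And>i j. i \<in> I \<Longrightarrow> j \<in> I \<Longrightarrow> j \<noteq> i \<Longrightarrow> p i \<cdot> \<iota> j = \<z> (y j) (y i)"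
    and z: "\<And>i. i \<in> I \<Longrightarrow> p i \<cdot> f = \<z> x (y i)"
  shows "f = \<z> x c"
proof -
  note a = coproduct_arr[OF cop]
  have x: "x \<in> Obj T" using f by auto
  interpret Z: comm_group "hgrp T x c" by (rule comm_group_Hom) (use x a in simp_all)
  have "f = finprod (hgrp T x c) (\<lambda>i. \<iota> i \<cdot> (p i \<cdot> f)) F"
    by (rule supported_expand[OF cop F f p])
  also have "\<dots> = one (hgrp T x c)"
  proof (rule Z.finprod_one_eqI)
    fix i assume "i \<in> F"
    then have i: "i \<in> I" using F(1) by blast
    show "\<iota> i \<cdot> (p i \<cdot> f) = one (hgrp T x c)"
      unfolding z[OF i] using a(2-4)[OF i] x by simp
  qed
  finally show ?thesis by simp
qed

end

section \<open>Small coproducts and localizing subcategories\<close>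

locale rcg = univ \<kappa> + tt T for \<kappa> :: "'u rel" and T :: "('o, 'm) ttcat" (structure) +
  assumes rcg: "rigidly_compactly_generated \<kappa> T"
begin

text \<open>The coproduct axioms and the definitions of compact and localizing speak of index sets
  in \<open>'u\<close>. The bijection \<open>m\<close> with its inverse \<open>n\<close> transports
  them to any index type, such as the natural numbers or pairs of an object and an arrow.\<close>

lemma small_reindex:
  fixes I :: "'i set"
  assumes "small \<kappa> I"
  shows "\<exists>(m :: 'i \<Rightarrow> 'u) J n. bij_betw m I J \<and> bij_betw n J I \<and> small \<kappa> J \<and> (\<forall>i\<in>I. n (m i) = i)"
proof -
  obtain m :: "'i \<Rightarrow> 'u" where m: "inj_on m I" using small_inj[OF assms] by auto
  then have b: "bij_betw m I (m ` I)" by (rule inj_on_imp_bij_betw)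
  have "\<forall>i\<in>I. the_inv_into I m (m i) = i" using the_inv_into_f_f[OF m] by blast
  then show ?thesis
    using b bij_betw_the_inv_into[OF b] small_image[OF assms] by blast
qed

lemma coproduct_exists:
  fixes I :: "'i set"
  assumes "small \<kappa> I" "\<forall>i\<in>I. y i \<in> Obj T"
  shows "\<exists>c \<iota>. is_coproduct T I y c \<iota>"
proof -
  obtain m :: "'i \<Rightarrow> 'u" and J n where mn: "bij_betw m I J" "bij_betw n J I" "small \<kappa> J" "\<forall>i\<in>I. n (m i) = i"
    using small_reindex[OF assms(1)] by blast
  have "\<forall>I :: 'u set. \<forall>x. small \<kappa> I \<and> (\<forall>i\<in>I. x i \<in> Obj T) \<longrightarrow> (\<exists>c \<iota>. is_coproduct T I x c \<iota>)"
    using rcg unfolding rigidly_compactly_generated_def by (elim conjE)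
  moreover have "\<forall>j\<in>J. y (n j) \<in> Obj T" using bij_betwE[OF mn(2)] assms(2) by blast
  ultimately obtain c \<iota> where "is_coproduct T J (\<lambda>j. y (n j)) c \<iota>"
    using mn(3) by (metis (no_types, lifting))
  from coproduct_reindex[OF mn(1) this] have "is_coproduct T I y c (\<lambda>i. \<iota> (m i))"
    by (rule coproduct_cong[rotated]) (use mn(4) in simp)
  then show ?thesis by blast
qed

lemma coproduct_tensor:
  fixes I :: "'i set"
  assumes "small \<kappa> I" "is_coproduct T I y c \<iota>" "w \<in> Obj T"
  shows "is_coproduct T I (\<lambda>i. y i \<otimes>\<^sub>o w) (c \<otimes>\<^sub>o w) (\<lambda>i. \<iota> i \<otimes>\<^sub>a Ide T w)"
proof -
  obtain m :: "'i \<Rightarrow> 'u" and J n where mn: "bij_betw m I J" "bij_betw n J I" "small \<kappa> J" "\<forall>i\<in>I. n (m i) = i"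
    using small_reindex[OF assms(1)] by blast
  note a = coproduct_arr[OF assms(2)]
  note o = coproduct_summand_obj[OF assms(2)]
  have "\<forall>I :: 'u set. \<forall>x c \<iota>. \<forall>y\<in>Obj T. small \<kappa> I \<and> (\<forall>i\<in>I. x i \<in> Obj T) \<and> is_coproduct T I x c \<iota> \<longrightarrow>
        is_coproduct T I (\<lambda>i. x i \<otimes>\<^sub>o y) (c \<otimes>\<^sub>o y) (\<lambda>i. \<iota> i \<otimes>\<^sub>a Ide T y)"
    using rcg unfolding rigidly_compactly_generated_def by (elim conjE)
  from this[rule_format, OF assms(3), of J "\<lambda>j. y (n j)" c "\<lambda>j. \<iota> (n j)"]
  have "is_coproduct T J (\<lambda>j. y (n j) \<otimes>\<^sub>o w) (c \<otimes>\<^sub>o w) (\<lambda>j. \<iota> (n j) \<otimes>\<^sub>a Ide T w)"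
    using mn(3) coproduct_reindex[OF mn(2) assms(2)] bij_betwE[OF mn(2)] o by blast
  from coproduct_reindex[OF mn(1) this] show ?thesis
    by (rule coproduct_cong[rotated]) (use mn(4) in simp)
qed

lemma localizing_coproduct:
  fixes I :: "'i set"
  assumes "localizing \<kappa> T L" "small \<kappa> I" "\<forall>i\<in>I. y i \<in> L" "is_coproduct T I y c \<iota>"
  shows "c \<in> L"
proof -
  obtain m :: "'i \<Rightarrow> 'u" and J n where mn: "bij_betw m I J" "bij_betw n J I" "small \<kappa> J" "\<forall>i\<in>I. n (m i) = i"
    using small_reindex[OF assms(2)] by blast
  have "\<forall>I :: 'u set. \<forall>x c \<iota>. small \<kappa> I \<and> (\<forall>i\<in>I. x i \<in> L) \<and> is_coproduct T I x c \<iota> \<longrightarrow> c \<in> L"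
    using assms(1) unfolding localizing_def by (elim conjE)
  from this[rule_format, of J "\<lambda>j. y (n j)" c "\<lambda>j. \<iota> (n j)"] show ?thesis
    using mn(3) coproduct_reindex[OF mn(2) assms(4)] bij_betwE[OF mn(2)] assms(3) by blast
qed

lemma localizingD:
  assumes "localizing \<kappa> T L"
  shows "L \<subseteq> Obj T" "zero_ob T z \<Longrightarrow> z \<in> L" "x \<in> L \<Longrightarrow> isomorphic T x y \<Longrightarrow> y \<in> L" "two_of_three T (Obj T) L"
  using assms unfolding localizing_def iso_closed_def by blast+

lemma localizing_tri:
  assumes "localizing \<kappa> T L" "(f, g, h) \<in> Tri T"
  shows "Dom T f \<in> L \<Longrightarrow> Cod T f \<in> L \<Longrightarrow> Cod T g \<in> L" "Dom T f \<in> L \<Longrightarrow> Cod T g \<in> L \<Longrightarrow> Cod T f \<in> L"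
    "Cod T f \<in> L \<Longrightarrow> Cod T g \<in> L \<Longrightarrow> Dom T f \<in> L"
  using two_of_threeD[OF localizingD(4)[OF assms(1)] assms(2)] triD[OF assms(2)] by simp_all

lemma localizingI:
  assumes "L \<subseteq> Obj T" "\<And>z. zero_ob T z \<Longrightarrow> z \<in> L" "\<And>x y. x \<in> L \<Longrightarrow> isomorphic T x y \<Longrightarrow> y \<in> L"
    "two_of_three T (Obj T) L"
    "\<And>(I :: 'u set) y c \<iota>. small \<kappa> I \<Longrightarrow> \<forall>i\<in>I. y i \<in> L \<Longrightarrow> is_coproduct T I y c \<iota> \<Longrightarrow> c \<in> L"
  shows "localizing \<kappa> T L"
  unfolding localizing_def iso_closed_def
proof (intro conjI allI impI ballI)
  show "c \<in> L" if "small \<kappa> I \<and> (\<forall>i\<in>I. x i \<in> L) \<and> is_coproduct T I x c \<iota>" for I :: "'u set" and x c \<iota>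
    using that assms(5)[of I x c \<iota>] by blast
qed (use assms(1-4) in blast)+

text \<open>With this choice of localizing subcategory, membership statements checked on generators
  become vanishing statements.\<close>

lemma localizing_zeros: "localizing \<kappa> T {z. zero_ob T z}"
proof (rule localizingI)
  show "two_of_three T (Obj T) {z. zero_ob T z}"
  proof (rule two_of_threeI)
    show "\<Sigma>\<^sub>o x \<in> {z. zero_ob T z} \<longleftrightarrow> x \<in> {z. zero_ob T z}" if "x \<in> Obj T" for x
      using shift_zero_ob_iff[OF that] by simp
    fix f g h assume tri: "(f, g, h) \<in> Tri T" and "Dom T f \<in> {z. zero_ob T z}" "Cod T g \<in> {z. zero_ob T z}"
    then have z: "zero_ob T (Dom T f)" "zero_ob T (Cod T g)" by simp_all
    note t = triD[OF tri]
    \<comment> \<open>As \<open>g\<close> lands in a zero object, the identity of the middle vertex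
      factors through \<open>f\<close>, which makes that vertex a retract of a zero object.\<close>
    have "g \<cdot> Ide T (Cod T f) = \<z> (Dom T (Ide T (Cod T f))) (Cod T g)"
      using zero_ob_to[OF z(2) t(2)] t by simp
    then obtain m where m: "m \<in> Arr T" "Dom T m = Cod T f" "Cod T m = Dom T f" "f \<cdot> m = Ide T (Cod T f)"
      using tri_exact_cov[OF tri, of "Ide T (Cod T f)"] t by auto
    show "Cod T f \<in> {z. zero_ob T z}"
      using zero_ob_retract[OF z(1) m(1) t(1)] m t by simp
  qed (use zero_ob_obj in blast)
  fix I :: "'u set" and y c \<iota>
  assume y: "\<forall>i\<in>I. y i \<in> {z. zero_ob T z}" and cop: "is_coproduct T I y c \<iota>"
  note a = coproduct_arr[OF cop]
  have "Ide T c = \<z> c c"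
  proof (rule coproduct_arr_unique[OF cop])
    fix i assume i: "i \<in> I"
    note o = coproduct_summand_obj[OF cop i]
    have "\<iota> i = \<z> (y i) c" using zero_ob_from[of "y i" "\<iota> i"] y a(2-4)[OF i] i by simp
    then show "Ide T c \<cdot> \<iota> i = \<z> c c \<cdot> \<iota> i" using a o by simp
  qed (use a in simp_all)
  then show "c \<in> {z. zero_ob T z}" using a zero_ob_iff by simp
qed (use zero_ob_obj zero_ob_iso isomorphic_sym in blast)+

text \<open>Tensoring with \<open>w\<close> is exact and preserves small coproducts. This is what
  allows a statement about \<open>a \<otimes> w\<close>, for \<open>a\<close> in a generated
  localizing subcategory, to be checked on the generators.\<close>

lemma localizing_tensor_preimage:
  assumes L: "localizing \<kappa> T L" and w: "w \<in> Obj T"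
  shows "localizing \<kappa> T {s \<in> Obj T. s \<otimes>\<^sub>o w \<in> L}"
proof (rule localizingI)
  show "two_of_three T (Obj T) {s \<in> Obj T. s \<otimes>\<^sub>o w \<in> L}"
    unfolding two_of_three_def
  proof (intro allI impI, elim conjE)
    fix f g h assume tri: "(f, g, h) \<in> Tri T"
    note t = triD[OF tri]
    show "(Dom T f \<in> {s \<in> Obj T. s \<otimes>\<^sub>o w \<in> L} \<and> Cod T f \<in> {s \<in> Obj T. s \<otimes>\<^sub>o w \<in> L} \<longrightarrow> Cod T g \<in> {s \<in> Obj T. s \<otimes>\<^sub>o w \<in> L}) \<and>
       (Dom T f \<in> {s \<in> Obj T. s \<otimes>\<^sub>o w \<in> L} \<and> Cod T g \<in> {s \<in> Obj T. s \<otimes>\<^sub>o w \<in> L} \<longrightarrow> Cod T f \<in> {s \<in> Obj T. s \<otimes>\<^sub>o w \<in> L}) \<and>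
       (Cod T f \<in> {s \<in> Obj T. s \<otimes>\<^sub>o w \<in> L} \<and> Cod T g \<in> {s \<in> Obj T. s \<otimes>\<^sub>o w \<in> L} \<longrightarrow> Dom T f \<in> {s \<in> Obj T. s \<otimes>\<^sub>o w \<in> L})"
      using localizing_tri[OF L tri_tensor[OF tri w]] t w by simp
  qed
  show "y \<in> {s \<in> Obj T. s \<otimes>\<^sub>o w \<in> L}" if "x \<in> {s \<in> Obj T. s \<otimes>\<^sub>o w \<in> L}" "isomorphic T x y" for x y
    using that localizingD(3)[OF L _ tensor_isomorphic[OF that(2) isomorphic_refl[OF w]]] isomorphic_obj by simp
  show "z \<in> {s \<in> Obj T. s \<otimes>\<^sub>o w \<in> L}" if "zero_ob T z" for z
    using zero_ob_tensor(1)[OF that w] localizingD(2)[OF L] zero_ob_obj[OF that] by simp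
  show "c \<in> {s \<in> Obj T. s \<otimes>\<^sub>o w \<in> L}"
    if "small \<kappa> I" "\<forall>i\<in>I. y i \<in> {s \<in> Obj T. s \<otimes>\<^sub>o w \<in> L}" "is_coproduct T I y c \<iota>" for I :: "'u set" and y c \<iota>
    using localizing_coproduct[OF L that(1) _ coproduct_tensor[OF that(1,3) w]] that coproduct_arr(1) by simp
qed blast

section \<open>Compactness expressed by finite supports\<close>

lemma compact_obj: "compact_ob \<kappa> T x \<Longrightarrow> x \<in> Obj T"
  unfolding compact_ob_def by blast

text \<open>Surjectivity of the defining bijection writes \<open>f\<close> as a finite sum of maps
  through single summands, and maps agreeing on those summands agree on each term.\<close>

lemma compact_supported_index:
  fixes I :: "'u set"
  assumes x: "compact_ob \<kappa> T x" and I: "small \<kappa> I" and cop: "is_coproduct T I y c \<iota>"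
    and f: "f \<in> Arr T" "Dom T f = x" "Cod T f = c"
  shows "\<exists>F\<subseteq>I. finite F \<and> supported \<iota> F f"
proof -
  note a = coproduct_arr[OF cop] and o = coproduct_summand_obj[OF cop]
  have xo: "x \<in> Obj T" by (rule compact_obj[OF x])
  have "bij_betw (\<lambda>\<phi>. finprod (hgrp T x c) (\<lambda>i. \<iota> i \<cdot> \<phi> i) {i\<in>I. \<phi> i \<noteq> \<z> x (y i)})
          {\<phi> \<in> (\<Pi>\<^sub>E i\<in>I. Hom T x (y i)). finite {i\<in>I. \<phi> i \<noteq> \<z> x (y i)}} (Hom T x c)"
    using x I cop o unfolding compact_ob_def by (metis (no_types, lifting))
  then have "f \<in> (\<lambda>\<phi>. finprod (hgrp T x c) (\<lambda>i. \<iota> i \<cdot> \<phi> i) {i\<in>I. \<phi> i \<noteq> \<z> x (y i)}) `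
      {\<phi> \<in> (\<Pi>\<^sub>E i\<in>I. Hom T x (y i)). finite {i\<in>I. \<phi> i \<noteq> \<z> x (y i)}}"
    using f unfolding bij_betw_def by simp
  then obtain \<phi> where \<phi>: "\<phi> \<in> (\<Pi>\<^sub>E i\<in>I. Hom T x (y i))" "finite {i\<in>I. \<phi> i \<noteq> \<z> x (y i)}"
    and feq: "f = finprod (hgrp T x c) (\<lambda>i. \<iota> i \<cdot> \<phi> i) {i\<in>I. \<phi> i \<noteq> \<z> x (y i)}" by blast
  let ?F = "{i\<in>I. \<phi> i \<noteq> \<z> x (y i)}"
  have \<phi>i: "\<phi> i \<in> Arr T \<and> Dom T (\<phi> i) = x \<and> Cod T (\<phi> i) = y i" if "i \<in> I" for i
    using PiE_mem[OF \<phi>(1) that] by simp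
  have "supported \<iota> ?F f"
    unfolding supported_def
  proof (intro allI impI, elim conjE)
    fix g g' assume g: "g \<in> Arr T" "g' \<in> Arr T" "Dom T g = Cod T f" "Dom T g' = Cod T f" "Cod T g = Cod T g'"
      and eq: "\<forall>i\<in>?F. g \<cdot> \<iota> i = g' \<cdot> \<iota> i"
    interpret W: comm_group "hgrp T x (Cod T g')" by (rule comm_group_Hom) (use xo g in simp_all)
    have ar: "\<forall>i\<in>?F. \<iota> i \<cdot> \<phi> i \<in> Arr T \<and> Dom T (\<iota> i \<cdot> \<phi> i) = x \<and> Cod T (\<iota> i \<cdot> \<phi> i) = c"
      using a \<phi>i by simp
    have 1: "g \<cdot> f = finprod (hgrp T x (Cod T g')) (\<lambda>i. g \<cdot> (\<iota> i \<cdot> \<phi> i)) ?F"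
      unfolding feq by (rule comp_finprod[OF \<phi>(2) ar]) (use g f xo in simp_all)
    have 2: "g' \<cdot> f = finprod (hgrp T x (Cod T g')) (\<lambda>i. g' \<cdot> (\<iota> i \<cdot> \<phi> i)) ?F"
      unfolding feq by (rule comp_finprod[OF \<phi>(2) ar]) (use g f xo in simp_all)
    show "g \<cdot> f = g' \<cdot> f"
      unfolding 1 2
    proof (rule W.finprod_cong')
      show "(\<lambda>i. g' \<cdot> (\<iota> i \<cdot> \<phi> i)) \<in> ?F \<rightarrow> carrier (hgrp T x (Cod T g'))"
        using g f a \<phi>i by simp
      fix i assume i: "i \<in> ?F"
      then have iI: "i \<in> I" by simp
      have e: "g \<cdot> \<iota> i = g' \<cdot> \<iota> i" using eq i by blast
      show "g \<cdot> (\<iota> i \<cdot> \<phi> i) = g' \<cdot> (\<iota> i \<cdot> \<phi> i)"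
        using comp_eq_left[OF e, of "\<phi> i"] a(2-4)[OF iI] \<phi>i[OF iI] g f by simp
    qed simp
  qed
  then show ?thesis using \<phi>(2) by (intro exI[of _ ?F]) blast
qed

lemma supported_image:
  assumes "supported (\<lambda>j. \<iota> (n j)) F f"
  shows "supported \<iota> (n ` F) f"
  using assms unfolding supported_def by simp

lemma compact_supported:
  fixes I :: "'i set"
  assumes x: "compact_ob \<kappa> T x" and I: "small \<kappa> I" and cop: "is_coproduct T I y c \<iota>"
    and f: "f \<in> Arr T" "Dom T f = x" "Cod T f = c"
  shows "\<exists>F\<subseteq>I. finite F \<and> supported \<iota> F f"
proof -
  obtain m :: "'i \<Rightarrow> 'u" and J n where mn: "bij_betw m I J" "bij_betw n J I" "small \<kappa> J" "\<forall>i\<in>I. n (m i) = i"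
    using small_reindex[OF I] by blast
  obtain F where F: "F \<subseteq> J" "finite F" "supported (\<lambda>j. \<iota> (n j)) F f"
    using compact_supported_index[OF x mn(3) coproduct_reindex[OF mn(2) cop] f] by blast
  have "n ` F \<subseteq> I" using F(1) bij_betw_imp_surj_on[OF mn(2)] by blast
  then show ?thesis using F(2) supported_image[of \<iota> n F f, OF F(3)] by blast
qed

text \<open>Conversely, finite supports give back the bijection of the definition. A family is
  recovered from its sum by the projections, whence injectivity; surjectivity is
  \<open>supported_expand\<close>.\<close>

lemma compactI:
  assumes x: "x \<in> Obj T"
    and supp: "\<And>(I :: 'u set) y c \<iota> f. small \<kappa> I \<Longrightarrow> is_coproduct T I y c \<iota> \<Longrightarrow>
      f \<in> Arr T \<Longrightarrow> Dom T f = x \<Longrightarrow> Cod T f = c \<Longrightarrow> \<exists>F\<subseteq>I. finite F \<and> supported \<iota> F f"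
  shows "compact_ob \<kappa> T x"
  unfolding compact_ob_def
proof (intro conjI allI impI x, elim conjE)
  fix I :: "'u set" and y c \<iota>
  assume I: "small \<kappa> I" and cop: "is_coproduct T I y c \<iota>"
  note a = coproduct_arr[OF cop] and o = coproduct_summand_obj[OF cop]
  obtain p where p: "\<And>i. i \<in> I \<Longrightarrow> p i \<in> Arr T" "\<And>i. i \<in> I \<Longrightarrow> Dom T (p i) = c" "\<And>i. i \<in> I \<Longrightarrow> Cod T (p i) = y i"
    "\<And>i. i \<in> I \<Longrightarrow> p i \<cdot> \<iota> i = Ide T (y i)"
    "\<And>i j. i \<in> I \<Longrightarrow> j \<in> I \<Longrightarrow> j \<noteq> i \<Longrightarrow> p i \<cdot> \<iota> j = \<z> (y j) (y i)"
    using coproduct_proj[OF cop] by auto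
  define S where "S \<phi> = {i\<in>I. \<phi> i \<noteq> \<z> x (y i)}" for \<phi>
  define P where "P = {\<phi> \<in> (\<Pi>\<^sub>E i\<in>I. Hom T x (y i)). finite (S \<phi>)}"
  define \<Phi> where "\<Phi> \<phi> = finprod (hgrp T x c) (\<lambda>i. \<iota> i \<cdot> \<phi> i) (S \<phi>)" for \<phi>
  interpret X: comm_group "hgrp T x c" by (rule comm_group_Hom) (use x a in simp_all)
  have \<phi>i: "\<phi> i \<in> Arr T \<and> Dom T (\<phi> i) = x \<and> Cod T (\<phi> i) = y i" if "\<phi> \<in> P" "i \<in> I" for \<phi> i
    using PiE_mem[of \<phi> I "\<lambda>i. Hom T x (y i)" i] that unfolding P_def by simp
  have ar: "\<forall>i\<in>S \<phi>. \<iota> i \<cdot> \<phi> i \<in> Arr T \<and> Dom T (\<iota> i \<cdot> \<phi> i) = x \<and> Cod T (\<iota> i \<cdot> \<phi> i) = c" if "\<phi> \<in> P" for \<phi>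
    using a \<phi>i[OF that] unfolding S_def by simp
  have p\<Phi>: "p j \<cdot> \<Phi> \<phi> = \<phi> j" if \<phi>: "\<phi> \<in> P" and j: "j \<in> I" for \<phi> j
  proof -
    have fin: "finite (S \<phi>)" using \<phi> unfolding P_def by blast
    interpret Y: comm_group "hgrp T x (y j)" by (rule comm_group_Hom) (use x o[OF j] in simp_all)
    have "p j \<cdot> \<Phi> \<phi> = finprod (hgrp T x (y j)) (\<lambda>i. p j \<cdot> (\<iota> i \<cdot> \<phi> i)) (S \<phi>)"
      unfolding \<Phi>_def by (rule comp_finprod[OF fin ar[OF \<phi>]]) (use p j x in simp_all)
    also have "\<dots> = finprod (hgrp T x (y j)) (\<lambda>i. if j = i then \<phi> j else one (hgrp T x (y j))) (S \<phi>)"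
    proof (rule Y.finprod_cong')
      show "(\<lambda>i. if j = i then \<phi> j else one (hgrp T x (y j))) \<in> S \<phi> \<rightarrow> carrier (hgrp T x (y j))"
        using \<phi>i[OF \<phi> j] x o[OF j] by auto
      fix i assume "i \<in> S \<phi>"
      then have i: "i \<in> I" unfolding S_def by simp
      have "p j \<cdot> (\<iota> i \<cdot> \<phi> i) = (p j \<cdot> \<iota> i) \<cdot> \<phi> i"
        using a(2-4)[OF i] p(1-3)[OF j] \<phi>i[OF \<phi> i] by simp
      then show "p j \<cdot> (\<iota> i \<cdot> \<phi> i) = (if j = i then \<phi> j else one (hgrp T x (y j)))"
        using p(4)[OF j] p(5)[OF j i] \<phi>i[OF \<phi> i] o[OF j] by auto
    qed simp
    also have "\<dots> = \<phi> j"
    proof (cases "j \<in> S \<phi>")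
      case True
      show ?thesis by (rule Y.finprod_singleton[OF True fin]) (use \<phi>i[OF \<phi> j] in simp)
    next
      case False
      then have "\<phi> j = one (hgrp T x (y j))" using j unfolding S_def by simp
      moreover from this have "finprod (hgrp T x (y j)) (\<lambda>i. if j = i then \<phi> j else one (hgrp T x (y j))) (S \<phi>) =
          one (hgrp T x (y j))"
        by (intro Y.finprod_one_eqI) (simp only: if_cancel)
      ultimately show ?thesis by (simp only:)
    qed
    finally show ?thesis .
  qed
  have "bij_betw \<Phi> P (Hom T x c)"
  proof (rule bij_betw_imageI)
    show "inj_on \<Phi> P"
    proof (rule inj_onI)
      fix \<phi> \<psi> assume P: "\<phi> \<in> P" "\<psi> \<in> P" and eq: "\<Phi> \<phi> = \<Phi> \<psi>"
      show "\<phi> = \<psi>"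
      proof (rule PiE_ext)
        show "\<phi> \<in> (\<Pi>\<^sub>E i\<in>I. Hom T x (y i))" "\<psi> \<in> (\<Pi>\<^sub>E i\<in>I. Hom T x (y i))" using P unfolding P_def by simp_all
        show "\<phi> j = \<psi> j" if "j \<in> I" for j
          using p\<Phi>[OF P(1) that] p\<Phi>[OF P(2) that] eq by simp
      qed
    qed
    show "\<Phi> ` P = Hom T x c"
    proof (intro subset_antisym subsetI)
      fix f assume "f \<in> \<Phi> ` P"
      then obtain \<phi> where \<phi>: "\<phi> \<in> P" "f = \<Phi> \<phi>" by blast
      have "(\<lambda>i. \<iota> i \<cdot> \<phi> i) \<in> S \<phi> \<rightarrow> carrier (hgrp T x c)" using ar[OF \<phi>(1)] by simp
      then have "\<Phi> \<phi> \<in> carrier (hgrp T x c)" unfolding \<Phi>_def by (rule X.finprod_closed)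
      then show "f \<in> Hom T x c" using \<phi>(2) by simp
    next
      fix f assume "f \<in> Hom T x c"
      then have f: "f \<in> Arr T" "Dom T f = x" "Cod T f = c" by simp_all
      obtain F where F: "F \<subseteq> I" "finite F" "supported \<iota> F f" using supp[OF I cop f] by blast
      define \<phi> where "\<phi> = (\<lambda>i\<in>I. p i \<cdot> f)"
      \<comment> \<open>Outside \<open>F\<close> the projection \<open>p i\<close> agrees with the
        zero map on all summands in \<open>F\<close>, hence also after \<open>f\<close>. So the
        family of components is zero outside \<open>F\<close>.\<close>
      have "p i \<cdot> f = \<z> x (y i)" if i: "i \<in> I" "i \<notin> F" for i
      proof -
        have "p i \<cdot> f = \<z> c (y i) \<cdot> f"
        proof (rule supportedD[OF F(3)], safe?)
          fix j assume j: "j \<in> F"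
          then have jI: "j \<in> I" using F(1) by blast
          have "j \<noteq> i" using j i by blast
          then show "p i \<cdot> \<iota> j = \<z> c (y i) \<cdot> \<iota> j"
            using p(5)[OF i(1) jI] a(1) a(2-4)[OF jI] o[OF i(1)] by simp
        qed (use p i f a o in simp_all)
        then show ?thesis using f a o[OF i(1)] by simp
      qed
      then have SF: "S \<phi> \<subseteq> F" unfolding S_def \<phi>_def by auto
      then have "finite (S \<phi>)" using F(2) finite_subset by blast
      then have \<phi>: "\<phi> \<in> P" unfolding P_def \<phi>_def using p f by auto
      have "f = finprod (hgrp T x c) (\<lambda>i. \<iota> i \<cdot> (p i \<cdot> f)) F"
        by (rule supported_expand[OF cop F f p])
      also have "\<dots> = \<Phi> \<phi>"
        unfolding \<Phi>_def
      proof (rule X.finprod_mono_neutral_cong_left[symmetric, OF F(2) SF])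
        show "\<iota> i \<cdot> (p i \<cdot> f) = one (hgrp T x c)" if "i \<in> F - S \<phi>" for i
        proof -
          have i: "i \<in> I" "p i \<cdot> f = \<z> x (y i)" using that F(1) unfolding S_def \<phi>_def by auto
          show ?thesis unfolding i(2) using a(2-4)[OF i(1)] x by simp
        qed
        show "\<iota> i \<cdot> \<phi> i = \<iota> i \<cdot> (p i \<cdot> f)" if "i \<in> S \<phi>" for i
          using that unfolding S_def \<phi>_def by simp
        show "(\<lambda>i. \<iota> i \<cdot> (p i \<cdot> f)) \<in> F \<rightarrow> carrier (hgrp T x c)"
          using F(1) a p(1-3) f by (auto simp: subset_iff)
      qed
      finally show "f \<in> \<Phi> ` P" using \<phi> by blast
    qed
  qed
  then show "bij_betw (\<lambda>\<phi>. finprod (hgrp T x c) (\<lambda>i. \<iota> i \<cdot> \<phi> i) {i\<in>I. \<phi> i \<noteq> \<z> x (y i)})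
          {\<phi> \<in> (\<Pi>\<^sub>E i\<in>I. Hom T x (y i)). finite {i\<in>I. \<phi> i \<noteq> \<z> x (y i)}} (Hom T x c)"
    unfolding \<Phi>_def P_def S_def .
qed

lemma supportedI:
  assumes "\<And>g g'. g \<in> Arr T \<Longrightarrow> g' \<in> Arr T \<Longrightarrow> Dom T g = Cod T f \<Longrightarrow> Dom T g' = Cod T f \<Longrightarrow>
     Cod T g = Cod T g' \<Longrightarrow> \<forall>i\<in>F. g \<cdot> \<iota> i = g' \<cdot> \<iota> i \<Longrightarrow> g \<cdot> f = g' \<cdot> f"
  shows "supported \<iota> F f"
  unfolding supported_def using assms by blast

lemma compact_iso:
  assumes x: "compact_ob \<kappa> T x" and iso: "isomorphic T x x'"
  shows "compact_ob \<kappa> T x'"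
proof (rule compactI)
  show "x' \<in> Obj T" using isomorphic_obj[OF iso] by blast
  obtain u where u: "iso_arr T u" "Dom T u = x" "Cod T u = x'" using iso unfolding isomorphic_iff by blast
  note u' = iso_arr_in_arr[OF u(1)]
  fix I :: "'u set" and y c \<iota> f
  assume I: "small \<kappa> I" and cop: "is_coproduct T I y c \<iota>" and f: "f \<in> Arr T" "Dom T f = x'" "Cod T f = c"
  have "\<exists>F\<subseteq>I. finite F \<and> supported \<iota> F (f \<cdot> u)"
    by (rule compact_supported[OF x I cop]) (use f u u' in simp_all)
  then obtain F where F: "F \<subseteq> I" "finite F" "supported \<iota> F (f \<cdot> u)" by blast
  have "supported \<iota> F f"
  proof (rule supportedI)
    fix g g' assume g: "g \<in> Arr T" "g' \<in> Arr T" "Dom T g = Cod T f" "Dom T g' = Cod T f"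
     "Cod T g = Cod T g'" "\<forall>i\<in>F. g \<cdot> \<iota> i = g' \<cdot> \<iota> i"
    have "g \<cdot> (f \<cdot> u) = g' \<cdot> (f \<cdot> u)"
      by (rule supportedD[OF F(3)]) (use g f u u' in simp_all)
    then have "(g \<cdot> f) \<cdot> u = (g' \<cdot> f) \<cdot> u" using g(1-4) f u u' by simp
    then show "g \<cdot> f = g' \<cdot> f" by (rule iso_arr_cancel_right[OF u(1)]) (use g(1-4) f u in simp_all)
  qed
  then show "\<exists>F\<subseteq>I. finite F \<and> supported \<iota> F f" using F by blast
qed

lemma compact_zero: "zero_ob T z \<Longrightarrow> compact_ob \<kappa> T z"
proof (rule compactI)
  assume z: "zero_ob T z"
  note o = zero_ob_obj[OF z]
  show "z \<in> Obj T" by (rule o)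
  fix I :: "'u set" and y c \<iota> f
  assume "is_coproduct T I y c \<iota>" and f: "f \<in> Arr T" "Dom T f = z" "Cod T f = c"
  have c: "c \<in> Obj T" using f by auto
  have fz: "f = \<z> z c" using zero_ob_from[OF z f(1,2)] f by simp
  have "supported \<iota> {} f"
    by (rule supportedI) (use fz o c in simp)
  then show "\<exists>F\<subseteq>I. finite F \<and> supported \<iota> F f" by blast
qed

text \<open>The finite supports of the two restrictions unite to a support, because maps out of
  \<open>s\<close> are determined on the two summands.\<close>

lemma compact_coproduct2:
  assumes x: "compact_ob \<kappa> T x1" "compact_ob \<kappa> T x2"
    and cop: "is_coproduct T UNIV (\<lambda>b. if b then x1 else x2) s j"
  shows "compact_ob \<kappa> T s"
proof (rule compactI)
  note a = coproduct_arr[OF cop, simplified]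
  show "s \<in> Obj T" by (rule a)
  fix I :: "'u set" and y c \<iota> f
  assume I: "small \<kappa> I" and cop': "is_coproduct T I y c \<iota>" and f: "f \<in> Arr T" "Dom T f = s" "Cod T f = c"
  have "\<exists>F\<subseteq>I. finite F \<and> supported \<iota> F (f \<cdot> j True)"
    by (rule compact_supported[OF x(1) I cop']) (use f a in simp_all)
  then obtain F where F: "F \<subseteq> I" "finite F" "supported \<iota> F (f \<cdot> j True)" by blast
  have "\<exists>F\<subseteq>I. finite F \<and> supported \<iota> F (f \<cdot> j False)"
    by (rule compact_supported[OF x(2) I cop']) (use f a in simp_all)
  then obtain G where G: "G \<subseteq> I" "finite G" "supported \<iota> G (f \<cdot> j False)" by blast
  have "supported \<iota> (F \<union> G) f"
  proof (rule supportedI)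
    fix g g' assume g: "g \<in> Arr T" "g' \<in> Arr T" "Dom T g = Cod T f" "Dom T g' = Cod T f"
     "Cod T g = Cod T g'" "\<forall>i\<in>F \<union> G. g \<cdot> \<iota> i = g' \<cdot> \<iota> i"
    show "g \<cdot> f = g' \<cdot> f"
    proof (rule coproduct_arr_unique[OF cop])
      fix b
      have 1: "g \<cdot> (f \<cdot> j True) = g' \<cdot> (f \<cdot> j True)"
        by (rule supportedD[OF F(3)]) (use g f a in simp_all)
      have 2: "g \<cdot> (f \<cdot> j False) = g' \<cdot> (f \<cdot> j False)"
        by (rule supportedD[OF G(3)]) (use g f a in simp_all)
      show "(g \<cdot> f) \<cdot> j b = (g' \<cdot> f) \<cdot> j b"
        using 1 2 g(1-4) f a by (cases b) simp_all
    qed (use g f in simp_all)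
  qed
  then show "\<exists>F\<subseteq>I. finite F \<and> supported \<iota> F f" using F(1,2) G(1,2) by (intro exI[of _ "F \<union> G"]) simp
qed

text \<open>An equivalence preserves coproducts. Test objects are not literally suspensions, so each
  is desuspended up to an isomorphism \<open>u\<close>, and fullness and faithfulness transport the
  universal property.\<close>

lemma coproduct_shift:
  assumes cop: "is_coproduct T I y c \<iota>"
  shows "is_coproduct T I (\<lambda>i. \<Sigma>\<^sub>o (y i)) (\<Sigma>\<^sub>o c) (\<lambda>i. \<Sigma>\<^sub>a (\<iota> i))"
proof (rule is_coproductI)
  note a = coproduct_arr[OF cop] and o = coproduct_summand_obj[OF cop]
  show "\<Sigma>\<^sub>o c \<in> Obj T" using a by simp
  show "\<forall>i\<in>I. \<Sigma>\<^sub>a (\<iota> i) \<in> Arr T \<and> Dom T (\<Sigma>\<^sub>a (\<iota> i)) = \<Sigma>\<^sub>o (y i) \<and> Cod T (\<Sigma>\<^sub>a (\<iota> i)) = \<Sigma>\<^sub>o c"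
    using a by simp
next
  note a = coproduct_arr[OF cop] and o = coproduct_summand_obj[OF cop]
  fix w f assume w: "w \<in> Obj T" and f: "\<forall>i\<in>I. f i \<in> Arr T \<and> Dom T (f i) = \<Sigma>\<^sub>o (y i) \<and> Cod T (f i) = w"
  obtain w' u where u: "w' \<in> Obj T" "iso_arr T u" "Dom T u = \<Sigma>\<^sub>o w'" "Cod T u = w" using desuspension[OF w] by blast
  note u' = iso_arr_in_arr[OF u(2)]
  have "\<exists>k. k \<in> Arr T \<and> Dom T k = y i \<and> Cod T k = w' \<and> \<Sigma>\<^sub>a k = inv_arr T u \<cdot> f i" if "i \<in> I" for i
    by (rule shift_full) (use u u' f that o in simp_all)
  then obtain k where k: "\<forall>i\<in>I. k i \<in> Arr T \<and> Dom T (k i) = y i \<and> Cod T (k i) = w' \<and> \<Sigma>\<^sub>a (k i) = inv_arr T u \<cdot> f i"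
    by metis
  have "\<exists>h. h \<in> Arr T \<and> Dom T h = c \<and> Cod T h = w' \<and> (\<forall>i\<in>I. h \<cdot> \<iota> i = k i)"
    by (rule coproduct_arr_ex[OF cop u(1)]) (use k in blast)
  then obtain h where h: "h \<in> Arr T" "Dom T h = c" "Cod T h = w'" "\<forall>i\<in>I. h \<cdot> \<iota> i = k i" by blast
  have "(u \<cdot> \<Sigma>\<^sub>a h) \<cdot> \<Sigma>\<^sub>a (\<iota> i) = f i" if i: "i \<in> I" for i
  proof -
    have "(u \<cdot> \<Sigma>\<^sub>a h) \<cdot> \<Sigma>\<^sub>a (\<iota> i) = u \<cdot> \<Sigma>\<^sub>a (h \<cdot> \<iota> i)"
      using h(1-3) a(2-4)[OF i] u u' by (simp add: shift_comp)
    also have "\<dots> = u \<cdot> (inv_arr T u \<cdot> f i)" using h(4) k i by simp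
    also have "\<dots> = f i" using u u' f i by simp
    finally show ?thesis .
  qed
  then show "\<exists>h. h \<in> Arr T \<and> Dom T h = \<Sigma>\<^sub>o c \<and> Cod T h = w \<and> (\<forall>i\<in>I. h \<cdot> \<Sigma>\<^sub>a (\<iota> i) = f i)"
    using h u u' by (intro exI[of _ "u \<cdot> \<Sigma>\<^sub>a h"]) simp
next
  note a = coproduct_arr[OF cop] and o = coproduct_summand_obj[OF cop]
  fix g h assume gh: "g \<in> Arr T" "h \<in> Arr T" "Dom T g = \<Sigma>\<^sub>o c" "Dom T h = \<Sigma>\<^sub>o c" "Cod T g = Cod T h"
    "\<forall>i\<in>I. g \<cdot> \<Sigma>\<^sub>a (\<iota> i) = h \<cdot> \<Sigma>\<^sub>a (\<iota> i)"
  obtain w' u where u: "w' \<in> Obj T" "iso_arr T u" "Dom T u = \<Sigma>\<^sub>o w'" "Cod T u = Cod T h"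
    using desuspension[of "Cod T h"] gh(2) by auto
  note u' = iso_arr_in_arr[OF u(2)]
  have "\<exists>k. k \<in> Arr T \<and> Dom T k = c \<and> Cod T k = w' \<and> \<Sigma>\<^sub>a k = inv_arr T u \<cdot> g"
    by (rule shift_full) (use u u' gh a in simp_all)
  then obtain g' where g': "g' \<in> Arr T" "Dom T g' = c" "Cod T g' = w'" "\<Sigma>\<^sub>a g' = inv_arr T u \<cdot> g" by blast
  have "\<exists>k. k \<in> Arr T \<and> Dom T k = c \<and> Cod T k = w' \<and> \<Sigma>\<^sub>a k = inv_arr T u \<cdot> h"
    by (rule shift_full) (use u u' gh a in simp_all)
  then obtain h' where h': "h' \<in> Arr T" "Dom T h' = c" "Cod T h' = w'" "\<Sigma>\<^sub>a h' = inv_arr T u \<cdot> h" by blast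
  have "g' = h'"
  proof (rule coproduct_arr_unique[OF cop])
    fix i assume i: "i \<in> I"
    show "g' \<cdot> \<iota> i = h' \<cdot> \<iota> i"
    proof (rule shift_faithful)
      have "\<Sigma>\<^sub>a (g' \<cdot> \<iota> i) = inv_arr T u \<cdot> (g \<cdot> \<Sigma>\<^sub>a (\<iota> i))"
        using g' a(2-4)[OF i] gh(1,3,5) u u' by (simp add: shift_comp)
      also have "\<dots> = inv_arr T u \<cdot> (h \<cdot> \<Sigma>\<^sub>a (\<iota> i))" using gh(6) i by simp
      also have "\<dots> = \<Sigma>\<^sub>a (h' \<cdot> \<iota> i)"
        using h' a(2-4)[OF i] gh(2,4,5) u u' by (simp add: shift_comp)
      finally show "\<Sigma>\<^sub>a (g' \<cdot> \<iota> i) = \<Sigma>\<^sub>a (h' \<cdot> \<iota> i)" .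
    qed (use g' h' a(2-4)[OF i] in simp_all)
  qed (use g' h' in simp_all)
  then have "inv_arr T u \<cdot> g = inv_arr T u \<cdot> h" using g'(4) h'(4) by simp
  then show "g = h"
    by (rule iso_arr_cancel_left[OF iso_arr_inv[OF u(2)]]) (use gh(1-5) u u' in simp_all)
qed

lemma compact_unshift:
  assumes x: "x \<in> Obj T" and sx: "compact_ob \<kappa> T (\<Sigma>\<^sub>o x)"
  shows "compact_ob \<kappa> T x"
proof (rule compactI[OF x])
  fix I :: "'u set" and y c \<iota> f
  assume I: "small \<kappa> I" and cop: "is_coproduct T I y c \<iota>" and f: "f \<in> Arr T" "Dom T f = x" "Cod T f = c"
  note a = coproduct_arr[OF cop]
  have "\<exists>F\<subseteq>I. finite F \<and> supported (\<lambda>i. \<Sigma>\<^sub>a (\<iota> i)) F (\<Sigma>\<^sub>a f)"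
    by (rule compact_supported[OF sx I coproduct_shift[OF cop]]) (use f in simp_all)
  then obtain F where F: "F \<subseteq> I" "finite F" "supported (\<lambda>i. \<Sigma>\<^sub>a (\<iota> i)) F (\<Sigma>\<^sub>a f)" by blast
  have "supported \<iota> F f"
  proof (rule supportedI)
    fix g g' assume g: "g \<in> Arr T" "g' \<in> Arr T" "Dom T g = Cod T f" "Dom T g' = Cod T f"
     "Cod T g = Cod T g'" "\<forall>i\<in>F. g \<cdot> \<iota> i = g' \<cdot> \<iota> i"
    have e: "\<forall>i\<in>F. \<Sigma>\<^sub>a g \<cdot> \<Sigma>\<^sub>a (\<iota> i) = \<Sigma>\<^sub>a g' \<cdot> \<Sigma>\<^sub>a (\<iota> i)"
    proof
      fix i assume i: "i \<in> F"
      have iI: "i \<in> I" using i F(1) by blast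
      have "\<Sigma>\<^sub>a (g \<cdot> \<iota> i) = \<Sigma>\<^sub>a (g' \<cdot> \<iota> i)" using g(6) i by simp
      then show "\<Sigma>\<^sub>a g \<cdot> \<Sigma>\<^sub>a (\<iota> i) = \<Sigma>\<^sub>a g' \<cdot> \<Sigma>\<^sub>a (\<iota> i)"
        using a(2-4)[OF iI] g(1-4) f by (simp add: shift_comp)
    qed
    have "\<Sigma>\<^sub>a g \<cdot> \<Sigma>\<^sub>a f = \<Sigma>\<^sub>a g' \<cdot> \<Sigma>\<^sub>a f"
      by (rule supportedD[OF F(3) _ _ _ _ _ e]) (use g(1-5) f in simp_all)
    then have "\<Sigma>\<^sub>a (g \<cdot> f) = \<Sigma>\<^sub>a (g' \<cdot> f)" using g(1-4) f by (simp add: shift_comp)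
    then show "g \<cdot> f = g' \<cdot> f"
      by (rule shift_faithful) (use g(1-5) f in simp_all)
  qed
  then show "\<exists>F\<subseteq>I. finite F \<and> supported \<iota> F f" using F by blast
qed

notation unit_ob ("\<I>")

text \<open>Meant for a map \<open>k\<close> between coproducts that is induced summand by summand
  by the maps \<open>u i\<close>: such a map does not enlarge supports.\<close>

lemma supported_comp:
  assumes supp: "supported \<iota>' F f" and f: "f \<in> Arr T"
    and k: "k \<in> Arr T" "Dom T k = Cod T f"
    and \<iota>': "\<forall>i\<in>F. \<iota>' i \<in> Arr T \<and> Cod T (\<iota>' i) = Cod T f"
    and \<iota>: "\<forall>i\<in>F. \<iota> i \<in> Arr T \<and> Cod T (\<iota> i) = Cod T k"
    and u: "\<forall>i\<in>F. u i \<in> Arr T \<and> Cod T (u i) = Dom T (\<iota> i) \<and> k \<cdot> \<iota>' i = \<iota> i \<cdot> u i"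
  shows "supported \<iota> F (k \<cdot> f)"
proof (rule supportedI)
  fix g g' assume g: "g \<in> Arr T" "g' \<in> Arr T" "Dom T g = Cod T (k \<cdot> f)" "Dom T g' = Cod T (k \<cdot> f)"
     "Cod T g = Cod T g'" "\<forall>i\<in>F. g \<cdot> \<iota> i = g' \<cdot> \<iota> i"
  have "(g \<cdot> k) \<cdot> f = (g' \<cdot> k) \<cdot> f"
  proof (rule supportedD[OF supp])
    show "\<forall>i\<in>F. (g \<cdot> k) \<cdot> \<iota>' i = (g' \<cdot> k) \<cdot> \<iota>' i"
    proof
      fix i assume i: "i \<in> F"
      note \<iota>i = \<iota>[rule_format, OF i] and \<iota>'i = \<iota>'[rule_format, OF i] and ui = u[rule_format, OF i]
      have "(g \<cdot> k) \<cdot> \<iota>' i = g \<cdot> (\<iota> i \<cdot> u i)" using \<iota>'i ui g(1,3) k f by simp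
      also have "\<dots> = (g \<cdot> \<iota> i) \<cdot> u i" using \<iota>i ui g(1,3) k f by simp
      also have "\<dots> = (g' \<cdot> \<iota> i) \<cdot> u i" using g(6) i by simp
      also have "\<dots> = g' \<cdot> (\<iota> i \<cdot> u i)" using \<iota>i ui g(2,4) k f by simp
      also have "\<dots> = (g' \<cdot> k) \<cdot> \<iota>' i" using \<iota>'i ui g(2,4) k f by simp
      finally show "(g \<cdot> k) \<cdot> \<iota>' i = (g' \<cdot> k) \<cdot> \<iota>' i" .
    qed
  qed (use g(1-5) k f in simp_all)
  then show "g \<cdot> (k \<cdot> f) = g' \<cdot> (k \<cdot> f)" using g(1-4) k f by simp
qed

lemma supported_shift:
  assumes supp: "supported \<iota> F f" and f: "f \<in> Arr T"
    and \<iota>: "\<forall>i\<in>F. \<iota> i \<in> Arr T \<and> Cod T (\<iota> i) = Cod T f"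
  shows "supported (\<lambda>i. \<Sigma>\<^sub>a (\<iota> i)) F (\<Sigma>\<^sub>a f)"
proof (rule supportedI)
  fix g h assume gh: "g \<in> Arr T" "h \<in> Arr T" "Dom T g = Cod T (\<Sigma>\<^sub>a f)" "Dom T h = Cod T (\<Sigma>\<^sub>a f)" "Cod T g = Cod T h"
    "\<forall>i\<in>F. g \<cdot> \<Sigma>\<^sub>a (\<iota> i) = h \<cdot> \<Sigma>\<^sub>a (\<iota> i)"
  let ?c = "Cod T f"
  obtain w' u where u: "w' \<in> Obj T" "iso_arr T u" "Dom T u = \<Sigma>\<^sub>o w'" "Cod T u = Cod T h"
    using desuspension[of "Cod T h"] gh(2) by auto
  note u' = iso_arr_in_arr[OF u(2)]
  have "\<exists>k. k \<in> Arr T \<and> Dom T k = ?c \<and> Cod T k = w' \<and> \<Sigma>\<^sub>a k = inv_arr T u \<cdot> g"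
    by (rule shift_full) (use u u' gh(1-5) f in simp_all)
  then obtain g' where g': "g' \<in> Arr T" "Dom T g' = ?c" "Cod T g' = w'" "\<Sigma>\<^sub>a g' = inv_arr T u \<cdot> g" by blast
  have "\<exists>k. k \<in> Arr T \<and> Dom T k = ?c \<and> Cod T k = w' \<and> \<Sigma>\<^sub>a k = inv_arr T u \<cdot> h"
    by (rule shift_full) (use u u' gh(1-5) f in simp_all)
  then obtain h' where h': "h' \<in> Arr T" "Dom T h' = ?c" "Cod T h' = w'" "\<Sigma>\<^sub>a h' = inv_arr T u \<cdot> h" by blast
  have "g' \<cdot> f = h' \<cdot> f"
  proof (rule supportedD[OF supp])
    show "\<forall>i\<in>F. g' \<cdot> \<iota> i = h' \<cdot> \<iota> i"
    proof
      fix i assume i: "i \<in> F"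
      note \<iota>i = \<iota>[rule_format, OF i]
      show "g' \<cdot> \<iota> i = h' \<cdot> \<iota> i"
      proof (rule shift_faithful)
        have "\<Sigma>\<^sub>a (g' \<cdot> \<iota> i) = inv_arr T u \<cdot> (g \<cdot> \<Sigma>\<^sub>a (\<iota> i))"
          using g' \<iota>i gh(1,3,5) f u u' by (simp add: shift_comp)
        also have "\<dots> = inv_arr T u \<cdot> (h \<cdot> \<Sigma>\<^sub>a (\<iota> i))" using gh(6) i by simp
        also have "\<dots> = \<Sigma>\<^sub>a (h' \<cdot> \<iota> i)"
          using h' \<iota>i gh(2,4,5) f u u' by (simp add: shift_comp)
        finally show "\<Sigma>\<^sub>a (g' \<cdot> \<iota> i) = \<Sigma>\<^sub>a (h' \<cdot> \<iota> i)" .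
      qed (use g' h' \<iota>i f in simp_all)
    qed
  qed (use g' h' in simp_all)
  then have "\<Sigma>\<^sub>a (g' \<cdot> f) = \<Sigma>\<^sub>a (h' \<cdot> f)" by simp
  then have "inv_arr T u \<cdot> (g \<cdot> \<Sigma>\<^sub>a f) = inv_arr T u \<cdot> (h \<cdot> \<Sigma>\<^sub>a f)"
    using g' h' f gh(1-5) u u' by (simp add: shift_comp)
  then show "g \<cdot> \<Sigma>\<^sub>a f = h \<cdot> \<Sigma>\<^sub>a f"
    by (rule iso_arr_cancel_left[OF iso_arr_inv[OF u(2)]]) (use gh(1-5) f u u' in simp_all)
qed

text \<open>Harder than \<open>compact_unshift\<close>, since the target coproduct need not be a
  suspension. Its summands are desuspended, the coproduct \<open>c'\<close> of the results is
  formed, and \<open>\<Sigma>c'\<close> is compared with \<open>c\<close> by \<open>k\<close>. A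
  right inverse \<open>m\<close> of \<open>k\<close> suffices: \<open>m \<cdot> f\<close>
  desuspends, has finite support, and \<open>k\<close> carries that support back to
  \<open>f\<close>.\<close>

lemma compact_shift:
  assumes x: "compact_ob \<kappa> T x"
  shows "compact_ob \<kappa> T (\<Sigma>\<^sub>o x)"
proof (rule compactI)
  note xo = compact_obj[OF x]
  show "\<Sigma>\<^sub>o x \<in> Obj T" using xo by simp
  fix I :: "'u set" and y c \<iota> f
  assume I: "small \<kappa> I" and cop: "is_coproduct T I y c \<iota>" and f: "f \<in> Arr T" "Dom T f = \<Sigma>\<^sub>o x" "Cod T f = c"
  note a = coproduct_arr[OF cop] and o = coproduct_summand_obj[OF cop]
  have "\<forall>i\<in>I. \<exists>y' u. y' \<in> Obj T \<and> iso_arr T u \<and> Dom T u = \<Sigma>\<^sub>o y' \<and> Cod T u = y i"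
    using desuspension o by blast
  then obtain y' u where yu: "\<forall>i\<in>I. y' i \<in> Obj T \<and> iso_arr T (u i) \<and> Dom T (u i) = \<Sigma>\<^sub>o (y' i) \<and> Cod T (u i) = y i"
    by metis
  then have u': "\<forall>i\<in>I. u i \<in> Arr T" using iso_arr_in_arr by blast
  obtain c' \<iota>' where cop': "is_coproduct T I y' c' \<iota>'" using coproduct_exists[OF I, of y'] yu by blast
  note a' = coproduct_arr[OF cop']
  note cops = coproduct_shift[OF cop']
  have "\<exists>k. k \<in> Arr T \<and> Dom T k = \<Sigma>\<^sub>o c' \<and> Cod T k = c \<and> (\<forall>i\<in>I. k \<cdot> \<Sigma>\<^sub>a (\<iota>' i) = \<iota> i \<cdot> u i)"
    by (rule coproduct_arr_ex[OF cops a(1)]) (use a yu u' in simp)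
  then obtain k where k: "k \<in> Arr T" "Dom T k = \<Sigma>\<^sub>o c'" "Cod T k = c" "\<forall>i\<in>I. k \<cdot> \<Sigma>\<^sub>a (\<iota>' i) = \<iota> i \<cdot> u i" by blast
  have "\<exists>m. m \<in> Arr T \<and> Dom T m = c \<and> Cod T m = \<Sigma>\<^sub>o c' \<and> (\<forall>i\<in>I. m \<cdot> \<iota> i = \<Sigma>\<^sub>a (\<iota>' i) \<cdot> inv_arr T (u i))"
    by (rule coproduct_arr_ex[OF cop]) (use a' yu u' in simp_all)
  then obtain m where m: "m \<in> Arr T" "Dom T m = c" "Cod T m = \<Sigma>\<^sub>o c'" "\<forall>i\<in>I. m \<cdot> \<iota> i = \<Sigma>\<^sub>a (\<iota>' i) \<cdot> inv_arr T (u i)" by blast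
  have km: "k \<cdot> m = Ide T c"
  proof (rule coproduct_arr_unique[OF cop])
    fix i assume i: "i \<in> I"
    note ui = yu[rule_format, OF i] u'[rule_format, OF i]
    have "(k \<cdot> m) \<cdot> \<iota> i = k \<cdot> (\<Sigma>\<^sub>a (\<iota>' i) \<cdot> inv_arr T (u i))" using k(1,2) m i a by simp
    also have "\<dots> = (\<iota> i \<cdot> u i) \<cdot> inv_arr T (u i)"
      by (rule comp_eq_left) (use k i a'(2-4)[OF i] ui in simp_all)
    also have "\<dots> = Ide T c \<cdot> \<iota> i" using a(2-4)[OF i] ui by simp
    finally show "(k \<cdot> m) \<cdot> \<iota> i = Ide T c \<cdot> \<iota> i" .
  qed (use k m a in simp_all)
  have "\<exists>f'. f' \<in> Arr T \<and> Dom T f' = x \<and> Cod T f' = c' \<and> \<Sigma>\<^sub>a f' = m \<cdot> f"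
    by (rule shift_full) (use m f xo a' in simp_all)
  then obtain f' where f': "f' \<in> Arr T" "Dom T f' = x" "Cod T f' = c'" "\<Sigma>\<^sub>a f' = m \<cdot> f" by blast
  obtain F where F: "F \<subseteq> I" "finite F" "supported \<iota>' F f'"
    using compact_supported[OF x I cop' f'(1-3)] by blast
  have FI: "i \<in> I" if "i \<in> F" for i using that F(1) by blast
  have s: "supported (\<lambda>i. \<Sigma>\<^sub>a (\<iota>' i)) F (\<Sigma>\<^sub>a f')"
    by (rule supported_shift[OF F(3) f'(1)]) (use a' f' FI in simp)
  have "supported \<iota> F (k \<cdot> \<Sigma>\<^sub>a f')"
    by (rule supported_comp[OF s, where u=u]) (use f'(1-3) k a a' FI yu u' in simp_all)
  moreover have "k \<cdot> \<Sigma>\<^sub>a f' = f"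
    unfolding f'(4) using comp_eq_left[OF km, of f] k(1,2) m(1-3) f by simp
  ultimately show "\<exists>F\<subseteq>I. finite F \<and> supported \<iota> F f" using F(1,2) by auto
qed

lemma compact_desuspension:
  assumes "compact_ob \<kappa> T s"
  shows "\<exists>s' u. compact_ob \<kappa> T s' \<and> iso_arr T u \<and> Dom T u = \<Sigma>\<^sub>o s' \<and> Cod T u = s"
proof -
  obtain s' u where u: "s' \<in> Obj T" "iso_arr T u" "Dom T u = \<Sigma>\<^sub>o s'" "Cod T u = s"
    using desuspension[OF compact_obj[OF assms]] by blast
  then have "isomorphic T s (\<Sigma>\<^sub>o s')" using isomorphic_sym isomorphicI by blast
  then show ?thesis using u compact_unshift compact_iso[OF assms] by blast
qed

section \<open>Rigid objects and the compactness of tensor products\<close>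

lemma rigid_iff: "rigid_ob T x \<longleftrightarrow> (\<exists>y ev coev. dual_pair x y ev coev)"
  unfolding rigid_ob_def dual_pair_def by blast

lemma compact_iff_rigid: "compact_ob \<kappa> T x \<longleftrightarrow> rigid_ob T x"
proof -
  have "\<forall>x. compact_ob \<kappa> T x \<longleftrightarrow> rigid_ob T x"
    using rcg unfolding rigidly_compactly_generated_def by (elim conjE)
  then show ?thesis by blast
qed

lemma compact_dual:
  assumes "compact_ob \<kappa> T x"
  obtains y ev coev where "dual_pair x y ev coev"
  using assms unfolding compact_iff_rigid rigid_iff by blast

lemma compact_unit: "compact_ob \<kappa> T \<I>"
  unfolding compact_iff_rigid rigid_iff by (intro exI) (rule dual_pair_unit)

text \<open>The mate \<open>x \<rightarrow> c \<otimes> y'\<close> of a map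
  \<open>x \<otimes> y \<rightarrow> c\<close> has finite support, since tensoring with
  \<open>y'\<close> preserves the coproduct; transposition is natural and injective, so the support
  is one for the original map.\<close>

lemma compact_tensor:
  assumes x: "compact_ob \<kappa> T x" and y: "compact_ob \<kappa> T y"
  shows "compact_ob \<kappa> T (x \<otimes>\<^sub>o y)"
proof (rule compactI)
  note xo = compact_obj[OF x] and yo = compact_obj[OF y]
  show "x \<otimes>\<^sub>o y \<in> Obj T" using xo yo by simp
  obtain y' ev coev where d: "dual_pair y y' ev coev" by (rule compact_dual[OF y])
  note y'o = dual_pairD(2)[OF d]
  fix I :: "'u set" and z c \<iota> f
  assume I: "small \<kappa> I" and cop: "is_coproduct T I z c \<iota>"
    and f: "f \<in> Arr T" "Dom T f = x \<otimes>\<^sub>o y" "Cod T f = c"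
  note a = coproduct_arr[OF cop]
  note t = transp_arr[OF d xo f(1,2)]
  have "\<exists>F\<subseteq>I. finite F \<and> supported (\<lambda>i. \<iota> i \<otimes>\<^sub>a Ide T y') F (transp x y y' coev f)"
    by (rule compact_supported[OF x I coproduct_tensor[OF I cop y'o]]) (use t f in simp_all)
  then obtain F where F: "F \<subseteq> I" "finite F" "supported (\<lambda>i. \<iota> i \<otimes>\<^sub>a Ide T y') F (transp x y y' coev f)" by blast
  have "supported \<iota> F f"
  proof (rule supportedI)
    fix g g' assume g: "g \<in> Arr T" "g' \<in> Arr T" "Dom T g = Cod T f" "Dom T g' = Cod T f"
     "Cod T g = Cod T g'" "\<forall>i\<in>F. g \<cdot> \<iota> i = g' \<cdot> \<iota> i"
    have e: "\<forall>i\<in>F. (g \<otimes>\<^sub>a Ide T y') \<cdot> (\<iota> i \<otimes>\<^sub>a Ide T y') = (g' \<otimes>\<^sub>a Ide T y') \<cdot> (\<iota> i \<otimes>\<^sub>a Ide T y')"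
    proof
      fix i assume i: "i \<in> F"
      then have iI: "i \<in> I" using F(1) by blast
      show "(g \<otimes>\<^sub>a Ide T y') \<cdot> (\<iota> i \<otimes>\<^sub>a Ide T y') = (g' \<otimes>\<^sub>a Ide T y') \<cdot> (\<iota> i \<otimes>\<^sub>a Ide T y')"
        using g(1-4) g(6)[rule_format, OF i] a(2-4)[OF iI] y'o f by simp
    qed
    have "(g \<otimes>\<^sub>a Ide T y') \<cdot> transp x y y' coev f = (g' \<otimes>\<^sub>a Ide T y') \<cdot> transp x y y' coev f"
      by (rule supportedD[OF F(3) _ _ _ _ _ e]) (use g(1-5) t y'o in simp_all)
    then have tr: "transp x y y' coev (g \<cdot> f) = transp x y y' coev (g' \<cdot> f)"
      using transp_comp[OF d xo f(1,2)] g(1-4) by simp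
    show "g \<cdot> f = g' \<cdot> f"
      by (rule transp_inj[OF d xo _ _ _ _ _ tr]) (use g(1-5) f in simp_all)
  qed
  then show "\<exists>F\<subseteq>I. finite F \<and> supported \<iota> F f" using F by blast
qed

section \<open>Mapping telescopes\<close>

text \<open>The homotopy colimit of the sequence \<open>E\<close> is the object
  \<open>Cod T j\<close>, the cone of the identity minus the shift on the countable coproduct
  \<open>B\<close>. It is described by a triangle and not chosen.\<close>

definition telescope where
  "telescope E \<phi> B \<iota> s j h \<longleftrightarrow> (\<forall>n. E n \<in> Obj T) \<and>
     (\<forall>n. \<phi> n \<in> Arr T \<and> Dom T (\<phi> n) = E n \<and> Cod T (\<phi> n) = E (Suc n)) \<and>
     is_coproduct T (UNIV :: nat set) E B \<iota> \<and> (s, j, h) \<in> Tri T \<and> Dom T s = B \<and> Cod T s = B \<and>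
     (\<forall>n. s \<cdot> \<iota> n = diff (\<iota> n) (\<iota> (Suc n) \<cdot> \<phi> n))"

lemma telescope_exists:
  assumes E: "\<forall>n. E n \<in> Obj T" and \<phi>: "\<forall>n. \<phi> n \<in> Arr T \<and> Dom T (\<phi> n) = E n \<and> Cod T (\<phi> n) = E (Suc n)"
  shows "\<exists>B \<iota> s j h. telescope E \<phi> B \<iota> s j h"
proof -
  obtain B \<iota> where cop: "is_coproduct T (UNIV :: nat set) E B \<iota>"
    using coproduct_exists[OF small_nat, of E] E by blast
  note a = coproduct_arr[OF cop, simplified]
  have "\<exists>s. s \<in> Arr T \<and> Dom T s = B \<and> Cod T s = B \<and> (\<forall>n\<in>UNIV. s \<cdot> \<iota> n = diff (\<iota> n) (\<iota> (Suc n) \<cdot> \<phi> n))"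
    by (rule coproduct_arr_ex[OF cop a(1)]) (use a \<phi> in simp)
  then obtain s where s: "s \<in> Arr T" "Dom T s = B" "Cod T s = B" "\<forall>n. s \<cdot> \<iota> n = diff (\<iota> n) (\<iota> (Suc n) \<cdot> \<phi> n)" by blast
  obtain j h where "(s, j, h) \<in> Tri T" using tri_exists[OF s(1)] by blast
  then show ?thesis unfolding telescope_def using E \<phi> cop s by blast
qed

lemma telescopeD:
  assumes "telescope E \<phi> B \<iota> s j h"
  shows "E n \<in> Obj T" "\<phi> n \<in> Arr T" "Dom T (\<phi> n) = E n" "Cod T (\<phi> n) = E (Suc n)"
    "is_coproduct T (UNIV :: nat set) E B \<iota>" "(s, j, h) \<in> Tri T" "Dom T s = B" "Cod T s = B"
    "s \<cdot> \<iota> n = diff (\<iota> n) (\<iota> (Suc n) \<cdot> \<phi> n)"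
    "B \<in> Obj T" "\<iota> n \<in> Arr T" "Dom T (\<iota> n) = E n" "Cod T (\<iota> n) = B"
    "s \<in> Arr T" "j \<in> Arr T" "h \<in> Arr T" "Dom T j = B" "Dom T h = Cod T j" "Cod T h = \<Sigma>\<^sub>o B"
proof -
  have d: "\<forall>n. E n \<in> Obj T" "\<forall>n. \<phi> n \<in> Arr T \<and> Dom T (\<phi> n) = E n \<and> Cod T (\<phi> n) = E (Suc n)"
    "is_coproduct T (UNIV :: nat set) E B \<iota>" "(s, j, h) \<in> Tri T" "Dom T s = B" "Cod T s = B"
     "\<forall>n. s \<cdot> \<iota> n = diff (\<iota> n) (\<iota> (Suc n) \<cdot> \<phi> n)"
    using assms unfolding telescope_def by blast+
  note a = coproduct_arr[OF d(3), simplified] and t = triD[OF d(4)]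
  show "E n \<in> Obj T" "\<phi> n \<in> Arr T" "Dom T (\<phi> n) = E n" "Cod T (\<phi> n) = E (Suc n)"
    "is_coproduct T (UNIV :: nat set) E B \<iota>" "(s, j, h) \<in> Tri T" "Dom T s = B" "Cod T s = B"
    "s \<cdot> \<iota> n = diff (\<iota> n) (\<iota> (Suc n) \<cdot> \<phi> n)"
    "B \<in> Obj T" "\<iota> n \<in> Arr T" "Dom T (\<iota> n) = E n" "Cod T (\<iota> n) = B"
    "s \<in> Arr T" "j \<in> Arr T" "h \<in> Arr T" "Dom T j = B" "Dom T h = Cod T j" "Cod T h = \<Sigma>\<^sub>o B"
    using d a t by simp_all
qed

lemma telescope_step:
  assumes tel: "telescope E \<phi> B \<iota> s j h"
  shows "j \<cdot> \<iota> n = (j \<cdot> \<iota> (Suc n)) \<cdot> \<phi> n"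
proof -
  note d = telescopeD[OF tel]
  have "diff (j \<cdot> \<iota> n) (j \<cdot> (\<iota> (Suc n) \<cdot> \<phi> n)) = j \<cdot> (s \<cdot> \<iota> n)"
    unfolding d(9) by (rule comp_diff[symmetric]) (use d in simp_all)
  also have "\<dots> = (j \<cdot> s) \<cdot> \<iota> n" by (rule comp_assoc[symmetric]) (use d in simp_all)
  also have "\<dots> = \<z> (E n) (Cod T j)" unfolding tri_comp_zr[OF d(6)] using d by simp
  finally have "j \<cdot> \<iota> n = j \<cdot> (\<iota> (Suc n) \<cdot> \<phi> n)" by (rule diff_eq_zr) (use d in simp_all)
  then show ?thesis using d by simp
qed

text \<open>Compatibility of the \<open>u n\<close> says exactly that the induced map on the
  coproduct annihilates \<open>s\<close>, so it extends over the cone. The extension is not claimed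
  to be unique: the telescope is a weak colimit.\<close>

lemma telescope_arr_exists:
  assumes tel: "telescope E \<phi> B \<iota> s j h" and w: "w \<in> Obj T"
    and u: "\<forall>n. u n \<in> Arr T \<and> Dom T (u n) = E n \<and> Cod T (u n) = w \<and> u n = u (Suc n) \<cdot> \<phi> n"
  shows "\<exists>e. e \<in> Arr T \<and> Dom T e = Cod T j \<and> Cod T e = w \<and> (\<forall>n. e \<cdot> (j \<cdot> \<iota> n) = u n)"
proof -
  note d = telescopeD[OF tel]
  have "\<exists>v. v \<in> Arr T \<and> Dom T v = B \<and> Cod T v = w \<and> (\<forall>n\<in>UNIV. v \<cdot> \<iota> n = u n)"
    by (rule coproduct_arr_ex[OF d(5) w]) (use u in blast)
  then obtain v where v: "v \<in> Arr T" "Dom T v = B" "Cod T v = w" "\<And>n. v \<cdot> \<iota> n = u n" by blast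
  have "v \<cdot> s = \<z> B w"
  proof (rule coproduct_arr_unique[OF d(5)])
    fix n
    have "(v \<cdot> s) \<cdot> \<iota> n = v \<cdot> diff (\<iota> n) (\<iota> (Suc n) \<cdot> \<phi> n)"
      using v(1-3) d(7,8,10-14) d(9)[of n] by simp
    also have "\<dots> = diff (v \<cdot> \<iota> n) (v \<cdot> (\<iota> (Suc n) \<cdot> \<phi> n))"
      by (rule comp_diff) (use v(1-3) d in simp_all)
    also have "v \<cdot> (\<iota> (Suc n) \<cdot> \<phi> n) = u (Suc n) \<cdot> \<phi> n"
      by (rule comp_eq_left[OF v(4)]) (use v(1-3) d in simp_all)
    also have "\<dots> = v \<cdot> \<iota> n" using u v(4) by metis
    finally show "(v \<cdot> s) \<cdot> \<iota> n = \<z> B w \<cdot> \<iota> n" using v(1-3) d(1,10-13) w by simp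
  qed (use v(1-3) d w in simp_all)
  then have "v \<cdot> s = \<z> (Dom T s) (Cod T v)" using d v by simp
  then obtain e where e: "e \<in> Arr T" "Dom T e = Cod T j" "Cod T e = Cod T v" "e \<cdot> j = v"
    using tri_exact_con[OF d(6) v(1)] v(2) d(8) by auto
  have "e \<cdot> (j \<cdot> \<iota> n) = u n" for n
    using comp_eq_left[OF e(4), of "\<iota> n"] v(4) e(1,2) d(11-17) by simp
  then show ?thesis using e v(3) by blast
qed

text \<open>The components of \<open>k\<close> vanish one after the other, because
  \<open>p 0 \<cdot> s = p 0\<close> and \<open>p (Suc i) \<cdot> s\<close> differs from
  \<open>p (Suc i)\<close> by \<open>\<phi> i \<cdot> p i\<close>. Compactness of \<open>x\<close>
  makes the vanishing of all components sufficient.\<close>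

lemma telescope_compact_injective:
  assumes tel: "telescope E \<phi> B \<iota> s j h" and x: "compact_ob \<kappa> T x"
    and k: "k \<in> Arr T" "Dom T k = x" "Cod T k = B" "s \<cdot> k = \<z> x B"
  shows "k = \<z> x B"
proof -
  note d = telescopeD[OF tel] and xo = compact_obj[OF x]
  obtain p where p: "\<And>i. p i \<in> Arr T" "\<And>i. Dom T (p i) = B" "\<And>i. Cod T (p i) = E i"
    "\<And>i. p i \<cdot> \<iota> i = Ide T (E i)" "\<And>i j. j \<noteq> i \<Longrightarrow> p i \<cdot> \<iota> j = \<z> (E j) (E i)"
    using coproduct_proj[OF d(5)] by auto
  have ps\<iota>: "(p i \<cdot> s) \<cdot> \<iota> n = diff (p i \<cdot> \<iota> n) ((p i \<cdot> \<iota> (Suc n)) \<cdot> \<phi> n)" for i n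
  proof -
    have "(p i \<cdot> s) \<cdot> \<iota> n = p i \<cdot> diff (\<iota> n) (\<iota> (Suc n) \<cdot> \<phi> n)"
      using p(1-3) d(7,8,10-14) d(9)[of n] by simp
    also have "\<dots> = diff (p i \<cdot> \<iota> n) (p i \<cdot> (\<iota> (Suc n) \<cdot> \<phi> n))"
      by (rule comp_diff) (use p(1-3) d in simp_all)
    finally show ?thesis using p(1-3) d by simp
  qed
  have ps0: "p 0 \<cdot> s = p 0"
  proof (rule coproduct_arr_unique[OF d(5)])
    fix n show "(p 0 \<cdot> s) \<cdot> \<iota> n = p 0 \<cdot> \<iota> n"
      unfolding ps\<iota> using p d(1-4,10-13) by simp
  qed (use p d in simp_all)
  have psS: "p (Suc i) \<cdot> s = diff (p (Suc i)) (\<phi> i \<cdot> p i)" for i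
  proof (rule coproduct_arr_unique[OF d(5)])
    fix n
    have "diff (p (Suc i)) (\<phi> i \<cdot> p i) \<cdot> \<iota> n = diff (p (Suc i) \<cdot> \<iota> n) (\<phi> i \<cdot> (p i \<cdot> \<iota> n))"
      using p(1-3) d by (simp add: diff_comp)
    also have "\<phi> i \<cdot> (p i \<cdot> \<iota> n) = (p (Suc i) \<cdot> \<iota> (Suc n)) \<cdot> \<phi> n"
      using p(4)[of i] p(4)[of "Suc i"] p(5)[of n i] p(5)[of "Suc n" "Suc i"] d(1-4) by (cases "n = i") simp_all
    finally show "(p (Suc i) \<cdot> s) \<cdot> \<iota> n = diff (p (Suc i)) (\<phi> i \<cdot> p i) \<cdot> \<iota> n"
      unfolding ps\<iota> by simp
  qed (use p d in simp_all)
  have pk: "p i \<cdot> k = \<z> x (E i)" for i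
  proof (induction i)
    case 0
    have "p 0 \<cdot> k = p 0 \<cdot> (s \<cdot> k)"
      using comp_eq_left[OF ps0, of k] p(1-3) d(7,8,14) k(1-3) by simp
    then show ?case unfolding k(4) using p(1-3) xo by simp
  next
    case (Suc i)
    have "diff (p (Suc i) \<cdot> k) (\<phi> i \<cdot> (p i \<cdot> k)) = diff (p (Suc i)) (\<phi> i \<cdot> p i) \<cdot> k"
      using p(1-3) d(2-4) k(1-3) by (simp add: diff_comp)
    also have "\<dots> = p (Suc i) \<cdot> (s \<cdot> k)"
      by (rule comp_eq_left[OF psS, symmetric]) (use p(1-3) d k(1-3) in simp_all)
    also have "\<dots> = \<z> x (E (Suc i))" unfolding k(4) using p(1-3) xo by simp
    finally have "p (Suc i) \<cdot> k = \<phi> i \<cdot> (p i \<cdot> k)"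
      by (rule diff_eq_zr) (use p(1-3) d(1-4) k(1-3) in simp_all)
    also have "\<dots> = \<z> x (E (Suc i))" unfolding Suc using d(2-4) xo by simp
    finally show ?case .
  qed
  obtain F where "finite F" "supported \<iota> F k"
    using compact_supported[OF x small_nat d(5) k(1-3)] by blast
  from supported_eq_zr[OF d(5) subset_UNIV this k(1-3) p] pk show ?thesis by blast
qed

text \<open>Injectivity of \<open>s\<close> on maps from a desuspension of \<open>x\<close> gives
  \<open>h \<cdot> f = 0\<close>, so \<open>f\<close> lifts to the coproduct. The lift meets only
  finitely many stages, and all of them can be pushed forward to a common stage
  \<open>N\<close>.\<close>

lemma telescope_compact_factor:
  assumes tel: "telescope E \<phi> B \<iota> s j h" and x: "compact_ob \<kappa> T x"
    and f: "f \<in> Arr T" "Dom T f = x" "Cod T f = Cod T j"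
  shows "\<exists>N f'. f' \<in> Arr T \<and> Dom T f' = x \<and> Cod T f' = E N \<and> f = (j \<cdot> \<iota> N) \<cdot> f'"
proof -
  note d = telescopeD[OF tel] and xo = compact_obj[OF x]
  obtain x' u where x': "compact_ob \<kappa> T x'" "iso_arr T u" "Dom T u = \<Sigma>\<^sub>o x'" "Cod T u = x"
    using compact_desuspension[OF x] by blast
  note u' = iso_arr_in_arr[OF x'(2)] and x'o = compact_obj[OF x'(1)]
  have "\<exists>k. k \<in> Arr T \<and> Dom T k = x' \<and> Cod T k = B \<and> \<Sigma>\<^sub>a k = h \<cdot> (f \<cdot> u)"
    by (rule shift_full) (use d f u' x' x'o in simp_all)
  then obtain k where k: "k \<in> Arr T" "Dom T k = x'" "Cod T k = B" "\<Sigma>\<^sub>a k = h \<cdot> (f \<cdot> u)" by blast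
  have "\<Sigma>\<^sub>a s \<cdot> (h \<cdot> (f \<cdot> u)) = \<z> (Cod T j) (\<Sigma>\<^sub>o B) \<cdot> (f \<cdot> u)"
    by (rule comp_eq_left[OF tri_shift_comp_zr[OF d(6), unfolded d(8)]]) (use d f u' x' in simp_all)
  also have "\<dots> = \<z> (\<Sigma>\<^sub>o x') (\<Sigma>\<^sub>o B)" using f u' x' d(10) by simp
  finally have "\<Sigma>\<^sub>a (s \<cdot> k) = \<z> (\<Sigma>\<^sub>o x') (\<Sigma>\<^sub>o B)"
    using k d(7,8,14) by (simp add: shift_comp)
  then have "s \<cdot> k = \<z> x' B" by (rule shift_eq_zr) (use k d in simp_all)
  then have "k = \<z> x' B" by (rule telescope_compact_injective[OF tel x'(1) k(1-3)])
  then have "(h \<cdot> f) \<cdot> u = \<z> x (\<Sigma>\<^sub>o B) \<cdot> u" using k(4) f u' x' x'o d xo by simp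
  then have "h \<cdot> f = \<z> x (\<Sigma>\<^sub>o B)"
    by (rule iso_arr_cancel_right[OF x'(2)]) (use f u' x' d xo in simp_all)
  then obtain m where m: "m \<in> Arr T" "Dom T m = x" "Cod T m = B" "j \<cdot> m = f"
    using tri_exact_cov_third[OF d(6) f(1)] f d(7,8) by auto
  obtain F where F: "finite F" "supported \<iota> F m"
    using compact_supported[OF x small_nat d(5) m(1-3)] by blast
  obtain N where N: "F \<subseteq> {..N}" using F(1) finite_nat_iff_bounded_le by blast
  have "\<exists>\<tau>. \<forall>n\<le>N. \<tau> n \<in> Arr T \<and> Dom T (\<tau> n) = E n \<and> Cod T (\<tau> n) = E N \<and> (j \<cdot> \<iota> N) \<cdot> \<tau> n = j \<cdot> \<iota> n"
  proof (induction N)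
    case 0
    show ?case by (rule exI[of _ "\<lambda>n. Ide T (E 0)"]) (use d in simp)
  next
    case (Suc N)
    then obtain \<tau> where \<tau>: "\<forall>n\<le>N. \<tau> n \<in> Arr T \<and> Dom T (\<tau> n) = E n \<and> Cod T (\<tau> n) = E N \<and> (j \<cdot> \<iota> N) \<cdot> \<tau> n = j \<cdot> \<iota> n"
      by blast
    show ?case
    proof (rule exI[of _ "\<lambda>n. if n \<le> N then \<phi> N \<cdot> \<tau> n else Ide T (E (Suc N))"], intro allI impI)
      fix n assume n: "n \<le> Suc N"
      show "(if n \<le> N then \<phi> N \<cdot> \<tau> n else Ide T (E (Suc N))) \<in> Arr T \<and>
         Dom T (if n \<le> N then \<phi> N \<cdot> \<tau> n else Ide T (E (Suc N))) = E n \<and>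
         Cod T (if n \<le> N then \<phi> N \<cdot> \<tau> n else Ide T (E (Suc N))) = E (Suc N) \<and>
         (j \<cdot> \<iota> (Suc N)) \<cdot> (if n \<le> N then \<phi> N \<cdot> \<tau> n else Ide T (E (Suc N))) = j \<cdot> \<iota> n"
      proof (cases "n \<le> N")
        case True
        note \<tau>n = \<tau>[rule_format, OF True]
        have "(j \<cdot> \<iota> (Suc N)) \<cdot> (\<phi> N \<cdot> \<tau> n) = (j \<cdot> \<iota> N) \<cdot> \<tau> n"
          by (rule comp_eq_left[OF telescope_step[OF tel, symmetric]]) (use \<tau>n d in simp_all)
        then show ?thesis using True \<tau>n d(2-4) by simp
      next
        case False
        then have "n = Suc N" using n by simp
        then show ?thesis using d by simp
      qed
    qed
  qed
  then obtain \<tau> where \<tau>: "\<forall>n\<le>N. \<tau> n \<in> Arr T \<and> Dom T (\<tau> n) = E n \<and> Cod T (\<tau> n) = E N \<and> (j \<cdot> \<iota> N) \<cdot> \<tau> n = j \<cdot> \<iota> n"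
    by blast
  \<comment> \<open>The fold of the stages up to \<open>N\<close> into \<open>E N\<close>. Its value
    beyond \<open>N\<close> is arbitrary, as \<open>m\<close> is supported on stages up to
    \<open>N\<close>.\<close>
  have "\<exists>t. t \<in> Arr T \<and> Dom T t = B \<and> Cod T t = E N \<and> (\<forall>n\<in>UNIV. t \<cdot> \<iota> n = (if n \<le> N then \<tau> n else \<z> (E n) (E N)))"
    by (rule coproduct_arr_ex[OF d(5)]) (use d(1) \<tau> in auto)
  then obtain t where t: "t \<in> Arr T" "Dom T t = B" "Cod T t = E N" "\<And>n. n \<le> N \<Longrightarrow> t \<cdot> \<iota> n = \<tau> n" by auto
  have "((j \<cdot> \<iota> N) \<cdot> t) \<cdot> m = j \<cdot> m"
  proof (rule supportedD[OF F(2)])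
    show "\<forall>n\<in>F. ((j \<cdot> \<iota> N) \<cdot> t) \<cdot> \<iota> n = j \<cdot> \<iota> n"
    proof
      fix n assume "n \<in> F"
      then have n: "n \<le> N" using N by blast
      have "((j \<cdot> \<iota> N) \<cdot> t) \<cdot> \<iota> n = (j \<cdot> \<iota> N) \<cdot> (t \<cdot> \<iota> n)" using t(1-3) d by simp
      also have "\<dots> = j \<cdot> \<iota> n" using t(4)[OF n] \<tau> n by simp
      finally show "((j \<cdot> \<iota> N) \<cdot> t) \<cdot> \<iota> n = j \<cdot> \<iota> n" .
    qed
  qed (use t(1-3) d m in simp_all)
  then have "f = (j \<cdot> \<iota> N) \<cdot> (t \<cdot> m)" using m t(1-3) d by simp
  then show ?thesis using t(1-3) m(1-3) by (intro exI[of _ N] exI[of _ "t \<cdot> m"]) simp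
qed

lemma telescope_localizing:
  assumes tel: "telescope E \<phi> B \<iota> s j h" and L: "localizing \<kappa> T L" and E: "\<forall>n. E n \<in> L"
  shows "Cod T j \<in> L"
proof -
  note d = telescopeD[OF tel]
  have "B \<in> L" by (rule localizing_coproduct[OF L small_nat _ d(5)]) (use E in simp)
  then show ?thesis using localizing_tri(1)[OF L d(6)] d by simp
qed

text \<open>A retract \<open>x\<close> of \<open>y\<close> is the mapping telescope of the idempotent \<open>e\<close> of \<open>y\<close> that it splits.\<close>

lemma localizing_retract:
  assumes L: "localizing \<kappa> T L" and y: "y \<in> L"
    and sr: "s \<in> Arr T" "Dom T s = x" "Cod T s = y" "r \<in> Arr T" "Dom T r = y" "Cod T r = x" "r \<cdot> s = Ide T x"
  shows "x \<in> L"
proof -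
  have xo: "x \<in> Obj T" "y \<in> Obj T" using sr by auto
  define e where "e = s \<cdot> r"
  have e: "e \<in> Arr T" "Dom T e = y" "Cod T e = y" unfolding e_def using sr by simp_all
  have re: "r \<cdot> e = r" unfolding e_def using comp_eq_left[OF sr(7), of r] sr by simp
  have ee: "e \<cdot> e = e" using re sr e unfolding e_def by simp
  obtain B \<iota> t j h where tel: "telescope (\<lambda>_. y) (\<lambda>_. e) B \<iota> t j h"
    using telescope_exists[of "\<lambda>_. y" "\<lambda>_. e"] xo e by auto
  note d = telescopeD[OF tel]
  \<comment> \<open>The expected map to the colimit is \<open>r\<close> at every stage; it
    annihilates \<open>t\<close> because \<open>r \<cdot> e = r\<close>.\<close>
  have "\<exists>b. b \<in> Arr T \<and> Dom T b = B \<and> Cod T b = x \<and> (\<forall>n\<in>UNIV. b \<cdot> \<iota> n = r)"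
    by (rule coproduct_arr_ex[OF d(5) xo(1)]) (use sr in simp)
  then obtain b where b: "b \<in> Arr T" "Dom T b = B" "Cod T b = x" "\<And>n. b \<cdot> \<iota> n = r" by blast
  have bt: "b \<cdot> t = \<z> B x"
  proof (rule coproduct_arr_unique[OF d(5)])
    fix n
    have "(b \<cdot> t) \<cdot> \<iota> n = b \<cdot> diff (\<iota> n) (\<iota> (Suc n) \<cdot> e)"
      using b(1-3) d(7,8,10-14) d(9)[of n] by simp
    also have "\<dots> = diff (b \<cdot> \<iota> n) (b \<cdot> (\<iota> (Suc n) \<cdot> e))"
      by (rule comp_diff) (use b(1-3) d e in simp_all)
    also have "b \<cdot> (\<iota> (Suc n) \<cdot> e) = r \<cdot> e"
      by (rule comp_eq_left[OF b(4)]) (use b(1-3) d e in simp_all)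
    finally show "(b \<cdot> t) \<cdot> \<iota> n = \<z> B x \<cdot> \<iota> n" unfolding b(4) re using sr xo d by simp
  qed (use b d xo in simp_all)
  \<comment> \<open>Here \<open>a n\<close> is the sum of the \<open>\<iota> i \<cdot> e\<close> for
    \<open>i\<close> from \<open>0\<close> to \<open>n\<close>. It is found by asking for a
    retraction \<open>q\<close> of \<open>t\<close>: with
    \<open>q \<cdot> \<iota> n = \<iota> n - a n\<close>, idempotence gives
    \<open>q \<cdot> \<iota> (Suc n) \<cdot> e = - a n\<close>, so that
    \<open>q \<cdot> (\<iota> n - \<iota> (Suc n) \<cdot> e)\<close> collapses to
    \<open>\<iota> n\<close>.\<close>
  define a where "a = rec_nat (\<iota> 0 \<cdot> e) (\<lambda>n a. a \<oplus> (\<iota> (Suc n) \<cdot> e))"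
  have a_Suc: "a (Suc n) = a n \<oplus> (\<iota> (Suc n) \<cdot> e)" for n unfolding a_def by simp
  have a: "a n \<in> Arr T \<and> Dom T (a n) = y \<and> Cod T (a n) = B \<and> a n \<cdot> e = a n" for n
  proof (induction n)
    case 0
    show ?case unfolding a_def using d e ee by simp
  next
    case (Suc n)
    then show ?case unfolding a_Suc using d e ee by (simp add: plus_comp)
  qed
  have "\<exists>q. q \<in> Arr T \<and> Dom T q = B \<and> Cod T q = B \<and> (\<forall>n\<in>UNIV. q \<cdot> \<iota> n = diff (\<iota> n) (a n))"
    by (rule coproduct_arr_ex[OF d(5)]) (use a d in simp_all)
  then obtain q where q: "q \<in> Arr T" "Dom T q = B" "Cod T q = B" "\<And>n. q \<cdot> \<iota> n = diff (\<iota> n) (a n)" by blast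
  have qt: "q \<cdot> t = Ide T B"
  proof (rule coproduct_arr_unique[OF d(5)])
    fix n
    note an = a[of n] and aS = a[of "Suc n"]
    let ?i = "\<iota> (Suc n) \<cdot> e"
    have i: "?i \<in> Arr T" "Dom T ?i = y" "Cod T ?i = B" "?i \<cdot> e = ?i" using d e ee by simp_all
    have 1: "diff ?i (a n \<oplus> ?i) = \<ominus> (a n)"
    proof (rule neg_unique)
      have "a n \<oplus> diff ?i (a n \<oplus> ?i) = (a n \<oplus> ?i) \<oplus> \<ominus> (a n \<oplus> ?i)"
        unfolding diff_def using an i by (intro plus_assoc[symmetric]) simp_all
      then show "a n \<oplus> diff ?i (a n \<oplus> ?i) = \<z> (Dom T (a n)) (Cod T (a n))" using an i by simp
    qed (use an i in simp_all)
    have 2: "diff (diff (\<iota> n) (a n)) (\<ominus> (a n)) = \<iota> n"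
    proof -
      have "diff (diff (\<iota> n) (a n)) (\<ominus> (a n)) = (\<iota> n \<oplus> \<ominus> (a n)) \<oplus> a n"
        unfolding diff_def using an by simp
      also have "\<dots> = \<iota> n \<oplus> (\<ominus> (a n) \<oplus> a n)"
        using an d by (intro plus_assoc) simp_all
      also have "\<dots> = \<iota> n" using an d by simp
      finally show ?thesis .
    qed
    have "(q \<cdot> t) \<cdot> \<iota> n = q \<cdot> diff (\<iota> n) ?i"
      using q(1-3) d(7,8,10-14) d(9)[of n] by simp
    also have "\<dots> = diff (q \<cdot> \<iota> n) (q \<cdot> ?i)"
      by (rule comp_diff) (use q(1-3) d i in simp_all)
    also have "q \<cdot> ?i = diff (\<iota> (Suc n)) (a (Suc n)) \<cdot> e"
      by (rule comp_eq_left[OF q(4)]) (use q(1-3) d e in simp_all)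
    also have "\<dots> = diff ?i (a (Suc n) \<cdot> e)"
      by (rule diff_comp) (use aS d e in simp_all)
    also have "a (Suc n) \<cdot> e = a n \<oplus> ?i" using aS unfolding a_Suc by simp
    finally show "(q \<cdot> t) \<cdot> \<iota> n = Ide T B \<cdot> \<iota> n" unfolding q(4) 1 2 using d by simp
  qed (use q d in simp_all)
  \<comment> \<open>All stages have the same image in the telescope, and it absorbs
    \<open>e\<close>; hence the stage \<open>0\<close> alone provides the section
    \<open>\<iota> 0 \<cdot> s\<close> of \<open>b\<close>.\<close>
  have je: "(j \<cdot> \<iota> n) \<cdot> e = j \<cdot> \<iota> n" for n
  proof -
    have "(j \<cdot> \<iota> n) \<cdot> e = ((j \<cdot> \<iota> (Suc n)) \<cdot> e) \<cdot> e" using telescope_step[OF tel, of n] by simp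
    also have "\<dots> = (j \<cdot> \<iota> (Suc n)) \<cdot> e" using d e ee by simp
    finally show ?thesis using telescope_step[OF tel, of n] by simp
  qed
  have j0: "j \<cdot> \<iota> n = j \<cdot> \<iota> 0" for n
  proof (induction n)
    case (Suc n)
    have "j \<cdot> \<iota> (Suc n) = j \<cdot> \<iota> n" using je[of "Suc n"] telescope_step[OF tel, of n] by simp
    then show ?case using Suc by simp
  qed simp
  \<comment> \<open>The last condition of \<open>split_mono_cone\<close>, which then identifies the
    telescope with \<open>x\<close>.\<close>
  have "j \<cdot> (\<iota> 0 \<cdot> s) \<cdot> b = j"
  proof (rule coproduct_arr_unique[OF d(5)])
    fix n
    have "(j \<cdot> (\<iota> 0 \<cdot> s) \<cdot> b) \<cdot> \<iota> n = (j \<cdot> \<iota> 0) \<cdot> (s \<cdot> (b \<cdot> \<iota> n))" using d b(1-3) sr by simp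
    also have "\<dots> = (j \<cdot> \<iota> 0) \<cdot> e" unfolding b(4) e_def by simp
    also have "\<dots> = j \<cdot> \<iota> n" unfolding je j0[of n] by simp
    finally show "(j \<cdot> (\<iota> 0 \<cdot> s) \<cdot> b) \<cdot> \<iota> n = j \<cdot> \<iota> n" .
  qed (use d b(1-3) sr in simp_all)
  moreover have "b \<cdot> (\<iota> 0 \<cdot> s) = Ide T x"
    using comp_eq_left[OF b(4)[of 0], of s] b(1-3) d sr by simp
  ultimately have "isomorphic T (Cod T j) (Cod T b)"
    using split_mono_cone[OF d(6) q(1), of b "\<iota> 0 \<cdot> s"] qt bt q b d sr by simp
  then show ?thesis
    using localizingD(3)[OF L telescope_localizing[OF tel L]] y b(3) by simp
qed

section \<open>Bousfield localization\<close>

text \<open>The hypotheses bound Hom sets between compact generators only. This class contains the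
  compact objects and is closed under small coproducts and cones, so it contains every stage of the
  tower built below.\<close>

definition hom_small where
  "hom_small x \<longleftrightarrow> x \<in> Obj T \<and> (\<forall>c. compact_ob \<kappa> T c \<longrightarrow> small \<kappa> (Hom T c x))"

lemma small_inj_on: "inj_on h A \<Longrightarrow> h ` A \<subseteq> B \<Longrightarrow> small \<kappa> B \<Longrightarrow> small \<kappa> A"
  using small_image[OF small_subset, of B "h ` A" "inv_into A h"] by simp

lemma small_empty: "small \<kappa> {}"
proof -
  have "small \<kappa> ((\<lambda>_. undefined) ` ({} :: nat set))"
    by (intro small_image small_subset[OF small_nat] empty_subsetI)
  then show ?thesis by simp
qed

lemma skeleton_exists:
  "\<exists>G. (\<forall>g\<in>G. compact_ob \<kappa> T g) \<and> small \<kappa> G \<and> (\<forall>x. compact_ob \<kappa> T x \<longrightarrow> (\<exists>g\<in>G. isomorphic T g x)) \<and>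
     (\<forall>g\<in>G. \<forall>g'\<in>G. small \<kappa> (Hom T g g'))"
proof -
  have "\<exists>G \<subseteq> cpt \<kappa> T. small \<kappa> G \<and> (\<forall>x\<in>cpt \<kappa> T. \<exists>g\<in>G. isomorphic T g x) \<and>
        (\<forall>g\<in>G. \<forall>g'\<in>G. small \<kappa> (Hom T g g'))"
    using rcg unfolding rigidly_compactly_generated_def by (elim conjE)
  then obtain G where "G \<subseteq> cpt \<kappa> T" "small \<kappa> G" "\<forall>x\<in>cpt \<kappa> T. \<exists>g\<in>G. isomorphic T g x"
    "\<forall>g\<in>G. \<forall>g'\<in>G. small \<kappa> (Hom T g g')" by blast
  then show ?thesis by (intro exI[of _ G]) blast
qed

lemma hom_small_compact:
  assumes "compact_ob \<kappa> T x"
  shows "hom_small x"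
  unfolding hom_small_def
proof (intro conjI allI impI)
  show xo: "x \<in> Obj T" by (rule compact_obj[OF assms])
  fix c assume c: "compact_ob \<kappa> T c"
  obtain G where G: "\<forall>x. compact_ob \<kappa> T x \<longrightarrow> (\<exists>g\<in>G. isomorphic T g x)" "\<forall>g\<in>G. \<forall>g'\<in>G. small \<kappa> (Hom T g g')"
    using skeleton_exists by blast
  obtain g where g: "g \<in> G" "isomorphic T g c" using G(1) c by blast
  obtain g' where g': "g' \<in> G" "isomorphic T g' x" using G(1) assms by blast
  obtain u where u: "iso_arr T u" "Dom T u = g" "Cod T u = c" using g(2) unfolding isomorphic_iff by blast
  obtain v where v: "iso_arr T v" "Dom T v = g'" "Cod T v = x" using g'(2) unfolding isomorphic_iff by blast
  note uv = iso_arr_in_arr[OF u(1)] iso_arr_in_arr[OF v(1)]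
  have 1: "Hom T c x \<subseteq> (\<lambda>f. v \<cdot> f \<cdot> inv_arr T u) ` Hom T g g'"
  proof
    fix f assume f: "f \<in> Hom T c x"
    then have "f = v \<cdot> (inv_arr T v \<cdot> f \<cdot> u) \<cdot> inv_arr T u" "inv_arr T v \<cdot> f \<cdot> u \<in> Hom T g g'"
      using u v uv by simp_all
    then show "f \<in> (\<lambda>f. v \<cdot> f \<cdot> inv_arr T u) ` Hom T g g'" by blast
  qed
  have "small \<kappa> (Hom T g g')" using G(2) g(1) g'(1) by blast
  then show "small \<kappa> (Hom T c x)" by (rule small_subset[OF small_image 1])
qed

text \<open>A map from a compact object is determined by the finite graph \<open>H f\<close> of its
  non-zero components, so the maps inject into the finite subsets of a small set.\<close>

lemma hom_small_coproduct:
  fixes I :: "'i set"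
  assumes I: "small \<kappa> I" and cop: "is_coproduct T I y c \<iota>" and y: "\<forall>i\<in>I. hom_small (y i)"
  shows "hom_small c"
  unfolding hom_small_def
proof (intro conjI allI impI)
  note a = coproduct_arr[OF cop] and o = coproduct_summand_obj[OF cop]
  show "c \<in> Obj T" by (rule a)
  fix x assume x: "compact_ob \<kappa> T x"
  note xo = compact_obj[OF x]
  obtain p where p: "\<And>i. i \<in> I \<Longrightarrow> p i \<in> Arr T" "\<And>i. i \<in> I \<Longrightarrow> Dom T (p i) = c" "\<And>i. i \<in> I \<Longrightarrow> Cod T (p i) = y i"
    "\<And>i. i \<in> I \<Longrightarrow> p i \<cdot> \<iota> i = Ide T (y i)"
    "\<And>i j. i \<in> I \<Longrightarrow> j \<in> I \<Longrightarrow> j \<noteq> i \<Longrightarrow> p i \<cdot> \<iota> j = \<z> (y j) (y i)"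
    using coproduct_proj[OF cop] by auto
  define S where "S f = {i\<in>I. p i \<cdot> f \<noteq> \<z> x (y i)}" for f
  define H where "H f = (\<lambda>i. (i, p i \<cdot> f)) ` S f" for f
  have "inj_on H (Hom T x c)"
  proof (rule inj_onI)
    fix f g assume "f \<in> Hom T x c" "g \<in> Hom T x c" and H: "H f = H g"
    then have f: "f \<in> Arr T" "Dom T f = x" "Cod T f = c" and g: "g \<in> Arr T" "Dom T g = x" "Cod T g = c" by simp_all
    have pfg: "p i \<cdot> f = p i \<cdot> g" if i: "i \<in> I" for i
    proof (cases "i \<in> S f \<or> i \<in> S g")
      case True
      then have "(i, p i \<cdot> f) \<in> H g \<or> (i, p i \<cdot> g) \<in> H f"
        using H unfolding H_def by blast
      then show ?thesis unfolding H_def by auto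
    next
      case False
      then show ?thesis using i unfolding S_def by simp
    qed
    have "diff f g = \<z> x c"
    proof -
      have dfg: "diff f g \<in> Arr T" "Dom T (diff f g) = x" "Cod T (diff f g) = c" using f g by simp_all
      obtain F where F: "F \<subseteq> I" "finite F" "supported \<iota> F (diff f g)"
        using compact_supported[OF x I cop dfg] by blast
      show ?thesis
      proof (rule supported_eq_zr[OF cop F dfg p])
        fix i assume i: "i \<in> I"
        have "p i \<cdot> diff f g = diff (p i \<cdot> f) (p i \<cdot> g)"
          by (rule comp_diff) (use f g p(1-3)[OF i] in simp_all)
        then show "p i \<cdot> diff f g = \<z> x (y i)" unfolding pfg[OF i] using p(1-3)[OF i] g by simp
      qed
    qed
    then show "f = g" by (rule diff_eq_zr) (use f g in simp_all)
  qed
  moreover have "H ` Hom T x c \<subseteq> {F. finite F \<and> F \<subseteq> (SIGMA i:I. Hom T x (y i))}"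
  proof (rule image_subsetI)
    fix f assume "f \<in> Hom T x c"
    then have f: "f \<in> Arr T" "Dom T f = x" "Cod T f = c" by simp_all
    obtain F where F: "F \<subseteq> I" "finite F" "supported \<iota> F f"
      using compact_supported[OF x I cop f] by blast
    have "S f \<subseteq> F"
    proof
      fix i assume i: "i \<in> S f"
      then have iI: "i \<in> I" unfolding S_def by simp
      show "i \<in> F"
      proof (rule ccontr)
        assume iF: "i \<notin> F"
        have "p i \<cdot> f = \<z> c (y i) \<cdot> f"
        proof (rule supportedD[OF F(3)])
          show "\<forall>k\<in>F. p i \<cdot> \<iota> k = \<z> c (y i) \<cdot> \<iota> k"
          proof
            fix k assume k: "k \<in> F"
            then have kI: "k \<in> I" "k \<noteq> i" using F(1) iF by blast+
            show "p i \<cdot> \<iota> k = \<z> c (y i) \<cdot> \<iota> k"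
              using p(5)[OF iI kI] a(1) a(2-4)[OF kI(1)] o[OF iI] by simp
          qed
        qed (use p(1-3)[OF iI] f a(1) o[OF iI] in simp_all)
        then show False using i f a(1) o[OF iI] unfolding S_def by simp
      qed
    qed
    then have "finite (H f)" unfolding H_def using F(2) finite_subset by blast
    moreover have "H f \<subseteq> (SIGMA i:I. Hom T x (y i))" unfolding H_def S_def using p f by auto
    ultimately show "H f \<in> {F. finite F \<and> F \<subseteq> (SIGMA i:I. Hom T x (y i))}" by blast
  qed
  moreover have "small \<kappa> {F. finite F \<and> F \<subseteq> (SIGMA i:I. Hom T x (y i))}"
    by (intro small_finite_subsets small_Sigma I) (use y x in \<open>simp add: hom_small_def\<close>)
  ultimately show "small \<kappa> (Hom T x c)" by (rule small_inj_on)
qed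

text \<open>Count along the exact sequence: composing with \<open>h\<close> maps the Hom set to
  \<open>Hom(x, \<Sigma>(Dom f))\<close>, which is small after desuspending \<open>x\<close>, and
  two maps in one fibre differ by the image of a map from \<open>x\<close> to
  \<open>Cod f\<close>.\<close>

lemma hom_small_cone:
  assumes tri: "(f, g, h) \<in> Tri T" and small: "hom_small (Dom T f)" "hom_small (Cod T f)"
  shows "hom_small (Cod T g)"
  unfolding hom_small_def
proof (intro conjI allI impI)
  note t = triD[OF tri]
  show "Cod T g \<in> Obj T" using t by simp
  fix x assume x: "compact_ob \<kappa> T x"
  note xo = compact_obj[OF x]
  obtain x' u where x': "compact_ob \<kappa> T x'" "iso_arr T u" "Dom T u = \<Sigma>\<^sub>o x'" "Cod T u = x"
    using compact_desuspension[OF x] by blast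
  note u' = iso_arr_in_arr[OF x'(2)] and x'o = compact_obj[OF x'(1)]
  let ?H = "Hom T x (\<Sigma>\<^sub>o (Dom T f))"
  have 1: "?H \<subseteq> (\<lambda>k. \<Sigma>\<^sub>a k \<cdot> inv_arr T u) ` Hom T x' (Dom T f)"
  proof
    fix m assume m: "m \<in> ?H"
    have "\<exists>k. k \<in> Arr T \<and> Dom T k = x' \<and> Cod T k = Dom T f \<and> \<Sigma>\<^sub>a k = m \<cdot> u"
      by (rule shift_full) (use m u' x' x'o t in simp_all)
    then obtain k where k: "k \<in> Hom T x' (Dom T f)" "\<Sigma>\<^sub>a k = m \<cdot> u" by auto
    have "m = \<Sigma>\<^sub>a k \<cdot> inv_arr T u" unfolding k(2) using m u' x' by simp
    with k(1) show "m \<in> (\<lambda>k. \<Sigma>\<^sub>a k \<cdot> inv_arr T u) ` Hom T x' (Dom T f)" by blast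
  qed
  have "small \<kappa> (Hom T x' (Dom T f))" using small(1) x'(1) unfolding hom_small_def by blast
  then have H: "small \<kappa> ?H" by (rule small_subset[OF small_image 1])
  have fib: "small \<kappa> {m \<in> Hom T x (Cod T g). h \<cdot> m = k}" for k
  proof (cases "{m \<in> Hom T x (Cod T g). h \<cdot> m = k} = {}")
    case True
    show ?thesis unfolding True by (rule small_empty)
  next
    case False
    then obtain m0 where m0: "m0 \<in> Arr T" "Dom T m0 = x" "Cod T m0 = Cod T g" "h \<cdot> m0 = k" by auto
    have 2: "{m \<in> Hom T x (Cod T g). h \<cdot> m = k} \<subseteq> (\<lambda>a. m0 \<oplus> (g \<cdot> a)) ` Hom T x (Cod T f)"
    proof
      fix m assume "m \<in> {m \<in> Hom T x (Cod T g). h \<cdot> m = k}"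
      then have m: "m \<in> Arr T" "Dom T m = x" "Cod T m = Cod T g" "h \<cdot> m = k" by simp_all
      have "h \<cdot> diff m m0 = diff (h \<cdot> m) (h \<cdot> m0)"
        by (rule comp_diff) (use m(1-3) m0(1-3) t in simp_all)
      also have "\<dots> = diff (h \<cdot> m0) (h \<cdot> m0)" unfolding m(4) m0(4) ..
      also have "\<dots> = \<z> x (\<Sigma>\<^sub>o (Dom T f))" using m0(1-3) t by simp
      finally obtain a where a: "a \<in> Arr T" "Dom T a = x" "Cod T a = Cod T f" "g \<cdot> a = diff m m0"
        using tri_exact_cov_third[OF tri, of "diff m m0"] m(1-3) m0(1-3) by auto
      have "m0 \<oplus> diff m m0 = (m0 \<oplus> m) \<oplus> \<ominus> m0"
        unfolding diff_def by (rule plus_assoc[symmetric]) (use m(1-3) m0(1-3) in simp_all)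
      also have "m0 \<oplus> m = m \<oplus> m0" by (rule plus_comm) (use m(1-3) m0(1-3) in simp_all)
      also have "(m \<oplus> m0) \<oplus> \<ominus> m0 = m \<oplus> (m0 \<oplus> \<ominus> m0)"
        by (rule plus_assoc) (use m(1-3) m0(1-3) in simp_all)
      also have "\<dots> = m" using m(1-3) m0(1-3) by simp
      finally have "m = m0 \<oplus> (g \<cdot> a)" unfolding a(4) ..
      moreover have "a \<in> Hom T x (Cod T f)" using a by simp
      ultimately show "m \<in> (\<lambda>a. m0 \<oplus> (g \<cdot> a)) ` Hom T x (Cod T f)" by blast
    qed
    have "small \<kappa> (Hom T x (Cod T f))" using small(2) x unfolding hom_small_def by blast
    then show ?thesis by (rule small_subset[OF small_image 2])
  qed
  have "Hom T x (Cod T g) \<subseteq> (\<Union>k\<in>?H. {m \<in> Hom T x (Cod T g). h \<cdot> m = k})" using t by auto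
  then show "small \<kappa> (Hom T x (Cod T g))" by (rule small_subset[OF small_UN[OF H fib]])
qed

text \<open>The colimit of the objects \<open>E\<close> over \<open>w\<close> obtained by iterating this step represents the
  functor \<open>Hom(-, w)\<close> on the localizing subcategory generated by \<open>S\<close>, as in the proof of Brown
  representability.\<close>

lemma kill_step:
  assumes S: "small \<kappa> S" "\<forall>s\<in>S. compact_ob \<kappa> T s"
    and E: "hom_small E" and e: "e \<in> Arr T" "Dom T e = E" "Cod T e = w"
  shows "\<exists>E' e' \<phi>. hom_small E' \<and> e' \<in> Arr T \<and> Dom T e' = E' \<and> Cod T e' = w \<and>
     \<phi> \<in> Arr T \<and> Dom T \<phi> = E \<and> Cod T \<phi> = E' \<and> e' \<cdot> \<phi> = e \<and>
     (\<forall>f. f \<in> Arr T \<and> Dom T f \<in> S \<and> Cod T f = E \<and> e \<cdot> f = \<z> (Dom T f) w \<longrightarrow> \<phi> \<cdot> f = \<z> (Dom T f) E') \<and>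
     (\<forall>L. localizing \<kappa> T L \<and> S \<subseteq> L \<and> E \<in> L \<longrightarrow> E' \<in> L)"
proof -
  have o: "E \<in> Obj T" "w \<in> Obj T" using e by auto
  \<comment> \<open>One copy of \<open>s\<close> for each map from \<open>s\<close> to
    \<open>E\<close> that \<open>e\<close> annihilates; passing to the cone of the combined map
    \<open>p\<close> kills all of them at once.\<close>
  define I where "I = (SIGMA s:S. {f \<in> Hom T s E. e \<cdot> f = \<z> s w})"
  have sm: "small \<kappa> {f \<in> Hom T s E. e \<cdot> f = \<z> s w}" if "s \<in> S" for s
    by (rule small_subset[of "Hom T s E"]) (use E S(2) that in \<open>auto simp: hom_small_def\<close>)
  have I: "small \<kappa> I" unfolding I_def by (rule small_Sigma[OF S(1) sm])
  have IS: "fst i \<in> S" "snd i \<in> Arr T" "Dom T (snd i) = fst i" "Cod T (snd i) = E" "e \<cdot> snd i = \<z> (fst i) w"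
    if "i \<in> I" for i using that unfolding I_def by auto
  obtain B \<iota> where cop: "is_coproduct T I fst B \<iota>"
    using coproduct_exists[OF I, of fst] IS S(2) compact_obj by blast
  note a = coproduct_arr[OF cop]
  have "\<exists>p. p \<in> Arr T \<and> Dom T p = B \<and> Cod T p = E \<and> (\<forall>i\<in>I. p \<cdot> \<iota> i = snd i)"
    by (rule coproduct_arr_ex[OF cop o(1)]) (use IS in simp)
  then obtain p where p: "p \<in> Arr T" "Dom T p = B" "Cod T p = E" "\<forall>i\<in>I. p \<cdot> \<iota> i = snd i" by blast
  obtain \<phi> h where tri: "(p, \<phi>, h) \<in> Tri T" using tri_exists[OF p(1)] by blast
  note t = triD[OF tri]
  have "e \<cdot> p = \<z> B w"
  proof (rule coproduct_arr_unique[OF cop])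
    fix i assume i: "i \<in> I"
    have "(e \<cdot> p) \<cdot> \<iota> i = e \<cdot> snd i" using p(1-3) p(4)[rule_format, OF i] e a(2-4)[OF i] by simp
    then show "(e \<cdot> p) \<cdot> \<iota> i = \<z> B w \<cdot> \<iota> i" using IS(5)[OF i] a(1) a(2-4)[OF i] o by simp
  qed (use e p(1-3) a o in simp_all)
  then obtain e' where e': "e' \<in> Arr T" "Dom T e' = Cod T \<phi>" "Cod T e' = w" "e' \<cdot> \<phi> = e"
    using tri_exact_con[OF tri e(1)] e p(1-3) by auto
  have kill: "\<phi> \<cdot> f = \<z> (Dom T f) (Cod T \<phi>)"
    if f: "f \<in> Arr T" "Dom T f \<in> S" "Cod T f = E" "e \<cdot> f = \<z> (Dom T f) w" for f
  proof -
    have i: "(Dom T f, f) \<in> I" unfolding I_def using f by simp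
    have "\<phi> \<cdot> f = \<phi> \<cdot> (p \<cdot> \<iota> (Dom T f, f))" using p(4) i by simp
    also have "\<dots> = \<z> B (Cod T \<phi>) \<cdot> \<iota> (Dom T f, f)"
      by (rule comp_eq_left[OF tri_comp_zr[OF tri, unfolded p(2)]]) (use t p(1-3) a(2-4)[OF i] in simp_all)
    also have "\<dots> = \<z> (Dom T f) (Cod T \<phi>)" using t a(1) a(2-4)[OF i] by simp
    finally show ?thesis .
  qed
  have "hom_small B"
    by (rule hom_small_coproduct[OF I cop]) (use IS S(2) hom_small_compact in blast)
  then have "hom_small (Cod T \<phi>)" using hom_small_cone[OF tri] E p(2,3) by simp
  moreover have "Cod T \<phi> \<in> L" if "localizing \<kappa> T L" "S \<subseteq> L" "E \<in> L" for L
  proof -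
    have "B \<in> L" by (rule localizing_coproduct[OF that(1) I _ cop]) (use IS that(2) in blast)
    then show ?thesis using localizing_tri(1)[OF that(1) tri] p(2,3) that(3) by simp
  qed
  ultimately show ?thesis
    using e' kill t p(3) by (intro exI[of _ "Cod T \<phi>"] exI[of _ e'] exI[of _ \<phi>]) auto
qed

text \<open>The initial stage makes every map from \<open>S\<close> to \<open>w\<close> lift. The
  later stages only have to shrink the kernel, since liftings persist along the tower.\<close>

lemma start_step:
  assumes S: "small \<kappa> S" "\<forall>s\<in>S. compact_ob \<kappa> T s" and w: "hom_small w"
  shows "\<exists>E e. hom_small E \<and> e \<in> Arr T \<and> Dom T e = E \<and> Cod T e = w \<and>
     (\<forall>f. f \<in> Arr T \<and> Dom T f \<in> S \<and> Cod T f = w \<longrightarrow>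
        (\<exists>f'. f' \<in> Arr T \<and> Dom T f' = Dom T f \<and> Cod T f' = E \<and> e \<cdot> f' = f)) \<and>
     (\<forall>L. localizing \<kappa> T L \<and> S \<subseteq> L \<longrightarrow> E \<in> L)"
proof -
  have o: "w \<in> Obj T" using w unfolding hom_small_def by blast
  define I where "I = (SIGMA s:S. Hom T s w)"
  have sm: "small \<kappa> (Hom T s w)" if "s \<in> S" for s
    using w S(2) that unfolding hom_small_def by blast
  have I: "small \<kappa> I" unfolding I_def by (rule small_Sigma[OF S(1) sm])
  have IS: "fst i \<in> S" "snd i \<in> Arr T" "Dom T (snd i) = fst i" "Cod T (snd i) = w"
    if "i \<in> I" for i using that unfolding I_def by auto
  obtain B \<iota> where cop: "is_coproduct T I fst B \<iota>"
    using coproduct_exists[OF I, of fst] IS S(2) compact_obj by blast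
  note a = coproduct_arr[OF cop]
  have "\<exists>p. p \<in> Arr T \<and> Dom T p = B \<and> Cod T p = w \<and> (\<forall>i\<in>I. p \<cdot> \<iota> i = snd i)"
    by (rule coproduct_arr_ex[OF cop o]) (use IS in simp)
  then obtain p where p: "p \<in> Arr T" "Dom T p = B" "Cod T p = w" "\<forall>i\<in>I. p \<cdot> \<iota> i = snd i" by blast
  have "\<exists>f'. f' \<in> Arr T \<and> Dom T f' = Dom T f \<and> Cod T f' = B \<and> p \<cdot> f' = f"
    if f: "f \<in> Arr T" "Dom T f \<in> S" "Cod T f = w" for f
  proof -
    have i: "(Dom T f, f) \<in> I" unfolding I_def using f by simp
    then show ?thesis using p(4) a(2-4)[OF i] by (intro exI[of _ "\<iota> (Dom T f, f)"]) simp
  qed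
  moreover have "hom_small B"
    by (rule hom_small_coproduct[OF I cop]) (use IS S(2) hom_small_compact in blast)
  moreover have "B \<in> L" if "localizing \<kappa> T L" "S \<subseteq> L" for L
    by (rule localizing_coproduct[OF that(1) I _ cop]) (use IS that(2) in blast)
  ultimately show ?thesis using p by (intro exI[of _ B] exI[of _ p]) auto
qed

text \<open>Composing with \<open>e\<close> is bijective on maps from objects of \<open>S\<close>:
  surjective because of the initial stage, injective because a map from a compact object to the
  telescope factors through a stage and, if \<open>w\<close> does not see it, dies at the next one.
  Since \<open>S\<close> is closed under desuspension up to isomorphism, the cone of
  \<open>e\<close> receives only zero maps from \<open>S\<close>.\<close>

lemma localization_exists:
  assumes S: "small \<kappa> S" "\<forall>s\<in>S. compact_ob \<kappa> T s"
    and desusp: "\<forall>s\<in>S. \<exists>s'\<in>S. isomorphic T (\<Sigma>\<^sub>o s') s" and w: "hom_small w"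
  shows "\<exists>e b c. (e, b, c) \<in> Tri T \<and> Cod T e = w \<and>
     (\<forall>L. localizing \<kappa> T L \<and> S \<subseteq> L \<longrightarrow> Dom T e \<in> L) \<and>
     (\<forall>f. f \<in> Arr T \<and> Dom T f \<in> S \<and> Cod T f = Cod T b \<longrightarrow> f = \<z> (Dom T f) (Cod T b))"
proof -
  have wo: "w \<in> Obj T" using w unfolding hom_small_def by blast
  \<comment> \<open>The invariant of the tower of pairs of an object and its map to
    \<open>w\<close>. The lifting property is demanded at stage \<open>0\<close> alone;
    \<open>Q\<close> records that a transition kills the kernel of its stage.\<close>
  define P where "P n x \<longleftrightarrow> (case x of (E, e) \<Rightarrow> hom_small E \<and> e \<in> Arr T \<and> Dom T e = E \<and> Cod T e = w \<and>
     (n = (0::nat) \<longrightarrow> (\<forall>f. f \<in> Arr T \<and> Dom T f \<in> S \<and> Cod T f = w \<longrightarrow>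
        (\<exists>f'. f' \<in> Arr T \<and> Dom T f' = Dom T f \<and> Cod T f' = E \<and> e \<cdot> f' = f))) \<and>
     (\<forall>L. localizing \<kappa> T L \<and> S \<subseteq> L \<longrightarrow> E \<in> L))" for n x
  define Q where "Q n x x' \<longleftrightarrow> (case (x, x') of ((E, e), (E', e')) \<Rightarrow> \<exists>\<phi>.
     \<phi> \<in> Arr T \<and> Dom T \<phi> = E \<and> Cod T \<phi> = E' \<and> e' \<cdot> \<phi> = e \<and>
     (\<forall>f. f \<in> Arr T \<and> Dom T f \<in> S \<and> Cod T f = E \<and> e \<cdot> f = \<z> (Dom T f) w \<longrightarrow> \<phi> \<cdot> f = \<z> (Dom T f) E'))"
     for n :: nat and x x'
  have "\<exists>F. \<forall>n. P n (F n) \<and> Q n (F n) (F (Suc n))"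
  proof (rule dependent_nat_choice)
    obtain E e where "hom_small E \<and> e \<in> Arr T \<and> Dom T e = E \<and> Cod T e = w \<and>
     (\<forall>f. f \<in> Arr T \<and> Dom T f \<in> S \<and> Cod T f = w \<longrightarrow>
        (\<exists>f'. f' \<in> Arr T \<and> Dom T f' = Dom T f \<and> Cod T f' = E \<and> e \<cdot> f' = f)) \<and>
     (\<forall>L. localizing \<kappa> T L \<and> S \<subseteq> L \<longrightarrow> E \<in> L)" using start_step[OF S w] by blast
    then show "\<exists>x. P 0 x" unfolding P_def by (intro exI[of _ "(E, e)"]) simp
    fix x n assume Px: "P n x"
    obtain E e where x: "x = (E, e)" by (cases x)
    have E: "hom_small E" "e \<in> Arr T" "Dom T e = E" "Cod T e = w" "\<forall>L. localizing \<kappa> T L \<and> S \<subseteq> L \<longrightarrow> E \<in> L"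
      using Px unfolding P_def x by simp_all
    obtain E' e' \<phi> where s: "hom_small E'" "e' \<in> Arr T" "Dom T e' = E'" "Cod T e' = w"
     "\<phi> \<in> Arr T" "Dom T \<phi> = E" "Cod T \<phi> = E'" "e' \<cdot> \<phi> = e"
     "\<forall>f. f \<in> Arr T \<and> Dom T f \<in> S \<and> Cod T f = E \<and> e \<cdot> f = \<z> (Dom T f) w \<longrightarrow> \<phi> \<cdot> f = \<z> (Dom T f) E'"
     "\<forall>L. localizing \<kappa> T L \<and> S \<subseteq> L \<and> E \<in> L \<longrightarrow> E' \<in> L"
      using kill_step[OF S E(1-4)] by blast
    show "\<exists>y. P (Suc n) y \<and> Q n x y"
    proof (intro exI[of _ "(E', e')"] conjI)
      show "P (Suc n) (E', e')" unfolding P_def using s(1-4,10) E(5) by simp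
      show "Q n x (E', e')" unfolding Q_def x prod.case using s(5-9) by blast
    qed
  qed
  then obtain F where F: "\<forall>n. P n (F n) \<and> Q n (F n) (F (Suc n))" by blast
  define E where "E n = fst (F n)" for n
  define v where "v n = snd (F n)" for n
  have Fn: "F n = (E n, v n)" for n unfolding E_def v_def by simp
  have PF: "hom_small (E n)" "v n \<in> Arr T" "Dom T (v n) = E n" "Cod T (v n) = w"
    "\<forall>L. localizing \<kappa> T L \<and> S \<subseteq> L \<longrightarrow> E n \<in> L" for n
    using F[rule_format, of n] unfolding P_def Fn by simp_all
  have start: "\<forall>f. f \<in> Arr T \<and> Dom T f \<in> S \<and> Cod T f = w \<longrightarrow>
        (\<exists>f'. f' \<in> Arr T \<and> Dom T f' = Dom T f \<and> Cod T f' = E 0 \<and> v 0 \<cdot> f' = f)"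
    using F[rule_format, of 0] unfolding P_def Fn by simp
  have "\<forall>n. \<exists>\<phi>. \<phi> \<in> Arr T \<and> Dom T \<phi> = E n \<and> Cod T \<phi> = E (Suc n) \<and> v (Suc n) \<cdot> \<phi> = v n \<and>
     (\<forall>f. f \<in> Arr T \<and> Dom T f \<in> S \<and> Cod T f = E n \<and> v n \<cdot> f = \<z> (Dom T f) w \<longrightarrow> \<phi> \<cdot> f = \<z> (Dom T f) (E (Suc n)))"
    using F unfolding Q_def Fn by simp
  then obtain \<phi> where \<phi>: "\<forall>n. \<phi> n \<in> Arr T \<and> Dom T (\<phi> n) = E n \<and> Cod T (\<phi> n) = E (Suc n) \<and> v (Suc n) \<cdot> \<phi> n = v n \<and>
     (\<forall>f. f \<in> Arr T \<and> Dom T f \<in> S \<and> Cod T f = E n \<and> v n \<cdot> f = \<z> (Dom T f) w \<longrightarrow> \<phi> n \<cdot> f = \<z> (Dom T f) (E (Suc n)))"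
    by metis
  have Eo: "\<forall>n. E n \<in> Obj T" using PF(1) unfolding hom_small_def by blast
  obtain B \<iota> s j h where tel: "telescope E \<phi> B \<iota> s j h"
    using telescope_exists[OF Eo, of \<phi>] \<phi> by blast
  note d = telescopeD[OF tel]
  let ?K = "Cod T j"
  have Ko: "?K \<in> Obj T" using d by simp
  have "\<exists>e. e \<in> Arr T \<and> Dom T e = ?K \<and> Cod T e = w \<and> (\<forall>n. e \<cdot> (j \<cdot> \<iota> n) = v n)"
    by (rule telescope_arr_exists[OF tel wo]) (use PF \<phi> in simp)
  then obtain e where e: "e \<in> Arr T" "Dom T e = ?K" "Cod T e = w" "\<And>n. e \<cdot> (j \<cdot> \<iota> n) = v n" by blast
  have surj: "\<exists>f'. f' \<in> Arr T \<and> Dom T f' = Dom T f \<and> Cod T f' = ?K \<and> e \<cdot> f' = f"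
    if f: "f \<in> Arr T" "Dom T f \<in> S" "Cod T f = w" for f
  proof -
    obtain f' where f': "f' \<in> Arr T" "Dom T f' = Dom T f" "Cod T f' = E 0" "v 0 \<cdot> f' = f"
      using start f by blast
    have "e \<cdot> ((j \<cdot> \<iota> 0) \<cdot> f') = f"
      using comp_eq_left[OF e(4)[of 0], of f'] f' e(1,2) d by simp
    then show ?thesis using f' d by (intro exI[of _ "(j \<cdot> \<iota> 0) \<cdot> f'"]) simp
  qed
  have inj: "f = \<z> (Dom T f) ?K"
    if f: "f \<in> Arr T" "Dom T f \<in> S" "Cod T f = ?K" "e \<cdot> f = \<z> (Dom T f) w" for f
  proof -
    have fc: "compact_ob \<kappa> T (Dom T f)" using S(2) f(2) by blast
    obtain N f' where f': "f' \<in> Arr T" "Dom T f' = Dom T f" "Cod T f' = E N" "f = (j \<cdot> \<iota> N) \<cdot> f'"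
      using telescope_compact_factor[OF tel fc f(1) refl f(3)] by blast
    have "v N \<cdot> f' = e \<cdot> ((j \<cdot> \<iota> N) \<cdot> f')"
      by (rule comp_eq_left[OF e(4), symmetric]) (use f'(1-3) e(1,2) d in simp_all)
    also have "\<dots> = \<z> (Dom T f) w" using f'(4) f(4) by simp
    finally have "v N \<cdot> f' = \<z> (Dom T f') w" using f'(2) by simp
    then have k: "\<phi> N \<cdot> f' = \<z> (Dom T f') (E (Suc N))" using \<phi> f'(1-3) f(2) by auto
    have "f = ((j \<cdot> \<iota> (Suc N)) \<cdot> \<phi> N) \<cdot> f'" using f'(4) telescope_step[OF tel, of N] by simp
    also have "\<dots> = (j \<cdot> \<iota> (Suc N)) \<cdot> (\<phi> N \<cdot> f')" by (rule comp_assoc) (use f'(1-3) d in simp_all)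
    also have "\<dots> = \<z> (Dom T f) ?K" unfolding k using f'(1,2) f(1) d by simp
    finally show ?thesis .
  qed
  obtain b c where tri: "(e, b, c) \<in> Tri T" using tri_exists[OF e(1)] by blast
  note t = triD[OF tri]
  \<comment> \<open>The boundary \<open>c \<cdot> f\<close> desuspends to a map annihilated by
    \<open>e\<close>, so it vanishes by injectivity. Then \<open>f\<close> comes from a map into
    \<open>w\<close>, which lifts along \<open>e\<close> by surjectivity, and
    \<open>b \<cdot> e = 0\<close>.\<close>
  have "f = \<z> (Dom T f) (Cod T b)" if f: "f \<in> Arr T" "Dom T f \<in> S" "Cod T f = Cod T b" for f
  proof -
    let ?s = "Dom T f"
    obtain s' u where s': "s' \<in> S" "iso_arr T u" "Dom T u = \<Sigma>\<^sub>o s'" "Cod T u = ?s"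
      using desusp f(2) unfolding isomorphic_iff by blast
    note u' = iso_arr_in_arr[OF s'(2)]
    have o: "s' \<in> Obj T" "?s \<in> Obj T" using S(2) s'(1) compact_obj f(1) by auto
    have "\<exists>k. k \<in> Arr T \<and> Dom T k = s' \<and> Cod T k = ?K \<and> \<Sigma>\<^sub>a k = c \<cdot> (f \<cdot> u)"
      by (rule shift_full) (use t f u' s' o e(1-3) Ko in simp_all)
    then obtain k where k: "k \<in> Arr T" "Dom T k = s'" "Cod T k = ?K" "\<Sigma>\<^sub>a k = c \<cdot> (f \<cdot> u)" by blast
    have "\<Sigma>\<^sub>a e \<cdot> (c \<cdot> (f \<cdot> u)) = \<z> (Cod T b) (\<Sigma>\<^sub>o w) \<cdot> (f \<cdot> u)"
      by (rule comp_eq_left[OF tri_shift_comp_zr[OF tri, unfolded e(3)]]) (use t f u' s' e(1-3) in simp_all)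
    also have "\<dots> = \<z> (\<Sigma>\<^sub>o s') (\<Sigma>\<^sub>o w)" using f u' s' wo by simp
    finally have "\<Sigma>\<^sub>a (e \<cdot> k) = \<z> (\<Sigma>\<^sub>o s') (\<Sigma>\<^sub>o w)" using k e(1-3) by (simp add: shift_comp)
    then have "e \<cdot> k = \<z> s' w" by (rule shift_eq_zr) (use k e in simp_all)
    then have kz: "k = \<z> s' ?K" using inj[of k] k(1-3) s'(1) by simp
    have "(c \<cdot> f) \<cdot> u = \<z> ?s (\<Sigma>\<^sub>o ?K) \<cdot> u"
      using k(4) kz f u' s' o t e(1,2) Ko by simp
    then have "c \<cdot> f = \<z> ?s (\<Sigma>\<^sub>o ?K)"
      by (rule iso_arr_cancel_right[OF s'(2)]) (use f u' s' o t e(1,2) Ko in simp_all)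
    then obtain m where m: "m \<in> Arr T" "Dom T m = ?s" "Cod T m = w" "b \<cdot> m = f"
      using tri_exact_cov_third[OF tri f(1,3)] e(2,3) by auto
    obtain m' where m': "m' \<in> Arr T" "Dom T m' = ?s" "Cod T m' = ?K" "e \<cdot> m' = m"
      using surj[of m] m(1-3) f(2) by auto
    have "f = b \<cdot> (e \<cdot> m')" using m(4) m'(4) by simp
    also have "\<dots> = \<z> ?K (Cod T b) \<cdot> m'"
      by (rule comp_eq_left[OF tri_comp_zr[OF tri, unfolded e(2)]]) (use t m'(1-3) e(1-3) in simp_all)
    also have "\<dots> = \<z> ?s (Cod T b)" using m'(1-3) t by simp
    finally show ?thesis .
  qed
  moreover have "?K \<in> L" if "localizing \<kappa> T L" "S \<subseteq> L" for L
    by (rule telescope_localizing[OF tel that(1)]) (use PF(5) that in blast)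
  ultimately show ?thesis using tri e(2,3) by (intro exI[of _ e] exI[of _ b] exI[of _ c]) auto
qed

text \<open>The right orthogonal \<open>N\<close> of \<open>C\<close> is stable under suspension and
  desuspension, because \<open>C\<close> is. Its left orthogonal is therefore localizing; it
  contains \<open>C\<close>, hence all that \<open>C\<close> generates.\<close>

lemma perp_Loc:
  assumes C: "C \<subseteq> Obj T" "\<forall>s\<in>C. \<Sigma>\<^sub>o s \<in> C" "\<forall>s\<in>C. \<exists>s'\<in>C. isomorphic T (\<Sigma>\<^sub>o s') s"
    and l: "l \<in> Obj T" "\<forall>f. f \<in> Arr T \<and> Dom T f \<in> C \<and> Cod T f = l \<longrightarrow> f = \<z> (Dom T f) l"
  shows "l \<in> perp T (Loc \<kappa> T C)"
proof -
  define N where "N = {l \<in> Obj T. \<forall>f. f \<in> Arr T \<and> Dom T f \<in> C \<and> Cod T f = l \<longrightarrow> f = \<z> (Dom T f) l}"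
  have N_shift: "\<Sigma>\<^sub>o n \<in> N" if n: "n \<in> N" for n
  proof -
    have no: "n \<in> Obj T" using n unfolding N_def by blast
    have "f = \<z> (Dom T f) (\<Sigma>\<^sub>o n)" if f: "f \<in> Arr T" "Dom T f \<in> C" "Cod T f = \<Sigma>\<^sub>o n" for f
    proof -
      obtain s' u where s': "s' \<in> C" "iso_arr T u" "Dom T u = \<Sigma>\<^sub>o s'" "Cod T u = Dom T f"
        using C(3) f(2) unfolding isomorphic_iff by blast
      note u' = iso_arr_in_arr[OF s'(2)]
      have o: "s' \<in> Obj T" using s'(1) C(1) by blast
      have "\<exists>k. k \<in> Arr T \<and> Dom T k = s' \<and> Cod T k = n \<and> \<Sigma>\<^sub>a k = f \<cdot> u"
        by (rule shift_full) (use f u' s' o no in simp_all)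
      then obtain k where k: "k \<in> Arr T" "Dom T k = s'" "Cod T k = n" "\<Sigma>\<^sub>a k = f \<cdot> u" by blast
      have "k = \<z> s' n" using n k(1-3) s'(1) unfolding N_def by blast
      then have "f \<cdot> u = \<z> (Dom T f) (\<Sigma>\<^sub>o n) \<cdot> u" using k(4) o no u' s' f by simp
      then show ?thesis by (rule iso_arr_cancel_right[OF s'(2)]) (use f s' no in simp_all)
    qed
    then show ?thesis unfolding N_def using no by simp
  qed
  have N_desusp: "\<exists>n' v. n' \<in> N \<and> iso_arr T v \<and> Dom T v = \<Sigma>\<^sub>o n' \<and> Cod T v = n" if n: "n \<in> N" for n
  proof -
    have no: "n \<in> Obj T" using n unfolding N_def by blast
    obtain n' v where v: "n' \<in> Obj T" "iso_arr T v" "Dom T v = \<Sigma>\<^sub>o n'" "Cod T v = n" using desuspension[OF no] by blast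
    note v' = iso_arr_in_arr[OF v(2)]
    have "k = \<z> (Dom T k) n'" if k: "k \<in> Arr T" "Dom T k \<in> C" "Cod T k = n'" for k
    proof -
      have vk: "v \<cdot> \<Sigma>\<^sub>a k \<in> Arr T" "Dom T (v \<cdot> \<Sigma>\<^sub>a k) = \<Sigma>\<^sub>o (Dom T k)" "Cod T (v \<cdot> \<Sigma>\<^sub>a k) = n"
        using v v' k by simp_all
      then have "v \<cdot> \<Sigma>\<^sub>a k = \<z> (\<Sigma>\<^sub>o (Dom T k)) n"
        using n C(2) k(2) unfolding N_def by (metis (mono_tags, lifting) mem_Collect_eq)
      then have "v \<cdot> \<Sigma>\<^sub>a k = v \<cdot> \<z> (\<Sigma>\<^sub>o (Dom T k)) (\<Sigma>\<^sub>o n')" using v v' k by simp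
      then have "\<Sigma>\<^sub>a k = \<z> (\<Sigma>\<^sub>o (Dom T k)) (\<Sigma>\<^sub>o n')"
        by (rule iso_arr_cancel_left[OF v(2)]) (use v k in simp_all)
      then show ?thesis by (rule shift_eq_zr) (use k in simp_all)
    qed
    then show ?thesis using v unfolding N_def by blast
  qed
  define L where "L = {x \<in> Obj T. \<forall>f. f \<in> Arr T \<and> Dom T f = x \<and> Cod T f \<in> N \<longrightarrow> f = \<z> x (Cod T f)}"
  have LD: "f = \<z> (Dom T f) (Cod T f)" if "Dom T f \<in> L" "f \<in> Arr T" "Cod T f \<in> N" for f
    using that unfolding L_def by blast
  have LI: "x \<in> L" if "x \<in> Obj T" "\<And>f. f \<in> Arr T \<Longrightarrow> Dom T f = x \<Longrightarrow> Cod T f \<in> N \<Longrightarrow> f = \<z> x (Cod T f)" for x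
    using that unfolding L_def by blast
  have "localizing \<kappa> T L"
  proof (rule localizingI)
    show "L \<subseteq> Obj T" unfolding L_def by blast
    show "z \<in> L" if "zero_ob T z" for z
      by (rule LI) (use zero_ob_obj[OF that] zero_ob_from[OF that] in auto)
    show "y \<in> L" if xL: "x \<in> L" and iso: "isomorphic T x y" for x y
    proof (rule LI)
      show "y \<in> Obj T" using isomorphic_obj[OF iso] by blast
      obtain u where u: "iso_arr T u" "Dom T u = x" "Cod T u = y" using iso unfolding isomorphic_iff by blast
      note u' = iso_arr_in_arr[OF u(1)]
      fix f assume f: "f \<in> Arr T" "Dom T f = y" "Cod T f \<in> N"
      have "f \<cdot> u = \<z> x (Cod T f)" using LD[of "f \<cdot> u"] xL f u u' by simp
      also have "\<dots> = \<z> y (Cod T f) \<cdot> u" using f(1) u u' by simp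
      finally show "f = \<z> y (Cod T f)"
        by (rule iso_arr_cancel_right[OF u(1)]) (use f u u' \<open>y \<in> Obj T\<close> in simp_all)
    qed
    show "two_of_three T (Obj T) L"
    proof (rule two_of_threeI)
      show "L \<subseteq> Obj T" unfolding L_def by blast
      fix x assume x: "x \<in> Obj T"
      show "\<Sigma>\<^sub>o x \<in> L \<longleftrightarrow> x \<in> L"
      proof
        assume sx: "\<Sigma>\<^sub>o x \<in> L"
        show "x \<in> L"
        proof (rule LI[OF x])
          fix f assume f: "f \<in> Arr T" "Dom T f = x" "Cod T f \<in> N"
          have "\<Sigma>\<^sub>a f = \<z> (\<Sigma>\<^sub>o x) (\<Sigma>\<^sub>o (Cod T f))" using LD[of "\<Sigma>\<^sub>a f"] f sx N_shift by simp
          then show "f = \<z> x (Cod T f)" by (rule shift_eq_zr) (use f in simp_all)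
        qed
      next
        assume xL: "x \<in> L"
        show "\<Sigma>\<^sub>o x \<in> L"
        proof (rule LI)
          show "\<Sigma>\<^sub>o x \<in> Obj T" using x by simp
          fix f assume f: "f \<in> Arr T" "Dom T f = \<Sigma>\<^sub>o x" "Cod T f \<in> N"
          obtain n v where v: "n \<in> N" "iso_arr T v" "Dom T v = \<Sigma>\<^sub>o n" "Cod T v = Cod T f"
            using N_desusp[OF f(3)] by blast
          note v' = iso_arr_in_arr[OF v(2)]
          have no: "n \<in> Obj T" using v(1) unfolding N_def by blast
          have "\<exists>k. k \<in> Arr T \<and> Dom T k = x \<and> Cod T k = n \<and> \<Sigma>\<^sub>a k = inv_arr T v \<cdot> f"
            by (rule shift_full) (use f v v' x no in simp_all)
          then obtain k where k: "k \<in> Arr T" "Dom T k = x" "Cod T k = n" "\<Sigma>\<^sub>a k = inv_arr T v \<cdot> f" by blast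
          have kz: "k = \<z> x n" using LD[of k] k(1-3) xL v(1) by simp
          have "f = v \<cdot> (inv_arr T v \<cdot> f)" using f v v' by simp
          also have "\<dots> = v \<cdot> \<z> (\<Sigma>\<^sub>o x) (\<Sigma>\<^sub>o n)" unfolding k(4)[symmetric] kz using x no by simp
          also have "\<dots> = \<z> (\<Sigma>\<^sub>o x) (Cod T f)" using v v' x by simp
          finally show "f = \<z> (\<Sigma>\<^sub>o x) (Cod T f)" .
        qed
      qed
    next
      fix f g h assume tri: "(f, g, h) \<in> Tri T" and L: "Dom T f \<in> L" "Cod T g \<in> L"
      note t = triD[OF tri]
      show "Cod T f \<in> L"
      proof (rule LI)
        show "Cod T f \<in> Obj T" using t by simp
        fix k assume k: "k \<in> Arr T" "Dom T k = Cod T f" "Cod T k \<in> N"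
        have "k \<cdot> f = \<z> (Dom T f) (Cod T k)" using LD[of "k \<cdot> f"] k t L(1) by simp
        then obtain m where m: "m \<in> Arr T" "Dom T m = Cod T g" "Cod T m = Cod T k" "m \<cdot> g = k"
          using tri_exact_con[OF tri k(1,2)] by blast
        have "m = \<z> (Cod T g) (Cod T k)" using LD[of m] m L(2) k(3) by simp
        then have "k = \<z> (Cod T g) (Cod T k) \<cdot> g" using m(4) by simp
        also have "\<dots> = \<z> (Cod T f) (Cod T k)" using t k(1) by simp
        finally show "k = \<z> (Cod T f) (Cod T k)" .
      qed
    qed
    fix I :: "'u set" and y c \<iota>
    assume y: "\<forall>i\<in>I. y i \<in> L" and cop: "is_coproduct T I y c \<iota>"
    note a = coproduct_arr[OF cop] and o = coproduct_summand_obj[OF cop]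
    show "c \<in> L"
    proof (rule LI)
      show "c \<in> Obj T" by (rule a)
      fix f assume f: "f \<in> Arr T" "Dom T f = c" "Cod T f \<in> N"
      show "f = \<z> c (Cod T f)"
      proof (rule coproduct_arr_unique[OF cop])
        fix i assume i: "i \<in> I"
        have "f \<cdot> \<iota> i = \<z> (y i) (Cod T f)" using LD[of "f \<cdot> \<iota> i"] f a(2-4)[OF i] y i by simp
        then show "f \<cdot> \<iota> i = \<z> c (Cod T f) \<cdot> \<iota> i" using f a(1) a(2-4)[OF i] by simp
      qed (use f a(1) in simp_all)
    qed
  qed
  moreover have "C \<subseteq> L"
  proof
    fix x assume x: "x \<in> C"
    show "x \<in> L" by (rule LI) (use x C(1) in \<open>auto simp: N_def\<close>)
  qed
  ultimately have sub: "Loc \<kappa> T C \<subseteq> L" unfolding Loc_def by blast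
  have lN: "l \<in> N" using l unfolding N_def by blast
  have "Hom T x l = {\<z> x l}" if "x \<in> Loc \<kappa> T C" for x
  proof -
    have x: "x \<in> L" "x \<in> Obj T" using that sub unfolding L_def by blast+
    show ?thesis
    proof (intro subset_antisym subsetI)
      show "f \<in> {\<z> x l}" if "f \<in> Hom T x l" for f using LD[of f] that x lN by simp
      show "f \<in> Hom T x l" if "f \<in> {\<z> x l}" for f using that x l(1) by simp
    qed
  qed
  then show ?thesis unfolding perp_def using l(1) by blast
qed

lemma Loc_localizing: "C \<subseteq> Obj T \<Longrightarrow> localizing \<kappa> T L \<Longrightarrow> C \<subseteq> L \<Longrightarrow> Loc \<kappa> T C \<subseteq> L"
  unfolding Loc_def by blast

text \<open>The tower needs a small generating set, so \<open>C\<close> is cut down to its part in a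
  small skeleton of the compact objects. Closure under isomorphism and suspension makes this part
  closed under desuspension and carries the orthogonality back to \<open>C\<close>.\<close>

lemma compact_localization_exists:
  assumes C: "C \<subseteq> cpt \<kappa> T" "\<forall>x\<in>C. \<forall>y. isomorphic T x y \<longrightarrow> y \<in> C" "\<forall>x\<in>cpt \<kappa> T. \<Sigma>\<^sub>o x \<in> C \<longleftrightarrow> x \<in> C"
  shows "\<exists>a b c e l. (a, b, c) \<in> Tri T \<and> a \<in> Hom T e \<I> \<and> b \<in> Hom T \<I> l \<and>
    e \<in> Loc \<kappa> T C \<and> l \<in> perp T (Loc \<kappa> T C)"
proof -
  obtain G where G: "\<forall>g\<in>G. compact_ob \<kappa> T g" "small \<kappa> G" "\<forall>x. compact_ob \<kappa> T x \<longrightarrow> (\<exists>g\<in>G. isomorphic T g x)"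
    using skeleton_exists by blast
  define S where "S = G \<inter> C"
  have Sc: "\<forall>s\<in>S. compact_ob \<kappa> T s" and Ss: "small \<kappa> S" "S \<subseteq> C"
    using G(1) small_subset[OF G(2)] unfolding S_def by blast+
  have CS: "\<exists>g\<in>S. isomorphic T g x" if x: "x \<in> C" for x
  proof -
    obtain g where g: "g \<in> G" "isomorphic T g x" using G(3) C(1) x by blast
    then have "g \<in> C" using C(2) x isomorphic_sym by blast
    then show ?thesis using g unfolding S_def by blast
  qed
  have Cd: "\<exists>s'. s' \<in> C \<and> isomorphic T (\<Sigma>\<^sub>o s') s" if s: "s \<in> C" for s
  proof -
    obtain s' u where u: "compact_ob \<kappa> T s'" "iso_arr T u" "Dom T u = \<Sigma>\<^sub>o s'" "Cod T u = s"
      using compact_desuspension C(1) s by blast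
    have i: "isomorphic T (\<Sigma>\<^sub>o s') s" by (rule isomorphicI) (use u in auto)
    then have "\<Sigma>\<^sub>o s' \<in> C" using C(2) s isomorphic_sym by blast
    then show ?thesis using C(3) u(1) i by blast
  qed
  have desusp: "\<forall>s\<in>S. \<exists>s'\<in>S. isomorphic T (\<Sigma>\<^sub>o s') s"
  proof
    fix s assume "s \<in> S"
    then obtain s' where s': "s' \<in> C" "isomorphic T (\<Sigma>\<^sub>o s') s" using Cd Ss(2) by blast
    obtain g where g: "g \<in> S" "isomorphic T g s'" using CS[OF s'(1)] by blast
    obtain u where u: "iso_arr T u" "Dom T u = g" "Cod T u = s'" using g(2) unfolding isomorphic_iff by blast
    have "isomorphic T (\<Sigma>\<^sub>o g) (\<Sigma>\<^sub>o s')"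
      by (rule isomorphicI[OF shift_iso_arr[OF u(1)]]) (use u iso_arr_in_arr[OF u(1)] in simp_all)
    then show "\<exists>s'\<in>S. isomorphic T (\<Sigma>\<^sub>o s') s" using g(1) s'(2) isomorphic_trans by blast
  qed
  obtain a b c where abc: "(a, b, c) \<in> Tri T" "Cod T a = \<I>"
    "\<forall>L. localizing \<kappa> T L \<and> S \<subseteq> L \<longrightarrow> Dom T a \<in> L"
    "\<forall>f. f \<in> Arr T \<and> Dom T f \<in> S \<and> Cod T f = Cod T b \<longrightarrow> f = \<z> (Dom T f) (Cod T b)"
    using localization_exists[OF Ss(1) Sc desusp hom_small_compact[OF compact_unit]] by blast
  note t = triD[OF abc(1)]
  have "Dom T a \<in> Loc \<kappa> T C" unfolding Loc_def using abc(3) Ss(2) by blast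
  moreover have "Cod T b \<in> perp T (Loc \<kappa> T C)"
  proof (rule perp_Loc)
    show "C \<subseteq> Obj T" using C(1) compact_obj by blast
    show "\<forall>s\<in>C. \<Sigma>\<^sub>o s \<in> C" using C(1,3) by blast
    show "\<forall>s\<in>C. \<exists>s'\<in>C. isomorphic T (\<Sigma>\<^sub>o s') s" using Cd by blast
    show "Cod T b \<in> Obj T" using t by simp
    show "\<forall>f. f \<in> Arr T \<and> Dom T f \<in> C \<and> Cod T f = Cod T b \<longrightarrow> f = \<z> (Dom T f) (Cod T b)"
    proof (intro allI impI, elim conjE)
      fix f assume f: "f \<in> Arr T" "Dom T f \<in> C" "Cod T f = Cod T b"
      obtain g where g: "g \<in> S" "isomorphic T g (Dom T f)" using CS[OF f(2)] by blast
      obtain u where u: "iso_arr T u" "Dom T u = g" "Cod T u = Dom T f" using g(2) unfolding isomorphic_iff by blast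
      note u' = iso_arr_in_arr[OF u(1)]
      have "f \<cdot> u = \<z> g (Cod T b)"
        using abc(4)[rule_format, of "f \<cdot> u"] f u u' g(1) by simp
      also have "\<dots> = \<z> (Dom T f) (Cod T b) \<cdot> u" using f(1) u u' t by simp
      finally show "f = \<z> (Dom T f) (Cod T b)"
        by (rule iso_arr_cancel_right[OF u(1)]) (use f u u' t in simp_all)
    qed
  qed
  moreover have "a \<in> Hom T (Dom T a) \<I>" "b \<in> Hom T \<I> (Cod T b)" using t abc(2) by simp_all
  ultimately show ?thesis using abc(1) by blast
qed

end

section \<open>Tensor products up to isomorphism\<close>

context mon
begin

text \<open>A normal form for iterated tensor products. An expression is read off as a list by
  \<open>tens_atom\<close> and \<open>tens_mult\<close>; two expressions with the same multiset of
  factors are then isomorphic by \<open>isomorphic_perm\<close>, which removes all rebracketing and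
  reordering from the arguments below.\<close>

fun tens :: "'o list \<Rightarrow> 'o" where
  "tens [] = UnitO C"
| "tens (x # xs) = x \<otimes>\<^sub>o tens xs"

lemma tens_obj: "set xs \<subseteq> Obj C \<Longrightarrow> tens xs \<in> Obj C"
  by (induction xs) simp_all

lemma tens_atom: "x \<in> Obj C \<Longrightarrow> set [x] \<subseteq> Obj C \<and> isomorphic C x (tens [x])"
  using isomorphic_sym[OF isomorphicI[of "RUnit C x"]] by simp

lemma tens_append:
  "set xs \<subseteq> Obj C \<Longrightarrow> set ys \<subseteq> Obj C \<Longrightarrow> isomorphic C (tens xs \<otimes>\<^sub>o tens ys) (tens (xs @ ys))"
proof (induction xs)
  case Nil
  then show ?case using lunit_isomorphic tens_obj by simp
next
  case (Cons x xs)
  have "isomorphic C ((x \<otimes>\<^sub>o tens xs) \<otimes>\<^sub>o tens ys) (x \<otimes>\<^sub>o (tens xs \<otimes>\<^sub>o tens ys))"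
    by (rule assoc_isomorphic) (use Cons.prems tens_obj in simp_all)
  also have "isomorphic C \<dots> (x \<otimes>\<^sub>o tens (xs @ ys))"
    by (rule tensor_isomorphic[OF isomorphic_refl]) (use Cons in simp_all)
  finally show ?case by simp
qed

lemma tens_mult:
  assumes "set xs \<subseteq> Obj C \<and> isomorphic C a (tens xs)" "set ys \<subseteq> Obj C \<and> isomorphic C b (tens ys)"
  shows "set (xs @ ys) \<subseteq> Obj C \<and> isomorphic C (a \<otimes>\<^sub>o b) (tens (xs @ ys))"
  using assms isomorphic_trans[OF tensor_isomorphic tens_append] by auto

end

context tt
begin

lemma tens_move: "set (xs @ x # ys) \<subseteq> Obj T \<Longrightarrow> isomorphic T (tens (xs @ x # ys)) (tens (x # xs @ ys))"
proof (induction xs)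
  case Nil
  then show ?case using isomorphic_refl tens_obj[of "x # ys"] by simp
next
  case (Cons z xs)
  have o: "z \<in> Obj T" "x \<in> Obj T" "tens (xs @ ys) \<in> Obj T" using Cons.prems tens_obj by simp_all
  have "isomorphic T (z \<otimes>\<^sub>o tens (xs @ x # ys)) (z \<otimes>\<^sub>o (x \<otimes>\<^sub>o tens (xs @ ys)))"
    by (rule tensor_isomorphic[OF isomorphic_refl]) (use Cons in simp_all)
  also have "isomorphic T \<dots> ((z \<otimes>\<^sub>o x) \<otimes>\<^sub>o tens (xs @ ys))"
    by (rule isomorphic_sym[OF assoc_isomorphic]) (use o in simp_all)
  also have "isomorphic T \<dots> ((x \<otimes>\<^sub>o z) \<otimes>\<^sub>o tens (xs @ ys))"
    by (rule tensor_isomorphic[OF braid_isomorphic isomorphic_refl]) (use o in simp_all)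
  also have "isomorphic T \<dots> (x \<otimes>\<^sub>o (z \<otimes>\<^sub>o tens (xs @ ys)))"
    by (rule assoc_isomorphic) (use o in simp_all)
  finally show ?case by simp
qed

lemma tens_perm: "mset xs = mset ys \<Longrightarrow> set xs \<subseteq> Obj T \<Longrightarrow> isomorphic T (tens xs) (tens ys)"
proof (induction xs arbitrary: ys)
  case Nil
  then show ?case using isomorphic_refl by simp
next
  case (Cons x xs)
  then have "x \<in> set ys" using mset_eq_setD by fastforce
  then obtain as bs where ys: "ys = as @ x # bs" using split_list by fast
  have m: "mset xs = mset (as @ bs)" using Cons.prems(1) unfolding ys by simp
  have s: "set (as @ x # bs) \<subseteq> Obj T" using Cons.prems mset_eq_setD unfolding ys by metis
  have "isomorphic T (x \<otimes>\<^sub>o tens xs) (x \<otimes>\<^sub>o tens (as @ bs))"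
    by (rule tensor_isomorphic[OF isomorphic_refl Cons.IH[OF m]]) (use Cons.prems(2) in simp_all)
  also have "isomorphic T \<dots> (tens ys)"
    using isomorphic_sym[OF tens_move[OF s]] unfolding ys by simp
  finally show ?case by simp
qed

lemma isomorphic_perm:
  assumes "set xs \<subseteq> Obj T \<and> isomorphic T a (tens xs)" "set ys \<subseteq> Obj T \<and> isomorphic T b (tens ys)"
    "mset xs = mset ys"
  shows "isomorphic T a b"
  using assms isomorphic_trans isomorphic_sym tens_perm by metis

end

section \<open>Thick ideals and the spectrum\<close>

context rcg
begin

lemma thickD:
  assumes "thick_ideal \<kappa> T J"
  shows "J \<subseteq> cpt \<kappa> T" "x \<in> J \<Longrightarrow> compact_ob \<kappa> T x" "zero_ob T z \<Longrightarrow> z \<in> J" "x \<in> J \<Longrightarrow> isomorphic T x y \<Longrightarrow> y \<in> J"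
    "two_of_three T (cpt \<kappa> T) J"
    "compact_ob \<kappa> T x \<Longrightarrow> y \<in> J \<Longrightarrow> s \<in> Hom T x y \<Longrightarrow> r \<in> Hom T y x \<Longrightarrow> r \<cdot> s = Ide T x \<Longrightarrow> x \<in> J"
    "compact_ob \<kappa> T x \<Longrightarrow> y \<in> J \<Longrightarrow> x \<otimes>\<^sub>o y \<in> J"
  using assms unfolding thick_ideal_def iso_closed_def by blast+

lemma thickI:
  assumes "J \<subseteq> cpt \<kappa> T" "\<And>z. zero_ob T z \<Longrightarrow> z \<in> J" "\<And>x y. x \<in> J \<Longrightarrow> isomorphic T x y \<Longrightarrow> y \<in> J"
    "\<And>f g h. (f, g, h) \<in> Tri T \<Longrightarrow> compact_ob \<kappa> T (Dom T f) \<Longrightarrow> compact_ob \<kappa> T (Cod T f) \<Longrightarrow> compact_ob \<kappa> T (Cod T g) \<Longrightarrow>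
      (Dom T f \<in> J \<longrightarrow> Cod T f \<in> J \<longrightarrow> Cod T g \<in> J) \<and> (Dom T f \<in> J \<longrightarrow> Cod T g \<in> J \<longrightarrow> Cod T f \<in> J) \<and>
      (Cod T f \<in> J \<longrightarrow> Cod T g \<in> J \<longrightarrow> Dom T f \<in> J)"
    "\<And>x y s r. compact_ob \<kappa> T x \<Longrightarrow> y \<in> J \<Longrightarrow> s \<in> Arr T \<Longrightarrow> Dom T s = x \<Longrightarrow> Cod T s = y \<Longrightarrow>
      r \<in> Arr T \<Longrightarrow> Dom T r = y \<Longrightarrow> Cod T r = x \<Longrightarrow> r \<cdot> s = Ide T x \<Longrightarrow> x \<in> J"
    "\<And>x y. compact_ob \<kappa> T x \<Longrightarrow> y \<in> J \<Longrightarrow> x \<otimes>\<^sub>o y \<in> J"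
  shows "thick_ideal \<kappa> T J"
  unfolding thick_ideal_def
proof (intro conjI)
  show "two_of_three T (cpt \<kappa> T) J"
    unfolding two_of_three_def
  proof (intro allI impI, elim conjE)
    fix f g h assume "(f, g, h) \<in> Tri T" "{Dom T f, Cod T f, Cod T g} \<subseteq> cpt \<kappa> T"
    then show "(Dom T f \<in> J \<and> Cod T f \<in> J \<longrightarrow> Cod T g \<in> J) \<and> (Dom T f \<in> J \<and> Cod T g \<in> J \<longrightarrow> Cod T f \<in> J) \<and>
        (Cod T f \<in> J \<and> Cod T g \<in> J \<longrightarrow> Dom T f \<in> J)"
      using assms(4)[of f g h] by simp
  qed
  show "\<forall>x\<in>cpt \<kappa> T. \<forall>y\<in>J. \<forall>s r. s \<in> Hom T x y \<and> r \<in> Hom T y x \<and> r \<cdot> s = Ide T x \<longrightarrow> x \<in> J"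
    using assms(5) by auto
  show "iso_closed T J" unfolding iso_closed_def using assms(3) by blast
qed (use assms(1,2,6) in auto)

lemma thick_tri:
  assumes "thick_ideal \<kappa> T J" "(f, g, h) \<in> Tri T"
    "compact_ob \<kappa> T (Dom T f)" "compact_ob \<kappa> T (Cod T f)" "compact_ob \<kappa> T (Cod T g)"
  shows "Dom T f \<in> J \<Longrightarrow> Cod T f \<in> J \<Longrightarrow> Cod T g \<in> J" "Dom T f \<in> J \<Longrightarrow> Cod T g \<in> J \<Longrightarrow> Cod T f \<in> J"
    "Cod T f \<in> J \<Longrightarrow> Cod T g \<in> J \<Longrightarrow> Dom T f \<in> J"
  using two_of_threeD[OF thickD(5)[OF assms(1)] assms(2)] assms(3-5) by simp_all

lemma thick_tensor_right:
  assumes "thick_ideal \<kappa> T J" "compact_ob \<kappa> T x" "y \<in> J"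
  shows "y \<otimes>\<^sub>o x \<in> J"
  using thickD(4)[OF assms(1) thickD(7)[OF assms] braid_isomorphic] compact_obj[OF assms(2)]
    compact_obj[OF thickD(2)[OF assms(1,3)]] by blast

text \<open>The triangle \<open>x \<rightarrow> 0 \<rightarrow> \<Sigma>x\<close> gives both
  directions.\<close>

lemma thick_shift:
  assumes J: "thick_ideal \<kappa> T J" and x: "compact_ob \<kappa> T x"
  shows "\<Sigma>\<^sub>o x \<in> J \<longleftrightarrow> x \<in> J"
proof -
  obtain z where z: "zero_ob T z" using zero_ob_exists by blast
  note o = zero_ob_obj[OF z] compact_obj[OF x]
  have t: "(\<z> x z, \<z> z (\<Sigma>\<^sub>o x), \<ominus> (Ide T (\<Sigma>\<^sub>o x))) \<in> Tri T"
    using tri_rot[OF tri_ide[OF o(2) z]] o by simp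
  show ?thesis
    using thick_tri[OF J t] thickD(3)[OF J z] o x compact_shift[OF x] compact_zero[OF z] by auto
qed

lemma thick_cpt: "thick_ideal \<kappa> T (cpt \<kappa> T)"
  by (rule thickI) (use compact_zero compact_iso compact_tensor in auto)

lemma thick_Inter:
  assumes "\<K> \<noteq> {}" "\<And>K. K \<in> \<K> \<Longrightarrow> thick_ideal \<kappa> T K"
  shows "thick_ideal \<kappa> T (\<Inter>\<K>)"
proof (rule thickI)
  show "\<Inter>\<K> \<subseteq> cpt \<kappa> T" using assms thickD(1) by blast
  show "z \<in> \<Inter>\<K>" if "zero_ob T z" for z using thickD(3)[OF assms(2) that] by blast
  show "y \<in> \<Inter>\<K>" if "x \<in> \<Inter>\<K>" "isomorphic T x y" for x y
    using thickD(4)[OF assms(2) _ that(2)] that(1) by blast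
  show "x \<otimes>\<^sub>o y \<in> \<Inter>\<K>" if "compact_ob \<kappa> T x" "y \<in> \<Inter>\<K>" for x y
    using thickD(7)[OF assms(2) that(1)] that(2) by blast
  show "x \<in> \<Inter>\<K>" if x: "compact_ob \<kappa> T x" and y: "y \<in> \<Inter>\<K>" and sr: "s \<in> Arr T" "Dom T s = x" "Cod T s = y"
      "r \<in> Arr T" "Dom T r = y" "Cod T r = x" "r \<cdot> s = Ide T x" for x y s r
  proof
    fix K assume "K \<in> \<K>"
    then show "x \<in> K" using thickD(6)[OF assms(2) x, of K y s r] y sr by simp
  qed
  fix f g h assume t: "(f, g, h) \<in> Tri T" "compact_ob \<kappa> T (Dom T f)" "compact_ob \<kappa> T (Cod T f)" "compact_ob \<kappa> T (Cod T g)"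
  show "(Dom T f \<in> \<Inter>\<K> \<longrightarrow> Cod T f \<in> \<Inter>\<K> \<longrightarrow> Cod T g \<in> \<Inter>\<K>) \<and> (Dom T f \<in> \<Inter>\<K> \<longrightarrow> Cod T g \<in> \<Inter>\<K> \<longrightarrow> Cod T f \<in> \<Inter>\<K>) \<and>
      (Cod T f \<in> \<Inter>\<K> \<longrightarrow> Cod T g \<in> \<Inter>\<K> \<longrightarrow> Dom T f \<in> \<Inter>\<K>)"
    using thick_tri[OF assms(2) t] by (meson InterI InterD)
qed

lemma thick_Union_chain:
  assumes "\<K> \<noteq> {}" "\<And>K. K \<in> \<K> \<Longrightarrow> thick_ideal \<kappa> T K" and chain: "\<And>K K'. K \<in> \<K> \<Longrightarrow> K' \<in> \<K> \<Longrightarrow> K \<subseteq> K' \<or> K' \<subseteq> K"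
  shows "thick_ideal \<kappa> T (\<Union>\<K>)"
proof (rule thickI)
  show "\<Union>\<K> \<subseteq> cpt \<kappa> T" using assms thickD(1) by blast
  show "z \<in> \<Union>\<K>" if "zero_ob T z" for z using thickD(3)[OF assms(2) that] assms(1) by blast
  show "y \<in> \<Union>\<K>" if "x \<in> \<Union>\<K>" "isomorphic T x y" for x y
    using thickD(4)[OF assms(2) _ that(2)] that(1) by blast
  show "x \<otimes>\<^sub>o y \<in> \<Union>\<K>" if "compact_ob \<kappa> T x" "y \<in> \<Union>\<K>" for x y
    using thickD(7)[OF assms(2) that(1)] that(2) by blast
  show "x \<in> \<Union>\<K>" if x: "compact_ob \<kappa> T x" and y: "y \<in> \<Union>\<K>" and sr: "s \<in> Arr T" "Dom T s = x" "Cod T s = y"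
      "r \<in> Arr T" "Dom T r = y" "Cod T r = x" "r \<cdot> s = Ide T x" for x y s r
  proof -
    obtain K where K: "K \<in> \<K>" "y \<in> K" using y by blast
    then have "x \<in> K" using thickD(6)[OF assms(2) x, of K y s r] sr by simp
    then show ?thesis using K by blast
  qed
  fix f g h assume t: "(f, g, h) \<in> Tri T" "compact_ob \<kappa> T (Dom T f)" "compact_ob \<kappa> T (Cod T f)" "compact_ob \<kappa> T (Cod T g)"
  have common: "\<exists>K\<in>\<K>. x \<in> K \<and> y \<in> K" if "x \<in> \<Union>\<K>" "y \<in> \<Union>\<K>" for x y
    using that chain by (metis UnionE subsetD)
  show "(Dom T f \<in> \<Union>\<K> \<longrightarrow> Cod T f \<in> \<Union>\<K> \<longrightarrow> Cod T g \<in> \<Union>\<K>) \<and> (Dom T f \<in> \<Union>\<K> \<longrightarrow> Cod T g \<in> \<Union>\<K> \<longrightarrow> Cod T f \<in> \<Union>\<K>) \<and>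
      (Cod T f \<in> \<Union>\<K> \<longrightarrow> Cod T g \<in> \<Union>\<K> \<longrightarrow> Dom T f \<in> \<Union>\<K>)"
  proof (intro conjI impI)
    assume "Dom T f \<in> \<Union>\<K>" "Cod T f \<in> \<Union>\<K>"
    then obtain K where "K \<in> \<K>" "Dom T f \<in> K" "Cod T f \<in> K" using common by blast
    then show "Cod T g \<in> \<Union>\<K>" using thick_tri(1)[OF assms(2) t] by blast
  next
    assume "Dom T f \<in> \<Union>\<K>" "Cod T g \<in> \<Union>\<K>"
    then obtain K where "K \<in> \<K>" "Dom T f \<in> K" "Cod T g \<in> K" using common by blast
    then show "Cod T f \<in> \<Union>\<K>" using thick_tri(2)[OF assms(2) t] by blast
  next
    assume "Cod T f \<in> \<Union>\<K>" "Cod T g \<in> \<Union>\<K>"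
    then obtain K where "K \<in> \<K>" "Cod T f \<in> K" "Cod T g \<in> K" using common by blast
    then show "Dom T f \<in> \<Union>\<K>" using thick_tri(3)[OF assms(2) t] by blast
  qed
qed

text \<open>The ideal quotient of \<open>J\<close> by \<open>b\<close>. It enlarges a maximal ideal
  in the proof of primality.\<close>

lemma thick_colon:
  assumes J: "thick_ideal \<kappa> T J" and b: "compact_ob \<kappa> T b"
  shows "thick_ideal \<kappa> T {x \<in> cpt \<kappa> T. x \<otimes>\<^sub>o b \<in> J}"
proof (rule thickI)
  note bo = compact_obj[OF b]
  let ?K = "{x \<in> cpt \<kappa> T. x \<otimes>\<^sub>o b \<in> J}"
  show "?K \<subseteq> cpt \<kappa> T" by blast
  show "z \<in> ?K" if "zero_ob T z" for z
    using compact_zero[OF that] thickD(3)[OF J zero_ob_tensor(1)[OF that bo]] by simp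
  show "y \<in> ?K" if "x \<in> ?K" "isomorphic T x y" for x y
    using that compact_iso[OF _ that(2)] thickD(4)[OF J _ tensor_isomorphic[OF that(2) isomorphic_refl[OF bo]]] by blast
  show "x \<otimes>\<^sub>o y \<in> ?K" if x: "compact_ob \<kappa> T x" and y: "y \<in> ?K" for x y
  proof -
    have o: "x \<in> Obj T" "y \<in> Obj T" using x y compact_obj by blast+
    have "x \<otimes>\<^sub>o y \<otimes>\<^sub>o b \<in> J" using thickD(7)[OF J x] y by blast
    then have "(x \<otimes>\<^sub>o y) \<otimes>\<^sub>o b \<in> J" using thickD(4)[OF J _ isomorphic_sym[OF assoc_isomorphic[OF o bo]]] by blast
    then show ?thesis using compact_tensor[OF x] y by simp
  qed
  show "x \<in> ?K" if x: "compact_ob \<kappa> T x" and y: "y \<in> ?K" and sr: "s \<in> Arr T" "Dom T s = x" "Cod T s = y"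
      "r \<in> Arr T" "Dom T r = y" "Cod T r = x" "r \<cdot> s = Ide T x" for x y s r
  proof -
    have "x \<otimes>\<^sub>o b \<in> J"
      by (rule thickD(6)[OF J compact_tensor[OF x b], of "y \<otimes>\<^sub>o b" "s \<otimes>\<^sub>a Ide T b" "r \<otimes>\<^sub>a Ide T b"])
        (use y sr bo compact_obj[OF x] in simp_all)
    then show ?thesis using x by simp
  qed
  fix f g h assume t: "(f, g, h) \<in> Tri T" "compact_ob \<kappa> T (Dom T f)" "compact_ob \<kappa> T (Cod T f)" "compact_ob \<kappa> T (Cod T g)"
  show "(Dom T f \<in> ?K \<longrightarrow> Cod T f \<in> ?K \<longrightarrow> Cod T g \<in> ?K) \<and> (Dom T f \<in> ?K \<longrightarrow> Cod T g \<in> ?K \<longrightarrow> Cod T f \<in> ?K) \<and>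
      (Cod T f \<in> ?K \<longrightarrow> Cod T g \<in> ?K \<longrightarrow> Dom T f \<in> ?K)"
    using thick_tri[OF J tri_tensor[OF t(1) bo]] triD[OF t(1)] t bo compact_tensor[OF _ b] by simp
qed

section \<open>Localizing ideals and the compact objects that they absorb\<close>

definition loc_ideal where
  "loc_ideal L \<longleftrightarrow> localizing \<kappa> T L \<and> (\<forall>x\<in>Obj T. \<forall>y\<in>L. x \<otimes>\<^sub>o y \<in> L)"

lemma loc_idealD:
  assumes "loc_ideal L"
  shows "localizing \<kappa> T L" "x \<in> Obj T \<Longrightarrow> y \<in> L \<Longrightarrow> x \<otimes>\<^sub>o y \<in> L" "zero_ob T z \<Longrightarrow> z \<in> L"
    "x \<in> L \<Longrightarrow> isomorphic T x y \<Longrightarrow> y \<in> L"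
  using assms localizingD(2,3) unfolding loc_ideal_def by blast+

lemma loc_ideal_zeros: "loc_ideal {z. zero_ob T z}"
  unfolding loc_ideal_def using localizing_zeros zero_ob_tensor(2) by simp

text \<open>The first duality equation, composed with the inverse of the left unitor, reads as a
  retraction.\<close>

lemma dual_retract:
  assumes x: "compact_ob \<kappa> T x"
  obtains y ev coev s r where "dual_pair x y ev coev" "s \<in> Arr T" "Dom T s = x" "Cod T s = (x \<otimes>\<^sub>o y) \<otimes>\<^sub>o x"
    "r \<in> Arr T" "Dom T r = (x \<otimes>\<^sub>o y) \<otimes>\<^sub>o x" "Cod T r = x" "r \<cdot> s = Ide T x"
proof -
  obtain y ev coev where d: "dual_pair x y ev coev" by (rule compact_dual[OF x])
  note [simp] = dual_pairD(1-8)[OF d]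
  let ?s = "(coev \<otimes>\<^sub>a Ide T x) \<cdot> inv_arr T (LUnit T x)"
  let ?r = "RUnit T x \<cdot> (Ide T x \<otimes>\<^sub>a ev) \<cdot> Assoc T x y x"
  have "?r \<cdot> ?s = (RUnit T x \<cdot> (Ide T x \<otimes>\<^sub>a ev) \<cdot> Assoc T x y x \<cdot> (coev \<otimes>\<^sub>a Ide T x)) \<cdot> inv_arr T (LUnit T x)"
    by simp
  also have "\<dots> = Ide T x" unfolding dual_pairD(9)[OF d] by simp
  finally show ?thesis using that[OF d, of ?s ?r] by simp
qed

text \<open>The closure under retracts is the delicate condition; it rests on
  \<open>localizing_retract\<close> and so on countable coproducts. The others express exactness and
  associativity of the tensor product.\<close>

lemma thick_preimage:
  assumes L: "loc_ideal L" and t: "t \<in> Obj T"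
  shows "thick_ideal \<kappa> T {x \<in> cpt \<kappa> T. x \<otimes>\<^sub>o t \<in> L}"
proof (rule thickI)
  note Ll = loc_idealD(1)[OF L]
  let ?K = "{x \<in> cpt \<kappa> T. x \<otimes>\<^sub>o t \<in> L}"
  show "?K \<subseteq> cpt \<kappa> T" by blast
  show "z \<in> ?K" if "zero_ob T z" for z
    using compact_zero[OF that] loc_idealD(3)[OF L zero_ob_tensor(1)[OF that t]] by simp
  show "y \<in> ?K" if "x \<in> ?K" "isomorphic T x y" for x y
    using that compact_iso[OF _ that(2)] loc_idealD(4)[OF L _ tensor_isomorphic[OF that(2) isomorphic_refl[OF t]]] by blast
  show "x \<otimes>\<^sub>o y \<in> ?K" if x: "compact_ob \<kappa> T x" and y: "y \<in> ?K" for x y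
  proof -
    have o: "x \<in> Obj T" "y \<in> Obj T" using x y compact_obj by blast+
    have "x \<otimes>\<^sub>o y \<otimes>\<^sub>o t \<in> L" using loc_idealD(2)[OF L o(1)] y by blast
    then have "(x \<otimes>\<^sub>o y) \<otimes>\<^sub>o t \<in> L" using loc_idealD(4)[OF L _ isomorphic_sym[OF assoc_isomorphic[OF o t]]] by blast
    then show ?thesis using compact_tensor[OF x] y by simp
  qed
  show "x \<in> ?K" if x: "compact_ob \<kappa> T x" and y: "y \<in> ?K" and sr: "s \<in> Arr T" "Dom T s = x" "Cod T s = y"
      "r \<in> Arr T" "Dom T r = y" "Cod T r = x" "r \<cdot> s = Ide T x" for x y s r
  proof -
    have "x \<otimes>\<^sub>o t \<in> L"
      by (rule localizing_retract[OF Ll, of "y \<otimes>\<^sub>o t" "s \<otimes>\<^sub>a Ide T t" _ "r \<otimes>\<^sub>a Ide T t"])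
        (use y sr t compact_obj[OF x] in simp_all)
    then show ?thesis using x by simp
  qed
  fix f g h assume tr: "(f, g, h) \<in> Tri T" "compact_ob \<kappa> T (Dom T f)" "compact_ob \<kappa> T (Cod T f)" "compact_ob \<kappa> T (Cod T g)"
  show "(Dom T f \<in> ?K \<longrightarrow> Cod T f \<in> ?K \<longrightarrow> Cod T g \<in> ?K) \<and> (Dom T f \<in> ?K \<longrightarrow> Cod T g \<in> ?K \<longrightarrow> Cod T f \<in> ?K) \<and>
      (Cod T f \<in> ?K \<longrightarrow> Cod T g \<in> ?K \<longrightarrow> Dom T f \<in> ?K)"
    using localizing_tri[OF Ll tri_tensor[OF tr(1) t]] triD[OF tr(1)] tr t by simp
qed

definition radical where
  "radical J \<longleftrightarrow> thick_ideal \<kappa> T J \<and> (\<forall>x. compact_ob \<kappa> T x \<longrightarrow> x \<otimes>\<^sub>o x \<in> J \<longrightarrow> x \<in> J)"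

text \<open>With a dual \<open>y\<close>, the object \<open>x\<close> is a retract of
  \<open>(x \<otimes> y) \<otimes> x\<close>, which up to order is \<open>y\<close> tensored with
  the square of \<open>x\<close>. So \<open>L\<close> contains \<open>x \<otimes> t\<close> as soon
  as it contains the square of \<open>x\<close> tensored with \<open>t\<close>.\<close>

lemma radical_preimage:
  assumes L: "loc_ideal L" and t: "t \<in> Obj T"
  shows "radical {x \<in> cpt \<kappa> T. x \<otimes>\<^sub>o t \<in> L}"
  unfolding radical_def
proof (intro conjI allI impI thick_preimage L t)
  fix x assume x: "compact_ob \<kappa> T x" and xx: "x \<otimes>\<^sub>o x \<in> {x \<in> cpt \<kappa> T. x \<otimes>\<^sub>o t \<in> L}"
  obtain y ev coev s r where d: "dual_pair x y ev coev" and
    sr: "s \<in> Arr T" "Dom T s = x" "Cod T s = (x \<otimes>\<^sub>o y) \<otimes>\<^sub>o x"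
    "r \<in> Arr T" "Dom T r = (x \<otimes>\<^sub>o y) \<otimes>\<^sub>o x" "Cod T r = x" "r \<cdot> s = Ide T x"
    by (rule dual_retract[OF x])
  have o: "x \<in> Obj T" "y \<in> Obj T" using dual_pairD(1,2)[OF d] by blast+
  have "y \<otimes>\<^sub>o ((x \<otimes>\<^sub>o x) \<otimes>\<^sub>o t) \<in> L" using loc_idealD(2)[OF L o(2)] xx by blast
  moreover have "isomorphic T (y \<otimes>\<^sub>o ((x \<otimes>\<^sub>o x) \<otimes>\<^sub>o t)) (((x \<otimes>\<^sub>o y) \<otimes>\<^sub>o x) \<otimes>\<^sub>o t)"
    by (rule isomorphic_perm, (rule tens_mult tens_atom o t)+, simp)
  ultimately have "((x \<otimes>\<^sub>o y) \<otimes>\<^sub>o x) \<otimes>\<^sub>o t \<in> L" by (rule loc_idealD(4)[OF L])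
  then have "x \<otimes>\<^sub>o t \<in> L"
    by (rule localizing_retract[OF loc_idealD(1)[OF L], of _ "s \<otimes>\<^sub>a Ide T t" _ "r \<otimes>\<^sub>a Ide T t"])
      (use sr t o in simp_all)
  then show "x \<in> {x \<in> cpt \<kappa> T. x \<otimes>\<^sub>o t \<in> L}" using x by simp
qed

section \<open>Prime ideals and supports of compact objects\<close>

lemma prime_exists:
  assumes J: "thick_ideal \<kappa> T J"
    and M: "M \<subseteq> cpt \<kappa> T" "\<I> \<in> M" "\<forall>a\<in>M. \<forall>b\<in>M. a \<otimes>\<^sub>o b \<in> M" "J \<inter> M = {}"
  shows "\<exists>P\<in>Spc \<kappa> T. J \<subseteq> P \<and> P \<inter> M = {}"
proof -
  define A where "A = {K. thick_ideal \<kappa> T K \<and> J \<subseteq> K \<and> K \<inter> M = {}}"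
  have "\<exists>P\<in>A. \<forall>X\<in>A. P \<subseteq> X \<longrightarrow> X = P"
  proof (rule subset_Zorn_nonempty)
    show "A \<noteq> {}" using J M(4) unfolding A_def by blast
    fix \<C> assume C: "\<C> \<noteq> {}" "subset.chain A \<C>"
    have "thick_ideal \<kappa> T (\<Union>\<C>)"
      by (rule thick_Union_chain[OF C(1)]) (use C(2) in \<open>auto simp: subset_chain_def A_def\<close>)
    then show "\<Union>\<C> \<in> A" using C unfolding subset_chain_def A_def by blast
  qed
  then obtain P where P: "thick_ideal \<kappa> T P" "J \<subseteq> P" "P \<inter> M = {}"
    and max: "\<And>X. thick_ideal \<kappa> T X \<Longrightarrow> P \<subseteq> X \<Longrightarrow> X \<inter> M = {} \<Longrightarrow> X = P"
    unfolding A_def by auto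
  have colon: "P \<subseteq> {x \<in> cpt \<kappa> T. x \<otimes>\<^sub>o b \<in> P}" if "compact_ob \<kappa> T b" for b
    using thick_tensor_right[OF P(1) that] thickD(1)[OF P(1)] by blast
  have "x \<in> P \<or> y \<in> P" if xy: "compact_ob \<kappa> T x" "compact_ob \<kappa> T y" "x \<otimes>\<^sub>o y \<in> P" for x y
  proof (rule ccontr)
    assume n: "\<not> (x \<in> P \<or> y \<in> P)"
    \<comment> \<open>The quotient of \<open>P\<close> by \<open>y\<close> contains
      \<open>x\<close>, which is not in \<open>P\<close>; by maximality it meets \<open>M\<close>,
      say in \<open>s\<close>. Repeating this with the quotient by \<open>s\<close>, which contains
      \<open>y\<close>, puts a product of two members of \<open>M\<close> into
      \<open>P\<close>.\<close>
    have "{c \<in> cpt \<kappa> T. c \<otimes>\<^sub>o y \<in> P} \<inter> M \<noteq> {}"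
      using max[OF thick_colon[OF P(1) xy(2)] colon[OF xy(2)]] n xy by blast
    then obtain s where s: "s \<in> M" "compact_ob \<kappa> T s" "s \<otimes>\<^sub>o y \<in> P" by blast
    then have "y \<otimes>\<^sub>o s \<in> P"
      using thickD(4)[OF P(1) _ braid_isomorphic] compact_obj xy(2) by blast
    then have "{c \<in> cpt \<kappa> T. c \<otimes>\<^sub>o s \<in> P} \<inter> M \<noteq> {}"
      using max[OF thick_colon[OF P(1) s(2)] colon[OF s(2)]] n xy by blast
    then obtain s' where s': "s' \<in> M" "s' \<otimes>\<^sub>o s \<in> P" by blast
    then have "s' \<otimes>\<^sub>o s \<in> M" using M(3) s(1) by blast
    then show False using s'(2) P(3) by blast
  qed
  moreover have "P \<noteq> cpt \<kappa> T" using P(3) M(1,2) by blast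
  ultimately have "P \<in> Spc \<kappa> T" using P(1) unfolding Spc_def by blast
  then show ?thesis using P(2,3) by blast
qed

lemma SpcD:
  assumes "P \<in> Spc \<kappa> T"
  shows "thick_ideal \<kappa> T P" "P \<noteq> cpt \<kappa> T"
    "compact_ob \<kappa> T x \<Longrightarrow> compact_ob \<kappa> T y \<Longrightarrow> x \<otimes>\<^sub>o y \<in> P \<Longrightarrow> x \<in> P \<or> y \<in> P"
  using assms unfolding Spc_def by blast+

lemma supp_tensor:
  assumes "compact_ob \<kappa> T x" "compact_ob \<kappa> T y"
  shows "supp \<kappa> T (x \<otimes>\<^sub>o y) = supp \<kappa> T x \<inter> supp \<kappa> T y"
  using SpcD(3)[OF _ assms] thickD(7)[OF SpcD(1) assms(1)] thick_tensor_right[OF SpcD(1) assms(2)]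
  unfolding supp_def by blast

lemma supp_zero: "zero_ob T z \<Longrightarrow> supp \<kappa> T z = {}"
  using thickD(3)[OF SpcD(1)] unfolding supp_def by blast

lemma supp_unit: "supp \<kappa> T \<I> = Spc \<kappa> T"
proof -
  have "\<I> \<notin> P" if P: "P \<in> Spc \<kappa> T" for P
  proof
    assume "\<I> \<in> P"
    then have "x \<in> P" if "compact_ob \<kappa> T x" for x
      using thickD(4)[OF SpcD(1)[OF P] thick_tensor_right[OF SpcD(1)[OF P] that] lunit_isomorphic[OF compact_obj[OF that]]]
      by blast
    then show False using SpcD(1,2)[OF P] thickD(1) by blast
  qed
  then show ?thesis unfolding supp_def by blast
qed

lemma supp_subset: "supp \<kappa> T x \<subseteq> Spc \<kappa> T"
  unfolding supp_def by blast

text \<open>A direct sum lies in a prime exactly if both summands do: the summands are retracts of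
  it, and conversely it sits in a triangle whose cone is the second summand. Unions of supports make
  the generating family of the topology closed under intersection.\<close>

lemma supp_coproduct2:
  assumes x: "compact_ob \<kappa> T x1" "compact_ob \<kappa> T x2"
  shows "\<exists>s. compact_ob \<kappa> T s \<and> supp \<kappa> T s = supp \<kappa> T x1 \<union> supp \<kappa> T x2"
proof -
  note xo = compact_obj[OF x(1)] compact_obj[OF x(2)]
  have "\<forall>x\<in>Obj T. \<forall>y\<in>Obj T. \<exists>c \<iota>. is_coproduct T UNIV (\<lambda>b. if b then x else y) c \<iota>"
    using is_additive unfolding is_additive_def by (elim conjE)
  then obtain s j where cop: "is_coproduct T UNIV (\<lambda>b. if b then x1 else x2) s j" using xo by blast
  note a = coproduct_arr[OF cop, simplified]
  have sc: "compact_ob \<kappa> T s" by (rule compact_coproduct2[OF x cop])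
  obtain p where p: "\<And>b. p b \<in> Arr T" "\<And>b. Dom T (p b) = s" "\<And>b. Cod T (p b) = (if b then x1 else x2)"
    "\<And>b. p b \<cdot> j b = Ide T (if b then x1 else x2)"
    "\<And>b b'. b' \<noteq> b \<Longrightarrow> p b \<cdot> j b' = \<z> (if b' then x1 else x2) (if b then x1 else x2)"
    using coproduct_proj[OF cop] by auto
  have jT: "j True \<in> Arr T" "Dom T (j True) = x1" "Cod T (j True) = s" using a by auto
  have jF: "j False \<in> Arr T" "Dom T (j False) = x2" "Cod T (j False) = s" using a by auto
  have pT: "p True \<in> Arr T" "Dom T (p True) = s" "Cod T (p True) = x1" "p True \<cdot> j True = Ide T x1"
    using p(1-4)[of True] by simp_all
  have pF: "p False \<in> Arr T" "Dom T (p False) = s" "Cod T (p False) = x2" "p False \<cdot> j False = Ide T x2"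
    "p False \<cdot> j True = \<z> x1 x2"
    using p(1-4)[of False] p(5)[of True False] by simp_all
  obtain g h where tri: "(j True, g, h) \<in> Tri T" using tri_exists[OF jT(1)] by blast
  note t = triD[OF tri]
  have gj: "g \<cdot> j True = \<z> x1 (Cod T g)" using tri_comp_zr[OF tri] jT by simp
  have "g \<cdot> j False \<cdot> p False = g"
  proof (rule coproduct_arr_unique[OF cop])
    fix b :: bool
    show "(g \<cdot> j False \<cdot> p False) \<cdot> j b = g \<cdot> j b"
    proof (cases b)
      case True
      have "(g \<cdot> j False \<cdot> p False) \<cdot> j True = g \<cdot> (j False \<cdot> (p False \<cdot> j True))"
        using t(1-6) jT jF pF(1-3) by simp
      also have "\<dots> = \<z> x1 (Cod T g)" unfolding pF(5) using t(1-6) jT(2,3) jF xo by simp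
      finally show ?thesis using gj True by simp
    next
      case False
      have "(g \<cdot> j False \<cdot> p False) \<cdot> j False = g \<cdot> (j False \<cdot> (p False \<cdot> j False))"
        using t(1-6) jT jF pF(1-3) by simp
      also have "\<dots> = g \<cdot> j False" unfolding pF(4) using jF by simp
      finally show ?thesis using False by simp
    qed
  qed (use t jT jF pF in simp_all)
  then have iso: "isomorphic T (Cod T g) x2"
    using split_mono_cone[OF tri pT(1), of "p False" "j False"] jT jF pT pF by simp
  have gc: "compact_ob \<kappa> T (Cod T g)" by (rule compact_iso[OF x(2) isomorphic_sym[OF iso]])
  have "s \<in> P \<longleftrightarrow> x1 \<in> P \<and> x2 \<in> P" if P: "P \<in> Spc \<kappa> T" for P
  proof
    note P = SpcD(1)[OF P]
    show "x1 \<in> P \<and> x2 \<in> P" if "s \<in> P"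
      using thickD(6)[OF P x(1) that, of "j True" "p True"] thickD(6)[OF P x(2) that, of "j False" "p False"]
        jT jF pT pF by simp
    assume xs: "x1 \<in> P \<and> x2 \<in> P"
    then have "Cod T g \<in> P" using thickD(4)[OF P _ isomorphic_sym[OF iso]] by blast
    then show "s \<in> P" using thick_tri(2)[OF P tri] jT x(1) sc gc xs by simp
  qed
  then show ?thesis using sc unfolding supp_def by blast
qed

text \<open>The case of radical ideals suffices below, so that duals of compact objects need not be
  known to be compact.\<close>

lemma radical_supp:
  assumes J: "radical J" and x: "compact_ob \<kappa> T x" and sub: "supp \<kappa> T x \<subseteq> (\<Union>y\<in>J. supp \<kappa> T y)"
  shows "x \<in> J"
proof (rule ccontr)
  assume xJ: "x \<notin> J"
  have rad: "y \<in> J" if "compact_ob \<kappa> T y" "y \<otimes>\<^sub>o y \<in> J" for y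
    using J that unfolding radical_def by blast
  have Jt: "thick_ideal \<kappa> T J" using J unfolding radical_def by blast
  note xo = compact_obj[OF x]
  let ?p = "\<lambda>n. tens (replicate n x)"
  have pc: "compact_ob \<kappa> T (?p n)" for n
    by (induction n) (use compact_unit compact_tensor[OF x] in simp_all)
  have px: "set (replicate n x) \<subseteq> Obj T" for n using xo by auto
  have pp: "isomorphic T (?p m \<otimes>\<^sub>o ?p n) (?p (m + n))" for m n
    using tens_append[OF px px, of m n] by (simp add: replicate_add)
  \<comment> \<open>No power of \<open>x\<close> lies in \<open>J\<close>. If the power
    \<open>n + 1\<close> did, with \<open>n\<close> positive, tensoring with the power
    \<open>n - 1\<close> would give the power \<open>2n\<close>, which is the square of the power
    \<open>n\<close>; radicality descends to the power \<open>n\<close>, excluded by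
    induction.\<close>
  have pJ: "?p n \<notin> J" for n
  proof (induction n)
    case 0
    have "\<I> \<notin> J"
      using thickD(4)[OF Jt thick_tensor_right[OF Jt x] lunit_isomorphic[OF xo]] xJ by blast
    then show ?case by simp
  next
    case (Suc n)
    show ?case
    proof
      assume S: "?p (Suc n) \<in> J"
      show False
      proof (cases n)
        case 0
        then have "isomorphic T (?p (Suc n)) x" using isomorphic_sym[OF tens_atom[OF xo, THEN conjunct2]] by simp
        then show False using thickD(4)[OF Jt S] xJ by blast
      next
        case (Suc m)
        have "?p m \<otimes>\<^sub>o ?p (Suc n) \<in> J" by (rule thickD(7)[OF Jt pc S])
        then have "?p (m + Suc n) \<in> J" using thickD(4)[OF Jt _ pp] by blast
        moreover have e: "m + Suc n = n + n" using Suc by simp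
        ultimately have "?p (n + n) \<in> J" unfolding e by blast
        then have "?p n \<otimes>\<^sub>o ?p n \<in> J" using thickD(4)[OF Jt _ isomorphic_sym[OF pp]] by blast
        then show False using rad[OF pc] Suc.IH by blast
      qed
    qed
  qed
  \<comment> \<open>The powers of \<open>x\<close>, closed under isomorphism so as to be closed
    under the tensor product. A prime that contains \<open>J\<close> and avoids them is a point of
    the support of \<open>x\<close> outside all supports of members of \<open>J\<close>.\<close>
  define M where "M = {c \<in> cpt \<kappa> T. \<exists>n. isomorphic T c (?p n)}"
  have "\<exists>P\<in>Spc \<kappa> T. J \<subseteq> P \<and> P \<inter> M = {}"
  proof (rule prime_exists[OF Jt])
    show "M \<subseteq> cpt \<kappa> T" unfolding M_def by blast
    have "isomorphic T \<I> (?p 0)" using isomorphic_refl by simp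
    then show "\<I> \<in> M" using compact_unit unfolding M_def by blast
    show "\<forall>a\<in>M. \<forall>b\<in>M. a \<otimes>\<^sub>o b \<in> M"
    proof (intro ballI)
      fix a b assume "a \<in> M" "b \<in> M"
      then obtain m n where mn: "compact_ob \<kappa> T a" "isomorphic T a (?p m)" "compact_ob \<kappa> T b" "isomorphic T b (?p n)"
        unfolding M_def by blast
      have "isomorphic T (a \<otimes>\<^sub>o b) (?p (m + n))"
        by (rule isomorphic_trans[OF tensor_isomorphic[OF mn(2,4)] pp])
      then show "a \<otimes>\<^sub>o b \<in> M" using compact_tensor[OF mn(1,3)] unfolding M_def by blast
    qed
    show "J \<inter> M = {}" using pJ thickD(4)[OF Jt] unfolding M_def by blast
  qed
  then obtain P where P: "P \<in> Spc \<kappa> T" "J \<subseteq> P" "P \<inter> M = {}" by blast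
  have "isomorphic T x (?p 1)" using tens_atom[OF xo] by simp
  then have "x \<in> M" using x unfolding M_def by blast
  then have "P \<in> supp \<kappa> T x" using P unfolding supp_def by blast
  then show False using sub P(2) unfolding supp_def by blast
qed

section \<open>The topology of the spectrum\<close>

lemma Spc_top_space: "topspace (Spc_top \<kappa> T) = Spc \<kappa> T"
proof -
  obtain z where z: "zero_ob T z" using zero_ob_exists by blast
  have "Spc \<kappa> T - supp \<kappa> T z = Spc \<kappa> T" using supp_zero[OF z] by simp
  then have "Spc \<kappa> T \<in> {Spc \<kappa> T - supp \<kappa> T x |x. compact_ob \<kappa> T x}" using compact_zero[OF z] by blast
  then show ?thesis unfolding Spc_top_def topology_generated_by_topspace by blast
qed

lemma openin_Spc_compl_supp: "compact_ob \<kappa> T x \<Longrightarrow> openin (Spc_top \<kappa> T) (Spc \<kappa> T - supp \<kappa> T x)"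
  unfolding Spc_top_def by (rule topology_generated_by_Basis) blast

text \<open>The complements of supports are declared as generators of the topology; by
  \<open>supp_coproduct2\<close> they are closed under finite intersections, so they form a
  basis.\<close>

lemma Spc_basis:
  assumes "openin (Spc_top \<kappa> T) V" "P \<in> V"
  shows "\<exists>y. compact_ob \<kappa> T y \<and> P \<in> Spc \<kappa> T - supp \<kappa> T y \<and> Spc \<kappa> T - supp \<kappa> T y \<subseteq> V"
proof -
  have "generate_topology_on {Spc \<kappa> T - supp \<kappa> T x |x. compact_ob \<kappa> T x} V"
    using assms(1) unfolding Spc_top_def by (rule openin_topology_generated_by)
  then show ?thesis using assms(2)
  proof (induction V)
    case (Int a b)
    then obtain y y' where y: "compact_ob \<kappa> T y" "P \<in> Spc \<kappa> T - supp \<kappa> T y" "Spc \<kappa> T - supp \<kappa> T y \<subseteq> a"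
      "compact_ob \<kappa> T y'" "P \<in> Spc \<kappa> T - supp \<kappa> T y'" "Spc \<kappa> T - supp \<kappa> T y' \<subseteq> b" by blast
    obtain s where s: "compact_ob \<kappa> T s" "supp \<kappa> T s = supp \<kappa> T y \<union> supp \<kappa> T y'"
      using supp_coproduct2[OF y(1,4)] by blast
    then show ?case using y by (intro exI[of _ s]) blast
  next
    case (UN K)
    then show ?case by blast
  qed blast+
qed

text \<open>The members of \<open>M\<close>, whose complements of supports are finitely covered,
  form a multiplicative set. If the thick ideal generated by \<open>x\<close> avoided
  \<open>M\<close>, some prime would contain \<open>x\<close> and avoid \<open>M\<close>; but that
  prime lies in a member of the cover, and a basic neighbourhood of it there provides an object of
  the prime that belongs to \<open>M\<close>.\<close>

lemma compactin_compl_supp: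
  assumes x: "compact_ob \<kappa> T x"
  shows "compactin (Spc_top \<kappa> T) (Spc \<kappa> T - supp \<kappa> T x)"
  unfolding compactin_def
proof (intro conjI allI impI)
  show "Spc \<kappa> T - supp \<kappa> T x \<subseteq> topspace (Spc_top \<kappa> T)" unfolding Spc_top_space by blast
  fix \<U> assume U: "(\<forall>U\<in>\<U>. openin (Spc_top \<kappa> T) U) \<and> Spc \<kappa> T - supp \<kappa> T x \<subseteq> \<Union>\<U>"
  define M where "M = {c \<in> cpt \<kappa> T. \<exists>\<F>. finite \<F> \<and> \<F> \<subseteq> \<U> \<and> Spc \<kappa> T - supp \<kappa> T c \<subseteq> \<Union>\<F>}"
  define J where "J = \<Inter>{K. thick_ideal \<kappa> T K \<and> x \<in> K}"
  have J: "thick_ideal \<kappa> T J"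
    unfolding J_def by (rule thick_Inter) (use thick_cpt x in blast)+
  have "J \<inter> M \<noteq> {}"
  proof
    assume JM: "J \<inter> M = {}"
    have "\<exists>P\<in>Spc \<kappa> T. J \<subseteq> P \<and> P \<inter> M = {}"
    proof (rule prime_exists[OF J _ _ _ JM])
      show "M \<subseteq> cpt \<kappa> T" unfolding M_def by blast
      show "\<I> \<in> M" unfolding M_def using compact_unit supp_unit by auto
      show "\<forall>a\<in>M. \<forall>b\<in>M. a \<otimes>\<^sub>o b \<in> M"
      proof (intro ballI)
        fix a b assume "a \<in> M" "b \<in> M"
        then obtain F G where FG: "compact_ob \<kappa> T a" "finite F" "F \<subseteq> \<U>" "Spc \<kappa> T - supp \<kappa> T a \<subseteq> \<Union>F"
          "compact_ob \<kappa> T b" "finite G" "G \<subseteq> \<U>" "Spc \<kappa> T - supp \<kappa> T b \<subseteq> \<Union>G" unfolding M_def by blast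
        have "Spc \<kappa> T - supp \<kappa> T (a \<otimes>\<^sub>o b) \<subseteq> \<Union>(F \<union> G)"
          unfolding supp_tensor[OF FG(1,5)] using FG(4,8) by blast
        moreover have "finite (F \<union> G)" "F \<union> G \<subseteq> \<U>" using FG by blast+
        ultimately show "a \<otimes>\<^sub>o b \<in> M" using compact_tensor[OF FG(1,5)] unfolding M_def by blast
      qed
    qed
    then obtain P where P: "P \<in> Spc \<kappa> T" "J \<subseteq> P" "P \<inter> M = {}" by blast
    have "x \<in> P" using P(2) unfolding J_def by blast
    then have "P \<in> Spc \<kappa> T - supp \<kappa> T x" using P(1) unfolding supp_def by blast
    then obtain V where V: "V \<in> \<U>" "P \<in> V" "openin (Spc_top \<kappa> T) V" using U by blast
    obtain y where y: "compact_ob \<kappa> T y" "P \<in> Spc \<kappa> T - supp \<kappa> T y" "Spc \<kappa> T - supp \<kappa> T y \<subseteq> V"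
      using Spc_basis[OF V(3,2)] by blast
    have "y \<in> M" unfolding M_def using y V(1) by (auto intro!: exI[of _ "{V}"])
    moreover have "y \<in> P" using y(2) unfolding supp_def by blast
    ultimately show False using P(3) by blast
  qed
  then obtain c \<F> where c: "c \<in> J" "finite \<F>" "\<F> \<subseteq> \<U>" "Spc \<kappa> T - supp \<kappa> T c \<subseteq> \<Union>\<F>" unfolding M_def by blast
  \<comment> \<open>A prime that contains \<open>x\<close> is one of the ideals intersected in
    \<open>J\<close>, so it contains \<open>c\<close> as well.\<close>
  have "Spc \<kappa> T - supp \<kappa> T x \<subseteq> Spc \<kappa> T - supp \<kappa> T c"
    using c(1) SpcD(1) unfolding J_def supp_def by blast
  then show "\<exists>\<F>. finite \<F> \<and> \<F> \<subseteq> \<U> \<and> Spc \<kappa> T - supp \<kappa> T x \<subseteq> \<Union>\<F>" using c by blast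
qed

lemma thomason_UN_supp:
  assumes "\<And>x. x \<in> J \<Longrightarrow> compact_ob \<kappa> T x"
  shows "thomason \<kappa> T (\<Union>x\<in>J. supp \<kappa> T x)"
  unfolding thomason_in_def
proof (intro exI[of _ "supp \<kappa> T ` J"] conjI ballI)
  show "\<Union> (supp \<kappa> T ` J) = \<Union> (supp \<kappa> T ` J)" ..
  fix A assume "A \<in> supp \<kappa> T ` J"
  then obtain x where x: "compact_ob \<kappa> T x" "A = supp \<kappa> T x" using assms by blast
  show "closedin (Spc_top \<kappa> T) A"
    unfolding closedin_def Spc_top_space x(2) using supp_subset openin_Spc_compl_supp[OF x(1)] by blast
  show "compactin (Spc_top \<kappa> T) (topspace (Spc_top \<kappa> T) - A)"
    unfolding Spc_top_space x(2) by (rule compactin_compl_supp[OF x(1)])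
qed

lemma thomason_supp: "compact_ob \<kappa> T x \<Longrightarrow> thomason \<kappa> T (supp \<kappa> T x)"
  using thomason_UN_supp[of "{x}"] by simp

lemma thomason_Spc: "thomason \<kappa> T (Spc \<kappa> T)"
  using thomason_supp[OF compact_unit] unfolding supp_unit .

lemma thomason_empty: "thomason \<kappa> T {}"
  using thomason_UN_supp[of "{}"] by simp

lemma thomason_subset: "thomason \<kappa> T Y \<Longrightarrow> Y \<subseteq> Spc \<kappa> T"
  unfolding thomason_in_def using closedin_subset Spc_top_space by blast

text \<open>A closed set with quasi-compact complement is the support of a single compact object:
  its complement is a finite union of basic open sets, and the tensor product of the corresponding
  objects has the intersection of their supports as its support.\<close>

lemma thomason_point:
  assumes Y: "thomason \<kappa> T Y" and P: "P \<in> Y"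
  shows "\<exists>x\<in>cpt_supp \<kappa> T Y. P \<in> supp \<kappa> T x"
proof -
  obtain A where A: "P \<in> A" "A \<subseteq> Y" "closedin (Spc_top \<kappa> T) A" "compactin (Spc_top \<kappa> T) (Spc \<kappa> T - A)"
    using Y P unfolding thomason_in_def Spc_top_space by blast
  have AS: "A \<subseteq> Spc \<kappa> T" using A(3) closedin_subset Spc_top_space by blast
  have op: "openin (Spc_top \<kappa> T) (Spc \<kappa> T - A)" using A(3) unfolding closedin_def Spc_top_space by blast
  define \<U> where "\<U> = {Spc \<kappa> T - supp \<kappa> T y |y. compact_ob \<kappa> T y \<and> Spc \<kappa> T - supp \<kappa> T y \<subseteq> Spc \<kappa> T - A}"
  have "\<forall>U\<in>\<U>. openin (Spc_top \<kappa> T) U" unfolding \<U>_def using openin_Spc_compl_supp by blast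
  moreover have "Spc \<kappa> T - A \<subseteq> \<Union>\<U>"
  proof
    fix Q assume "Q \<in> Spc \<kappa> T - A"
    from Spc_basis[OF op this] obtain y where "compact_ob \<kappa> T y" "Q \<in> Spc \<kappa> T - supp \<kappa> T y"
      "Spc \<kappa> T - supp \<kappa> T y \<subseteq> Spc \<kappa> T - A" by blast
    then show "Q \<in> \<Union>\<U>" unfolding \<U>_def by blast
  qed
  ultimately obtain \<F> where F: "finite \<F>" "\<F> \<subseteq> \<U>" "Spc \<kappa> T - A \<subseteq> \<Union>\<F>"
    using A(4) unfolding compactin_def by meson
  have "\<exists>c. compact_ob \<kappa> T c \<and> Spc \<kappa> T - supp \<kappa> T c = \<Union>\<F>"
    using F(1,2)
  proof (induction \<F>)
    case empty
    show ?case using compact_unit supp_unit by (intro exI[of _ \<I>]) simp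
  next
    case (insert V \<F>)
    then obtain c where c: "compact_ob \<kappa> T c" "Spc \<kappa> T - supp \<kappa> T c = \<Union>\<F>" by blast
    obtain y where y: "compact_ob \<kappa> T y" "V = Spc \<kappa> T - supp \<kappa> T y" using insert.prems unfolding \<U>_def by blast
    have "Spc \<kappa> T - supp \<kappa> T (y \<otimes>\<^sub>o c) = V \<union> \<Union>\<F>"
      unfolding supp_tensor[OF y(1) c(1)] y(2) c(2)[symmetric] by blast
    then show ?case using compact_tensor[OF y(1) c(1)] by (intro exI[of _ "y \<otimes>\<^sub>o c"]) simp
  qed
  then obtain c where c: "compact_ob \<kappa> T c" "Spc \<kappa> T - supp \<kappa> T c = \<Union>\<F>" by blast
  have "\<Union>\<F> \<subseteq> Spc \<kappa> T - A" using F(2) unfolding \<U>_def by blast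
  then have "supp \<kappa> T c = A" using F(3) c(2) AS supp_subset[of c] by blast
  then show ?thesis using A(1,2) c(1) unfolding cpt_supp_def by blast
qed

text \<open>An object is supported in \<open>Y\<close> exactly if it lies in all primes outside
  \<open>Y\<close>. The ideal \<open>cpt\<close> is inserted so that the intersection stays inside
  the compact objects when there are no such primes.\<close>

lemma thick_cpt_supp: "thick_ideal \<kappa> T (cpt_supp \<kappa> T Y)"
proof -
  have "cpt_supp \<kappa> T Y = \<Inter>(insert (cpt \<kappa> T) (Spc \<kappa> T - Y))"
    unfolding cpt_supp_def supp_def by blast
  moreover have "thick_ideal \<kappa> T (\<Inter>(insert (cpt \<kappa> T) (Spc \<kappa> T - Y)))"
    by (rule thick_Inter) (use thick_cpt SpcD(1) in blast)+
  ultimately show ?thesis by simp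
qed

section \<open>Rickard idempotents\<close>

lemma rickard_exists: "\<exists>e l. rickard \<kappa> T Y e l"
proof -
  note J = thick_cpt_supp[of Y]
  have "\<exists>a b c e l. (a, b, c) \<in> Tri T \<and> a \<in> Hom T e \<I> \<and> b \<in> Hom T \<I> l \<and>
    e \<in> Loc \<kappa> T (cpt_supp \<kappa> T Y) \<and> l \<in> perp T (Loc \<kappa> T (cpt_supp \<kappa> T Y))"
    by (rule compact_localization_exists[OF thickD(1)[OF J]]) (use thickD(4)[OF J] thick_shift[OF J] in blast)+
  then show ?thesis unfolding rickard_def by blast
qed

text \<open>Because \<open>Gam\<close> and \<open>Lam\<close> are separate choices, neither is known
  to be the partner of the other; each carries an existential partner of its own.\<close>

lemma Gam_rickard: "\<exists>l. rickard \<kappa> T Y (Gam \<kappa> T Y) l"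
  unfolding Gam_def using someI_ex[OF rickard_exists] by simp

lemma Lam_rickard: "\<exists>e. rickard \<kappa> T Y e (Lam \<kappa> T Y)"
proof -
  have "\<exists>l e. rickard \<kappa> T Y e l" using rickard_exists by blast
  then show ?thesis unfolding Lam_def by (rule someI_ex)
qed

lemma rickardD:
  assumes "rickard \<kappa> T Y e l"
  shows "e \<in> Obj T" "l \<in> Obj T" "e \<in> Loc \<kappa> T (cpt_supp \<kappa> T Y)"
    "\<And>f. f \<in> Arr T \<Longrightarrow> Cod T f = l \<Longrightarrow> Dom T f \<in> Loc \<kappa> T (cpt_supp \<kappa> T Y) \<Longrightarrow> f = \<z> (Dom T f) l"
proof -
  obtain a b c where abc: "(a, b, c) \<in> Tri T" "a \<in> Hom T e \<I>" "b \<in> Hom T \<I> l"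
     "e \<in> Loc \<kappa> T (cpt_supp \<kappa> T Y)" "l \<in> perp T (Loc \<kappa> T (cpt_supp \<kappa> T Y))"
    using assms unfolding rickard_def by blast
  show "e \<in> Obj T" "l \<in> Obj T" using abc(2,3) by auto
  show "e \<in> Loc \<kappa> T (cpt_supp \<kappa> T Y)" by fact
  show "f = \<z> (Dom T f) l" if "f \<in> Arr T" "Cod T f = l" "Dom T f \<in> Loc \<kappa> T (cpt_supp \<kappa> T Y)" for f
  proof -
    have "Hom T (Dom T f) l = {\<z> (Dom T f) l}" using abc(5) that(3) unfolding perp_def by blast
    moreover have "f \<in> Hom T (Dom T f) l" using that by simp
    ultimately show ?thesis by blast
  qed
qed

lemma Gam_obj: "Gam \<kappa> T Y \<in> Obj T" and Lam_obj: "Lam \<kappa> T Y \<in> Obj T"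
  using Gam_rickard Lam_rickard rickardD by blast+

text \<open>Tensored with \<open>v\<close>, the defining triangle decomposes \<open>v\<close> into a
  part supported on \<open>Y\<close> and a part away from it; these are treated separately.\<close>

lemma rickard_tri_mem:
  assumes r: "rickard \<kappa> T Y e l" and L: "localizing \<kappa> T L" and v: "v \<in> Obj T"
    and m: "e \<otimes>\<^sub>o v \<in> L" "l \<otimes>\<^sub>o v \<in> L"
  shows "v \<in> L"
proof -
  obtain a b c where abc: "(a, b, c) \<in> Tri T" "a \<in> Hom T e \<I>" "b \<in> Hom T \<I> l"
    using r unfolding rickard_def by blast
  note t = triD[OF abc(1)]
  have "\<I> \<otimes>\<^sub>o v \<in> L"
    using localizing_tri(2)[OF L tri_tensor[OF abc(1) v]] m abc(2,3) t v by simp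
  then show ?thesis using localizingD(3)[OF L _ lunit_isomorphic[OF v]] by blast
qed

text \<open>Reduces membership to the generators, since the objects \<open>s\<close> with
  \<open>s \<otimes> w\<close> in \<open>L\<close> form a localizing subcategory.\<close>

lemma Loc_tensor_mem:
  assumes a: "a \<in> Loc \<kappa> T C" "C \<subseteq> Obj T" and L: "localizing \<kappa> T L" and w: "w \<in> Obj T"
    and C: "\<And>x. x \<in> C \<Longrightarrow> x \<otimes>\<^sub>o w \<in> L"
  shows "a \<otimes>\<^sub>o w \<in> L"
proof -
  have "C \<subseteq> {s \<in> Obj T. s \<otimes>\<^sub>o w \<in> L}" using C a(2) by blast
  then have "Loc \<kappa> T C \<subseteq> {s \<in> Obj T. s \<otimes>\<^sub>o w \<in> L}"
    by (rule Loc_localizing[OF a(2) localizing_tensor_preimage[OF L w]])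
  then show ?thesis using a(1) by blast
qed

lemma cpt_supp_obj: "cpt_supp \<kappa> T Y \<subseteq> Obj T"
  unfolding cpt_supp_def using compact_obj by blast

lemma generation:
  assumes "t \<in> Obj T" "\<And>x f. compact_ob \<kappa> T x \<Longrightarrow> f \<in> Arr T \<Longrightarrow> Dom T f = x \<Longrightarrow> Cod T f = t \<Longrightarrow> f = \<z> x t"
  shows "zero_ob T t"
proof -
  have "\<forall>t\<in>Obj T. (\<forall>x\<in>cpt \<kappa> T. Hom T x t = {\<z> x t}) \<longrightarrow> zero_ob T t"
    using rcg unfolding rigidly_compactly_generated_def by (elim conjE)
  moreover have "Hom T x t = {\<z> x t}" if "compact_ob \<kappa> T x" for x
  proof (intro subset_antisym subsetI)
    show "f \<in> {\<z> x t}" if "f \<in> Hom T x t" for f using assms(2)[OF \<open>compact_ob \<kappa> T x\<close>] that by simp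
    show "f \<in> Hom T x t" if "f \<in> {\<z> x t}" for f using that assms(1) compact_obj[OF \<open>compact_ob \<kappa> T x\<close>] by simp
  qed
  ultimately show ?thesis using assms(1) by simp
qed

text \<open>By duality \<open>l\<close> is annihilated by the dual of \<open>x\<close>, and \<open>x\<close> is a retract of the tensor
  product of its dual with \<open>x \<otimes> x\<close>.\<close>

lemma rickard_annihilates:
  assumes r: "rickard \<kappa> T Y e l" and x: "x \<in> cpt_supp \<kappa> T Y"
  shows "zero_ob T (x \<otimes>\<^sub>o l)"
proof -
  have xc: "compact_ob \<kappa> T x" using x unfolding cpt_supp_def by blast
  note lo = rickardD(2)[OF r]
  obtain y ev coev s r' where d: "dual_pair x y ev coev" and
    sr: "s \<in> Arr T" "Dom T s = x" "Cod T s = (x \<otimes>\<^sub>o y) \<otimes>\<^sub>o x"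
    "r' \<in> Arr T" "Dom T r' = (x \<otimes>\<^sub>o y) \<otimes>\<^sub>o x" "Cod T r' = x" "r' \<cdot> s = Ide T x"
    by (rule dual_retract[OF xc])
  have o: "x \<in> Obj T" "y \<in> Obj T" using dual_pairD(1,2)[OF d] by blast+
  have "zero_ob T (l \<otimes>\<^sub>o y)"
  proof (rule generation)
    show "l \<otimes>\<^sub>o y \<in> Obj T" using lo o by simp
    fix c g assume c: "compact_ob \<kappa> T c" and g: "g \<in> Arr T" "Dom T g = c" "Cod T g = l \<otimes>\<^sub>o y"
    note co = compact_obj[OF c]
    have cx: "c \<otimes>\<^sub>o x \<in> Loc \<kappa> T (cpt_supp \<kappa> T Y)"
      using thickD(7)[OF thick_cpt_supp c x] unfolding Loc_def by blast
    \<comment> \<open>The mate of \<open>g\<close> is a map from \<open>c \<otimes> x\<close> to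
      \<open>l\<close>. Its source is compact with support in \<open>Y\<close>, so the mate vanishes
      by orthogonality, and \<open>g\<close> with it.\<close>
    note u = untransp_arr[OF d lo g(1,3)]
    have "untransp l x y ev g = \<z> (c \<otimes>\<^sub>o x) l"
      using rickardD(4)[OF r u(1,3)] u(2) g(2) cx by simp
    then have "g = transp c x y coev (\<z> (c \<otimes>\<^sub>o x) l)"
      using transp_untransp[OF d lo g(1,3)] g(2) by simp
    also have "\<dots> = \<z> c (l \<otimes>\<^sub>o y)"
      unfolding transp_def using dual_pairD(1-8)[OF d] co lo by simp
    finally show "g = \<z> c (l \<otimes>\<^sub>o y)" .
  qed
  then have "zero_ob T ((x \<otimes>\<^sub>o x) \<otimes>\<^sub>o (l \<otimes>\<^sub>o y))" by (rule zero_ob_tensor(2)) (use o in simp)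
  moreover have "isomorphic T (((x \<otimes>\<^sub>o y) \<otimes>\<^sub>o x) \<otimes>\<^sub>o l) ((x \<otimes>\<^sub>o x) \<otimes>\<^sub>o (l \<otimes>\<^sub>o y))"
    by (rule isomorphic_perm, (rule tens_mult tens_atom o lo)+, simp)
  ultimately have "zero_ob T (((x \<otimes>\<^sub>o y) \<otimes>\<^sub>o x) \<otimes>\<^sub>o l)" by (rule zero_ob_iso[rotated])
  then show ?thesis
    by (rule zero_ob_retract[of _ "s \<otimes>\<^sub>a Ide T l" "r' \<otimes>\<^sub>a Ide T l"]) (use sr lo o in simp_all)
qed

lemma zero_ob_perm:
  assumes "zero_ob T b" "set xs \<subseteq> Obj T \<and> isomorphic T a (tens xs)" "set ys \<subseteq> Obj T \<and> isomorphic T b (tens ys)"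
    "mset xs = mset ys"
  shows "zero_ob T a"
  using zero_ob_iso[OF isomorphic_perm[OF assms(2-4)] assms(1)] .

section \<open>Tensor triangular support\<close>

text \<open>The choice in \<open>g_ob\<close> may have picked a presentation of \<open>W\<close>
  other than the obvious one. It is recovered here, and the support computations below use nothing
  about \<open>A\<close> and \<open>B\<close> beyond what is listed.\<close>

lemma g_ob_eq:
  assumes "weakly_visible \<kappa> T W"
  obtains A B where "thomason \<kappa> T A" "thomason \<kappa> T B" "W = A \<inter> (Spc \<kappa> T - B)"
    "g_ob \<kappa> T W = Gam \<kappa> T A \<otimes>\<^sub>o Lam \<kappa> T B"
proof -
  have "\<exists>x Y1 Y2. thomason \<kappa> T Y1 \<and> thomason \<kappa> T Y2 \<and> W = Y1 \<inter> (Spc \<kappa> T - Y2) \<and>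
     x = Gam \<kappa> T Y1 \<otimes>\<^sub>o Lam \<kappa> T Y2"
    using assms unfolding weakly_visible_def by blast
  from someI_ex[OF this] show ?thesis using that unfolding g_ob_def by blast
qed

lemma not_in_Supp:
  assumes "weakly_visible \<kappa> T W" "P \<in> W" "zero_ob T (t \<otimes>\<^sub>o g_ob \<kappa> T W)"
  shows "P \<notin> Supp \<kappa> T t"
  using assms unfolding Supp_def by blast

lemma g_obj: "weakly_visible \<kappa> T W \<Longrightarrow> g_ob \<kappa> T W \<in> Obj T"
  using g_ob_eq Gam_obj Lam_obj tensor_obj by metis

lemma Supp_tensor:
  assumes "a \<in> Obj T" "s \<in> Obj T"
  shows "Supp \<kappa> T (a \<otimes>\<^sub>o s) \<subseteq> Supp \<kappa> T s"
proof
  fix P assume P: "P \<in> Supp \<kappa> T (a \<otimes>\<^sub>o s)"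
  have "\<not> zero_ob T (s \<otimes>\<^sub>o g_ob \<kappa> T W)" if W: "weakly_visible \<kappa> T W" "P \<in> W" for W
  proof
    assume "zero_ob T (s \<otimes>\<^sub>o g_ob \<kappa> T W)"
    then have "zero_ob T (a \<otimes>\<^sub>o (s \<otimes>\<^sub>o g_ob \<kappa> T W))" by (rule zero_ob_tensor(2)) fact
    then have "zero_ob T ((a \<otimes>\<^sub>o s) \<otimes>\<^sub>o g_ob \<kappa> T W)"
      using zero_ob_iso[OF assoc_isomorphic[OF assms g_obj[OF W(1)]]] by blast
    then show False using P W unfolding Supp_def by blast
  qed
  then show "P \<in> Supp \<kappa> T s" using P unfolding Supp_def by blast
qed

text \<open>Points outside \<open>B\<close> are tested with the complement of \<open>B\<close> as
  weakly visible set. Whatever presentation \<open>A - C\<close> was chosen for it, the intersection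
  of \<open>A\<close> and \<open>B\<close> lies in \<open>C\<close>; so the tensor product of a
  compact object on \<open>A\<close> with one on \<open>B\<close> is annihilated by
  \<open>Lam C\<close>. Passing from generators to \<open>Gam A\<close> and then to \<open>a\<close>
  gives the vanishing.\<close>

lemma Supp_Loc:
  assumes B: "thomason \<kappa> T B" and a: "a \<in> Obj T" "a \<in> Loc \<kappa> T (cpt_supp \<kappa> T B)" and s: "s \<in> Obj T"
  shows "Supp \<kappa> T (a \<otimes>\<^sub>o s) \<subseteq> B"
proof (rule subsetI, rule ccontr)
  fix P assume P: "P \<in> Supp \<kappa> T (a \<otimes>\<^sub>o s)" "P \<notin> B"
  have wv: "weakly_visible \<kappa> T (Spc \<kappa> T - B)"
    unfolding weakly_visible_def using thomason_Spc B by blast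
  obtain A C where AC: "thomason \<kappa> T A" "thomason \<kappa> T C" "Spc \<kappa> T - B = A \<inter> (Spc \<kappa> T - C)"
    "g_ob \<kappa> T (Spc \<kappa> T - B) = Gam \<kappa> T A \<otimes>\<^sub>o Lam \<kappa> T C" by (rule g_ob_eq[OF wv])
  have sub: "A \<inter> B \<subseteq> C" using AC(3) thomason_subset[OF AC(1)] by blast
  note Go = Gam_obj[of A] and Lo = Lam_obj[of C]
  obtain eC where rC: "rickard \<kappa> T C eC (Lam \<kappa> T C)" using Lam_rickard by blast
  have 1: "x \<otimes>\<^sub>o (Gam \<kappa> T A \<otimes>\<^sub>o Lam \<kappa> T C) \<in> {z. zero_ob T z}" if x: "x \<in> cpt_supp \<kappa> T B" for x
  proof -
    have xo: "x \<in> Obj T" using x cpt_supp_obj by blast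
    have "Gam \<kappa> T A \<otimes>\<^sub>o (x \<otimes>\<^sub>o Lam \<kappa> T C) \<in> {z. zero_ob T z}"
    proof (rule Loc_tensor_mem[OF _ cpt_supp_obj localizing_zeros])
      show "Gam \<kappa> T A \<in> Loc \<kappa> T (cpt_supp \<kappa> T A)" using Gam_rickard rickardD(3) by blast
      show "x \<otimes>\<^sub>o Lam \<kappa> T C \<in> Obj T" using xo Lo by simp
      fix y assume y: "y \<in> cpt_supp \<kappa> T A"
      have yo: "y \<in> Obj T" using y cpt_supp_obj by blast
      have "y \<otimes>\<^sub>o x \<in> cpt_supp \<kappa> T C"
        using x y compact_tensor supp_tensor sub unfolding cpt_supp_def by blast
      then have "zero_ob T ((y \<otimes>\<^sub>o x) \<otimes>\<^sub>o Lam \<kappa> T C)" by (rule rickard_annihilates[OF rC])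
      then show "y \<otimes>\<^sub>o (x \<otimes>\<^sub>o Lam \<kappa> T C) \<in> {z. zero_ob T z}"
        using zero_ob_iso[OF isomorphic_sym[OF assoc_isomorphic[OF yo xo Lo]]] by blast
    qed
    then have "zero_ob T (Gam \<kappa> T A \<otimes>\<^sub>o (x \<otimes>\<^sub>o Lam \<kappa> T C))" by blast
    then have "zero_ob T (x \<otimes>\<^sub>o (Gam \<kappa> T A \<otimes>\<^sub>o Lam \<kappa> T C))"
      by - (rule zero_ob_perm, assumption, (rule tens_mult tens_atom xo Go Lo)+, simp)
    then show ?thesis by blast
  qed
  have "a \<otimes>\<^sub>o (Gam \<kappa> T A \<otimes>\<^sub>o Lam \<kappa> T C) \<in> {z. zero_ob T z}"
    by (rule Loc_tensor_mem[OF a(2) cpt_supp_obj localizing_zeros _ 1]) (use Go Lo in simp)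
  then have "zero_ob T (s \<otimes>\<^sub>o (a \<otimes>\<^sub>o (Gam \<kappa> T A \<otimes>\<^sub>o Lam \<kappa> T C)))" using zero_ob_tensor(2) s by blast
  then have "zero_ob T ((a \<otimes>\<^sub>o s) \<otimes>\<^sub>o (Gam \<kappa> T A \<otimes>\<^sub>o Lam \<kappa> T C))"
    by - (rule zero_ob_perm, assumption, (rule tens_mult tens_atom a(1) s Go Lo)+, simp)
  then have "P \<notin> Supp \<kappa> T (a \<otimes>\<^sub>o s)"
    by (intro not_in_Supp[OF wv]) (use P AC(4) in \<open>auto simp: Supp_def\<close>)
  then show False using P(1) by blast
qed

text \<open>Points of \<open>Y\<close> are tested with \<open>Y\<close> itself. For the chosen
  presentation \<open>A - C\<close> one has \<open>A \<subseteq> C \<union> Y\<close>. The compact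
  objects annihilating \<open>Lam C \<otimes> Lam Y\<close> form a radical ideal that contains the
  objects supported on \<open>C\<close> and those supported on \<open>Y\<close>; by
  \<open>radical_supp\<close> it contains everything supported on the union, hence on
  \<open>A\<close>, and so \<open>Gam A\<close> annihilates that product too.\<close>

lemma Supp_Lam:
  assumes Y: "thomason \<kappa> T Y" and s: "s \<in> Obj T"
  shows "Supp \<kappa> T (Lam \<kappa> T Y \<otimes>\<^sub>o s) \<inter> Y = {}"
proof -
  have wv: "weakly_visible \<kappa> T Y"
    unfolding weakly_visible_def using Y thomason_empty thomason_subset[OF Y] by (intro exI[of _ Y] exI[of _ "{}"]) blast
  obtain A C where AC: "thomason \<kappa> T A" "thomason \<kappa> T C" "Y = A \<inter> (Spc \<kappa> T - C)"
    "g_ob \<kappa> T Y = Gam \<kappa> T A \<otimes>\<^sub>o Lam \<kappa> T C" by (rule g_ob_eq[OF wv])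
  have sub: "A \<subseteq> C \<union> Y" using AC(3) thomason_subset[OF AC(1)] by blast
  note Go = Gam_obj[of A] and Lo = Lam_obj[of C] and Yo = Lam_obj[of Y]
  obtain eC where rC: "rickard \<kappa> T C eC (Lam \<kappa> T C)" using Lam_rickard by blast
  obtain eY where rY: "rickard \<kappa> T Y eY (Lam \<kappa> T Y)" using Lam_rickard by blast
  define J where "J = {x \<in> cpt \<kappa> T. x \<otimes>\<^sub>o (Lam \<kappa> T C \<otimes>\<^sub>o Lam \<kappa> T Y) \<in> {z. zero_ob T z}}"
  have J: "radical J"
    unfolding J_def by (rule radical_preimage[OF loc_ideal_zeros]) (use Lo Yo in simp)
  have CJ: "cpt_supp \<kappa> T C \<subseteq> J"
  proof
    fix x assume x: "x \<in> cpt_supp \<kappa> T C"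
    have xo: "x \<in> Obj T" using x cpt_supp_obj by blast
    have "zero_ob T ((x \<otimes>\<^sub>o Lam \<kappa> T C) \<otimes>\<^sub>o Lam \<kappa> T Y)"
      by (rule zero_ob_tensor(1)[OF rickard_annihilates[OF rC x] Yo])
    then have "zero_ob T (x \<otimes>\<^sub>o (Lam \<kappa> T C \<otimes>\<^sub>o Lam \<kappa> T Y))"
      by - (rule zero_ob_perm, assumption, (rule tens_mult tens_atom xo Yo Lo)+, simp)
    then show "x \<in> J" using x unfolding J_def cpt_supp_def by blast
  qed
  have YJ: "cpt_supp \<kappa> T Y \<subseteq> J"
  proof
    fix x assume x: "x \<in> cpt_supp \<kappa> T Y"
    have xo: "x \<in> Obj T" using x cpt_supp_obj by blast
    have "zero_ob T ((x \<otimes>\<^sub>o Lam \<kappa> T Y) \<otimes>\<^sub>o Lam \<kappa> T C)"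
      by (rule zero_ob_tensor(1)[OF rickard_annihilates[OF rY x] Lo])
    then have "zero_ob T (x \<otimes>\<^sub>o (Lam \<kappa> T C \<otimes>\<^sub>o Lam \<kappa> T Y))"
      by - (rule zero_ob_perm, assumption, (rule tens_mult tens_atom xo Yo Lo)+, simp)
    then show "x \<in> J" using x unfolding J_def cpt_supp_def by blast
  qed
  have cov: "C \<union> Y \<subseteq> (\<Union>y\<in>J. supp \<kappa> T y)"
    using thomason_point[OF AC(2)] thomason_point[OF Y] CJ YJ by blast
  have "x \<in> J" if "x \<in> cpt_supp \<kappa> T A" for x
    using radical_supp[OF J, of x] that cov sub unfolding cpt_supp_def by blast
  then have 1: "x \<otimes>\<^sub>o (Lam \<kappa> T C \<otimes>\<^sub>o Lam \<kappa> T Y) \<in> {z. zero_ob T z}" if "x \<in> cpt_supp \<kappa> T A" for x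
    using that unfolding J_def by blast
  have "Gam \<kappa> T A \<otimes>\<^sub>o (Lam \<kappa> T C \<otimes>\<^sub>o Lam \<kappa> T Y) \<in> {z. zero_ob T z}"
  proof (rule Loc_tensor_mem[OF _ cpt_supp_obj localizing_zeros _ 1])
    show "Gam \<kappa> T A \<in> Loc \<kappa> T (cpt_supp \<kappa> T A)" using Gam_rickard rickardD(3) by blast
  qed (use Lo Yo in simp_all)
  then have "zero_ob T (s \<otimes>\<^sub>o (Gam \<kappa> T A \<otimes>\<^sub>o (Lam \<kappa> T C \<otimes>\<^sub>o Lam \<kappa> T Y)))" using zero_ob_tensor(2) s by blast
  then have "zero_ob T ((Lam \<kappa> T Y \<otimes>\<^sub>o s) \<otimes>\<^sub>o (Gam \<kappa> T A \<otimes>\<^sub>o Lam \<kappa> T C))"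
    by - (rule zero_ob_perm, assumption, (rule tens_mult tens_atom s Go Lo Yo)+, simp)
  then show ?thesis using not_in_Supp[OF wv] unfolding AC(4) by blast
qed

section \<open>The local-to-global principle\<close>

theorem weakly_scattered_local_to_global:
  assumes detection: "detection_property \<kappa> T" and t: "t \<in> Obj T"
    and ws: "weakly_scattered (subtopology (inverse_topology (Spc_top \<kappa> T)) (Supp \<kappa> T t))"
  shows "local_to_global \<kappa> T t"
  unfolding local_to_global_def Locid_def
proof (intro allI impI InterI)
  fix \<W> L
  assume W: "(\<forall>W\<in>\<W>. weakly_visible \<kappa> T W) \<and> \<Union>\<W> = Spc \<kappa> T"
    and "L \<in> {L. localizing \<kappa> T L \<and> (\<forall>x\<in>Obj T. \<forall>y\<in>L. x \<otimes>\<^sub>o y \<in> L) \<and> {t \<otimes>\<^sub>o g_ob \<kappa> T W |W. W \<in> \<W>} \<subseteq> L}"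
  then have L: "loc_ideal L" and gL: "\<And>W. W \<in> \<W> \<Longrightarrow> t \<otimes>\<^sub>o g_ob \<kappa> T W \<in> L"
    unfolding loc_ideal_def by blast+
  note Ll = loc_idealD(1)[OF L]
  have perm: "a \<in> L" if "b \<in> L" "set xs \<subseteq> Obj T \<and> isomorphic T b (tens xs)"
    "set ys \<subseteq> Obj T \<and> isomorphic T a (tens ys)" "mset xs = mset ys" for a b xs ys
    using loc_idealD(4)[OF L that(1) isomorphic_perm[OF that(2-4)]] .
  have zeroL: "z \<in> L" if "Supp \<kappa> T z = {}" "z \<in> Obj T" for z
    using detection that loc_idealD(3)[OF L] unfolding detection_property_def by blast
  define J where "J = {x \<in> cpt \<kappa> T. x \<otimes>\<^sub>o t \<in> L}"
  have J: "radical J" unfolding J_def by (rule radical_preimage[OF L t])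
  define Y where "Y = (\<Union>x\<in>J. supp \<kappa> T x)"
  have Y: "thomason \<kappa> T Y" unfolding Y_def by (rule thomason_UN_supp) (simp add: J_def)
  \<comment> \<open>The object \<open>eY\<close> plays the part of \<open>Gam Y\<close>: it is the
    partner of the given \<open>Lam Y\<close>, while \<open>Gam Y\<close> itself may come from
    another triangle.\<close>
  obtain eY where rY: "rickard \<kappa> T Y eY (Lam \<kappa> T Y)" using Lam_rickard by blast
  note eYo = rickardD(1)[OF rY] and LYo = Lam_obj[of Y]
  have YJ: "x \<otimes>\<^sub>o t \<in> L" if "x \<in> cpt_supp \<kappa> T Y" for x
    using radical_supp[OF J, of x] that unfolding cpt_supp_def Y_def J_def by blast
  have eYt: "eY \<otimes>\<^sub>o t \<in> L"
    by (rule Loc_tensor_mem[OF rickardD(3)[OF rY] cpt_supp_obj Ll t YJ])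
  show "t \<in> L"
  proof (cases "Supp \<kappa> T t \<subseteq> Y")
    case True
    have "Supp \<kappa> T (Lam \<kappa> T Y \<otimes>\<^sub>o t) = {}"
      using Supp_Lam[OF Y t] Supp_tensor[OF LYo t] True by blast
    then have "Lam \<kappa> T Y \<otimes>\<^sub>o t \<in> L" by (rule zeroL) (use LYo t in simp)
    then show ?thesis by (rule rickard_tri_mem[OF rY Ll t eYt])
  next
    case False
    let ?X = "inverse_topology (Spc_top \<kappa> T)"
    let ?C = "subtopology ?X (Supp \<kappa> T t)"
    define F where "F = Supp \<kappa> T t - Y"
    have oY: "openin ?X V" if "thomason \<kappa> T V" for V using that unfolding openin_inverse_topology .
    have topX: "Supp \<kappa> T t \<subseteq> topspace ?X"
      using openin_subset[OF oY[OF thomason_Spc]] unfolding Supp_def by blast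
    have F: "closedin ?C F" "F \<noteq> {}" "F \<subseteq> Supp \<kappa> T t"
    proof -
      have "closedin ?X (topspace ?X - Y)" using oY[OF Y] by blast
      then show "closedin ?C F" unfolding F_def closedin_subtopology using topX by blast
    qed (use False in \<open>auto simp: F_def\<close>)
    then obtain w where "w \<in> F" "weakly_isolated (subtopology ?C F) w"
      using ws unfolding weakly_scattered_def by blast
    moreover have "subtopology ?C F = subtopology ?X F"
      using F(3) by (simp add: subtopology_subtopology inf.absorb2)
    ultimately obtain U where w: "w \<in> F" and U: "openin (subtopology ?X F) U" "w \<in> U"
      "U \<subseteq> Abstract_Topology.closure_of (subtopology ?X F) {w}"
      unfolding weakly_isolated_def by auto
    obtain U0 where U0: "thomason \<kappa> T U0" "U = U0 \<inter> F"
      using U(1) unfolding openin_subtopology openin_inverse_topology by blast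
    have "w \<in> Spc \<kappa> T" using w F(3) unfolding Supp_def by blast
    then obtain V where V: "V \<in> \<W>" "w \<in> V" "weakly_visible \<kappa> T V" using W by blast
    obtain A B where AB: "thomason \<kappa> T A" "thomason \<kappa> T B" "V = A \<inter> (Spc \<kappa> T - B)"
      "g_ob \<kappa> T V = Gam \<kappa> T A \<otimes>\<^sub>o Lam \<kappa> T B" by (rule g_ob_eq[OF V(3)])
    have UB: "U \<inter> B = {}"
    proof (rule ccontr)
      assume "U \<inter> B \<noteq> {}"
      then obtain Q where Q: "Q \<in> U" "Q \<in> B" by blast
      have "openin (subtopology ?X F) (B \<inter> F)" using oY[OF AB(2)] by (rule openin_subtopology_Int)
      moreover have "Q \<in> B \<inter> F" using Q U0(2) by blast
      ultimately have "w \<in> B"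
        using U(3) Q(1) unfolding closure_of_def by blast
      then show False using V(2) AB(3) by blast
    qed
    have "thomason \<kappa> T (U0 \<inter> A)"
      using openin_Int[OF oY[OF U0(1)] oY[OF AB(1)]] unfolding openin_inverse_topology .
    moreover have "w \<in> U0 \<inter> A" using U(2) U0(2) V(2) AB(3) by blast
    ultimately obtain x where x: "x \<in> cpt_supp \<kappa> T (U0 \<inter> A)" "w \<in> supp \<kappa> T x"
      using thomason_point by blast
    have xc: "compact_ob \<kappa> T x" and xs: "supp \<kappa> T x \<subseteq> U0 \<inter> A" using x(1) unfolding cpt_supp_def by blast+
    note xo = compact_obj[OF xc]
    \<comment> \<open>The objects \<open>Gam A\<close> and \<open>Lam B\<close> occur in
      \<open>g_ob\<close> of \<open>V\<close>, so these two are kept and completed to triangles by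
      partners \<open>lA\<close> and \<open>eB\<close>.\<close>
    obtain eB where rB: "rickard \<kappa> T B eB (Lam \<kappa> T B)" using Lam_rickard by blast
    obtain lA where rA: "rickard \<kappa> T A (Gam \<kappa> T A) lA" using Gam_rickard by blast
    note eBo = rickardD(1)[OF rB] and LBo = Lam_obj[of B] and GAo = Gam_obj[of A] and lAo = rickardD(2)[OF rA]
    note os = xo t eBo LBo GAo lAo eYo LYo
    \<comment> \<open>A point of this support would lie in \<open>B\<close>, in the support of
      \<open>x\<close>, hence in \<open>U0\<close>, and in \<open>Supp t\<close> but not in
      \<open>Y\<close>. It would thus belong to \<open>U\<close> and to \<open>B\<close>, which are
      disjoint.\<close>
    have "Supp \<kappa> T (eB \<otimes>\<^sub>o (x \<otimes>\<^sub>o (Lam \<kappa> T Y \<otimes>\<^sub>o t))) = {}"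
    proof (rule ccontr)
      assume "Supp \<kappa> T (eB \<otimes>\<^sub>o (x \<otimes>\<^sub>o (Lam \<kappa> T Y \<otimes>\<^sub>o t))) \<noteq> {}"
      then obtain Q where Q: "Q \<in> Supp \<kappa> T (eB \<otimes>\<^sub>o (x \<otimes>\<^sub>o (Lam \<kappa> T Y \<otimes>\<^sub>o t)))" by blast
      have vo: "Lam \<kappa> T Y \<otimes>\<^sub>o t \<in> Obj T" "x \<otimes>\<^sub>o (Lam \<kappa> T Y \<otimes>\<^sub>o t) \<in> Obj T" using os by simp_all
      have QB: "Q \<in> B" by (rule subsetD[OF Supp_Loc[OF AB(2) eBo rickardD(3)[OF rB] vo(2)] Q])
      have Q1: "Q \<in> Supp \<kappa> T (x \<otimes>\<^sub>o (Lam \<kappa> T Y \<otimes>\<^sub>o t))" by (rule subsetD[OF Supp_tensor[OF eBo vo(2)] Q])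
      have "x \<in> Loc \<kappa> T (cpt_supp \<kappa> T (supp \<kappa> T x))" unfolding Loc_def cpt_supp_def using xc by blast
      then have Qx: "Q \<in> supp \<kappa> T x" by (rule subsetD[OF Supp_Loc[OF thomason_supp[OF xc] xo _ vo(1)] Q1])
      have Q2: "Q \<in> Supp \<kappa> T (Lam \<kappa> T Y \<otimes>\<^sub>o t)" by (rule subsetD[OF Supp_tensor[OF xo vo(1)] Q1])
      have "Q \<in> Supp \<kappa> T t" "Q \<notin> Y" using Supp_tensor[OF LYo t] Supp_Lam[OF Y t] Q2 by blast+
      then have "Q \<in> U" using Qx xs U0(2) unfolding F_def by blast
      then show False using QB UB by blast
    qed
    then have eBL: "eB \<otimes>\<^sub>o (x \<otimes>\<^sub>o (Lam \<kappa> T Y \<otimes>\<^sub>o t)) \<in> L" by (rule zeroL) (use os in simp)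
    have lBL: "Lam \<kappa> T B \<otimes>\<^sub>o (x \<otimes>\<^sub>o (Lam \<kappa> T Y \<otimes>\<^sub>o t)) \<in> L"
    \<comment> \<open>Decompose along \<open>A\<close>: the part of \<open>Gam A\<close> is, up to
      order, a tensor multiple of \<open>t \<otimes> g_ob V\<close> and so lies in \<open>L\<close>;
      the other part vanishes, because \<open>lA\<close> annihilates \<open>x\<close>.\<close>
    proof (rule rickard_tri_mem[OF rA Ll])
      have "(x \<otimes>\<^sub>o Lam \<kappa> T Y) \<otimes>\<^sub>o (t \<otimes>\<^sub>o (Gam \<kappa> T A \<otimes>\<^sub>o Lam \<kappa> T B)) \<in> L"
        using loc_idealD(2)[OF L _ gL[OF V(1)]] os unfolding AB(4) by simp
      then show "Gam \<kappa> T A \<otimes>\<^sub>o (Lam \<kappa> T B \<otimes>\<^sub>o (x \<otimes>\<^sub>o (Lam \<kappa> T Y \<otimes>\<^sub>o t))) \<in> L"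
        by - (rule perm, assumption, (rule tens_mult tens_atom os)+, simp)
      have "x \<in> cpt_supp \<kappa> T A" using xc xs unfolding cpt_supp_def by blast
      then have "zero_ob T (x \<otimes>\<^sub>o lA)" by (rule rickard_annihilates[OF rA])
      then have "(x \<otimes>\<^sub>o lA) \<otimes>\<^sub>o (Lam \<kappa> T B \<otimes>\<^sub>o (Lam \<kappa> T Y \<otimes>\<^sub>o t)) \<in> L"
        using loc_idealD(3)[OF L] zero_ob_tensor(1) os by simp
      then show "lA \<otimes>\<^sub>o (Lam \<kappa> T B \<otimes>\<^sub>o (x \<otimes>\<^sub>o (Lam \<kappa> T Y \<otimes>\<^sub>o t))) \<in> L"
        by - (rule perm, assumption, (rule tens_mult tens_atom os)+, simp)
    qed (use os in simp)
    have "x \<otimes>\<^sub>o (Lam \<kappa> T Y \<otimes>\<^sub>o t) \<in> L"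
      by (rule rickard_tri_mem[OF rB Ll _ eBL lBL]) (use os in simp)
    \<comment> \<open>The triangle of \<open>Y\<close> is applied again, now to
      \<open>x \<otimes> t\<close>. Its second part is what was just obtained, and its first part is
      a tensor multiple of \<open>eY \<otimes> t\<close>.\<close>
    then have 1: "Lam \<kappa> T Y \<otimes>\<^sub>o (x \<otimes>\<^sub>o t) \<in> L"
      by - (rule perm, assumption, (rule tens_mult tens_atom os)+, simp)
    have "x \<otimes>\<^sub>o (eY \<otimes>\<^sub>o t) \<in> L" by (rule loc_idealD(2)[OF L xo eYt])
    then have 2: "eY \<otimes>\<^sub>o (x \<otimes>\<^sub>o t) \<in> L"
      by - (rule perm, assumption, (rule tens_mult tens_atom os)+, simp)
    have "x \<otimes>\<^sub>o t \<in> L" by (rule rickard_tri_mem[OF rY Ll _ 2 1]) (use os in simp)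
    then have "x \<in> J" using xc unfolding J_def by blast
    then have "w \<in> Y" using x(2) unfolding Y_def by blast
    then show ?thesis using w unfolding F_def by blast
  qed
qed

end

theorem theorem3p4:
  fixes \<kappa> :: "'u rel"
    and T :: "('o, 'm) ttcat"
    and M :: "('a, 'b) model_cat"
    and X :: "'x moninf"
    and D :: "('u, 'p, 'q) derivator"
    and t :: 'o
  assumes "universe \<kappa>"
    and "rigidly_compactly_generated \<kappa> T"
    and "detection_property \<kappa> T"
    and "homotopy_category_of_model_category \<kappa> M T \<or>
         homotopy_category_of_infinity_category X T \<or>
         underlying_category_of_derivator \<kappa> D T"
    and "t \<in> Obj T"
    and "weakly_scattered (subtopology (inverse_topology (Spc_top \<kappa> T)) (Supp \<kappa> T t))"
  shows "local_to_global \<kappa> T t"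
proof -
  have tt: "tt_category T"
    using assms(2) unfolding rigidly_compactly_generated_def by (elim conjE)
  then have m: "is_monoidal T" unfolding tt_category_def by (elim conjE)
  then have c: "is_category T" unfolding is_monoidal_def by (elim conjE)
  interpret rcg \<kappa> T
    by unfold_locales (fact assms(1) c m tt assms(2))+
  show ?thesis by (rule weakly_scattered_local_to_global[OF assms(3,5,6)])
qed

end
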